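(* The tensor $$\tilde b_*=\sum_{i=1}^{2^{mn}}g_i\,h_i^{*\prime}\in T_{(m+1)n}(V)\otimes T_{m(n+1)}(V^* )$$ generates a one-dimensional $GL\,V$-module such that $$\mathcal A(\tilde b_* )=(\mathrm{Ber}\,A)^{-1}\cdot\tilde b_*$$ for every $\mathcal A\in GL\,V$, where $A$ is the matrix of $\mathcal A$.
   Context: **Setting.** $K$ is a field of characteristic zero and $G=G_0\oplus G_1$ is the Grassmann algebra over $K$ with a countable (infinite) set of generators, with its even part $G_0$ and odd part $G_1$. $V$ is a free $\mathbb Z_2$-graded $G$-module of dimension $m|n$, with a basis $e_1,\dots,e_m$ of even elements and $\varepsilon_1,\dots,\varepsilon_n$ of odd elements. It is a $G$-bimodule with compatible left and right structures: $av=(-1)^{|a||v|}va$ for homogeneous $a\in G$, $v\in V$. Put $\Omega=\{e_1,\dots,e_m,\varepsilon_1,\dots,\varepsilon_n\}$. $GL\,V$ is the group of invertible even (right) $G$-linear operators on $V$. It is identified with the group $GL_{m,n}$ of invertible block matrices $A=\begin{pmatrix}A_{11}&A_{12}\\ A_{21}&A_{22}\end{pmatrix}$, where $A_{11}$ ($m\times m$) and $A_{22}$ ($n\times n$) have entries in $G_0$ and $A_{12},A_{21}$ have entries in $G_1$: writing $(\vartheta_1,\dots,\vartheta_{m+n})=(e_1,\dots,e_m,\varepsilon_1,\dots,\varepsilon_n)$, the matrix $A=(a_{ij})$ of $\mathcal A$ is given by $\mathcal A(\vartheta_j)=\sum_i\vartheta_i a_{ij}$. The Berezinian is $\mathrm{Ber}\,A=\det(A_{11}-A_{12}A_{22}^{-1}A_{21})\det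 A_{22}^{-1}$. **Tensors.** $T_l(V)=V\otimes\cdots\otimes V$ ($l$ factors, over $G$; $T_0(V)=G$), the tensor sign being omitted. $GL\,V$ acts by $\mathcal A(v_1\cdots v_l)=\mathcal A(v_1)\cdots\mathcal A(v_l)$. The symmetric group $S_l$ acts on the left: for homogeneous $v_i$, $\sigma(v_1\cdots v_l)=(-1)^N v_{\sigma^{-1}(1)}\cdots v_{\sigma^{-1}(l)}$, where $N$ is the number of pairs $i<j$ with $\sigma(i)>\sigma(j)$ and $v_i,v_j$ both odd. For a partition $\lambda$ of $l$, $T=T_\lambda$ is the Young tableau of shape $\lambda$ filled with $1,\dots,l$ row by row, left to right and top to bottom. $R(T)$, $C(T)\subset S_l$ are its row and column stabilizers. The Young symmetrizer is $e_T=\sum_{\sigma\in C(T),\,\tau\in R(T)}\mathrm{sgn}(\sigma)\,\tau\sigma$. Put $\lambda_h=(n+1,\dots,n+1)$ ($m$ rows) and $\lambda_g=(n,\dots,n)$ ($m+1$ rows). **Canonical tensors.** A filling of $\lambda_h$ or $\lambda_g$ by elements of $\Omega$ defines the tensor $e_Tv_1\cdots v_l$, where $v_1,\dots,v_l$ is the filling read row by row. The filling is canonical if each $e_i$ occurs only in row $i$ and each $\varepsilon_j$ occurs only in column $j$. Thus each box $(i,j)$ of the small rectangle ($1\le i\le m$, $1\le j\le n$) contains $e_i$ or $\varepsilon_j$; box $(i,n+1)$ of $\lambda_h$ contains $e_i$; box $(m+1,j)$ of $\lambda_g$ contains $\varepsilon_j$. Let $h_1,\dots,h_{2^{mn}}$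 and $g_1,\dots,g_{2^{mn}}$ be the tensors of the canonical fillings of $\lambda_h$ and $\lambda_g$, numbered so that $h_i$ and $g_i$ have the same filling of the small rectangle. For a canonical tensor $f$, let $\kappa(f)$ be the product over the columns $j\le n$ of $(\text{number of }\varepsilon_j\text{ in column }j)!$ (the cardinality of the group of permutations of odd elements preserving the filling). Let $\rho(f)$ be the number of odd basis elements in the small rectangle. Put $$\alpha(h_i)=\frac{(-1)^{n\rho(h_i)}\kappa(h_i)}{\kappa(g_i)} .$$ **Dual tensors.** $V^*$ is the dual $G$-module with dual basis $\vartheta_i^*$, $(\vartheta_i^*,\vartheta_j)=\delta_{ij}$, where $\vartheta_i^*$ has the parity of $\vartheta_i$. Write $e_i^*=\vartheta_i^*$, $\varepsilon_j^*=\vartheta_{m+j}^*$. The pairing of $T_l(V^* )$ with $T_l(V)$ is given for homogeneous elements by $(u_1^*\cdots u_l^*,w_1\cdots w_l)=(-1)^\chi(u_1^*,w_1)\cdots(u_l^*,w_l)$, where $\chi$ is the number of pairs of odd elements changing their order in passing from $u_1^*,\dots,u_l^*,w_1,\dots,w_l$ to $u_1^*,w_1,\dots,u_l^*,w_l$. $S_l$ acts on $T_l(V^* )$ on the right by $(u_1^*\cdots u_l^* )\sigma=(-1)^{N'}u_{\sigma(1)}^*\cdots u_{\sigma(l)}^*$, where $N'$ is the number of pairs $i<j$ with $\sigma(i)>\sigma(j)$ and $u^*_{\sigma(i)},u^*_{\sigma(j)}$ both odd. $\mathcal A\in GL\,V$ acts on $V^*$ by $(\mathcal A(\vartheta_i^*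 ),\mathcal A(\vartheta_j))=\delta_{ij}$, i.e. the column $(\mathcal A(\vartheta_i^* ))_i$ equals $A^{-1}$ times the column $(\vartheta_i^* )_i$. It acts factorwise on $T_l(V^* )$ and on products of tensors over $V$ and $V^*$: $\mathcal A(xy)=\mathcal A(x)\mathcal A(y)$. If $h_i=e_T(w_1\cdots w_l)$ with $w_k\in\Omega$ the canonical filling, put $h_i^*=(w_1^*\cdots w_l^* )e_T$. One has $(h_i^*,h_j)=0$ for $i\ne j$, and $(h_i^*,h_i)$ is a nonzero integer. Put $h_i^{*\prime}=\frac{\alpha(h_i)}{(h_i^*,h_i)}h_i^*$. *)

theory Defs
  imports "Jordan_Normal_Form.Matrix" "HOL-Combinatorics.Permutations" "HOL-Library.FuncSet"
begin

section \<open>The Grassmann algebra on countably many generators\<close>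

text \<open>
  An element is given by its coefficients: the coefficient at a finite set
  \<open>S = {s\<^sub>1 < \<dots> < s\<^sub>k}\<close> belongs to the monomial \<open>\<xi>\<^bsub>s\<^sub>1\<^esub> \<cdots> \<xi>\<^bsub>s\<^sub>k\<^esub>\<close>.
\<close>

typedef (overloaded) 'k grassmann =
  "{f :: nat set \<Rightarrow> 'k::zero. finite {S. f S \<noteq> 0} \<and> (\<forall>S. f S \<noteq> 0 \<longrightarrow> finite S)}"
  morphisms gcoeff Abs_grassmann
  by (rule exI[of _ "\<lambda>_. 0"]) auto

setup_lifting type_definition_grassmann

lemma grassmann_eqI: "(\<And>S. finite S \<Longrightarrow> gcoeff x S = gcoeff y S) \<Longrightarrow> x = y"
proof -
  assume a: "\<And>S. finite S \<Longrightarrow> gcoeff x S = gcoeff y S"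
  have "gcoeff x S = gcoeff y S" for S
    using a[of S] gcoeff[of x] gcoeff[of y] by (cases "finite S") (auto, metis)
  then show "x = y" by (auto simp: gcoeff_inject[symmetric])
qed

definition inversions :: "nat set \<Rightarrow> nat set \<Rightarrow> nat" where
  "inversions A B = card {(a, b). a \<in> A \<and> b \<in> B \<and> b < a}"

lemma inversions_empty [simp]: "inversions {} B = 0" "inversions A {} = 0"
  by (auto simp: inversions_def)

lemma inversions_Un1:
  assumes "finite A" "finite B" "finite C" "A \<inter> B = {}"
  shows "inversions (A \<union> B) C = inversions A C + inversions B C"
proof -
  have "{(a, b). a \<in> A \<union> B \<and> b \<in> C \<and> b < a} =
        {(a, b). a \<in> A \<and> b \<in> C \<and> b < a} \<union> {(a, b). a \<in> B \<and> b \<in> C \<and> b < a}" by auto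
  moreover have "finite {(a, b). a \<in> A \<and> b \<in> C \<and> b < a}"
    by (rule finite_subset[of _ "A \<times> C"]) (use assms in auto)
  moreover have "finite {(a, b). a \<in> B \<and> b \<in> C \<and> b < a}"
    by (rule finite_subset[of _ "B \<times> C"]) (use assms in auto)
  ultimately show ?thesis unfolding inversions_def
    using assms(4) by (simp, subst card_Un_disjoint) auto
qed

lemma inversions_Un2:
  assumes "finite A" "finite B" "finite C" "B \<inter> C = {}"
  shows "inversions A (B \<union> C) = inversions A B + inversions A C"
proof -
  have "{(a, b). a \<in> A \<and> b \<in> B \<union> C \<and> b < a} =
        {(a, b). a \<in> A \<and> b \<in> B \<and> b < a} \<union> {(a, b). a \<in> A \<and> b \<in> C \<and> b < a}" by auto
  moreover have "finite {(a, b). a \<in> A \<and> b \<in> B \<and> b < a}"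
    by (rule finite_subset[of _ "A \<times> B"]) (use assms in auto)
  moreover have "finite {(a, b). a \<in> A \<and> b \<in> C \<and> b < a}"
    by (rule finite_subset[of _ "A \<times> C"]) (use assms in auto)
  ultimately show ?thesis unfolding inversions_def
    using assms(4) by (simp, subst card_Un_disjoint) auto
qed

instantiation grassmann :: (zero) zero
begin
lift_definition zero_grassmann :: "'a grassmann" is "\<lambda>_. 0" by auto
instance ..
end

instantiation grassmann :: (zero_neq_one) one
begin
lift_definition one_grassmann :: "'a grassmann" is "\<lambda>S. if S = {} then 1 else 0" by auto
instance ..
end

instantiation grassmann :: (ab_group_add) ab_group_add
begin
lift_definition plus_grassmann :: "'a grassmann \<Rightarrow> 'a grassmann \<Rightarrow> 'a grassmann"
  is "\<lambda>f g S. f S + g S"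
proof -
  fix f g :: "nat set \<Rightarrow> 'a"
  assume "finite {S. f S \<noteq> 0} \<and> (\<forall>S. f S \<noteq> 0 \<longrightarrow> finite S)"
    "finite {S. g S \<noteq> 0} \<and> (\<forall>S. g S \<noteq> 0 \<longrightarrow> finite S)"
  then show "finite {S. f S + g S \<noteq> 0} \<and> (\<forall>S. f S + g S \<noteq> 0 \<longrightarrow> finite S)"
    by (intro conjI finite_subset[of "{S. f S + g S \<noteq> 0}" "{S. f S \<noteq> 0} \<union> {S. g S \<noteq> 0}"])
      (auto, metis add.right_neutral)
qed
lift_definition uminus_grassmann :: "'a grassmann \<Rightarrow> 'a grassmann" is "\<lambda>f S. - f S" by auto
definition minus_grassmann :: "'a grassmann \<Rightarrow> 'a grassmann \<Rightarrow> 'a grassmann"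
  where "minus_grassmann x y = x + - y"
instance
  by standard (transfer; auto simp: add_ac minus_grassmann_def fun_eq_iff)+
end

instantiation grassmann :: (comm_ring_1) ring_1
begin

lift_definition times_grassmann :: "'a grassmann \<Rightarrow> 'a grassmann \<Rightarrow> 'a grassmann"
  is "\<lambda>f g S. \<Sum>A\<in>Pow S. (-1) ^ inversions A (S - A) * f A * g (S - A)"
proof -
  fix f g :: "nat set \<Rightarrow> 'a"
  let ?h = "\<lambda>S. \<Sum>A\<in>Pow S. (-1) ^ inversions A (S - A) * f A * g (S - A)"
  assume fg: "finite {S. f S \<noteq> 0} \<and> (\<forall>S. f S \<noteq> 0 \<longrightarrow> finite S)"
    "finite {S. g S \<noteq> 0} \<and> (\<forall>S. g S \<noteq> 0 \<longrightarrow> finite S)"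
  have "\<exists>A B. f A \<noteq> 0 \<and> g B \<noteq> 0 \<and> S = A \<union> B" if nz: "?h S \<noteq> 0" for S
  proof -
    obtain A where "A \<in> Pow S" "(-1) ^ inversions A (S - A) * f A * g (S - A) \<noteq> 0"
      by (rule sum.not_neutral_contains_not_neutral[OF nz])
    then show ?thesis by (intro exI[of _ A] exI[of _ "S - A"]) auto
  qed
  then have sub: "{S. ?h S \<noteq> 0} \<subseteq> (\<lambda>(A, B). A \<union> B) ` ({S. f S \<noteq> 0} \<times> {S. g S \<noteq> 0})"
    by fastforce
  have "finite {S. ?h S \<noteq> 0}" by (rule finite_subset[OF sub]) (use fg in auto)
  moreover have "\<forall>S. ?h S \<noteq> 0 \<longrightarrow> finite S" using sub fg by auto
  ultimately show "finite {S. ?h S \<noteq> 0} \<and> (\<forall>S. ?h S \<noteq> 0 \<longrightarrow> finite S)" by blast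
qed

instance
proof
  fix x y z :: "'a grassmann"
  show "x * y * z = x * (y * z)"
  proof (rule grassmann_eqI)
    fix S :: "nat set" assume S: "finite S"
    then have fin: "A \<subseteq> S \<Longrightarrow> finite A" for A by (auto intro: finite_subset)
    define s :: "nat set \<Rightarrow> nat set \<Rightarrow> 'a" where "s A B = (-1) ^ inversions A B" for A B
    have "gcoeff (x * y * z) S = (\<Sum>D\<in>Pow S. \<Sum>A\<in>Pow D.
        s D (S - D) * s A (D - A) * gcoeff x A * gcoeff y (D - A) * gcoeff z (S - D))"
      by (simp add: times_grassmann.rep_eq s_def sum_distrib_left sum_distrib_right mult.assoc)
    also have "\<dots> = (\<Sum>(D, A)\<in>(SIGMA D:Pow S. Pow D).
        s D (S - D) * s A (D - A) * gcoeff x A * gcoeff y (D - A) * gcoeff z (S - D))"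
      by (rule sum.Sigma) (use S fin in auto)
    also have "\<dots> = (\<Sum>(A, B)\<in>(SIGMA A:Pow S. Pow (S - A)).
        s A (S - A) * s B (S - A - B) * gcoeff x A * gcoeff y B * gcoeff z (S - A - B))"
    proof (rule sum.reindex_bij_witness[of _ "\<lambda>(A, B). (A \<union> B, A)" "\<lambda>(D, A). (A, D - A)"], goal_cases)
      case (5 p)
      then obtain D A where p: "p = (D, A)" "A \<subseteq> D" "D \<subseteq> S" by auto
      have S1: "S - A - (D - A) = S - D" using p by auto
      have e1: "inversions D (S - D) = inversions A (S - D) + inversions (D - A) (S - D)"
        using inversions_Un1[of A "D - A" "S - D"] p fin S by (auto simp: Un_absorb1)
      have "(D - A) \<union> (S - D) = S - A" using p by auto
      then have e2: "inversions A (S - A) = inversions A (D - A) + inversions A (S - D)"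
        using inversions_Un2[of A "D - A" "S - D"] p fin S by fastforce
      show ?case using p S1 by (simp add: s_def e1 e2 power_add mult_ac)
    qed auto
    also have "\<dots> = (\<Sum>A\<in>Pow S. \<Sum>B\<in>Pow (S - A).
        s A (S - A) * s B (S - A - B) * gcoeff x A * gcoeff y B * gcoeff z (S - A - B))"
      by (rule sum.Sigma[symmetric]) (use S in auto)
    also have "\<dots> = gcoeff (x * (y * z)) S"
      by (simp add: times_grassmann.rep_eq s_def sum_distrib_left sum_distrib_right mult_ac)
    finally show "gcoeff (x * y * z) S = gcoeff (x * (y * z)) S" .
  qed
  show "1 * x = x"
  proof (rule grassmann_eqI)
    fix S :: "nat set" assume S: "finite S"
    have "gcoeff (1 * x) S = (\<Sum>A\<in>Pow S. if A = {} then gcoeff x S else 0)"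
      by (auto simp: times_grassmann.rep_eq one_grassmann.rep_eq intro!: sum.cong)
    then show "gcoeff (1 * x) S = gcoeff x S" using S by simp
  qed
  show "x * 1 = x"
  proof (rule grassmann_eqI)
    fix S :: "nat set" assume S: "finite S"
    have "gcoeff (x * 1) S = (\<Sum>A\<in>Pow S. if A = S then gcoeff x S else 0)"
      by (auto simp: times_grassmann.rep_eq one_grassmann.rep_eq intro!: sum.cong)
    then show "gcoeff (x * 1) S = gcoeff x S" using S by simp
  qed
  show "(x + y) * z = x * z + y * z" "x * (y + z) = x * y + x * z"
    by (rule grassmann_eqI,
        simp add: times_grassmann.rep_eq plus_grassmann.rep_eq algebra_simps sum.distrib)+
  have "gcoeff (0 :: 'a grassmann) {} \<noteq> gcoeff 1 {}"
    by (simp add: zero_grassmann.rep_eq one_grassmann.rep_eq)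
  then show "(0 :: 'a grassmann) \<noteq> 1" by metis
qed

end

lift_definition gconst :: "'k::zero \<Rightarrow> 'k grassmann" is "\<lambda>c S. if S = {} then c else 0"
  by auto

text \<open>
  The sign rule for moving a Grassmann coefficient past \<open>p\<close> odd elements: a homogeneous \<open>a\<close>
  becomes \<open>(-1)\<^bsup>p\<bar>a\<bar>\<^esup> a\<close>.
\<close>

lift_definition grade_sign :: "nat \<Rightarrow> 'k::comm_ring_1 grassmann \<Rightarrow> 'k grassmann"
  is "\<lambda>p f S. (-1) ^ (p * card S) * f S"
proof -
  fix p and f :: "nat set \<Rightarrow> 'k"
  assume f: "finite {S. f S \<noteq> 0} \<and> (\<forall>S. f S \<noteq> 0 \<longrightarrow> finite S)"
  have "{S. (-1) ^ (p * card S) * f S \<noteq> 0} \<subseteq> {S. f S \<noteq> 0}" by auto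
  then show "finite {S. (-1) ^ (p * card S) * f S \<noteq> 0} \<and>
      (\<forall>S. (-1) ^ (p * card S) * f S \<noteq> 0 \<longrightarrow> finite S)"
    using f by (auto intro: finite_subset)
qed

lemma grade_sign_add: "grade_sign p (x + y) = grade_sign p x + grade_sign p y"
  by transfer (auto simp: algebra_simps)

lemma grade_sign_zero [simp]: "grade_sign p 0 = 0"
  by transfer auto

lemma grade_sign_one [simp]: "grade_sign p 1 = 1"
  by transfer auto

lemma grade_sign_0 [simp]: "grade_sign 0 x = x"
  by transfer auto

lemma grade_sign_comp: "grade_sign p (grade_sign q x) = grade_sign (p + q) x"
  by transfer (auto simp: power_add algebra_simps)

lemma grade_sign_mult: "grade_sign p (x * y) = grade_sign p x * grade_sign p y"
proof (rule grassmann_eqI)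
  fix S :: "nat set" assume S: "finite S"
  have "(-1) ^ (p * card S) * ((-1) ^ i * gcoeff x A * gcoeff y (S - A)) =
    (-1) ^ i * ((-1) ^ (p * card A) * gcoeff x A) * ((-1) ^ (p * card (S - A)) * gcoeff y (S - A))"
    if "A \<subseteq> S" for A i
  proof -
    have "card S = card A + card (S - A)"
      using S that by (metis card_Diff_subset card_mono finite_subset le_add_diff_inverse)
    then show ?thesis by (simp add: power_add algebra_simps)
  qed
  then show "gcoeff (grade_sign p (x * y)) S = gcoeff (grade_sign p x * grade_sign p y) S"
    by (auto simp: grade_sign.rep_eq times_grassmann.rep_eq sum_distrib_left intro!: sum.cong)
qed

lemma grade_sign_sum: "grade_sign p (sum f I) = (\<Sum>i\<in>I. grade_sign p (f i))"
  by (induction I rule: infinite_finite_induct) (auto simp: grade_sign_add)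

lifting_forget grassmann.lifting


section \<open>Tensors over \<open>V\<close> and \<open>V\<^sup>*\<close>\<close>

text \<open>
  Indices start at \<open>0\<close>: for \<open>V\<close> of dimension \<open>m|n\<close>, the basis consists of the even
  \<open>E i\<close> (\<open>i < m\<close>) and the odd \<open>Eps j\<close> (\<open>j < n\<close>), and \<open>E_dual i\<close>, \<open>Eps_dual j\<close> form the
  dual basis.

  Since \<open>V\<close> and \<open>V\<^sup>*\<close> are free over \<open>G\<close>, tensor products of copies of them are free over \<open>G\<close>
  with basis the words in these letters.  The type \<open>stensor\<close> is the tensor algebra on all
  letters; the function \<open>tcoeff x\<close> gives the right coefficients: \<open>x = \<Sum>\<^sub>w w \<cdot> tcoeff x w\<close>.
  In the product, \<open>(w a)(w' a') = (-1)\<^bsup>\<bar>a\<bar>\<bar>w'\<bar>\<^esup> w w' a a'\<close> for homogeneous \<open>a\<close>.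
  Left multiplication by \<open>G\<close> is multiplication by \<open>scal a\<close> from the left, so that
  \<open>a w = (-1)\<^bsup>\<bar>a\<bar>\<bar>w\<bar>\<^esup> w a\<close>.
\<close>

datatype letter = E nat | Eps nat | E_dual nat | Eps_dual nat

fun odd_letter :: "letter \<Rightarrow> bool" where
  "odd_letter (E i) = False"
| "odd_letter (Eps j) = True"
| "odd_letter (E_dual i) = False"
| "odd_letter (Eps_dual j) = True"

fun dual :: "letter \<Rightarrow> letter" where
  "dual (E i) = E_dual i"
| "dual (Eps j) = Eps_dual j"
| "dual (E_dual i) = E i"
| "dual (Eps_dual j) = Eps j"

definition odd_count :: "letter list \<Rightarrow> nat" where
  "odd_count w = length (filter odd_letter w)"

lemma odd_count_Nil [simp]: "odd_count [] = 0"
  by (simp add: odd_count_def)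

lemma odd_count_append: "odd_count (u @ v) = odd_count u + odd_count v"
  by (simp add: odd_count_def)

typedef (overloaded) 'k stensor =
  "{f :: letter list \<Rightarrow> 'k::zero grassmann. finite {w. f w \<noteq> 0}}"
  morphisms tcoeff Abs_stensor
  by (rule exI[of _ "\<lambda>_. 0"]) auto

setup_lifting type_definition_stensor

lemma stensor_eqI: "(\<And>w. tcoeff x w = tcoeff y w) \<Longrightarrow> x = y"
  by (auto simp: tcoeff_inject[symmetric])

instantiation stensor :: (zero) zero
begin
lift_definition zero_stensor :: "'a stensor" is "\<lambda>_. 0" by auto
instance ..
end

instantiation stensor :: (zero_neq_one) one
begin
lift_definition one_stensor :: "'a stensor" is "\<lambda>w. if w = [] then 1 else 0" by auto
instance ..
end

instantiation stensor :: (ab_group_add) ab_group_add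
begin
lift_definition plus_stensor :: "'a stensor \<Rightarrow> 'a stensor \<Rightarrow> 'a stensor"
  is "\<lambda>f g w. f w + g w"
proof -
  fix f g :: "letter list \<Rightarrow> 'a grassmann"
  assume "finite {w. f w \<noteq> 0}" "finite {w. g w \<noteq> 0}"
  then show "finite {w. f w + g w \<noteq> 0}"
    by (intro finite_subset[of "{w. f w + g w \<noteq> 0}" "{w. f w \<noteq> 0} \<union> {w. g w \<noteq> 0}"]) auto
qed
lift_definition uminus_stensor :: "'a stensor \<Rightarrow> 'a stensor" is "\<lambda>f w. - f w" by auto
definition minus_stensor :: "'a stensor \<Rightarrow> 'a stensor \<Rightarrow> 'a stensor"
  where "minus_stensor x y = x + - y"
instance
  by standard (transfer; auto simp: add_ac minus_stensor_def fun_eq_iff)+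
end

instantiation stensor :: (comm_ring_1) ring_1
begin

lift_definition times_stensor :: "'a stensor \<Rightarrow> 'a stensor \<Rightarrow> 'a stensor"
  is "\<lambda>f g w. \<Sum>i\<le>length w. grade_sign (odd_count (drop i w)) (f (take i w)) * g (drop i w)"
proof -
  fix f g :: "letter list \<Rightarrow> 'a grassmann"
  let ?h = "\<lambda>w. \<Sum>i\<le>length w. grade_sign (odd_count (drop i w)) (f (take i w)) * g (drop i w)"
  assume fg: "finite {w. f w \<noteq> 0}" "finite {w. g w \<noteq> 0}"
  have "\<exists>u v. f u \<noteq> 0 \<and> g v \<noteq> 0 \<and> w = u @ v" if nz: "?h w \<noteq> 0" for w
  proof -
    obtain i where "grade_sign (odd_count (drop i w)) (f (take i w)) * g (drop i w) \<noteq> 0"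
      by (rule sum.not_neutral_contains_not_neutral[OF nz])
    then show ?thesis by (intro exI[of _ "take i w"] exI[of _ "drop i w"]) auto
  qed
  then have "{w. ?h w \<noteq> 0} \<subseteq> (\<lambda>(u, v). u @ v) ` ({w. f w \<noteq> 0} \<times> {w. g w \<noteq> 0})"
    by fastforce
  then show "finite {w. ?h w \<noteq> 0}" by (rule finite_subset) (use fg in auto)
qed

instance
proof
  fix x y z :: "'a stensor"
  show "x * y * z = x * (y * z)"
  proof (rule stensor_eqI)
    fix w :: "letter list"
    let ?l = "length w"
    have "tcoeff (x * y * z) w = (\<Sum>i\<le>?l. \<Sum>j\<le>i.
        grade_sign (odd_count (drop i w) + odd_count (drop j (take i w))) (tcoeff x (take j w)) *
        grade_sign (odd_count (drop i w)) (tcoeff y (drop j (take i w))) * tcoeff z (drop i w))"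
      by (auto simp: times_stensor.rep_eq grade_sign_sum grade_sign_mult grade_sign_comp
          sum_distrib_left sum_distrib_right min_def intro!: sum.cong)
    also have "\<dots> = (\<Sum>(i, j)\<in>(SIGMA i:{..?l}. {..i}).
        grade_sign (odd_count (drop i w) + odd_count (drop j (take i w))) (tcoeff x (take j w)) *
        grade_sign (odd_count (drop i w)) (tcoeff y (drop j (take i w))) * tcoeff z (drop i w))"
      by (rule sum.Sigma) auto
    also have "\<dots> = (\<Sum>(j, k)\<in>(SIGMA j:{..?l}. {..?l - j}).
        grade_sign (odd_count (drop j w)) (tcoeff x (take j w)) *
        (grade_sign (odd_count (drop (j + k) w)) (tcoeff y (take k (drop j w))) *
         tcoeff z (drop (j + k) w)))"
    proof (rule sum.reindex_bij_witness[of _ "\<lambda>(j, k). (j + k, j)" "\<lambda>(i, j). (j, i - j)"], goal_cases)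
      case (5 p)
      then obtain i j where p: "p = (i, j)" "j \<le> i" "i \<le> ?l" by auto
      have "drop j w = drop j (take i w) @ drop i w"
        using p by (metis append_take_drop_id drop_append length_take min.absorb2 diff_is_0_eq drop0)
      then have "odd_count (drop j w) = odd_count (drop i w) + odd_count (drop j (take i w))"
        by (metis odd_count_append add.commute)
      then show ?case using p by (simp add: drop_take mult.assoc)
    qed auto
    also have "\<dots> = (\<Sum>j\<le>?l. \<Sum>k\<le>?l - j.
        grade_sign (odd_count (drop j w)) (tcoeff x (take j w)) *
        (grade_sign (odd_count (drop (j + k) w)) (tcoeff y (take k (drop j w))) *
         tcoeff z (drop (j + k) w)))"
      by (rule sum.Sigma[symmetric]) auto
    also have "\<dots> = tcoeff (x * (y * z)) w"
      by (simp add: times_stensor.rep_eq sum_distrib_left add.commute)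
    finally show "tcoeff (x * y * z) w = tcoeff (x * (y * z)) w" .
  qed
  show "1 * x = x"
  proof (rule stensor_eqI)
    fix w :: "letter list"
    have "tcoeff (1 * x) w = (\<Sum>i\<le>length w. if i = 0 then tcoeff x w else 0)"
      unfolding times_stensor.rep_eq one_stensor.rep_eq by (rule sum.cong) auto
    then show "tcoeff (1 * x) w = tcoeff x w" by simp
  qed
  show "x * 1 = x"
  proof (rule stensor_eqI)
    fix w :: "letter list"
    have "tcoeff (x * 1) w = (\<Sum>i\<le>length w. if i = length w then tcoeff x w else 0)"
      unfolding times_stensor.rep_eq one_stensor.rep_eq by (rule sum.cong) auto
    then show "tcoeff (x * 1) w = tcoeff x w" by simp
  qed
  show "(x + y) * z = x * z + y * z" "x * (y + z) = x * y + x * z"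
    by (rule stensor_eqI,
        simp add: times_stensor.rep_eq plus_stensor.rep_eq grade_sign_add algebra_simps sum.distrib)+
  have "tcoeff (0 :: 'a stensor) [] \<noteq> tcoeff 1 []"
    by (simp add: zero_stensor.rep_eq one_stensor.rep_eq)
  then show "(0 :: 'a stensor) \<noteq> 1" by metis
qed

end

lift_definition scal :: "'k::zero grassmann \<Rightarrow> 'k stensor" is "\<lambda>a w. if w = [] then a else 0"
  by auto

lift_definition word :: "letter list \<Rightarrow> 'k::zero_neq_one stensor" is "\<lambda>u w. if w = u then 1 else 0"
  by auto

text \<open>The right \<open>G\<close>-linear extension of a map defined on words.\<close>

definition linear_ext :: "(letter list \<Rightarrow> 'k stensor) \<Rightarrow> 'k stensor \<Rightarrow> 'k::comm_ring_1 stensor" where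
  "linear_ext f x = (\<Sum>w | tcoeff x w \<noteq> 0. f w * scal (tcoeff x w))"

definition has_parity :: "nat \<Rightarrow> 'k::zero stensor \<Rightarrow> bool" where
  "has_parity p x \<longleftrightarrow> (\<forall>w S. gcoeff (tcoeff x w) S \<noteq> 0 \<longrightarrow> (odd_count w + card S) mod 2 = p mod 2)"

definition Omega :: "nat \<Rightarrow> nat \<Rightarrow> letter set" where
  "Omega m n = E ` {..<m} \<union> Eps ` {..<n}"

definition theta :: "nat \<Rightarrow> nat \<Rightarrow> letter" where
  "theta m k = (if k < m then E k else Eps (k - m))"

text \<open>\<open>T\<^sub>k(V) \<otimes> T\<^sub>l(V\<^sup>*)\<close> for \<open>V\<close> of dimension \<open>m|n\<close>\<close>

definition tensors :: "nat \<Rightarrow> nat \<Rightarrow> nat \<Rightarrow> nat \<Rightarrow> 'k::zero stensor set" where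
  "tensors m n k l = {x. \<forall>w. tcoeff x w \<noteq> 0 \<longrightarrow>
     length w = k + l \<and> set (take k w) \<subseteq> Omega m n \<and> set (drop k w) \<subseteq> dual ` Omega m n}"

abbreviation V_space :: "nat \<Rightarrow> nat \<Rightarrow> 'k::zero stensor set" where
  "V_space m n \<equiv> tensors m n 1 0"


section \<open>The general linear supergroup and the Berezinian\<close>

text \<open>Only the values of an operator on \<open>V\<close> matter.\<close>

definition GL_V :: "nat \<Rightarrow> nat \<Rightarrow> ('k::comm_ring_1 stensor \<Rightarrow> 'k stensor) set" where
  "GL_V m n = {\<A>. bij_betw \<A> (V_space m n) (V_space m n) \<and>
     (\<forall>x\<in>V_space m n. \<forall>y\<in>V_space m n. \<A> (x + y) = \<A> x + \<A> y) \<and>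
     (\<forall>x\<in>V_space m n. \<forall>a. \<A> (x * scal a) = \<A> x * scal a) \<and>
     (\<forall>p. \<forall>x\<in>V_space m n. has_parity p x \<longrightarrow> has_parity p (\<A> x))}"

definition matrix_of :: "nat \<Rightarrow> nat \<Rightarrow> ('k::comm_ring_1 stensor \<Rightarrow> 'k stensor) \<Rightarrow> 'k grassmann mat" where
  "matrix_of m n \<A> = mat (m + n) (m + n) (\<lambda>(i, j). tcoeff (\<A> (word [theta m j])) [theta m i])"

definition mat_inv :: "'a::semiring_1 mat \<Rightarrow> 'a mat" where
  "mat_inv A = (THE B. B \<in> carrier_mat (dim_col A) (dim_row A) \<and> inverts_mat A B \<and> inverts_mat B A)"

definition ring_inv :: "'a::monoid_mult \<Rightarrow> 'a" where
  "ring_inv x = (THE y. x * y = 1 \<and> y * x = 1)"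

text \<open>
  The library determinant requires a commutative ring type.  The Grassmann algebra is not
  commutative, but its even part is, and the Leibniz formula is only used for matrices with
  even entries, where the order of the factors is irrelevant.
\<close>

definition leibniz_det :: "'a::ring_1 mat \<Rightarrow> 'a" where
  "leibniz_det A = (\<Sum>p | p permutes {0..<dim_row A}.
     of_int (sign p) * prod_list (map (\<lambda>i. A $$ (i, p i)) [0..<dim_row A]))"

definition Ber :: "nat \<Rightarrow> 'a::ring_1 mat \<Rightarrow> 'a" where
  "Ber m A = (case split_block A m m of (A11, A12, A21, A22) \<Rightarrow>
     leibniz_det (A11 - A12 * mat_inv A22 * A21) * leibniz_det (mat_inv A22))"

text \<open>\<open>dual_image m n \<A> i\<close> is the image of the \<open>i\<close>-th dual basis vector: row \<open>i\<close> of
  \<open>A\<^sup>-\<^sup>1\<close> times the column of dual basis vectors, the coefficients standing on the left.\<close>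

definition dual_image ::
  "nat \<Rightarrow> nat \<Rightarrow> ('k::comm_ring_1 stensor \<Rightarrow> 'k stensor) \<Rightarrow> nat \<Rightarrow> 'k stensor" where
  "dual_image m n \<A> i =
     (\<Sum>k<m + n. scal (mat_inv (matrix_of m n \<A>) $$ (i, k)) * word [dual (theta m k)])"

fun act_letter ::
  "nat \<Rightarrow> nat \<Rightarrow> ('k::comm_ring_1 stensor \<Rightarrow> 'k stensor) \<Rightarrow> letter \<Rightarrow> 'k stensor" where
  "act_letter m n \<A> (E i) = \<A> (word [E i])"
| "act_letter m n \<A> (Eps j) = \<A> (word [Eps j])"
| "act_letter m n \<A> (E_dual i) = dual_image m n \<A> i"
| "act_letter m n \<A> (Eps_dual j) = dual_image m n \<A> (m + j)"

definition act ::
  "nat \<Rightarrow> nat \<Rightarrow> ('k::comm_ring_1 stensor \<Rightarrow> 'k stensor) \<Rightarrow> 'k stensor \<Rightarrow> 'k stensor" where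
  "act m n \<A> = linear_ext (\<lambda>w. prod_list (map (act_letter m n \<A>) w))"

definition GL_submodule :: "nat \<Rightarrow> nat \<Rightarrow> 'k::comm_ring_1 stensor set \<Rightarrow> bool" where
  "GL_submodule m n M \<longleftrightarrow> 0 \<in> M \<and> (\<forall>x\<in>M. \<forall>y\<in>M. x + y \<in> M) \<and>
     (\<forall>x\<in>M. \<forall>a. x * scal a \<in> M \<and> scal a * x \<in> M) \<and>
     (\<forall>\<A>\<in>GL_V m n. \<forall>x\<in>M. act m n \<A> x \<in> M)"

definition GL_generated :: "nat \<Rightarrow> nat \<Rightarrow> 'k::comm_ring_1 stensor \<Rightarrow> 'k stensor set" where
  "GL_generated m n x = \<Inter> {M. GL_submodule m n M \<and> x \<in> M}"

text \<open>Free of rank one over \<open>G\<close>, i.e. of dimension \<open>1|0\<close> or \<open>0|1\<close>.\<close>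

definition one_dimensional :: "'k::comm_ring_1 stensor set \<Rightarrow> bool" where
  "one_dimensional M \<longleftrightarrow>
     (\<exists>b p. has_parity p b \<and> (\<forall>a. b * scal a \<in> M) \<and> (\<forall>x\<in>M. \<exists>!a. x = b * scal a))"


section \<open>Symmetric groups and Young symmetrizers\<close>

text \<open>Positions in a word and rows and columns of a diagram are numbered from \<open>0\<close>.\<close>

definition sym_left :: "(nat \<Rightarrow> nat) \<Rightarrow> 'k stensor \<Rightarrow> 'k::comm_ring_1 stensor" where
  "sym_left \<sigma> = linear_ext (\<lambda>v.
     (-1) ^ card {(i, j). i < j \<and> j < length v \<and> \<sigma> i > \<sigma> j \<and> odd_letter (v ! i) \<and> odd_letter (v ! j)} *
     word (map (\<lambda>k. v ! inv_into UNIV \<sigma> k) [0..<length v]))"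

definition sym_right :: "'k stensor \<Rightarrow> (nat \<Rightarrow> nat) \<Rightarrow> 'k::comm_ring_1 stensor" where
  "sym_right x \<sigma> = linear_ext (\<lambda>u.
     (-1) ^ card {(i, j). i < j \<and> j < length u \<and> \<sigma> i > \<sigma> j \<and>
       odd_letter (u ! \<sigma> i) \<and> odd_letter (u ! \<sigma> j)} *
     word (map (\<lambda>k. u ! \<sigma> k) [0..<length u])) x"

text \<open>The boxes of the diagram of \<open>\<lambda>\<close> in the order in which \<open>T\<^sub>\<lambda>\<close> numbers them.\<close>

definition boxes :: "nat list \<Rightarrow> (nat \<times> nat) list" where
  "boxes lam = concat (map (\<lambda>i. map (\<lambda>j. (i, j)) [0..<lam ! i]) [0..<length lam])"

definition row_stab :: "nat list \<Rightarrow> (nat \<Rightarrow> nat) set" where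
  "row_stab lam = {\<tau>. \<tau> permutes {..<sum_list lam} \<and>
     (\<forall>k<sum_list lam. fst (boxes lam ! \<tau> k) = fst (boxes lam ! k))}"

definition col_stab :: "nat list \<Rightarrow> (nat \<Rightarrow> nat) set" where
  "col_stab lam = {\<sigma>. \<sigma> permutes {..<sum_list lam} \<and>
     (\<forall>k<sum_list lam. snd (boxes lam ! \<sigma> k) = snd (boxes lam ! k))}"

definition young_left :: "nat list \<Rightarrow> 'k::comm_ring_1 stensor \<Rightarrow> 'k stensor" where
  "young_left lam x =
     (\<Sum>\<sigma>\<in>col_stab lam. \<Sum>\<tau>\<in>row_stab lam. of_int (sign \<sigma>) * sym_left (\<tau> \<circ> \<sigma>) x)"

definition young_right :: "'k::comm_ring_1 stensor \<Rightarrow> nat list \<Rightarrow> 'k stensor" where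
  "young_right x lam =
     (\<Sum>\<sigma>\<in>col_stab lam. \<Sum>\<tau>\<in>row_stab lam. of_int (sign \<sigma>) * sym_right x (\<tau> \<circ> \<sigma>))"

text \<open>
  The pairing of \<open>T\<^sub>l(V\<^sup>*)\<close> with \<open>T\<^sub>l(V)\<close>: first on words, then extended \<open>G\<close>-bilinearly, where
  \<open>(u a, w b) = (u, a w) b = (-1)\<^bsup>\<bar>a\<bar>\<bar>w\<bar>\<^esup> (u, w) a b\<close>.
\<close>

definition word_pairing :: "letter list \<Rightarrow> letter list \<Rightarrow> 'k::comm_ring_1" where
  "word_pairing u w = (if length u = length w
     then (-1) ^ card {(i, j). i < j \<and> j < length w \<and> odd_letter (w ! i) \<and> odd_letter (u ! j)} *
       (\<Prod>k<length w. if u ! k = dual (w ! k) then 1 else 0)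
     else 0)"

definition pairing :: "'k::comm_ring_1 stensor \<Rightarrow> 'k stensor \<Rightarrow> 'k grassmann" where
  "pairing x y = (\<Sum>u | tcoeff x u \<noteq> 0. \<Sum>w | tcoeff y w \<noteq> 0.
     gconst (word_pairing u w) * grade_sign (odd_count w) (tcoeff x u) * tcoeff y w)"


section \<open>Canonical tensors\<close>

definition lambda_h :: "nat \<Rightarrow> nat \<Rightarrow> nat list" where
  "lambda_h m n = replicate m (n + 1)"

definition lambda_g :: "nat \<Rightarrow> nat \<Rightarrow> nat list" where
  "lambda_g m n = replicate (m + 1) n"

definition canonical_fillings :: "nat \<Rightarrow> nat \<Rightarrow> nat list \<Rightarrow> (nat \<times> nat \<Rightarrow> letter) set" where
  "canonical_fillings m n lam = {F \<in> set (boxes lam) \<rightarrow>\<^sub>E Omega m n.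
     \<forall>(i, j)\<in>set (boxes lam). (\<forall>k. F (i, j) = E k \<longrightarrow> k = i) \<and> (\<forall>k. F (i, j) = Eps k \<longrightarrow> k = j)}"

definition canonical_tensor :: "nat list \<Rightarrow> (nat \<times> nat \<Rightarrow> letter) \<Rightarrow> 'k::comm_ring_1 stensor" where
  "canonical_tensor lam F = young_left lam (word (map F (boxes lam)))"

definition dual_canonical_tensor :: "nat list \<Rightarrow> (nat \<times> nat \<Rightarrow> letter) \<Rightarrow> 'k::comm_ring_1 stensor" where
  "dual_canonical_tensor lam F = young_right (word (map (\<lambda>b. dual (F b)) (boxes lam))) lam"

text \<open>
  The pairs of canonical fillings of \<open>\<lambda>\<^sub>h\<close> and \<open>\<lambda>\<^sub>g\<close> that agree on the small rectangle; these
  pairs replace the common numbering of the \<open>h\<^sub>i\<close> and \<open>g\<^sub>i\<close> by \<open>1, \<dots>, 2\<^bsup>mn\<^esup>\<close>.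
\<close>

definition matching_fillings ::
  "nat \<Rightarrow> nat \<Rightarrow> ((nat \<times> nat \<Rightarrow> letter) \<times> (nat \<times> nat \<Rightarrow> letter)) set" where
  "matching_fillings m n = {(H, F).
     H \<in> canonical_fillings m n (lambda_h m n) \<and> F \<in> canonical_fillings m n (lambda_g m n) \<and>
     (\<forall>i<m. \<forall>j<n. H (i, j) = F (i, j))}"

definition kappa :: "nat \<Rightarrow> nat list \<Rightarrow> (nat \<times> nat \<Rightarrow> letter) \<Rightarrow> nat" where
  "kappa n lam F = (\<Prod>j<n. fact (card {i. (i, j) \<in> set (boxes lam) \<and> F (i, j) = Eps j}))"

definition rho :: "nat \<Rightarrow> nat \<Rightarrow> (nat \<times> nat \<Rightarrow> letter) \<Rightarrow> nat" where
  "rho m n F = card {(i, j). i < m \<and> j < n \<and> odd_letter (F (i, j))}"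

definition alpha ::
  "nat \<Rightarrow> nat \<Rightarrow> (nat \<times> nat \<Rightarrow> letter) \<Rightarrow> (nat \<times> nat \<Rightarrow> letter) \<Rightarrow> 'k::field_char_0" where
  "alpha m n H F = (-1) ^ (n * rho m n H) * of_nat (kappa n (lambda_h m n) H) /
     of_nat (kappa n (lambda_g m n) F)"

definition h_dual' ::
  "nat \<Rightarrow> nat \<Rightarrow> (nat \<times> nat \<Rightarrow> letter) \<Rightarrow> (nat \<times> nat \<Rightarrow> letter) \<Rightarrow> 'k::field_char_0 stensor" where
  "h_dual' m n H F =
     (let h = canonical_tensor (lambda_h m n) H; h_star = dual_canonical_tensor (lambda_h m n) H
      in scal (gconst (alpha m n H F) * ring_inv (pairing h_star h)) * h_star)"

definition b_star :: "nat \<Rightarrow> nat \<Rightarrow> 'k::field_char_0 stensor" where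
  "b_star m n = (\<Sum>(H, F)\<in>matching_fillings m n.
     canonical_tensor (lambda_g m n) F * h_dual' m n H F)"

end

(*
  Let eta be the m x n matrix of independent odd variables and put v_j = eps_j + sum_i e_i eta_ij,
  u_i = e_i^* - sum_j eta_ij eps_j^*. The product of the alternating products of the v_j along the rows
  of lambda_g and of the u_i along the columns of lambda_h is a polynomial in eta, and its Berezin
  integral over eta is a nonzero multiple of b_*: the coefficients of the monomials in eta are the
  canonical tensors, and integration pairs complementary monomials, i.e. equal fillings of the small
  rectangle. A matrix A acts on the v_j and u_i through a fractional linear change of the variables eta
  together with powers of determinants, so the integral is multiplied by a Berezinian Jacobian.
  By the Gauss decomposition it suffices to compute this factor for unitriangular and block diagonal A;
  it is 1 and det(A_22) / det(A_11) respectively.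
*)
theory Submission
  imports Defs "Jordan_Normal_Form.Determinant"
begin

section \<open>Supercommutativity of the Grassmann algebra\<close>

text \<open>No scalars are adjoined for the variables eta: G has infinitely many generators, so the
  variables are generators with numbers N, ..., N + mn - 1 of G itself, with N above every generator
  occurring in the matrix at hand. The integral reads off the coefficient of the top monomial, and
  whatever is free of these generators passes through it.

  The weights 1/|stabilizer| in the integrand come from a double count of arbitrary against
  canonical fillings. The numbers (h_i^*, h_i) contain in addition the constant z with e_T e_T = z
  e_T. It is nonzero, since otherwise a nonzero tensor with integer coefficients would have a
  vanishing sum of squares. The quotient of the two normalisations is z up to a sign and does not
  depend on i.

  A general change of variables formula is avoided. Translations and linear maps act on products of
  odd variables in an elementary way. The chart of a lower unitriangular matrix is split into
  factors with a single odd entry x: as x^2 = 0, each such chart is affine in x, and its divergence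
  cancels against the determinant factors.\<close>

definition geven :: "'k::comm_ring_1 grassmann \<Rightarrow> bool" where
  "geven a \<longleftrightarrow> grade_sign 1 a = a"

definition godd :: "'k::comm_ring_1 grassmann \<Rightarrow> bool" where
  "godd a \<longleftrightarrow> grade_sign 1 a = - a"

lemma gcoeff_zero [simp]: "gcoeff 0 S = 0"
  by (simp add: zero_grassmann.rep_eq)

lemma gcoeff_one: "gcoeff 1 S = (if S = {} then 1 else 0)"
  by (simp add: one_grassmann.rep_eq)

lemma gcoeff_add [simp]: "gcoeff (x + y) S = gcoeff x S + gcoeff y S"
  by (simp add: plus_grassmann.rep_eq)

lemma gcoeff_uminus [simp]: "gcoeff (- x) S = - gcoeff x S"
  by (simp add: uminus_grassmann.rep_eq)

lemma gcoeff_diff [simp]: "gcoeff (x - y) S = gcoeff x S - gcoeff y S"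
  using gcoeff_add[of x "- y" S] by simp

lemma gcoeff_sum: "gcoeff (sum f I) S = (\<Sum>i\<in>I. gcoeff (f i) S)"
  by (induction I rule: infinite_finite_induct) auto

lemma gcoeff_grade_sign: "gcoeff (grade_sign p x) S = (-1) ^ (p * card S) * gcoeff x S"
  by (simp add: grade_sign.rep_eq)

lemma gcoeff_gconst: "gcoeff (gconst c) S = (if S = {} then c else 0)"
  by (simp add: gconst.rep_eq)

lemma gcoeff_infinite: "\<not> finite S \<Longrightarrow> gcoeff x S = 0"
  using gcoeff[of x] by auto

lemmas gcoeff_mult = times_grassmann.rep_eq

lemma grade_sign_uminus: "grade_sign p (- x) = - grade_sign p x"
  by (rule grassmann_eqI) (simp add: gcoeff_grade_sign)

lemma grade_sign_diff: "grade_sign p (x - y) = grade_sign p x - grade_sign p y"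
  by (rule grassmann_eqI) (simp add: gcoeff_grade_sign algebra_simps)

lemma grade_sign_eq_odd: "odd p \<Longrightarrow> grade_sign p x = grade_sign 1 x"
  by (rule grassmann_eqI) (simp add: gcoeff_grade_sign uminus_power_if)

lemma grade_sign_eq_even: "even p \<Longrightarrow> grade_sign p x = x"
  by (rule grassmann_eqI) (simp add: gcoeff_grade_sign)

lemma grade_sign_geven: "geven a \<Longrightarrow> grade_sign p a = a"
  by (cases "even p") (auto simp: grade_sign_eq_even grade_sign_eq_odd[of p] geven_def)

lemma grade_sign_godd: "godd a \<Longrightarrow> grade_sign p a = (-1) ^ p * a"
  by (cases "even p") (auto simp: grade_sign_eq_even grade_sign_eq_odd[of p] godd_def)

lemma grade_sign_gconst [simp]: "grade_sign p (gconst c) = gconst c"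
  by (rule grassmann_eqI) (simp add: gcoeff_grade_sign gcoeff_gconst)

lemma geven_simps [simp]:
  "geven 0" "geven 1" "geven (gconst c)" "godd 0"
  by (simp_all add: geven_def godd_def)

lemma geven_add: "geven a \<Longrightarrow> geven b \<Longrightarrow> geven (a + b)"
  and godd_add: "godd a \<Longrightarrow> godd b \<Longrightarrow> godd (a + b)"
  and geven_uminus: "geven a \<Longrightarrow> geven (- a)"
  and godd_uminus: "godd a \<Longrightarrow> godd (- a)"
  and geven_diff: "geven a \<Longrightarrow> geven b \<Longrightarrow> geven (a - b)"
  and godd_diff: "godd a \<Longrightarrow> godd b \<Longrightarrow> godd (a - b)"
  and geven_mult: "geven a \<Longrightarrow> geven b \<Longrightarrow> geven (a * b)"
  and geven_mult_odd: "godd a \<Longrightarrow> godd b \<Longrightarrow> geven (a * b)"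
  and godd_mult: "geven a \<Longrightarrow> godd b \<Longrightarrow> godd (a * b)"
  and godd_mult2: "godd a \<Longrightarrow> geven b \<Longrightarrow> godd (a * b)"
  by (simp_all add: geven_def godd_def grade_sign_add grade_sign_uminus grade_sign_diff grade_sign_mult)

lemma geven_sum: "(\<And>i. i \<in> I \<Longrightarrow> geven (f i)) \<Longrightarrow> geven (sum f I)"
  by (simp add: geven_def grade_sign_sum)

lemma godd_sum: "(\<And>i. i \<in> I \<Longrightarrow> godd (f i)) \<Longrightarrow> godd (sum f I)"
  by (simp add: godd_def grade_sign_sum sum_negf)

text \<open>In characteristic 0 the eigenvalues 1 and -1 of \<open>grade_sign 1\<close> differ, so
  its eigenvectors are the elements supported on sets of even, respectively odd, cardinality
  (\<open>godd_iff\<close>).\<close>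

lemma geven_iff: "geven (a :: 'k::field_char_0 grassmann) \<longleftrightarrow> (\<forall>S. gcoeff a S \<noteq> 0 \<longrightarrow> even (card S))"
proof
  assume a: "geven a"
  show "\<forall>S. gcoeff a S \<noteq> 0 \<longrightarrow> even (card S)"
  proof (intro allI impI)
    fix S assume nz: "gcoeff a S \<noteq> 0"
    have "(-1) ^ card S * gcoeff a S = gcoeff a S"
      using a gcoeff_grade_sign[of 1 a S] by (simp add: geven_def)
    with nz show "even (card S)" by (cases "even (card S)") auto
  qed
next
  assume "\<forall>S. gcoeff a S \<noteq> 0 \<longrightarrow> even (card S)"
  then show "geven a" unfolding geven_def
    by (intro grassmann_eqI) (auto simp: gcoeff_grade_sign uminus_power_if)
qed

lemma godd_iff: "godd (a :: 'k::field_char_0 grassmann) \<longleftrightarrow> (\<forall>S. gcoeff a S \<noteq> 0 \<longrightarrow> odd (card S))"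
proof
  assume a: "godd a"
  show "\<forall>S. gcoeff a S \<noteq> 0 \<longrightarrow> odd (card S)"
  proof (intro allI impI)
    fix S assume nz: "gcoeff a S \<noteq> 0"
    have "(-1) ^ card S * gcoeff a S = - gcoeff a S"
      using a gcoeff_grade_sign[of 1 a S] by (simp add: godd_def)
    with nz show "odd (card S)" by (cases "even (card S)") auto
  qed
next
  assume *: "\<forall>S. gcoeff a S \<noteq> 0 \<longrightarrow> odd (card S)"
  show "godd a" unfolding godd_def
  proof (rule grassmann_eqI)
    fix S show "gcoeff (grade_sign 1 a) S = gcoeff (- a) S"
      using * by (cases "gcoeff a S = 0") (auto simp: gcoeff_grade_sign uminus_power_if)
  qed
qed

text \<open>By disjointness every pair in \<open>A \<times> B\<close> is an inversion for exactly
  one of the two orders.\<close>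

lemma inversions_swap:
  assumes "finite A" "finite B" "A \<inter> B = {}"
  shows "inversions A B + inversions B A = card A * card B"
proof -
  let ?P = "{(a, b). a \<in> A \<and> b \<in> B \<and> b < a}" and ?Q = "{(a, b). a \<in> A \<and> b \<in> B \<and> a < b}"
  have "A \<times> B = ?P \<union> ?Q" using assms(3) nat_neq_iff by (auto simp: disjoint_iff)
  moreover have "finite ?P" "finite ?Q"
    by (rule finite_subset[of _ "A \<times> B"]; use assms in auto)+
  ultimately have "card (A \<times> B) = card ?P + card ?Q"
    by (simp add: card_Un_disjoint disjoint_iff)
  moreover have "card ?Q = inversions B A" unfolding inversions_def
    by (rule bij_betw_same_card[of prod.swap]) (auto simp: bij_betw_def inj_on_def image_iff)
  ultimately show ?thesis by (simp add: inversions_def card_cartesian_product)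
qed

text \<open>Complementation in \<open>S\<close> matches the terms of the two products. By
  \<open>inversions_swap\<close> their signs differ by the parity of
  \<open>card A * card (S - A)\<close>, and \<open>card A\<close> is odd wherever \<open>a\<close>
  has a coefficient. As \<open>y\<close> is arbitrary, the remaining sign is recorded by
  \<open>grade_sign 1\<close>.\<close>

lemma godd_commute:
  fixes a :: "'k::field_char_0 grassmann"
  assumes "godd a"
  shows "a * y = grade_sign 1 y * a"
proof (rule grassmann_eqI)
  fix S :: "nat set" assume S: "finite S"
  have "gcoeff (grade_sign 1 y * a) S =
      (\<Sum>A\<in>Pow S. (-1) ^ inversions (S - A) A * gcoeff (grade_sign 1 y) (S - A) * gcoeff a A)"
    unfolding gcoeff_mult
    by (rule sum.reindex_bij_witness[of _ "\<lambda>A. S - A" "\<lambda>A. S - A"]) (auto simp: double_diff)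
  also have "\<dots> = (\<Sum>A\<in>Pow S. (-1) ^ inversions A (S - A) * gcoeff a A * gcoeff y (S - A))"
  proof (rule sum.cong)
    fix A assume "A \<in> Pow S"
    then have fin: "finite A" "finite (S - A)" using S by (auto intro: finite_subset)
    show "(-1) ^ inversions (S - A) A * gcoeff (grade_sign 1 y) (S - A) * gcoeff a A =
      (-1) ^ inversions A (S - A) * gcoeff a A * gcoeff y (S - A)"
    proof (cases "gcoeff a A = 0")
      case False
      then have "odd (card A)" using assms by (auto simp: godd_iff)
      then have "even (inversions A (S - A) + inversions (S - A) A) = even (card (S - A))"
        using inversions_swap[OF fin] by auto
      then show ?thesis by (auto simp: gcoeff_grade_sign uminus_power_if)
    qed auto
  qed auto
  finally show "gcoeff (a * y) S = gcoeff (grade_sign 1 y * a) S" by (simp add: gcoeff_mult)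
qed

lemma geven_commute:
  fixes a :: "'k::field_char_0 grassmann"
  assumes "geven a"
  shows "a * y = y * a"
proof (rule grassmann_eqI)
  fix S :: "nat set" assume S: "finite S"
  have "gcoeff (y * a) S =
      (\<Sum>A\<in>Pow S. (-1) ^ inversions (S - A) A * gcoeff y (S - A) * gcoeff a A)"
    unfolding gcoeff_mult
    by (rule sum.reindex_bij_witness[of _ "\<lambda>A. S - A" "\<lambda>A. S - A"]) (auto simp: double_diff)
  also have "\<dots> = (\<Sum>A\<in>Pow S. (-1) ^ inversions A (S - A) * gcoeff a A * gcoeff y (S - A))"
  proof (rule sum.cong)
    fix A assume "A \<in> Pow S"
    then have fin: "finite A" "finite (S - A)" using S by (auto intro: finite_subset)
    show "(-1) ^ inversions (S - A) A * gcoeff y (S - A) * gcoeff a A =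
      (-1) ^ inversions A (S - A) * gcoeff a A * gcoeff y (S - A)"
    proof (cases "gcoeff a A = 0")
      case False
      then have "even (card A)" using assms by (auto simp: geven_iff)
      then have "even (inversions A (S - A) + inversions (S - A) A)"
        using inversions_swap[OF fin] by auto
      then show ?thesis by (auto simp: uminus_power_if)
    qed auto
  qed auto
  finally show "gcoeff (a * y) S = gcoeff (y * a) S" by (simp add: gcoeff_mult)
qed

lemma godd_square:
  fixes a :: "'k::field_char_0 grassmann"
  assumes "godd a"
  shows "a * a = 0"
proof -
  have "a * a = - (a * a)" using godd_commute[OF assms, of a] assms by (simp add: godd_def)
  then have "2 * gcoeff (a * a) S = 0" for S by (metis add.right_inverse gcoeff_add gcoeff_zero mult_2)
  then show ?thesis by (intro grassmann_eqI) simp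
qed

lemma gconst_simps [simp]:
  "gconst 0 = 0" "gconst 1 = 1"
  by (rule grassmann_eqI; simp add: gcoeff_gconst gcoeff_one)+

lemma gconst_add: "gconst (a + b) = gconst a + gconst b"
  by (rule grassmann_eqI) (simp add: gcoeff_gconst)

lemma gconst_uminus: "gconst (- a) = - gconst a"
  by (rule grassmann_eqI) (simp add: gcoeff_gconst)

lemma gcoeff_gconst_mult: "gcoeff (gconst c * x) S = c * gcoeff x S"
proof (cases "finite S")
  case True
  have "gcoeff (gconst c * x) S = (\<Sum>A\<in>Pow S. if A = {} then c * gcoeff x S else 0)"
    unfolding gcoeff_mult by (rule sum.cong) (auto simp: gcoeff_gconst)
  then show ?thesis using True by simp
qed (simp add: gcoeff_infinite)

lemma gconst_mult: "gconst (a * b) = gconst a * gconst b"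
  by (rule grassmann_eqI) (simp add: gcoeff_gconst_mult, simp add: gcoeff_gconst)

lemma gconst_of_int: "gconst (of_int z) = of_int z"
proof -
  have n: "gconst (of_nat k) = of_nat k" for k by (induction k) (simp_all add: gconst_add)
  show ?thesis by (cases z) (simp_all add: n gconst_uminus gconst_add del: of_nat_Suc)
qed

lemma gconst_power: "gconst (a ^ k) = gconst a ^ k"
  by (induction k) (simp_all add: gconst_mult)

lemma gconst_eq_iff: "gconst a = gconst b \<longleftrightarrow> a = b"
  by (metis gcoeff_gconst)

lemma gconst_mult_cancel:
  "(c :: 'k::field_char_0) \<noteq> 0 \<Longrightarrow> (gconst c * x = gconst c * y) = (x = y)"
proof
  assume c: "c \<noteq> 0" and eq: "gconst c * x = gconst c * y"
  have *: "gconst (inverse c) * (gconst c * z) = z" for z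
    using c by (simp add: mult.assoc[symmetric] gconst_mult[symmetric])
  show "x = y" using *[of x] *[of y] unfolding eq by (rule box_equals[OF refl])
qed simp

section \<open>Variables, degree and the Berezin integral\<close>

lemma gcoeff_mult_nonzero:
  assumes "gcoeff (x * y) S \<noteq> 0"
  obtains A B where "gcoeff x A \<noteq> 0" "gcoeff y B \<noteq> 0" "A \<inter> B = {}" "S = A \<union> B"
proof -
  obtain A where "A \<in> Pow S" "(-1) ^ inversions A (S - A) * gcoeff x A * gcoeff y (S - A) \<noteq> 0"
    using sum.not_neutral_contains_not_neutral[OF assms[unfolded gcoeff_mult]] by metis
  then show ?thesis by (intro that[of A "S - A"]) auto
qed

text \<open>The subalgebra generated by the generators with numbers in \<open>U\<close>.\<close>

definition gvars :: "nat set \<Rightarrow> 'k::comm_ring_1 grassmann set" where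
  "gvars U = {a. \<forall>S. gcoeff a S \<noteq> 0 \<longrightarrow> S \<subseteq> U}"

text \<open>The filtration by degree in the generators of \<open>Z\<close>; integration over
  \<open>Z\<close> kills all but the top degree.\<close>

definition gdeg :: "nat set \<Rightarrow> nat \<Rightarrow> 'k::comm_ring_1 grassmann set" where
  "gdeg Z d = {a. \<forall>S. gcoeff a S \<noteq> 0 \<longrightarrow> card (S \<inter> Z) \<le> d}"

lemma gvars_mono: "U \<subseteq> U' \<Longrightarrow> a \<in> gvars U \<Longrightarrow> a \<in> gvars U'"
  by (auto simp: gvars_def)

lemma gvars_simps [simp]: "0 \<in> gvars U" "1 \<in> gvars U" "gconst c \<in> gvars U"
  by (auto simp: gvars_def gcoeff_one gcoeff_gconst split: if_splits)

lemma gvars_add: "a \<in> gvars U \<Longrightarrow> b \<in> gvars U \<Longrightarrow> a + b \<in> gvars U"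
  unfolding gvars_def mem_Collect_eq by (metis add.right_neutral gcoeff_add)

lemma gvars_uminus: "a \<in> gvars U \<Longrightarrow> - a \<in> gvars U"
  by (auto simp: gvars_def)

lemma gvars_mult: "a \<in> gvars U \<Longrightarrow> b \<in> gvars U \<Longrightarrow> a * b \<in> gvars U"
  by (auto simp: gvars_def elim!: gcoeff_mult_nonzero)

lemma gvars_sum: "(\<And>i. i \<in> I \<Longrightarrow> f i \<in> gvars U) \<Longrightarrow> sum f I \<in> gvars U"
  by (induction I rule: infinite_finite_induct) (auto intro: gvars_add)

lemma gvars_prod_list: "(\<And>x. x \<in> set xs \<Longrightarrow> x \<in> gvars U) \<Longrightarrow> prod_list xs \<in> gvars U"
  by (induction xs) (auto intro: gvars_mult)

lemma gvars_grade_sign: "a \<in> gvars U \<Longrightarrow> grade_sign p a \<in> gvars U"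
  unfolding gvars_def mem_Collect_eq gcoeff_grade_sign by (metis mult_zero_right)

text \<open>An element involves finitely many generators, so fresh ones are always left over to
  serve as integration variables.\<close>

lemma ex_gvars: "\<exists>N. a \<in> gvars {..<N}"
proof -
  have "finite (\<Union>{S. gcoeff a S \<noteq> 0})" using gcoeff[of a] by auto
  then obtain N where "\<forall>x\<in>\<Union>{S. gcoeff a S \<noteq> 0}. x < N" using finite_nat_set_iff_bounded by auto
  then show ?thesis by (intro exI[of _ N]) (auto simp: gvars_def)
qed

lemma ex_gvars_finite: "finite X \<Longrightarrow> \<exists>N. X \<subseteq> gvars {..<N}"
proof (induction X rule: finite_induct)
  case (insert a X)
  then obtain N where N: "X \<subseteq> gvars {..<N}" by auto
  obtain N' where N': "a \<in> gvars {..<N'}" using ex_gvars by auto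
  have "x \<in> gvars {..<max N N'}" if "x \<in> insert a X" for x
    using that N N' gvars_mono[of "{..<N}" "{..<max N N'}"] gvars_mono[of "{..<N'}" "{..<max N N'}"] by auto
  then show ?case by blast
qed auto

lemma gdeg_mono: "d \<le> d' \<Longrightarrow> a \<in> gdeg Z d \<Longrightarrow> a \<in> gdeg Z d'"
  by (auto simp: gdeg_def intro: order_trans)

lemma gdeg_simps [simp]: "0 \<in> gdeg Z d" "1 \<in> gdeg Z d" "gconst c \<in> gdeg Z d"
  by (auto simp: gdeg_def gcoeff_one gcoeff_gconst split: if_splits)

lemma gdeg_add: "a \<in> gdeg Z d \<Longrightarrow> b \<in> gdeg Z d \<Longrightarrow> a + b \<in> gdeg Z d"
  unfolding gdeg_def mem_Collect_eq by (metis add.right_neutral gcoeff_add)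

lemma gdeg_sum: "(\<And>i. i \<in> I \<Longrightarrow> f i \<in> gdeg Z d) \<Longrightarrow> sum f I \<in> gdeg Z d"
  by (induction I rule: infinite_finite_induct) (auto intro: gdeg_add)

lemma gdeg_mult: "a \<in> gdeg Z d \<Longrightarrow> b \<in> gdeg Z d' \<Longrightarrow> a * b \<in> gdeg Z (d + d')"
proof -
  assume a: "a \<in> gdeg Z d" and b: "b \<in> gdeg Z d'"
  show ?thesis unfolding gdeg_def
  proof (intro CollectI allI impI)
    fix S assume "gcoeff (a * b) S \<noteq> 0"
    then obtain A B where "gcoeff a A \<noteq> 0" "gcoeff b B \<noteq> 0" "S = A \<union> B"
      by (rule gcoeff_mult_nonzero)
    then have "card (A \<inter> Z) \<le> d" "card (B \<inter> Z) \<le> d'" "S \<inter> Z = (A \<inter> Z) \<union> (B \<inter> Z)"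
      using a b by (auto simp: gdeg_def)
    then show "card (S \<inter> Z) \<le> d + d'"
      by (metis (no_types, lifting) add_mono card_Un_le le_trans)
  qed
qed

lemma gdeg_prod_list: "(\<And>x. x \<in> set xs \<Longrightarrow> x \<in> gdeg Z 1) \<Longrightarrow> prod_list xs \<in> gdeg Z (length xs)"
proof (induction xs)
  case (Cons x xs)
  then show ?case using gdeg_mult[of x Z 1 "prod_list xs" "length xs"] by auto
qed auto

lemma gdeg_gvars: "a \<in> gvars U \<Longrightarrow> U \<inter> Z = {} \<Longrightarrow> a \<in> gdeg Z 0"
  unfolding gdeg_def gvars_def mem_Collect_eq
  by (metis card.empty inf_mono le_zero_eq order_refl subset_empty)

section \<open>Monomials and the Berezin integral\<close>

setup_lifting type_definition_grassmann

lift_definition gmon :: "nat set \<Rightarrow> 'k::comm_ring_1 grassmann"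
  is "\<lambda>S T. if T = S \<and> finite S then 1 else 0"
  by auto

text \<open>The Berezin integral over the generators \<open>N, \<dots>, N + L - 1\<close>, with the remaining
  generators restricted to those below \<open>N\<close> (so that no sign occurs).\<close>

lift_definition gtop :: "nat \<Rightarrow> nat \<Rightarrow> 'k::comm_ring_1 grassmann \<Rightarrow> 'k grassmann"
  is "\<lambda>N L f S. if S \<subseteq> {..<N} then f (S \<union> {N..<N + L}) else 0"
proof -
  fix N L and f :: "nat set \<Rightarrow> 'k"
  assume f: "finite {S. f S \<noteq> 0} \<and> (\<forall>S. f S \<noteq> 0 \<longrightarrow> finite S)"
  let ?g = "\<lambda>S. if S \<subseteq> {..<N} then f (S \<union> {N..<N + L}) else 0"
  have "{S. ?g S \<noteq> 0} \<subseteq> (\<lambda>T. T \<inter> {..<N}) ` {T. f T \<noteq> 0}"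
  proof
    fix S assume "S \<in> {S. ?g S \<noteq> 0}"
    then have S: "S \<subseteq> {..<N}" "f (S \<union> {N..<N + L}) \<noteq> 0" by (auto split: if_splits)
    then have "S = (S \<union> {N..<N + L}) \<inter> {..<N}" by auto
    with S show "S \<in> (\<lambda>T. T \<inter> {..<N}) ` {T. f T \<noteq> 0}" by blast
  qed
  then have "finite {S. ?g S \<noteq> 0}" by (rule finite_subset) (use f in auto)
  then show "finite {S. ?g S \<noteq> 0} \<and> (\<forall>S. ?g S \<noteq> 0 \<longrightarrow> finite S)"
    by (auto split: if_splits intro: finite_subset)
qed

lifting_forget grassmann.lifting

lemma gcoeff_gmon: "finite S \<Longrightarrow> gcoeff (gmon S) T = (if T = S then 1 else 0)"
  by (simp add: gmon.rep_eq)

lemma gmon_empty [simp]: "gmon {} = 1"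
  by (rule grassmann_eqI) (simp add: gcoeff_gmon gcoeff_one)

lemma gmon_mult:
  assumes "finite A" "finite B"
  shows "gmon A * gmon B = (if A \<inter> B = {} then (-1) ^ inversions A B * gmon (A \<union> B) else 0 :: 'k::comm_ring_1 grassmann)"
proof (rule grassmann_eqI)
  fix S :: "nat set" assume S: "finite S"
  have pow: "(-1) ^ i * x = (if even i then x else - x)" for i and x :: "'k grassmann"
    by simp
  have "gcoeff (gmon A * gmon B :: 'k grassmann) S = (\<Sum>A'\<in>Pow S. if A' = A then (if S - A = B then (-1) ^ inversions A B else 0) else (0 :: 'k))"
    unfolding gcoeff_mult by (rule sum.cong) (auto simp: gcoeff_gmon assms)
  also have "\<dots> = (if A \<subseteq> S \<and> S - A = B then (-1) ^ inversions A B else 0)" using S by simp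
  also have "\<dots> = gcoeff (if A \<inter> B = {} then (-1) ^ inversions A B * gmon (A \<union> B) else 0 :: 'k grassmann) S"
    using assms by (auto simp: pow gcoeff_gmon)
  finally show "gcoeff (gmon A * gmon B :: 'k grassmann) S = gcoeff (if A \<inter> B = {} then (-1) ^ inversions A B * gmon (A \<union> B) else 0 :: 'k grassmann) S" .
qed

lemma godd_gmon: "odd (card S) \<Longrightarrow> godd (gmon S :: 'k::field_char_0 grassmann)"
  by (simp add: godd_iff gmon.rep_eq)

lemma gmon_gvars: "S \<subseteq> U \<Longrightarrow> gmon S \<in> gvars U"
  by (simp add: gvars_def gmon.rep_eq)

lemma gmon_gdeg: "card (S \<inter> Z) \<le> d \<Longrightarrow> gmon S \<in> gdeg Z d"
  by (simp add: gdeg_def gmon.rep_eq)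

lemma gcoeff_gtop: "gcoeff (gtop N L f) S = (if S \<subseteq> {..<N} then gcoeff f (S \<union> {N..<N + L}) else 0)"
  by (simp add: gtop.rep_eq)

lemma gtop_add: "gtop N L (x + y) = gtop N L x + gtop N L y"
  by (rule grassmann_eqI) (simp add: gcoeff_gtop)

lemma gtop_zero [simp]: "gtop N L 0 = 0"
  by (rule grassmann_eqI) (simp add: gcoeff_gtop)

lemma gtop_uminus: "gtop N L (- x) = - gtop N L x"
  by (rule grassmann_eqI) (simp add: gcoeff_gtop)

lemma gtop_diff: "gtop N L (x - y) = gtop N L x - gtop N L y"
  by (rule grassmann_eqI) (simp add: gcoeff_gtop)

lemma gtop_sum: "gtop N L (sum f I) = (\<Sum>i\<in>I. gtop N L (f i))"
  by (induction I rule: infinite_finite_induct) (auto simp: gtop_add)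

text \<open>All generators in \<open>a\<close> have smaller numbers than the integration variables,
  so splitting them off on the left creates no inversion with these variables and hence no
  sign.\<close>

lemma gtop_mult:
  assumes a: "a \<in> gvars {..<N}"
  shows "gtop N L (a * f) = a * gtop N L f"
proof (rule grassmann_eqI)
  fix S :: "nat set" assume S: "finite S"
  let ?Z = "{N..<N + L}"
  show "gcoeff (gtop N L (a * f)) S = gcoeff (a * gtop N L f) S"
  proof (cases "S \<subseteq> {..<N}")
    case True
    have disj: "S \<inter> ?Z = {}" using True by auto
    have "gcoeff (a * f) (S \<union> ?Z) = (\<Sum>A\<in>Pow (S \<union> ?Z). (-1) ^ inversions A (S \<union> ?Z - A) * gcoeff a A * gcoeff f (S \<union> ?Z - A))"
      by (simp add: gcoeff_mult)
    also have "\<dots> = (\<Sum>A\<in>Pow S. (-1) ^ inversions A (S \<union> ?Z - A) * gcoeff a A * gcoeff f (S \<union> ?Z - A))"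
    proof (rule sum.mono_neutral_right)
      show "\<forall>A\<in>Pow (S \<union> ?Z) - Pow S. (-1) ^ inversions A (S \<union> ?Z - A) * gcoeff a A * gcoeff f (S \<union> ?Z - A) = 0"
      proof
        fix A assume A: "A \<in> Pow (S \<union> ?Z) - Pow S"
        then obtain x where "x \<in> A" "x \<in> ?Z" by blast
        then have "\<not> A \<subseteq> {..<N}" by auto
        then have "gcoeff a A = 0" using a by (auto simp: gvars_def)
        then show "(-1) ^ inversions A (S \<union> ?Z - A) * gcoeff a A * gcoeff f (S \<union> ?Z - A) = 0" by simp
      qed
    qed (use S in auto)
    also have "\<dots> = (\<Sum>A\<in>Pow S. (-1) ^ inversions A (S - A) * gcoeff a A * gcoeff (gtop N L f) (S - A))"
    proof (rule sum.cong)
      fix A assume A: "A \<in> Pow S"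
      then have 1: "S \<union> ?Z - A = (S - A) \<union> ?Z" using True by fastforce
      have "{(a, b). a \<in> A \<and> b \<in> ?Z \<and> b < a} = {}" using A True by fastforce
      then have "inversions A ?Z = 0" unfolding inversions_def by (simp only: card.empty)
      then have "inversions A ((S - A) \<union> ?Z) = inversions A (S - A)"
        using inversions_Un2[of A "S - A" ?Z] A S disj by (auto intro: finite_subset)
      then show "(-1) ^ inversions A (S \<union> ?Z - A) * gcoeff a A * gcoeff f (S \<union> ?Z - A) =
          (-1) ^ inversions A (S - A) * gcoeff a A * gcoeff (gtop N L f) (S - A)"
        using True by (auto simp: 1 gcoeff_gtop)
    qed auto
    finally show ?thesis using True by (simp add: gcoeff_gtop gcoeff_mult)
  next
    case False
    have "gcoeff (a * gtop N L f) S = 0"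
    proof (rule ccontr)
      assume "gcoeff (a * gtop N L f) S \<noteq> 0"
      then obtain A B where "gcoeff a A \<noteq> 0" "gcoeff (gtop N L f) B \<noteq> 0" "S = A \<union> B"
        by (rule gcoeff_mult_nonzero)
      then show False using a False by (auto simp: gvars_def gcoeff_gtop split: if_splits)
    qed
    then show ?thesis using False by (simp add: gcoeff_gtop)
  qed
qed

lemma gtop_low_degree: "f \<in> gdeg {N..<N + L} d \<Longrightarrow> d < L \<Longrightarrow> gtop N L f = 0"
proof (rule grassmann_eqI)
  fix S assume f: "f \<in> gdeg {N..<N + L} d" "d < L"
  have "card ((S \<union> {N..<N + L}) \<inter> {N..<N + L}) = L" by (simp add: Int_absorb1)
  then show "gcoeff (gtop N L f) S = gcoeff 0 S"
    using f by (fastforce simp: gcoeff_gtop gdeg_def)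
qed

lemma gtop_missing: "f \<in> gvars (- {N + k}) \<Longrightarrow> k < L \<Longrightarrow> gtop N L f = 0"
proof (rule grassmann_eqI)
  fix S assume f: "f \<in> gvars (- {N + k})" "k < L"
  then have "\<not> S \<union> {N..<N + L} \<subseteq> - {N + k}" by auto
  then have "gcoeff f (S \<union> {N..<N + L}) = 0" using f by (auto simp: gvars_def)
  then show "gcoeff (gtop N L f) S = gcoeff 0 S" by (simp add: gcoeff_gtop)
qed

lemma gtop_gmon: "gtop N L (gmon ((+) N ` T)) = (if T = {..<L} then 1 else 0)"
  if "T \<subseteq> {..<L}"
proof (rule grassmann_eqI)
  fix S :: "nat set"
  have fin: "finite ((+) N ` T)" using that by (auto intro: finite_subset)
  have Z: "{N..<N + L} = (+) N ` {..<L}"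
    by (simp add: lessThan_atLeast0 image_add_atLeastLessThan add.commute)
  have "S \<union> (+) N ` {..<L} = (+) N ` T \<longleftrightarrow> S = {} \<and> T = {..<L}" if S: "S \<subseteq> {..<N}"
  proof
    assume eq: "S \<union> (+) N ` {..<L} = (+) N ` T"
    have "x \<notin> S" for x
    proof
      assume "x \<in> S"
      then have "x \<in> (+) N ` T" "x < N" using eq S by auto
      then show False by auto
    qed
    then have "S = {}" by auto
    with eq show "S = {} \<and> T = {..<L}" by (auto simp: inj_image_eq_iff)
  qed auto
  then show "gcoeff (gtop N L (gmon ((+) N ` T))) S = gcoeff (if T = {..<L} then 1 else 0) S"
    using fin by (auto simp: gcoeff_gtop gcoeff_gmon Z gcoeff_one)
qed

section \<open>The tensor superalgebra\<close>

lemma tcoeff_zero [simp]: "tcoeff 0 w = 0"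
  by (simp add: zero_stensor.rep_eq)

lemma tcoeff_add [simp]: "tcoeff (x + y) w = tcoeff x w + tcoeff y w"
  by (simp add: plus_stensor.rep_eq)

lemma tcoeff_uminus [simp]: "tcoeff (- x) w = - tcoeff x w"
  by (simp add: uminus_stensor.rep_eq)

lemma tcoeff_diff [simp]: "tcoeff (x - y) w = tcoeff x w - tcoeff y w"
  using tcoeff_add[of x "- y" w] by simp

lemma tcoeff_sum: "tcoeff (sum f I) w = (\<Sum>i\<in>I. tcoeff (f i) w)"
  by (induction I rule: infinite_finite_induct) auto

lemma tcoeff_one: "tcoeff 1 w = (if w = [] then 1 else 0)"
  by (simp add: one_stensor.rep_eq)

lemma tcoeff_scal: "tcoeff (scal a) w = (if w = [] then a else 0)"
  by (simp add: scal.rep_eq)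

lemma tcoeff_word: "tcoeff (word u) w = (if w = u then 1 else 0)"
  by (simp add: word.rep_eq)

lemmas tcoeff_mult = times_stensor.rep_eq

lemma finite_tcoeff [simp]: "finite {w. tcoeff x w \<noteq> 0}"
  using tcoeff[of x] by simp

lemma tcoeff_mult_scal [simp]: "tcoeff (x * scal a) w = tcoeff x w * a"
proof -
  have "tcoeff (x * scal a) w = (\<Sum>i\<le>length w. if i = length w then tcoeff x w * a else 0)"
    unfolding tcoeff_mult by (rule sum.cong) (auto simp: tcoeff_scal)
  then show ?thesis by simp
qed

lemma tcoeff_scal_mult: "tcoeff (scal a * x) w = grade_sign (odd_count w) a * tcoeff x w"
proof -
  have "tcoeff (scal a * x) w = (\<Sum>i\<le>length w. if i = 0 then grade_sign (odd_count w) a * tcoeff x w else 0)"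
    unfolding tcoeff_mult by (rule sum.cong) (auto simp: tcoeff_scal)
  then show ?thesis by simp
qed

lemma scal_simps [simp]: "scal 0 = 0" "scal 1 = 1"
  by (rule stensor_eqI; simp add: tcoeff_scal tcoeff_one)+

lemma scal_add: "scal (a + b) = scal a + scal b"
  by (rule stensor_eqI) (simp add: tcoeff_scal)

lemma scal_uminus: "scal (- a) = - scal a"
  by (rule stensor_eqI) (simp add: tcoeff_scal)

lemma scal_diff: "scal (a - b) = scal a - scal b"
  by (rule stensor_eqI) (simp add: tcoeff_scal)

lemma scal_mult: "scal (a * b) = scal a * scal b"
  by (rule stensor_eqI) (simp add: tcoeff_scal)

lemma scal_sum: "scal (sum f I) = (\<Sum>i\<in>I. scal (f i))"
  by (induction I rule: infinite_finite_induct) (auto simp: scal_add)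

lemma scal_power: "scal (a ^ k) = scal a ^ k"
  by (induction k) (auto simp: scal_mult)

lemma scal_of_int: "scal (of_int z) = of_int z"
proof -
  have n: "scal (of_nat k) = of_nat k" for k by (induction k) (simp_all add: scal_add)
  show ?thesis by (cases z) (simp_all add: n scal_uminus scal_add del: of_nat_Suc)
qed

lemma scal_m1: "scal ((-1) ^ k) = (-1) ^ k"
  by (simp add: scal_power scal_uminus)

lemma m1_commute: "(-1) ^ k * x = x * (-1 :: 'a::ring_1) ^ k"
  by (cases "even k") auto

lemma tcoeff_of_int_mult: "tcoeff (of_int z * x) w = of_int z * tcoeff x w"
  by (metis mult_of_int_commute scal_of_int tcoeff_mult_scal)

lemma tcoeff_m1_mult: "tcoeff ((-1) ^ k * x) w = (-1) ^ k * tcoeff x w"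
  by (cases "even k") auto

lemma word_Nil [simp]: "word [] = 1"
  by (rule stensor_eqI) (simp add: tcoeff_word tcoeff_one)

lemma word_append: "word (u @ v) = word u * word v"
proof (rule stensor_eqI)
  fix w
  have "tcoeff (word u * word v :: 'a stensor) w = (\<Sum>i\<le>length w. if i = length u then (if w = u @ v then 1 else 0) else 0)"
    unfolding tcoeff_mult
  proof (rule sum.cong)
    fix i assume "i \<in> {..length w}"
    then have "take i w = u \<and> drop i w = v \<longleftrightarrow> i = length u \<and> w = u @ v"
      by (auto simp: append_eq_conv_conj)
    then show "grade_sign (odd_count (drop i w)) (tcoeff (word u) (take i w)) * tcoeff (word v) (drop i w) =
      (if i = length u then (if w = u @ v then 1 else 0) else (0 :: 'a grassmann))"
      by (cases "take i w = u"; cases "drop i w = v") (simp_all add: tcoeff_word)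
  qed auto
  then show "tcoeff (word (u @ v) :: 'a stensor) w = tcoeff (word u * word v) w"
    by (auto simp: tcoeff_word)
qed

lemma word_Cons: "word (l # v) = word [l] * word v"
  using word_append[of "[l]" v] by simp

lemma word_prod_list: "word v = prod_list (map (\<lambda>l. word [l]) v)"
proof (induction v)
  case (Cons l v)
  then show ?case by (simp add: word_Cons[of l v])
qed simp

lemma scal_mult_word: "scal a * word w = word w * scal (grade_sign (odd_count w) a)"
  by (rule stensor_eqI) (auto simp: tcoeff_scal_mult tcoeff_word)

lemma stensor_expansion:
  assumes "finite S" "{w. tcoeff x w \<noteq> 0} \<subseteq> S"
  shows "x = (\<Sum>w\<in>S. word w * scal (tcoeff x w))"
proof (rule stensor_eqI)
  fix u
  have "tcoeff (\<Sum>w\<in>S. word w * scal (tcoeff x w)) u = (\<Sum>w\<in>S. if w = u then tcoeff x u else 0)"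
    by (auto simp: tcoeff_sum tcoeff_word intro!: sum.cong)
  also have "\<dots> = tcoeff x u" using assms by auto
  finally show "tcoeff x u = tcoeff (\<Sum>w\<in>S. word w * scal (tcoeff x w)) u" by simp
qed

text \<open>The step for words remembers that \<open>w\<close> lies in the support of the given
  tensor, so conditions on its words, such as a fixed length, are available there.\<close>

lemma stensor_induct [case_names zero word add]:
  assumes "P 0" "\<And>w a. tcoeff x w \<noteq> 0 \<Longrightarrow> P (word w * scal a)" "\<And>x y. P x \<Longrightarrow> P y \<Longrightarrow> P (x + y)"
  shows "P x"
proof -
  have "P (\<Sum>w\<in>S. word w * scal (tcoeff x w))" if "finite S" "S \<subseteq> {w. tcoeff x w \<noteq> 0}" for S
    using that by (induction S rule: finite_induct) (auto intro: assms)
  from this[OF finite_tcoeff[of x] order_refl] show ?thesis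
    using stensor_expansion[of "{w. tcoeff x w \<noteq> 0}" x] by simp
qed

lemma linear_ext_superset:
  assumes "finite S" "{w. tcoeff x w \<noteq> 0} \<subseteq> S"
  shows "linear_ext f x = (\<Sum>w\<in>S. f w * scal (tcoeff x w))"
  unfolding linear_ext_def by (rule sum.mono_neutral_left) (use assms in auto)

lemma linear_ext_add: "linear_ext f (x + y) = linear_ext f x + linear_ext f y"
proof -
  let ?S = "{w. tcoeff x w \<noteq> 0} \<union> {w. tcoeff y w \<noteq> 0}"
  have "linear_ext f (x + y) = (\<Sum>w\<in>?S. f w * scal (tcoeff (x + y) w))"
    by (rule linear_ext_superset) auto
  also have "\<dots> = (\<Sum>w\<in>?S. f w * scal (tcoeff x w)) + (\<Sum>w\<in>?S. f w * scal (tcoeff y w))"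
    by (simp add: scal_add algebra_simps sum.distrib)
  also have "\<dots> = linear_ext f x + linear_ext f y"
    by (subst (1 2) linear_ext_superset[of ?S]) auto
  finally show ?thesis .
qed

lemma linear_ext_scal: "linear_ext f (x * scal a) = linear_ext f x * scal a"
proof -
  let ?S = "{w. tcoeff x w \<noteq> 0}"
  have "linear_ext f (x * scal a) = (\<Sum>w\<in>?S. f w * scal (tcoeff (x * scal a) w))"
    by (rule linear_ext_superset) auto
  then show ?thesis by (simp add: linear_ext_def scal_mult sum_distrib_right mult.assoc)
qed

lemma linear_ext_zero [simp]: "linear_ext f 0 = 0"
  by (simp add: linear_ext_def)

lemma linear_ext_word [simp]: "linear_ext f (word w) = f w"
  by (subst linear_ext_superset[of "{w}"]) (auto simp: tcoeff_word)

lemma linear_ext_uminus: "linear_ext f (- x) = - linear_ext f x"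
  by (metis add.right_inverse add_eq_0_iff linear_ext_add linear_ext_zero)

lemma linear_ext_sum: "linear_ext f (sum g I) = (\<Sum>i\<in>I. linear_ext f (g i))"
  by (induction I rule: infinite_finite_induct) (auto simp: linear_ext_add)

lemma linear_ext_of_int: "linear_ext f (of_int z * x) = of_int z * linear_ext f x"
  by (metis linear_ext_scal mult_of_int_commute scal_of_int)

lemma linear_ext_m1: "linear_ext f ((-1) ^ k * x) = (-1) ^ k * linear_ext f x"
  by (cases "even k") (auto simp: linear_ext_uminus)

subsection \<open>Parity\<close>

setup_lifting type_definition_stensor

text \<open>The parity automorphism of the tensor superalgebra, acting on letters and coefficients
  together.\<close>

lift_definition tinv :: "'k::comm_ring_1 stensor \<Rightarrow> 'k stensor"
  is "\<lambda>f w. (-1) ^ odd_count w * grade_sign 1 (f w)"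
proof -
  fix f :: "letter list \<Rightarrow> 'k grassmann"
  assume "finite {w. f w \<noteq> 0}"
  then show "finite {w. (-1) ^ odd_count w * grade_sign 1 (f w) \<noteq> 0}"
    by (rule rev_finite_subset) auto
qed

lift_definition ttop :: "nat \<Rightarrow> nat \<Rightarrow> 'k::comm_ring_1 stensor \<Rightarrow> 'k stensor"
  is "\<lambda>N L f w. gtop N L (f w)"
proof -
  fix N L and f :: "letter list \<Rightarrow> 'k grassmann"
  assume "finite {w. f w \<noteq> 0}"
  then show "finite {w. gtop N L (f w) \<noteq> 0}"
    by (rule rev_finite_subset) auto
qed

lifting_forget stensor.lifting

lemma tcoeff_tinv: "tcoeff (tinv x) w = (-1) ^ odd_count w * grade_sign 1 (tcoeff x w)"
  by (simp add: tinv.rep_eq)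

lemma tinv_zero [simp]: "tinv 0 = 0"
  by (rule stensor_eqI) (simp add: tcoeff_tinv)

lemma tinv_one [simp]: "tinv 1 = 1"
  by (rule stensor_eqI) (simp add: tcoeff_tinv tcoeff_one)

lemma tinv_add: "tinv (x + y) = tinv x + tinv y"
  by (rule stensor_eqI) (simp add: tcoeff_tinv grade_sign_add algebra_simps)

lemma tinv_uminus: "tinv (- x) = - tinv x"
  by (rule stensor_eqI) (simp add: tcoeff_tinv grade_sign_uminus)

lemma tinv_word: "tinv (word w) = (-1) ^ odd_count w * word w"
  by (rule stensor_eqI) (simp add: tcoeff_tinv tcoeff_word tcoeff_m1_mult)

lemma tinv_scal: "tinv (scal a) = scal (grade_sign 1 a)"
  by (rule stensor_eqI) (simp add: tcoeff_tinv tcoeff_scal)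

lemma tinv_mult: "tinv (x * y) = tinv x * tinv y"
proof (rule stensor_eqI)
  fix w
  have g: "grade_sign p ((-1) ^ k * z) = (-1) ^ k * grade_sign p z" for p k and z :: "'a grassmann"
    by (cases "even k") (auto simp: grade_sign_uminus)
  have "(-1) ^ odd_count w * (grade_sign 1 (grade_sign (odd_count (drop i w)) a) * b) =
    grade_sign (odd_count (drop i w)) ((-1) ^ odd_count (take i w) * grade_sign 1 a) * ((-1) ^ odd_count (drop i w) * b)"
    for i and a b :: "'a grassmann"
  proof -
    have "odd_count w = odd_count (take i w) + odd_count (drop i w)"
      by (metis append_take_drop_id odd_count_append)
    then show ?thesis
      by (cases "even (odd_count (take i w))"; cases "even (odd_count (drop i w))")
        (simp_all add: g grade_sign_comp grade_sign_uminus add.commute)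
  qed
  then show "tcoeff (tinv (x * y)) w = tcoeff (tinv x * tinv y) w"
    by (simp add: tcoeff_tinv tcoeff_mult grade_sign_sum grade_sign_mult sum_distrib_left)
qed

definition homog :: "nat \<Rightarrow> 'k::comm_ring_1 stensor \<Rightarrow> bool" where
  "homog p x \<longleftrightarrow> tinv x = (-1) ^ p * x"

lemma homog_word: "homog (odd_count w) (word w)"
  by (simp add: homog_def tinv_word)

lemma homog_mult: "homog p x \<Longrightarrow> homog q y \<Longrightarrow> homog (p + q) (x * y)"
  unfolding homog_def tinv_mult
  by (cases "even p"; cases "even q") (simp_all)

lemma homog_add: "homog p x \<Longrightarrow> homog p y \<Longrightarrow> homog p (x + y)"
  and homog_diff: "homog p x \<Longrightarrow> homog p y \<Longrightarrow> homog p (x - y)"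
  and homog_uminus: "homog p x \<Longrightarrow> homog p (- x)"
  and homog_zero [simp]: "homog p 0"
  using tinv_add[of x "- y"] by (simp_all add: homog_def tinv_add tinv_uminus algebra_simps)

lemma homog_one [simp]: "homog 0 1"
  by (simp add: homog_def)

lemma homog_sum: "(\<And>i. i \<in> I \<Longrightarrow> homog p (f i)) \<Longrightarrow> homog p (sum f I)"
  by (induction I rule: infinite_finite_induct) (auto intro: homog_add)

lemma homog_cong: "even p = even q \<Longrightarrow> homog p x \<longleftrightarrow> homog q x"
  by (simp add: homog_def uminus_power_if)

lemma homog_scal: "geven a \<Longrightarrow> homog 0 (scal a)" "godd a \<Longrightarrow> homog 1 (scal a)"
  by (simp_all add: homog_def tinv_scal geven_def godd_def scal_uminus)

lemma homog_tcoeff: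
  assumes "homog p x"
  shows "if even (p + odd_count w) then geven (tcoeff x w) else godd (tcoeff x w)"
proof -
  have "(-1) ^ odd_count w * grade_sign 1 (tcoeff x w) = (-1) ^ p * tcoeff x w"
    using assms unfolding homog_def by (metis tcoeff_m1_mult tcoeff_tinv)
  then show ?thesis
    by (cases "even p"; cases "even (odd_count w)") (auto simp: geven_def godd_def minus_equation_iff)
qed

text \<open>The coefficient of \<open>x\<close> at \<open>w\<close> has parity
  \<open>p + odd_count w\<close>. Passing the word costs \<open>odd_count w\<close> signs and
  passing the coefficient costs the rest, so only \<open>p\<close> survives.\<close>

lemma scal_homog:
  fixes x :: "'k::field_char_0 stensor"
  assumes "homog p x"
  shows "scal a * x = x * scal (grade_sign p a)"
proof (rule stensor_eqI)
  fix w
  show "tcoeff (scal a * x) w = tcoeff (x * scal (grade_sign p a)) w"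
  proof (cases "even (p + odd_count w)")
    case True
    then have "geven (tcoeff x w)" using homog_tcoeff[OF assms, of w] by simp
    moreover have "grade_sign (odd_count w) a = grade_sign p a"
      using True by (cases "even p") (auto simp: grade_sign_eq_even grade_sign_eq_odd[of p] grade_sign_eq_odd[of "odd_count w"])
    ultimately show ?thesis by (simp add: tcoeff_scal_mult geven_commute)
  next
    case False
    then have "godd (tcoeff x w)" using homog_tcoeff[OF assms, of w] by simp
    moreover have "grade_sign (odd_count w) a = grade_sign 1 (grade_sign p a)"
      using False
      by (cases "even p") (auto simp: grade_sign_comp grade_sign_eq_even grade_sign_eq_odd[of "odd_count w"])
    ultimately show ?thesis by (simp add: tcoeff_scal_mult godd_commute)
  qed
qed

lemma scal_geven_commute:
  fixes x :: "'k::field_char_0 stensor"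
  assumes "geven a"
  shows "scal a * x = x * scal a"
  using assms by (intro stensor_eqI) (simp add: tcoeff_scal_mult grade_sign_geven geven_commute[of a])

lemma scal_godd_commute:
  fixes x :: "'k::field_char_0 stensor"
  assumes "godd a"
  shows "scal a * x = tinv x * scal a"
proof (rule stensor_eqI)
  fix w
  show "tcoeff (scal a * x) w = tcoeff (tinv x * scal a) w"
    using assms by (simp add: tcoeff_scal_mult grade_sign_godd tcoeff_tinv godd_commute mult.assoc)
qed

text \<open>Links the parity condition on supports with the eigenvector form \<open>homog\<close>,
  which is the one that behaves well under products.\<close>

lemma has_parity_homog:
  fixes x :: "'k::field_char_0 stensor"
  shows "has_parity p x \<longleftrightarrow> homog p x"
proof
  assume h: "has_parity p x"
  show "homog p x" unfolding homog_def
  proof (rule stensor_eqI, rule grassmann_eqI)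
    fix w S
    show "gcoeff (tcoeff (tinv x) w) S = gcoeff (tcoeff ((-1) ^ p * x) w) S"
    proof (cases "gcoeff (tcoeff x w) S = 0")
      case False
      then have "(odd_count w + card S) mod 2 = p mod 2" using h by (auto simp: has_parity_def)
      then have "even (odd_count w + card S) = even p" by presburger
      then show ?thesis
        by (cases "even p"; cases "even (card S)")
          (auto simp: tcoeff_tinv tcoeff_m1_mult gcoeff_grade_sign uminus_power_if)
    next
      case True
      then show ?thesis
        by (cases "even p"; cases "even (odd_count w)")
          (auto simp: tcoeff_tinv tcoeff_m1_mult gcoeff_grade_sign)
    qed
  qed
next
  assume h: "homog p x"
  show "has_parity p x" unfolding has_parity_def
  proof (intro allI impI)
    fix w S assume nz: "gcoeff (tcoeff x w) S \<noteq> 0"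
    show "(odd_count w + card S) mod 2 = p mod 2"
    proof (cases "even (p + odd_count w)")
      case True
      then have "even (card S)" using nz homog_tcoeff[OF h, of w] by (auto simp: geven_iff)
      with True show ?thesis by presburger
    next
      case False
      then have "odd (card S)" using nz homog_tcoeff[OF h, of w] by (auto simp: godd_iff)
      with False show ?thesis by presburger
    qed
  qed
qed

subsection \<open>Coefficients, lengths and the integral of a tensor\<close>

definition tvars :: "nat set \<Rightarrow> 'k::comm_ring_1 stensor set" where
  "tvars U = {x. \<forall>w. tcoeff x w \<in> gvars U}"

definition tlen :: "nat \<Rightarrow> 'k::zero stensor set" where
  "tlen l = {x. \<forall>w. tcoeff x w \<noteq> 0 \<longrightarrow> length w = l}"

lemma tvars_simps [simp]: "0 \<in> tvars U" "1 \<in> tvars U" "word w \<in> tvars U"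
  by (auto simp: tvars_def tcoeff_one tcoeff_word)

lemma tvars_add: "x \<in> tvars U \<Longrightarrow> y \<in> tvars U \<Longrightarrow> x + y \<in> tvars U"
  by (auto simp: tvars_def intro: gvars_add)

lemma tvars_sum: "(\<And>i. i \<in> I \<Longrightarrow> f i \<in> tvars U) \<Longrightarrow> sum f I \<in> tvars U"
  by (induction I rule: infinite_finite_induct) (auto intro: tvars_add)

lemma tvars_scal: "a \<in> gvars U \<Longrightarrow> scal a \<in> tvars U"
  by (auto simp: tvars_def tcoeff_scal)

lemma tvars_mult: "x \<in> tvars U \<Longrightarrow> y \<in> tvars U \<Longrightarrow> x * y \<in> tvars U"
  by (auto simp: tvars_def tcoeff_mult intro!: gvars_sum gvars_mult gvars_grade_sign)

lemma tvars_of_int: "of_int z \<in> tvars U"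
  using tvars_scal[OF gvars_simps(3)[of "of_int z" U]] by (simp only: gconst_of_int scal_of_int)

lemma tvars_m1: "(-1) ^ k \<in> tvars U"
  using tvars_of_int[of "(-1) ^ k" U] by simp

lemma tvars_prod_list: "(\<And>x. x \<in> set xs \<Longrightarrow> x \<in> tvars U) \<Longrightarrow> prod_list xs \<in> tvars U"
  by (induction xs) (auto intro: tvars_mult)

lemma tlen_simps [simp]: "0 \<in> tlen l" "(word w :: 'a::comm_ring_1 stensor) \<in> tlen l \<longleftrightarrow> length w = l"
  by (auto simp: tlen_def tcoeff_word)

lemma tlen_scal: "scal a \<in> tlen 0"
  by (auto simp: tlen_def tcoeff_scal)

lemma tlen_one [simp]: "(1 :: 'a::comm_ring_1 stensor) \<in> tlen 0"
  using tlen_scal[of "1 :: 'a grassmann"] by simp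

lemma tlen_add: "x \<in> tlen l \<Longrightarrow> y \<in> tlen l \<Longrightarrow> (x + y :: 'a::comm_ring_1 stensor) \<in> tlen l"
  unfolding tlen_def mem_Collect_eq by (metis add.right_neutral tcoeff_add)

lemma tlen_sum: "(\<And>i. i \<in> I \<Longrightarrow> (f i :: 'a::comm_ring_1 stensor) \<in> tlen l) \<Longrightarrow> sum f I \<in> tlen l"
  by (induction I rule: infinite_finite_induct) (auto intro: tlen_add)

lemma tlen_mult:
  assumes "x \<in> tlen k" "(y :: 'a::comm_ring_1 stensor) \<in> tlen l"
  shows "x * y \<in> tlen (k + l)"
  unfolding tlen_def
proof (intro CollectI allI impI)
  fix w assume "tcoeff (x * y) w \<noteq> 0"
  then obtain i where "i \<le> length w" "grade_sign (odd_count (drop i w)) (tcoeff x (take i w)) * tcoeff y (drop i w) \<noteq> 0"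
    using sum.not_neutral_contains_not_neutral[of "\<lambda>i. grade_sign (odd_count (drop i w)) (tcoeff x (take i w)) * tcoeff y (drop i w)"]
    unfolding tcoeff_mult by (metis (no_types, lifting) atMost_iff)
  then have "tcoeff x (take i w) \<noteq> 0" "tcoeff y (drop i w) \<noteq> 0" "i \<le> length w" by auto
  then show "length w = k + l" using assms unfolding tlen_def by fastforce
qed

lemma tlen_mult_scal: "x \<in> tlen k \<Longrightarrow> (x * scal a :: 'a::comm_ring_1 stensor) \<in> tlen k"
  using tlen_mult[OF _ tlen_scal, of x k a] by simp

lemma tlen_of_int: "x \<in> tlen k \<Longrightarrow> (of_int z * x :: 'a::comm_ring_1 stensor) \<in> tlen k"
  using tlen_mult_scal[of x k "of_int z"] by (simp add: scal_of_int mult_of_int_commute)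

lemma tlen_m1: "x \<in> tlen k \<Longrightarrow> ((-1) ^ j * x :: 'a::comm_ring_1 stensor) \<in> tlen k"
  using tlen_of_int[of x k "(-1) ^ j"] by simp

lemma tlen_prod_list: "(\<And>x. x \<in> set xs \<Longrightarrow> x \<in> tlen 1) \<Longrightarrow> prod_list xs \<in> (tlen (length xs) :: 'a::comm_ring_1 stensor set)"
proof (induction xs)
  case (Cons x xs)
  then show ?case using tlen_mult[of x 1 "prod_list xs" "length xs"] by auto
qed auto

text \<open>Since \<open>x\<close> has a single length, only the split after \<open>u\<close>
  contributes to the sum defining the product.\<close>

lemma tcoeff_mult_append:
  assumes "x \<in> tlen (length u)"
  shows "tcoeff (x * y) (u @ v) = grade_sign (odd_count v) (tcoeff x u) * tcoeff (y :: 'a::comm_ring_1 stensor) v"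
proof -
  have "tcoeff (x * y) (u @ v) = (\<Sum>i\<le>length (u @ v). if i = length u then grade_sign (odd_count v) (tcoeff x u) * tcoeff y v else 0)"
    unfolding tcoeff_mult
  proof (rule sum.cong)
    fix i assume i: "i \<in> {..length (u @ v)}"
    show "grade_sign (odd_count (drop i (u @ v))) (tcoeff x (take i (u @ v))) * tcoeff y (drop i (u @ v)) =
      (if i = length u then grade_sign (odd_count v) (tcoeff x u) * tcoeff y v else 0)"
    proof (cases "i = length u")
      case False
      then have "length (take i (u @ v)) \<noteq> length u" using i by auto
      then have "tcoeff x (take i (u @ v)) = 0" using assms unfolding tlen_def by blast
      then show ?thesis using False by (simp del: take_append)
    qed simp
  qed auto
  then show ?thesis by simp
qed

lemma tcoeff_ttop: "tcoeff (ttop N L x) w = gtop N L (tcoeff x w)"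
  by (simp add: ttop.rep_eq)

lemma ttop_add: "ttop N L (x + y) = ttop N L x + ttop N L y"
  by (rule stensor_eqI) (simp add: tcoeff_ttop gtop_add)

lemma ttop_zero [simp]: "ttop N L 0 = 0"
  by (rule stensor_eqI) (simp add: tcoeff_ttop)

lemma ttop_sum: "ttop N L (sum f I) = (\<Sum>i\<in>I. ttop N L (f i))"
  by (induction I rule: infinite_finite_induct) (auto simp: ttop_add)

lemma ttop_mult_scal: "x \<in> tvars {..<N} \<Longrightarrow> ttop N L (x * scal a) = x * scal (gtop N L a)"
  by (rule stensor_eqI) (simp add: tcoeff_ttop tvars_def gtop_mult)

subsection \<open>Algebra endomorphisms given on letters\<close>

definition hom_ext :: "(letter \<Rightarrow> 'k stensor) \<Rightarrow> 'k::comm_ring_1 stensor \<Rightarrow> 'k stensor" where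
  "hom_ext f = linear_ext (\<lambda>w. prod_list (map f w))"

lemmas hom_ext_add = linear_ext_add[of "\<lambda>w. prod_list (map f w)" for f, folded hom_ext_def]
lemmas hom_ext_sum = linear_ext_sum[of "\<lambda>w. prod_list (map f w)" for f, folded hom_ext_def]
lemmas hom_ext_uminus = linear_ext_uminus[of "\<lambda>w. prod_list (map f w)" for f, folded hom_ext_def]
lemmas hom_ext_mult_scal = linear_ext_scal[of "\<lambda>w. prod_list (map f w)" for f, folded hom_ext_def]
lemmas hom_ext_of_int = linear_ext_of_int[of "\<lambda>w. prod_list (map f w)" for f, folded hom_ext_def]
lemmas hom_ext_m1 = linear_ext_m1[of "\<lambda>w. prod_list (map f w)" for f, folded hom_ext_def]

lemma hom_ext_zero [simp]: "hom_ext f 0 = 0"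
  by (simp add: hom_ext_def)

lemma hom_ext_word: "hom_ext f (word w) = prod_list (map f w)"
  by (simp add: hom_ext_def)

lemma hom_ext_letter: "hom_ext f (word [l]) = f l"
  by (simp add: hom_ext_word)

lemma hom_ext_one [simp]: "hom_ext f 1 = 1"
  using hom_ext_word[of f "[]"] by simp

lemma hom_ext_scal [simp]: "hom_ext f (scal a) = scal a"
  using hom_ext_mult_scal[of f 1 a] by simp

lemma hom_ext_diff: "hom_ext f (x - y) = hom_ext f x - hom_ext f y"
  using hom_ext_add[of f x "- y"] hom_ext_uminus[of f y] by simp

lemma homog_prod_list_letters:
  assumes "\<And>l. homog (of_bool (odd_letter l)) (f l)"
  shows "homog (odd_count w) (prod_list (map f w))"
proof (induction w)
  case (Cons l w)
  have "odd_count (l # w) = of_bool (odd_letter l) + odd_count w" by (simp add: odd_count_def)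
  then show ?case using homog_mult[OF assms Cons] by simp
qed simp

text \<open>Multiplicativity needs that a coefficient passes \<open>f l\<close> with the same sign
  with which it passes the letter \<open>l\<close>; this is what preservation of parity
  provides.\<close>

lemma hom_ext_mult:
  fixes f :: "letter \<Rightarrow> 'k::field_char_0 stensor"
  assumes f: "\<And>l. homog (of_bool (odd_letter l)) (f l)"
  shows "hom_ext f (x * y) = hom_ext f x * hom_ext f y"
proof (induction x rule: stensor_induct)
  case (word u a)
  show ?case
  proof (induction y rule: stensor_induct)
    case (word v b)
    have s: "word u * scal a * (word v * scal b) = word (u @ v) * scal (grade_sign (odd_count v) a * b)"
      by (simp add: word_append scal_mult mult.assoc) (simp add: mult.assoc[symmetric] scal_mult_word)
    have "scal a * prod_list (map f v) = prod_list (map f v) * scal (grade_sign (odd_count v) a)"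
      by (rule scal_homog[OF homog_prod_list_letters[OF f]])
    then show ?case
      unfolding s hom_ext_mult_scal hom_ext_word
      by (simp add: scal_mult mult.assoc) (simp add: mult.assoc[symmetric])
  qed (auto simp: hom_ext_add algebra_simps)
qed (auto simp: hom_ext_add algebra_simps)

lemma hom_ext_prod_list:
  fixes f :: "letter \<Rightarrow> 'k::field_char_0 stensor"
  assumes f: "\<And>l. homog (of_bool (odd_letter l)) (f l)"
  shows "hom_ext f (prod_list xs) = prod_list (map (hom_ext f) xs)"
  by (induction xs) (auto simp: hom_ext_mult[OF f])

lemma hom_ext_comp:
  fixes f :: "letter \<Rightarrow> 'k::field_char_0 stensor"
  assumes f: "\<And>l. homog (of_bool (odd_letter l)) (f l)"
  shows "hom_ext f (hom_ext g x) = hom_ext (\<lambda>l. hom_ext f (g l)) x"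
proof (induction x rule: stensor_induct)
  case (word w a)
  show ?case by (simp add: hom_ext_mult_scal hom_ext_word hom_ext_prod_list[OF f] o_def)
qed (auto simp: hom_ext_add)

lemma hom_ext_cong:
  assumes "\<And>w l. tcoeff x w \<noteq> 0 \<Longrightarrow> l \<in> set w \<Longrightarrow> f l = g l"
  shows "hom_ext f x = hom_ext g x"
proof (induction x rule: stensor_induct)
  case (word w a)
  then have "map f w = map g w" using assms by (intro map_cong) auto
  then show ?case by (simp only: hom_ext_mult_scal hom_ext_word)
qed (auto simp: hom_ext_add)

text \<open>Integration commutes with a substitution whose coefficients avoid the integration
  variables. This is how the action of a matrix is moved from the integral to the integrand.\<close>

lemma ttop_hom_ext:
  assumes f: "\<And>l. f l \<in> tvars {..<N}"
  shows "ttop N L (hom_ext f x) = hom_ext f (ttop N L x)"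
proof (induction x rule: stensor_induct)
  case (word w a)
  have "prod_list (map f w) \<in> tvars {..<N}" by (rule tvars_prod_list) (use f in auto)
  then show ?case by (simp add: hom_ext_mult_scal hom_ext_word ttop_mult_scal)
qed (auto simp: hom_ext_add ttop_add)

section \<open>The action of permutations on tensors\<close>

abbreviation pinv :: "('a \<Rightarrow> 'a) \<Rightarrow> 'a \<Rightarrow> 'a" where
  "pinv \<equiv> inv_into UNIV"

definition inv_pairs :: "(nat \<Rightarrow> nat) \<Rightarrow> letter list \<Rightarrow> (nat \<times> nat) set" where
  "inv_pairs \<sigma> v = {(i, j). i < j \<and> j < length v \<and> \<sigma> i > \<sigma> j \<and> odd_letter (v ! i) \<and> odd_letter (v ! j)}"

definition perm_word :: "(nat \<Rightarrow> nat) \<Rightarrow> letter list \<Rightarrow> letter list" where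
  "perm_word \<sigma> v = map (\<lambda>k. v ! pinv \<sigma> k) [0..<length v]"

lemma sym_left_add: "sym_left \<sigma> (x + y) = sym_left \<sigma> x + sym_left \<sigma> y"
  and sym_left_sum: "sym_left \<sigma> (sum g I) = (\<Sum>i\<in>I. sym_left \<sigma> (g i))"
  and sym_left_mult_scal: "sym_left \<sigma> (x * scal a) = sym_left \<sigma> x * scal a"
  and sym_left_of_int: "sym_left \<sigma> (of_int z * x) = of_int z * sym_left \<sigma> x"
  and sym_left_m1: "sym_left \<sigma> ((-1) ^ k * x) = (-1) ^ k * sym_left \<sigma> x"
  by (simp_all add: sym_left_def linear_ext_add linear_ext_sum linear_ext_scal linear_ext_of_int linear_ext_m1)

lemma sym_left_zero [simp]: "sym_left \<sigma> 0 = 0"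
  by (simp add: sym_left_def)

lemma sym_left_word: "sym_left \<sigma> (word v) = (-1) ^ card (inv_pairs \<sigma> v) * word (perm_word \<sigma> v)"
  by (simp add: sym_left_def inv_pairs_def perm_word_def)

lemma length_perm_word [simp]: "length (perm_word \<sigma> v) = length v"
  by (simp add: perm_word_def)

lemma perm_word_nth: "k < length v \<Longrightarrow> perm_word \<sigma> v ! k = v ! pinv \<sigma> k"
  by (simp add: perm_word_def)

lemma perm_word_nth_image:
  assumes "\<sigma> permutes {..<length v}" "k < length v"
  shows "perm_word \<sigma> v ! \<sigma> k = v ! k"
  using assms permutes_in_image[OF assms(1), of k] by (simp add: perm_word_nth permutes_inverses)

lemma mset_perm_word: "\<sigma> permutes {..<length v} \<Longrightarrow> mset (perm_word \<sigma> v) = mset v"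
  using mset_permute_list[of "pinv \<sigma>" v] by (simp add: permute_list_def perm_word_def permutes_inv)

lemma set_perm_word: "\<sigma> permutes {..<length v} \<Longrightarrow> set (perm_word \<sigma> v) = set v"
  by (metis mset_perm_word set_mset_mset)

lemma odd_count_mset: "odd_count v = size (filter_mset odd_letter (mset v))"
  by (simp add: odd_count_def flip: mset_filter)

lemma finite_inv_pairs [simp]: "finite (inv_pairs \<sigma> v)"
  by (rule finite_subset[of _ "{..<length v} \<times> {..<length v}"]) (auto simp: inv_pairs_def)

lemma perm_word_comp:
  assumes "\<sigma> permutes {..<length v}" "\<tau> permutes {..<length v}"
  shows "perm_word (\<sigma> \<circ> \<tau>) v = perm_word \<sigma> (perm_word \<tau> v)"
proof (rule nth_equalityI)
  fix k assume "k < length (perm_word (\<sigma> \<circ> \<tau>) v)"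
  then have k: "k < length v" by simp
  then have "pinv \<sigma> k < length v" using permutes_in_image[OF permutes_inv[OF assms(1)], of k] by simp
  then show "perm_word (\<sigma> \<circ> \<tau>) v ! k = perm_word \<sigma> (perm_word \<tau> v) ! k"
    using k assms by (simp add: perm_word_nth o_inv_distrib permutes_bij)
qed simp

text \<open>Let \<open>D\<close> be the set of pairs of odd positions whose sorted image under
  \<open>\<tau>\<close> is inverted by \<open>\<sigma>\<close>. A pair is inverted by the composite
  exactly if it is inverted by one of the two stages, so the inversions of
  \<open>\<sigma> \<circ> \<tau>\<close> form the symmetric difference of
  \<open>inv_pairs \<tau> v\<close> and \<open>D\<close>, and cardinalities add modulo 2.\<close>

lemma inv_pairs_comp:
  assumes \<sigma>: "\<sigma> permutes {..<length v}" and \<tau>: "\<tau> permutes {..<length v}"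
  shows "even (card (inv_pairs (\<sigma> \<circ> \<tau>) v)) =
    even (card (inv_pairs \<tau> v) + card (inv_pairs \<sigma> (perm_word \<tau> v)))"
proof -
  let ?l = "length v"
  define q where "q \<rho> = (\<lambda>(i, j). (min (\<rho> i) (\<rho> j), max (\<rho> i) (\<rho> j)))" for \<rho> :: "nat \<Rightarrow> nat"
  define P where "P = {(i, j). i < j \<and> j < ?l \<and> odd_letter (v ! i) \<and> odd_letter (v ! j)}"
  define D where "D = {p \<in> P. q \<tau> p \<in> inv_pairs \<sigma> (perm_word \<tau> v)}"
  have lt: "\<tau> k < ?l \<longleftrightarrow> k < ?l" "pinv \<tau> k < ?l \<longleftrightarrow> k < ?l" "\<sigma> k < ?l \<longleftrightarrow> k < ?l" for k
    using permutes_in_image[OF \<tau>, of k] permutes_in_image[OF \<sigma>, of k]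
      permutes_in_image[OF permutes_inv[OF \<tau>], of k] by auto
  have inj: "\<tau> i = \<tau> j \<longleftrightarrow> i = j" "\<sigma> i = \<sigma> j \<longleftrightarrow> i = j" "pinv \<tau> i = pinv \<tau> j \<longleftrightarrow> i = j" for i j
    using permutes_inj[OF \<tau>] permutes_inj[OF \<sigma>] permutes_inj[OF permutes_inv[OF \<tau>]] by (auto dest: injD)
  have w: "perm_word \<tau> v ! \<tau> k = v ! k" if "k < ?l" for k
    using perm_word_nth_image[OF \<tau>] that by simp
  have iv: "pinv \<tau> (\<tau> k) = k" "\<tau> (pinv \<tau> k) = k" for k using permutes_inverses[OF \<tau>] by auto
  have "bij_betw (q \<tau>) D (inv_pairs \<sigma> (perm_word \<tau> v))"
  proof (rule bij_betw_byWitness[where f' = "q (pinv \<tau>)"])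
    show "\<forall>p\<in>D. q (pinv \<tau>) (q \<tau> p) = p"
      by (auto simp: D_def P_def q_def min_def max_def iv)
    show "\<forall>p\<in>inv_pairs \<sigma> (perm_word \<tau> v). q \<tau> (q (pinv \<tau>) p) = p"
      by (auto simp: inv_pairs_def q_def min_def max_def iv)
    show "q \<tau> ` D \<subseteq> inv_pairs \<sigma> (perm_word \<tau> v)" by (auto simp: D_def)
    show "q (pinv \<tau>) ` inv_pairs \<sigma> (perm_word \<tau> v) \<subseteq> D"
    proof
      fix p assume "p \<in> q (pinv \<tau>) ` inv_pairs \<sigma> (perm_word \<tau> v)"
      then obtain i j where p: "p = q (pinv \<tau>) (i, j)" and ij: "(i, j) \<in> inv_pairs \<sigma> (perm_word \<tau> v)" by auto
      then have *: "i < j" "j < ?l" "\<sigma> j < \<sigma> i" "odd_letter (v ! pinv \<tau> i)" "odd_letter (v ! pinv \<tau> j)"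
        by (auto simp: inv_pairs_def perm_word_nth)
      then have ne: "pinv \<tau> i \<noteq> pinv \<tau> j" and l: "pinv \<tau> i < ?l" "pinv \<tau> j < ?l" by (auto simp: inj lt)
      have "q \<tau> p = (i, j)" using * by (auto simp: p q_def min_def max_def iv)
      moreover have "p \<in> P" using * ne l by (auto simp: p q_def P_def min_def max_def)
      ultimately show "p \<in> D" using ij by (simp add: D_def)
    qed
  qed
  then have cD: "card D = card (inv_pairs \<sigma> (perm_word \<tau> v))" by (rule bij_betw_same_card)
  have "inv_pairs (\<sigma> \<circ> \<tau>) v = (inv_pairs \<tau> v - D) \<union> (D - inv_pairs \<tau> v)"
  proof (rule Set.set_eqI)
    fix p :: "nat \<times> nat"
    obtain i j where p: "p = (i, j)" by (cases p)
    show "p \<in> inv_pairs (\<sigma> \<circ> \<tau>) v \<longleftrightarrow> p \<in> (inv_pairs \<tau> v - D) \<union> (D - inv_pairs \<tau> v)"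
    proof (cases "p \<in> P")
      case False
      then show ?thesis by (auto simp: p P_def D_def inv_pairs_def)
    next
      case True
      then have ij: "i < j" "j < ?l" "odd_letter (v ! i)" "odd_letter (v ! j)" by (auto simp: P_def p)
      then have ne: "\<tau> i \<noteq> \<tau> j" "\<sigma> (\<tau> i) \<noteq> \<sigma> (\<tau> j)" and l: "\<tau> i < ?l" "\<tau> j < ?l" by (auto simp: inj lt)
      show ?thesis
      proof (cases "\<tau> i < \<tau> j")
        case True
        then have "p \<in> D \<longleftrightarrow> \<sigma> (\<tau> i) > \<sigma> (\<tau> j)"
          using ij l \<open>p \<in> P\<close> by (auto simp: D_def p q_def inv_pairs_def w)
        then show ?thesis using True ij by (auto simp: p inv_pairs_def)
      next
        case False
        then have "p \<in> D \<longleftrightarrow> \<sigma> (\<tau> j) > \<sigma> (\<tau> i)"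
          using ij l ne \<open>p \<in> P\<close> by (auto simp: D_def p q_def inv_pairs_def w)
        then show ?thesis using False ij ne by (auto simp: p inv_pairs_def)
      qed
    qed
  qed
  moreover have "finite D"
    by (rule finite_subset[of _ "{..<?l} \<times> {..<?l}"]) (auto simp: D_def P_def)
  ultimately have "card (inv_pairs (\<sigma> \<circ> \<tau>) v) = card (inv_pairs \<tau> v - D) + card (D - inv_pairs \<tau> v)"
    by (simp only:) (subst card_Un_disjoint; auto)
  moreover have "card (inv_pairs \<tau> v) = card (inv_pairs \<tau> v - D) + card (inv_pairs \<tau> v \<inter> D)"
    "card D = card (D - inv_pairs \<tau> v) + card (inv_pairs \<tau> v \<inter> D)"
    using \<open>finite D\<close> by (simp_all add: card_Diff_subset_Int Int_commute card_mono)
  ultimately have "card (inv_pairs (\<sigma> \<circ> \<tau>) v) + 2 * card (inv_pairs \<tau> v \<inter> D) =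
      card (inv_pairs \<tau> v) + card (inv_pairs \<sigma> (perm_word \<tau> v))"
    using cD by linarith
  then show ?thesis by (metis dvd_triv_left even_add)
qed

lemma sym_left_comp:
  assumes "\<sigma> permutes {..<l}" "\<tau> permutes {..<l}" "x \<in> tlen l"
  shows "sym_left (\<sigma> \<circ> \<tau>) x = sym_left \<sigma> (sym_left \<tau> x)"
proof (induction x rule: stensor_induct)
  case (word w a)
  then have l: "length w = l" using assms(3) by (auto simp: tlen_def)
  have "(-1) ^ card (inv_pairs (\<sigma> \<circ> \<tau>) w) = (-1) ^ card (inv_pairs \<tau> w) * (-1 :: 'a stensor) ^ card (inv_pairs \<sigma> (perm_word \<tau> w))"
    using inv_pairs_comp[of \<sigma> w \<tau>] assms l by (simp add: uminus_power_if)
  moreover have "perm_word (\<sigma> \<circ> \<tau>) w = perm_word \<sigma> (perm_word \<tau> w)"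
    using perm_word_comp[of \<sigma> w \<tau>] assms l by simp
  ultimately show ?case
    unfolding sym_left_mult_scal sym_left_word sym_left_m1 by (simp only: mult.assoc)
qed (auto simp: sym_left_add)

lemma sym_left_id [simp]: "sym_left id x = x"
proof (induction x rule: stensor_induct)
  case (word w a)
  have "inv_pairs id w = {}" by (auto simp: inv_pairs_def)
  moreover have "perm_word id w = w" by (simp add: perm_word_def map_nth)
  ultimately show ?case
    unfolding sym_left_mult_scal sym_left_word by (simp only: card.empty power_0 mult_1_left)
qed (auto simp: sym_left_add)

lemma sym_left_tlen: "x \<in> tlen l \<Longrightarrow> sym_left \<sigma> x \<in> tlen l"
proof -
  assume x: "x \<in> tlen l"
  show ?thesis
  proof (induction x rule: stensor_induct)
    case (word w a)
    then have "length w = l" using x by (auto simp: tlen_def)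
    then show ?case by (simp add: sym_left_mult_scal sym_left_word tlen_mult_scal tlen_m1)
  qed (auto simp: sym_left_add intro: tlen_add)
qed

lemma sym_left_tvars: "x \<in> tvars U \<Longrightarrow> sym_left \<sigma> x \<in> tvars U"
proof -
  assume "x \<in> tvars U"
  then have "tcoeff x w \<in> gvars U" for w by (simp add: tvars_def)
  then have "sym_left \<sigma> (\<Sum>w | tcoeff x w \<noteq> 0. word w * scal (tcoeff x w)) \<in> tvars U"
    unfolding sym_left_sum sym_left_mult_scal sym_left_word
    by (intro tvars_sum tvars_mult tvars_scal tvars_m1 tvars_simps)
  then show ?thesis using stensor_expansion[of "{w. tcoeff x w \<noteq> 0}" x] by simp
qed

text \<open>Reduces the right action used for dual tensors to the left action, so that one theory of
  symmetrizers serves both; an inverted pair is carried to the pair of its images in reverse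
  order.\<close>

lemma sym_right_sym_left:
  assumes "\<sigma> permutes {..<l}" "x \<in> tlen l"
  shows "sym_right x \<sigma> = sym_left (pinv \<sigma>) x"
  unfolding sym_right_def
proof (induction x rule: stensor_induct)
  case (word w a)
  then have l: "length w = l" using assms by (auto simp: tlen_def)
  have lt: "\<sigma> k < l \<longleftrightarrow> k < l" "pinv \<sigma> k < l \<longleftrightarrow> k < l" for k
    using permutes_in_image[OF assms(1), of k] permutes_in_image[OF permutes_inv[OF assms(1)], of k] by auto
  have iv: "pinv \<sigma> (\<sigma> k) = k" "\<sigma> (pinv \<sigma> k) = k" for k using permutes_inverses[OF assms(1)] by auto
  let ?A = "{(i, j). i < j \<and> j < length w \<and> \<sigma> i > \<sigma> j \<and> odd_letter (w ! \<sigma> i) \<and> odd_letter (w ! \<sigma> j)}"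
  have "bij_betw (\<lambda>(i, j). (\<sigma> j, \<sigma> i)) ?A (inv_pairs (pinv \<sigma>) w)"
    by (rule bij_betw_byWitness[where f' = "\<lambda>(i, j). (pinv \<sigma> j, pinv \<sigma> i)"]) (auto simp: inv_pairs_def iv lt l)
  then have "card ?A = card (inv_pairs (pinv \<sigma>) w)" by (rule bij_betw_same_card)
  moreover have "map (\<lambda>k. w ! \<sigma> k) [0..<length w] = perm_word (pinv \<sigma>) w"
    by (simp add: perm_word_def inv_inv_eq permutes_bij[OF assms(1)])
  ultimately show ?case
    by (simp add: linear_ext_scal sym_left_mult_scal sym_left_word)
qed (auto simp: linear_ext_add sym_left_add)

subsection \<open>Products of vectors of the same parity\<close>

lemma perm_adjacent_induct [consumes 1, case_names id adjacent comp]: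
  assumes "\<tau> permutes {..<l}" "P id"
    and adj: "\<And>k. Suc k < l \<Longrightarrow> P (transpose k (Suc k))"
    and comp: "\<And>\<sigma> \<tau>. \<sigma> permutes {..<l} \<Longrightarrow> \<tau> permutes {..<l} \<Longrightarrow> P \<sigma> \<Longrightarrow> P \<tau> \<Longrightarrow> P (\<sigma> \<circ> \<tau>)"
  shows "P \<tau>"
proof -
  have list: "P (apply_adj_transps ks)" if "\<forall>k\<in>set ks. Suc k < l" for ks
    using that
  proof (induction ks)
    case (Cons k ks)
    have "transpose k (Suc k) permutes {..<l}" using Cons.prems by (intro permutes_swap_id) auto
    moreover have "apply_adj_transps ks permutes {..<l}" using Cons.prems by (intro permutes_apply_adj_transps) auto
    moreover have "P (transpose k (Suc k))" "P (apply_adj_transps ks)" using Cons adj by auto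
    ultimately show ?case unfolding apply_adj_transps_Cons Suc_eq_plus1[symmetric] by (rule comp)
  qed (simp add: assms(2))
  have tr: "P (transpose a b)" if "a < b" "b < l" for a b
    using list[of "adj_transp_seq a b"] that by (simp add: adj_transp_seq_correct set_adj_transp_seq)
  show ?thesis using assms(1) finite_lessThan
  proof (induction rule: permutes_induct)
    case (swap a b p)
    have "P (transpose a b)" using swap tr[of a b] tr[of b a]
      by (cases "a < b") (auto simp: transpose_commute)
    then show ?case using swap by (intro comp permutes_swap_id)
  qed (rule assms(2))
qed

text \<open>The coefficient stays unspecified: around an adjacent transposition the outer factors
  only have to be monomials. The exact sign is supplied by
  \<open>prod_monomials_exact\<close>.\<close>

lemma prod_monomials:
  "\<exists>r. prod_list (map (\<lambda>k. word [v k] * scal (a k)) ks) = word (map v ks) * scal (r :: 'k::comm_ring_1 grassmann)"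
proof (induction ks)
  case (Cons k ks)
  then obtain r where r: "prod_list (map (\<lambda>k. word [v k] * scal (a k)) ks) = word (map v ks) * scal r" by auto
  have "word [v k] * scal (a k) * (word (map v ks) * scal r) =
    word [v k] * word (map v ks) * scal (grade_sign (odd_count (map v ks)) (a k) * r)"
    by (simp add: mult.assoc scal_mult) (simp add: mult.assoc[symmetric] scal_mult_word)
  then show ?case
    by (intro exI[of _ "grade_sign (odd_count (map v ks)) (a k) * r"])
      (simp only: list.map prod_list.Cons r word_Cons[of "v k" "map v ks"])
qed (intro exI[of _ 1], simp)

lemma monomial_mult:
  "word u * scal a * (word v * scal b) = word (u @ v) * scal (grade_sign (odd_count v) a * b)"
  by (simp add: word_append scal_mult mult.assoc) (simp add: mult.assoc[symmetric] scal_mult_word)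

lemma perm_word_adjacent: "perm_word (transpose (length u) (Suc (length u))) (u @ [c, d] @ t) = u @ [d, c] @ t"
proof (rule nth_equalityI)
  fix i assume "i < length (perm_word (transpose (length u) (Suc (length u))) (u @ [c, d] @ t))"
  then have i: "i < length (u @ [c, d] @ t)" by simp
  consider "i < length u" | "i = length u" | "i = Suc (length u)" | "i > Suc (length u)" by linarith
  then show "perm_word (transpose (length u) (Suc (length u))) (u @ [c, d] @ t) ! i = (u @ [d, c] @ t) ! i"
    unfolding perm_word_nth[OF i] inv_swap_id
    by cases (simp_all add: nth_append nth_Cons' transpose_def)
qed simp

lemma inv_pairs_adjacent:
  "inv_pairs (transpose (length u) (Suc (length u))) (u @ [c, d] @ t) =
    (if odd_letter c \<and> odd_letter d then {(length u, Suc (length u))} else {})"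
proof -
  have "transpose k (Suc k) i > transpose k (Suc k) j \<longleftrightarrow> i = k \<and> j = Suc k" if "i < j" for i j k :: nat
    using that by (auto simp: transpose_def)
  then have "inv_pairs (transpose (length u) (Suc (length u))) (u @ [c, d] @ t) =
      {(i, j). i = length u \<and> j = Suc (length u) \<and> odd_letter ((u @ [c, d] @ t) ! i) \<and> odd_letter ((u @ [c, d] @ t) ! j)}"
    by (auto simp: inv_pairs_def)
  moreover have "(u @ [c, d] @ t) ! length u = c" "(u @ [c, d] @ t) ! Suc (length u) = d"
    by (simp_all add: nth_append)
  ultimately show ?thesis by auto
qed

definition par_letter :: "letter \<Rightarrow> nat" where
  "par_letter l = of_bool (odd_letter l)"

lemma homogeneous_commute:
  fixes x y :: "'k::field_char_0 grassmann"
  assumes x: "if X then geven x else godd x" and y: "if Y then geven y else godd y"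
  shows "y * x = (if X \<or> Y then x * y else - (x * y))"
proof (cases X)
  case True
  then show ?thesis using x geven_commute[of x y] by simp
next
  case False
  then have eq: "x * y = grade_sign 1 y * x" using x godd_commute[of x y] by simp
  show ?thesis
  proof (cases Y)
    case True
    then have "grade_sign 1 y = y" using y by (simp add: geven_def)
    then show ?thesis using True eq by metis
  next
    case nY: False
    then have "grade_sign 1 y = - y" using y by (simp add: godd_def)
    then have "x * y = - (y * x)" using eq by simp
    then show ?thesis using False nY by simp
  qed
qed

lemma swap_sign:
  fixes x y :: "'k::field_char_0 grassmann"
  assumes x: "if even (p + of_bool c) then geven x else godd x"
    and y: "if even (p + of_bool d) then geven y else godd y"
  shows "(-1) ^ of_bool (c \<and> d) * (grade_sign (of_bool c) y * x) = (-1) ^ p * (grade_sign (of_bool d) x * y)"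
  using x y by (cases "even p"; cases c; cases d)
    (simp_all add: homogeneous_commute[OF x y] grade_sign_geven grade_sign_godd)

text \<open>Each factor has total parity \<open>p\<close>, shared between its letter and its
  coefficient. The action contributes the sign of exchanging the two letters; exchanging the
  coefficients and moving them past the letters contributes the other signs, and together they give
  the sign of exchanging two vectors of parity \<open>p\<close>.\<close>

lemma sym_left_adjacent:
  fixes a :: "nat \<Rightarrow> 'k::field_char_0 grassmann"
  assumes a: "\<And>k. grade_sign 1 (a k) = (-1) ^ (p + par_letter (v k)) * a k"
    and k: "Suc k < l" and s: "s = transpose k (Suc k)"
  shows "sym_left s (prod_list (map (\<lambda>k. word [v (s k)] * scal (a (s k))) [0..<l])) =
    (-1) ^ p * prod_list (map (\<lambda>k. word [v k] * scal (a k)) [0..<l])"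
proof -
  let ?x = "\<lambda>k. word [v k] * scal (a k)"
  have split: "[0..<l] = [0..<k] @ [k, Suc k] @ [Suc (Suc k)..<l]"
    using k upt_add_eq_append[of 0 k "l - k"] by (simp add: upt_conv_Cons)
  obtain b where b: "prod_list (map ?x [0..<k]) = word (map v [0..<k]) * scal b" using prod_monomials by blast
  obtain c where c: "prod_list (map ?x [Suc (Suc k)..<l]) = word (map v [Suc (Suc k)..<l]) * scal c"
    using prod_monomials by blast
  let ?u = "map v [0..<k]" and ?t = "map v [Suc (Suc k)..<l]"
  have "map (\<lambda>k. ?x (s k)) [0..<k] = map ?x [0..<k]" "map (\<lambda>k. ?x (s k)) [Suc (Suc k)..<l] = map ?x [Suc (Suc k)..<l]"
    by (auto simp: s transpose_def)
  then have "prod_list (map (\<lambda>k. ?x (s k)) [0..<k]) = word (map v [0..<k]) * scal b"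
    "prod_list (map (\<lambda>k. ?x (s k)) [Suc (Suc k)..<l]) = word (map v [Suc (Suc k)..<l]) * scal c"
    by (simp_all only: b c)
  moreover have "s k = Suc k" "s (Suc k) = k" by (auto simp: s)
  ultimately have L: "prod_list (map (\<lambda>k. ?x (s k)) [0..<l]) =
      word ?u * scal b * (?x (Suc k) * ?x k * (word ?t * scal c))"
    unfolding split by (simp add: mult.assoc)
  have R: "prod_list (map ?x [0..<l]) = word ?u * scal b * (?x k * ?x (Suc k) * (word ?t * scal c))"
    unfolding split using b c by (simp add: mult.assoc)
  let ?f = "\<lambda>r. grade_sign (odd_count ([v k, v (Suc k)] @ ?t)) b * (grade_sign (odd_count ?t) r * c)"
  have oc: "odd_count ([v (Suc k), v k] @ ?t) = odd_count ([v k, v (Suc k)] @ ?t)"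
    by (simp add: odd_count_def)
  let ?r = "grade_sign (par_letter (v k)) (a (Suc k)) * a k" and ?r' = "grade_sign (par_letter (v (Suc k))) (a k) * a (Suc k)"
  have pl: "odd_count [x] = par_letter x" for x by (simp add: odd_count_def par_letter_def)
  have L': "prod_list (map (\<lambda>k. ?x (s k)) [0..<l]) = word (?u @ [v (Suc k), v k] @ ?t) * scal (?f ?r)"
    unfolding L monomial_mult oc[symmetric] by (simp add: pl)
  have R': "prod_list (map ?x [0..<l]) = word (?u @ [v k, v (Suc k)] @ ?t) * scal (?f ?r')"
    unfolding R monomial_mult by (simp add: pl)
  have lenu: "length ?u = k" by simp
  have S: "sym_left s (word (?u @ [v (Suc k), v k] @ ?t)) =
      (-1) ^ (of_bool (odd_letter (v k) \<and> odd_letter (v (Suc k)))) * (word (?u @ [v k, v (Suc k)] @ ?t) :: 'k stensor)"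
    using perm_word_adjacent[of ?u "v (Suc k)" "v k" ?t] inv_pairs_adjacent[of ?u "v (Suc k)" "v k" ?t]
    by (simp add: sym_left_word s)
  have ab: "(-1) ^ (of_bool (odd_letter (v k) \<and> odd_letter (v (Suc k)))) * ?r = (-1) ^ p * ?r'"
  proof -
    have par: "if even (p + of_bool (odd_letter (v j))) then geven (a j) else godd (a j)" for j
      using a[of j] by (cases "even p"; cases "odd_letter (v j)") (auto simp: par_letter_def geven_def godd_def)
    show ?thesis
      unfolding par_letter_def by (rule swap_sign[OF par par])
  qed
  have f_m1: "?f ((-1) ^ j * r) = (-1) ^ j * ?f r" for j r
    by (cases "even j") (auto simp: grade_sign_uminus)
  have sc: "scal ((-1) ^ j * r) = (-1) ^ j * scal r" for j and r :: "'k grassmann"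
    by (cases "even j") (auto simp: scal_uminus)
  have "sym_left s (prod_list (map (\<lambda>k. ?x (s k)) [0..<l])) =
    word (?u @ [v k, v (Suc k)] @ ?t) * scal (?f ((-1) ^ (of_bool (odd_letter (v k) \<and> odd_letter (v (Suc k)))) * ?r))"
    unfolding L' sym_left_mult_scal S f_m1 sc by (simp add: m1_commute mult.assoc)
  also have "\<dots> = (-1) ^ p * prod_list (map ?x [0..<l])"
    unfolding ab f_m1 sc R' by (cases "even p") auto
  finally show ?thesis .
qed

lemma tlen_prod_map:
  "(\<And>k. k \<in> set ks \<Longrightarrow> f k \<in> tlen 1) \<Longrightarrow> prod_list (map f ks) \<in> (tlen (length ks) :: 'a::comm_ring_1 stensor set)"
  using tlen_prod_list[of "map f ks"] by auto

text \<open>Induction over adjacent transpositions. The families \<open>v\<close> and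
  \<open>a\<close> have to be arbitrary, because the inner permutation of a composite acts on a
  family already reindexed by the outer one.\<close>

lemma sym_left_prod_comp:
  fixes a :: "nat \<Rightarrow> 'k::field_char_0 grassmann"
  assumes "\<tau> permutes {..<l}" "\<And>k. grade_sign 1 (a k) = (-1) ^ (p + par_letter (v k)) * a k"
  shows "sym_left \<tau> (prod_list (map (\<lambda>k. word [v (\<tau> k)] * scal (a (\<tau> k))) [0..<l])) =
    of_int (sign \<tau> ^ p) * prod_list (map (\<lambda>k. word [v k] * scal (a k)) [0..<l])"
  using assms
proof (induction arbitrary: v a rule: perm_adjacent_induct)
  case id
  show ?case unfolding sym_left_id by simp
next
  case (adjacent k)
  have "of_int (sign (transpose k (Suc k)) ^ p) = (-1 :: 'k stensor) ^ p" by (simp add: sign_swap_id)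
  then show ?case using sym_left_adjacent[OF adjacent(2,1) refl] by simp
next
  case (comp \<sigma> \<tau>)
  let ?x = "\<lambda>k. word [v k] * scal (a k)"
  have len: "prod_list (map (\<lambda>k. word [v (f k)] * scal (a (f k))) [0..<l]) \<in> tlen l" for f
    using tlen_prod_map[of "[0..<l]" "\<lambda>k. word [v (f k)] * scal (a (f k))"] by (simp add: tlen_mult_scal)
  have "sym_left (\<sigma> \<circ> \<tau>) (prod_list (map (\<lambda>k. ?x ((\<sigma> \<circ> \<tau>) k)) [0..<l])) =
      sym_left \<sigma> (sym_left \<tau> (prod_list (map (\<lambda>k. ?x (\<sigma> (\<tau> k))) [0..<l])))"
    using sym_left_comp[OF comp(1,2) len[of "\<sigma> \<circ> \<tau>"]] by simp
  also have "\<dots> = sym_left \<sigma> (of_int (sign \<tau> ^ p) * prod_list (map (\<lambda>k. ?x (\<sigma> k)) [0..<l]))"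
    by (rule arg_cong[OF comp(4)]) (rule comp.prems)
  also have "\<dots> = of_int (sign \<tau> ^ p) * (of_int (sign \<sigma> ^ p) * prod_list (map ?x [0..<l]))"
    unfolding sym_left_of_int by (rule arg_cong[OF comp(3)]) (rule comp.prems)
  also have "\<dots> = of_int (sign (\<sigma> \<circ> \<tau>) ^ p) * prod_list (map ?x [0..<l])"
  proof -
    have "sign (\<sigma> \<circ> \<tau>) = sign \<tau> * sign \<sigma>"
      using comp(1,2) by (subst sign_compose) (auto simp: permutation_permutes)
    then show ?thesis by (simp only: power_mult_distrib of_int_mult mult.assoc)
  qed
  finally show ?case .
qed

lemma sym_left_prod:
  fixes a :: "nat \<Rightarrow> 'k::field_char_0 grassmann"
  assumes "\<tau> permutes {..<l}" "\<And>k. k < l \<Longrightarrow> grade_sign 1 (a k) = (-1) ^ (p + par_letter (v k)) * a k"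
  shows "sym_left \<tau> (prod_list (map (\<lambda>k. word [v k] * scal (a k)) [0..<l])) =
    of_int (sign \<tau> ^ p) * prod_list (map (\<lambda>k. word [v (pinv \<tau> k)] * scal (a (pinv \<tau> k))) [0..<l])"
proof -
  \<comment> \<open>Zero is both even and odd, so continuing by 0 beyond \<open>l\<close> turns the
    parity condition into one for all indices, as \<open>sym_left_prod_comp\<close> demands.\<close>
  define b where "b k = (if k < l then a k else 0)" for k
  have lt: "pinv \<tau> k < l \<longleftrightarrow> k < l" for k
    using permutes_in_image[OF permutes_inv[OF assms(1)], of k] by auto
  have "sym_left \<tau> (prod_list (map (\<lambda>k. word [v (pinv \<tau> (\<tau> k))] * scal (b (pinv \<tau> (\<tau> k)))) [0..<l])) =
    of_int (sign \<tau> ^ p) * prod_list (map (\<lambda>k. word [v (pinv \<tau> k)] * scal (b (pinv \<tau> k))) [0..<l])"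
    by (rule sym_left_prod_comp[OF assms(1), where v = "\<lambda>k. v (pinv \<tau> k)" and a = "\<lambda>k. b (pinv \<tau> k)"])
      (use assms(2) lt in \<open>auto simp: b_def\<close>)
  moreover have "map (\<lambda>k. word [v k] * scal (b k)) [0..<l] = map (\<lambda>k. word [v k] * scal (a k)) [0..<l]"
    "map (\<lambda>k. word [v (pinv \<tau> k)] * scal (b (pinv \<tau> k))) [0..<l] = map (\<lambda>k. word [v (pinv \<tau> k)] * scal (a (pinv \<tau> k))) [0..<l]"
    using lt by (auto simp: b_def)
  ultimately show ?thesis by (simp add: permutes_inverses[OF assms(1)])
qed

text \<open>Obtained from the action on tensors by attaching the even letter \<open>E 0\<close> to
  every factor: the word is then fixed by all permutations, and comparing its coefficient leaves
  only the sign.\<close>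

lemma godd_prod_permute:
  fixes z :: "nat \<Rightarrow> 'k::field_char_0 grassmann"
  assumes "\<tau> permutes {..<l}" "\<And>k. k < l \<Longrightarrow> godd (z k)"
  shows "prod_list (map (\<lambda>k. z (\<tau> k)) [0..<l]) = of_int (sign \<tau>) * prod_list (map z [0..<l])"
proof -
  have m: "prod_list (map (\<lambda>k. word [E 0] * scal (b k)) [i..<l]) = word (replicate (l - i) (E 0)) * scal (prod_list (map b [i..<l]))"
    for b :: "nat \<Rightarrow> 'k grassmann" and i
  proof (induction "l - i" arbitrary: i)
    case (Suc d)
    then have i: "[i..<l] = i # [Suc i..<l]" "l - i = Suc (l - Suc i)" by (auto simp: upt_conv_Cons)
    have "odd_count (replicate k (E 0)) = 0" for k by (simp add: odd_count_def)
    then show ?case using Suc(1)[of "Suc i"] Suc(2) by (simp add: i monomial_mult)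
  qed simp
  have "inv_pairs \<tau> (replicate l (E 0)) = {}" by (auto simp: inv_pairs_def)
  moreover have "perm_word \<tau> (replicate l (E 0)) = replicate l (E 0)"
    using set_perm_word[of \<tau> "replicate l (E 0)"] assms(1) by (intro nth_equalityI) (auto simp: perm_word_nth
        permutes_in_image[OF permutes_inv[OF assms(1)], of _, unfolded lessThan_iff])
  ultimately have s: "sym_left \<tau> (word (replicate l (E 0))) = (word (replicate l (E 0)) :: 'k stensor)"
    by (simp add: sym_left_word)
  have lt: "\<tau> k < l \<longleftrightarrow> k < l" for k
    using permutes_in_image[OF assms(1), of k] by auto
  have "sym_left \<tau> (prod_list (map (\<lambda>k. word [E 0] * scal (z (\<tau> k))) [0..<l])) =
     of_int (sign \<tau> ^ 1) * prod_list (map (\<lambda>k. word [E 0] * scal (z (\<tau> (pinv \<tau> k)))) [0..<l])"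
    by (rule sym_left_prod[OF assms(1), where v = "\<lambda>_. E 0"]) (use assms(2) lt in \<open>auto simp: godd_def par_letter_def\<close>)
  then have "word (replicate l (E 0)) * scal (prod_list (map (\<lambda>k. z (\<tau> k)) [0..<l])) =
     of_int (sign \<tau>) * (word (replicate l (E 0)) * scal (prod_list (map z [0..<l])))"
    unfolding m sym_left_mult_scal using s by (simp add: permutes_inverses[OF assms(1)])
  then have "tcoeff (word (replicate l (E 0)) * scal (prod_list (map (\<lambda>k. z (\<tau> k)) [0..<l]))) (replicate l (E 0)) =
    tcoeff (of_int (sign \<tau>) * (word (replicate l (E 0)) * scal (prod_list (map z [0..<l])))) (replicate l (E 0))"
    by simp
  then show ?thesis by (simp add: tcoeff_word tcoeff_of_int_mult)
qed

subsection \<open>Symmetrizers\<close>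

text \<open>One notion for row and column stabilizers: \<open>f\<close> gives the row or the column
  of a position.\<close>

definition line_stab :: "(nat \<Rightarrow> nat) \<Rightarrow> nat \<Rightarrow> (nat \<Rightarrow> nat) set" where
  "line_stab f l = {\<sigma>. \<sigma> permutes {..<l} \<and> (\<forall>k<l. f (\<sigma> k) = f k)}"

lemma line_stab_finite [simp]: "finite (line_stab f l)"
  by (rule finite_subset[OF _ finite_permutations[of "{..<l}"]]) (auto simp: line_stab_def)

lemma line_stab_permutes: "\<sigma> \<in> line_stab f l \<Longrightarrow> \<sigma> permutes {..<l}"
  by (simp add: line_stab_def)

lemma line_stab_less: "\<sigma> \<in> line_stab f l \<Longrightarrow> \<sigma> k < l \<longleftrightarrow> k < l"
  using permutes_in_image[of \<sigma> "{..<l}" k] by (simp add: line_stab_def)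

lemma line_stab_id [simp]: "id \<in> line_stab f l"
  by (simp add: line_stab_def permutes_id)

lemma line_stab_comp: "\<sigma> \<in> line_stab f l \<Longrightarrow> \<tau> \<in> line_stab f l \<Longrightarrow> \<sigma> \<circ> \<tau> \<in> line_stab f l"
  by (auto simp: line_stab_def permutes_compose permutes_in_image[of \<tau> "{..<l}", unfolded lessThan_iff])

lemma line_stab_inv: "\<sigma> \<in> line_stab f l \<Longrightarrow> pinv \<sigma> \<in> line_stab f l"
proof -
  assume \<sigma>: "\<sigma> \<in> line_stab f l"
  then have p: "\<sigma> permutes {..<l}" and i: "pinv \<sigma> permutes {..<l}" by (auto simp: line_stab_def permutes_inv)
  have "f (pinv \<sigma> k) = f k" if "k < l" for k
  proof -
    have "pinv \<sigma> k < l" using that permutes_in_image[OF i, of k] by simp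
    then have "f (\<sigma> (pinv \<sigma> k)) = f (pinv \<sigma> k)" using \<sigma> by (simp add: line_stab_def)
    then show ?thesis by (simp add: permutes_inverses[OF p])
  qed
  then show ?thesis using i by (simp add: line_stab_def)
qed

lemma line_stab_sum_comp_left:
  assumes "\<pi> \<in> line_stab f l"
  shows "(\<Sum>\<sigma>\<in>line_stab f l. F (\<pi> \<circ> \<sigma>)) = (\<Sum>\<sigma>\<in>line_stab f l. F \<sigma>)"
proof -
  have p: "\<pi> permutes {..<l}" using assms by (rule line_stab_permutes)
  have c: "pinv \<pi> \<circ> (\<pi> \<circ> \<sigma>) = \<sigma>" "\<pi> \<circ> (pinv \<pi> \<circ> \<sigma>) = \<sigma>" for \<sigma>
    by (rule ext, simp add: permutes_inverses[OF p])+
  show ?thesis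
    by (rule sum.reindex_bij_witness[of _ "\<lambda>\<sigma>. pinv \<pi> \<circ> \<sigma>" "\<lambda>\<sigma>. \<pi> \<circ> \<sigma>"])
      (simp_all only: c line_stab_comp line_stab_inv assms)
qed

lemma line_stab_sum_comp_right:
  assumes "\<pi> \<in> line_stab f l"
  shows "(\<Sum>\<sigma>\<in>line_stab f l. F (\<sigma> \<circ> \<pi>)) = (\<Sum>\<sigma>\<in>line_stab f l. F \<sigma>)"
proof -
  have p: "\<pi> permutes {..<l}" using assms by (rule line_stab_permutes)
  have c: "(\<sigma> \<circ> \<pi>) \<circ> pinv \<pi> = \<sigma>" "(\<sigma> \<circ> pinv \<pi>) \<circ> \<pi> = \<sigma>" for \<sigma> :: "nat \<Rightarrow> nat"
    by (rule ext, simp add: permutes_inverses[OF p])+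
  show ?thesis
    by (rule sum.reindex_bij_witness[of _ "\<lambda>\<sigma>. \<sigma> \<circ> pinv \<pi>" "\<lambda>\<sigma>. \<sigma> \<circ> \<pi>"])
      (simp_all only: c line_stab_comp line_stab_inv assms)
qed

lemma line_stab_sum_inv: "(\<Sum>\<sigma>\<in>line_stab f l. F (pinv \<sigma>)) = (\<Sum>\<sigma>\<in>line_stab f l. F \<sigma>)"
proof -
  have "pinv (pinv \<sigma>) = \<sigma>" if "\<sigma> \<in> line_stab f l" for \<sigma>
    by (rule inv_inv_eq[OF permutes_bij[OF line_stab_permutes[OF that]]])
  then have "bij_betw pinv (line_stab f l) (line_stab f l)"
    by (intro bij_betw_byWitness[where f' = pinv] ballI image_subsetI line_stab_inv)
  then show ?thesis by (rule sum.reindex_bij_betw)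
qed

lemma line_stab_sign_comp:
  "\<sigma> \<in> line_stab f l \<Longrightarrow> \<tau> \<in> line_stab g l \<Longrightarrow> sign (\<sigma> \<circ> \<tau>) = sign \<sigma> * sign \<tau>"
  by (rule sign_compose; rule permutes_imp_permutation[OF finite_lessThan line_stab_permutes], assumption)

lemma line_stab_sign_inv: "\<sigma> \<in> line_stab f l \<Longrightarrow> sign (pinv \<sigma>) = sign \<sigma>"
  by (rule sign_inverse, rule permutes_imp_permutation[OF finite_lessThan line_stab_permutes], assumption)

text \<open>The symmetrizer (\<open>e = 0\<close>) or antisymmetrizer (\<open>e = 1\<close>) of a Young subgroup.\<close>

definition symz :: "nat \<Rightarrow> (nat \<Rightarrow> nat) set \<Rightarrow> 'k::comm_ring_1 stensor \<Rightarrow> 'k stensor" where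
  "symz e K x = (\<Sum>\<tau>\<in>K. of_int (sign \<tau> ^ e) * sym_left \<tau> x)"

lemma symz_add: "symz e K (x + y) = symz e K x + symz e K y"
  by (simp add: symz_def sym_left_add distrib_left sum.distrib)

lemma symz_zero [simp]: "symz e K 0 = 0"
  by (simp add: symz_def)

lemma symz_sum: "symz e K (sum g I) = (\<Sum>i\<in>I. symz e K (g i))"
  by (induction I rule: infinite_finite_induct) (auto simp: symz_add)

lemma symz_mult_scal: "symz e K (x * scal a) = symz e K x * scal a"
  by (simp add: symz_def sym_left_mult_scal sum_distrib_right mult.assoc)

lemma of_int_left_commute: "of_int a * (of_int b * y) = of_int b * (of_int a * (y :: 'a::ring_1))"
proof -
  have "of_int (a * b) * y = of_int (b * a) * y" by (simp only: mult.commute)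
  then show ?thesis by (simp only: of_int_mult mult.assoc)
qed

lemma symz_of_int: "symz e K (of_int z * x) = of_int z * symz e K x"
  unfolding symz_def sym_left_of_int sum_distrib_left
  by (intro sum.cong refl of_int_left_commute)

lemma symz_tlen: "x \<in> tlen l \<Longrightarrow> symz e K x \<in> tlen l"
  unfolding symz_def by (intro tlen_sum tlen_of_int sym_left_tlen)

lemma symz_tvars: "x \<in> tvars U \<Longrightarrow> symz e K x \<in> tvars U"
  unfolding symz_def by (intro tvars_sum tvars_mult tvars_of_int sym_left_tvars)

lemma of_int_sign_square: "of_int (sign \<pi> ^ e) * (of_int (sign \<pi> ^ e) * x) = (x :: 'a::ring_1)"
  by (cases \<pi> rule: sign_cases; cases "even e") simp_all

lemma symz_sym_left:
  assumes "\<pi> \<in> line_stab f l" "x \<in> tlen l"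
  shows "symz e (line_stab f l) (sym_left \<pi> x) = of_int (sign \<pi> ^ e) * symz e (line_stab f l) x"
proof -
  have "symz e (line_stab f l) (sym_left \<pi> x) =
      (\<Sum>\<tau>\<in>line_stab f l. of_int (sign \<pi> ^ e) * (of_int (sign (\<tau> \<circ> \<pi>) ^ e) * sym_left (\<tau> \<circ> \<pi>) x))"
    unfolding symz_def
  proof (rule sum.cong)
    fix \<tau> assume \<tau>: "\<tau> \<in> line_stab f l"
    have "of_int (sign (\<tau> \<circ> \<pi>) ^ e) = of_int (sign \<pi> ^ e) * (of_int (sign \<tau> ^ e) :: 'a stensor)"
      by (simp add: line_stab_sign_comp[OF \<tau> assms(1)] power_mult_distrib mult.commute)
    then show "of_int (sign \<tau> ^ e) * sym_left \<tau> (sym_left \<pi> x) =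
        of_int (sign \<pi> ^ e) * (of_int (sign (\<tau> \<circ> \<pi>) ^ e) * sym_left (\<tau> \<circ> \<pi>) x)"
      by (simp only: mult.assoc of_int_sign_square sym_left_comp[OF line_stab_permutes[OF \<tau>] line_stab_permutes[OF assms(1)] assms(2)])
  qed simp
  then show ?thesis
    unfolding symz_def sum_distrib_left[symmetric]
    by (simp only: line_stab_sum_comp_right[OF assms(1), of "\<lambda>\<tau>. of_int (sign \<tau> ^ e) * sym_left \<tau> x"])
qed

lemma sym_left_symz:
  assumes "\<pi> \<in> line_stab f l" "x \<in> tlen l"
  shows "sym_left \<pi> (symz e (line_stab f l) x) = of_int (sign \<pi> ^ e) * symz e (line_stab f l) x"
proof -
  have "sym_left \<pi> (symz e (line_stab f l) x) =
      (\<Sum>\<tau>\<in>line_stab f l. of_int (sign \<pi> ^ e) * (of_int (sign (\<pi> \<circ> \<tau>) ^ e) * sym_left (\<pi> \<circ> \<tau>) x))"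
    unfolding symz_def sym_left_sum sym_left_of_int
  proof (rule sum.cong)
    fix \<tau> assume \<tau>: "\<tau> \<in> line_stab f l"
    have "of_int (sign (\<pi> \<circ> \<tau>) ^ e) = of_int (sign \<pi> ^ e) * (of_int (sign \<tau> ^ e) :: 'a stensor)"
      by (simp add: line_stab_sign_comp[OF assms(1) \<tau>] power_mult_distrib)
    then show "of_int (sign \<tau> ^ e) * sym_left \<pi> (sym_left \<tau> x) =
        of_int (sign \<pi> ^ e) * (of_int (sign (\<pi> \<circ> \<tau>) ^ e) * sym_left (\<pi> \<circ> \<tau>) x)"
      by (simp only: mult.assoc of_int_sign_square sym_left_comp[OF line_stab_permutes[OF assms(1)] line_stab_permutes[OF \<tau>] assms(2)])
  qed simp
  then show ?thesis
    unfolding symz_def sum_distrib_left[symmetric]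
    by (simp only: line_stab_sum_comp_left[OF assms(1), of "\<lambda>\<tau>. of_int (sign \<tau> ^ e) * sym_left \<tau> x"])
qed

lemma row_stab_line: "row_stab lam = line_stab (\<lambda>k. fst (boxes lam ! k)) (sum_list lam)"
  and col_stab_line: "col_stab lam = line_stab (\<lambda>k. snd (boxes lam ! k)) (sum_list lam)"
  by (simp_all add: row_stab_def col_stab_def line_stab_def)

text \<open>In e_T the row permutation stands to the left, so the columns are antisymmetrized
  first.\<close>

lemma young_left_symz:
  assumes "x \<in> tlen (sum_list lam)"
  shows "young_left lam x = symz 0 (row_stab lam) (symz 1 (col_stab lam) x)"
proof -
  have "symz 0 (row_stab lam) (symz 1 (col_stab lam) x) =
      (\<Sum>\<tau>\<in>row_stab lam. \<Sum>\<sigma>\<in>col_stab lam. of_int (sign \<sigma>) * sym_left \<tau> (sym_left \<sigma> x))"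
    by (simp add: symz_def sym_left_sum sym_left_of_int)
  also have "\<dots> = (\<Sum>\<tau>\<in>row_stab lam. \<Sum>\<sigma>\<in>col_stab lam. of_int (sign \<sigma>) * sym_left (\<tau> \<circ> \<sigma>) x)"
    by (intro sum.cong refl) (simp add: sym_left_comp[OF _ _ assms] row_stab_def col_stab_def)
  finally show ?thesis unfolding young_left_def by (subst sum.swap) (rule sym)
qed

text \<open>A right action inverts the product \<open>\<tau> \<circ> \<sigma>\<close>, hence the
  order of the two symmetrizers is reversed; the inverses run through the same stabilizers with the
  same signs.\<close>

lemma young_right_symz:
  assumes "x \<in> tlen (sum_list lam)"
  shows "young_right x lam = symz 1 (col_stab lam) (symz 0 (row_stab lam) x)"
proof -
  have "young_right x lam = (\<Sum>\<sigma>\<in>col_stab lam. \<Sum>\<tau>\<in>row_stab lam. of_int (sign (pinv \<sigma>)) * sym_left (pinv \<sigma>) (sym_left (pinv \<tau>) x))"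
    unfolding young_right_def
  proof (intro sum.cong refl)
    fix \<sigma> \<tau> assume *: "\<sigma> \<in> col_stab lam" "\<tau> \<in> row_stab lam"
    then have p: "\<sigma> permutes {..<sum_list lam}" "\<tau> permutes {..<sum_list lam}" by (auto simp: row_stab_def col_stab_def)
    have "sym_right x (\<tau> \<circ> \<sigma>) = sym_left (pinv (\<tau> \<circ> \<sigma>)) x"
      by (rule sym_right_sym_left[OF permutes_compose[OF p] assms])
    also have "pinv (\<tau> \<circ> \<sigma>) = pinv \<sigma> \<circ> pinv \<tau>" using p by (simp add: o_inv_distrib permutes_bij)
    finally show "of_int (sign \<sigma>) * sym_right x (\<tau> \<circ> \<sigma>) = of_int (sign (pinv \<sigma>)) * sym_left (pinv \<sigma>) (sym_left (pinv \<tau>) x)"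
      using sym_left_comp[OF permutes_inv[OF p(1)] permutes_inv[OF p(2)] assms]
        line_stab_sign_inv[OF *(1)[unfolded col_stab_line]] by (simp only:)
  qed
  also have "\<dots> = (\<Sum>\<sigma>\<in>col_stab lam. \<Sum>\<tau>\<in>row_stab lam. of_int (sign \<sigma>) * sym_left \<sigma> (sym_left \<tau> x))"
    unfolding col_stab_line row_stab_line
    by (simp only: line_stab_sum_inv[where F = "\<lambda>\<tau>. of_int (sign \<sigma>) * sym_left \<sigma> (sym_left \<tau> x)" for \<sigma>]
        line_stab_sum_inv[where F = "\<lambda>\<sigma>. \<Sum>\<tau>\<in>line_stab f l. of_int (sign \<sigma>) * sym_left \<sigma> (sym_left \<tau> x)" for f l])
  finally show ?thesis
    unfolding symz_def sym_left_sum sum_distrib_left by (simp only: power_one_right power_0 of_int_1 mult_1_left)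
qed

section \<open>The even part of the Grassmann algebra\<close>

text \<open>The even part becomes a type of commutative rings so that determinant theory applies to
  even matrix entries; \<open>emb\<close> carries the results back.\<close>

typedef (overloaded) 'k evn = "{a :: 'k::field_char_0 grassmann. geven a}"
  morphisms emb Abs_evn
  by (rule exI[of _ 0]) simp

setup_lifting type_definition_evn

instantiation evn :: (field_char_0) comm_ring_1
begin
lift_definition zero_evn :: "'a evn" is 0 by simp
lift_definition one_evn :: "'a evn" is 1 by simp
lift_definition plus_evn :: "'a evn \<Rightarrow> 'a evn \<Rightarrow> 'a evn" is "(+)" by (rule geven_add)
lift_definition uminus_evn :: "'a evn \<Rightarrow> 'a evn" is uminus by (rule geven_uminus)
lift_definition minus_evn :: "'a evn \<Rightarrow> 'a evn \<Rightarrow> 'a evn" is "(-)" by (rule geven_diff)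
lift_definition times_evn :: "'a evn \<Rightarrow> 'a evn \<Rightarrow> 'a evn" is "(*)" by (rule geven_mult)
instance
  by standard (transfer; simp add: algebra_simps geven_commute)+
end

lift_definition evn_const :: "'k::field_char_0 \<Rightarrow> 'k evn" is gconst by simp

lifting_forget evn.lifting

lemma geven_emb [simp]: "geven (emb a)"
  using emb[of a] by simp

lemma emb_simps [simp]:
  "emb 0 = 0" "emb 1 = 1" "emb (a + b) = emb a + emb b" "emb (- a) = - emb a"
  "emb (a - b) = emb a - emb b" "emb (a * b) = emb a * emb b" "emb (evn_const c) = gconst c"
  by (simp_all add: zero_evn.rep_eq one_evn.rep_eq plus_evn.rep_eq uminus_evn.rep_eq
      minus_evn.rep_eq times_evn.rep_eq evn_const.rep_eq)

lemma emb_eq_iff: "emb a = emb b \<longleftrightarrow> a = b"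
  by (rule emb_inject)

lemma emb_sum: "emb (sum f I) = (\<Sum>i\<in>I. emb (f i))"
  by (induction I rule: infinite_finite_induct) auto

lemma emb_of_int: "emb (of_int z) = of_int z"
proof -
  have n: "emb (of_nat k) = of_nat k" for k by (induction k) simp_all
  show ?thesis by (cases z) (simp_all add: n del: of_nat_Suc)
qed

lemma emb_prod_list: "emb (prod_list xs) = prod_list (map emb xs)"
  by (induction xs) auto

lemma prod_lessThan_prod_list: "(\<Prod>k<l. f k) = prod_list (map f [0..<l])" for f :: "nat \<Rightarrow> 'a::comm_monoid_mult"
  by (induction l) (auto simp: mult.commute)

lemma emb_prod: "emb (\<Prod>k<l. f k) = prod_list (map (\<lambda>k. emb (f k)) [0..<l])"
  by (simp add: prod_lessThan_prod_list emb_prod_list o_def)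

lemma geven_emb_ex: "geven (a :: 'k::field_char_0 grassmann) \<Longrightarrow> \<exists>b. emb b = a"
  by (metis Abs_evn_inverse mem_Collect_eq)

definition body :: "'k::field_char_0 evn \<Rightarrow> 'k" where
  "body a = gcoeff (emb a) {}"

lemma gcoeff_mult_empty: "gcoeff (x * y) {} = gcoeff x {} * gcoeff y {}"
  by (simp add: gcoeff_mult)

lemma body_hom: "comm_ring_hom body"
  by unfold_locales (simp_all add: body_def gcoeff_mult_empty gcoeff_one)

definition gord :: "nat \<Rightarrow> 'k::comm_ring_1 grassmann set" where
  "gord k = {x. \<forall>S. gcoeff x S \<noteq> 0 \<longrightarrow> k \<le> card S}"

lemma gord_mult: "x \<in> gord i \<Longrightarrow> y \<in> gord j \<Longrightarrow> x * y \<in> gord (i + j)"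
  unfolding gord_def
proof (intro CollectI allI impI)
  fix S assume x: "x \<in> {x. \<forall>S. gcoeff x S \<noteq> 0 \<longrightarrow> i \<le> card S}" and y: "y \<in> {x. \<forall>S. gcoeff x S \<noteq> 0 \<longrightarrow> j \<le> card S}"
    and "gcoeff (x * y) S \<noteq> 0"
  then obtain A B where AB: "gcoeff x A \<noteq> 0" "gcoeff y B \<noteq> 0" "A \<inter> B = {}" "S = A \<union> B"
    by (elim gcoeff_mult_nonzero)
  then have "finite A" "finite B" using gcoeff_infinite by metis+
  then show "i + j \<le> card S" using AB x y by (auto simp: card_Un_disjoint intro: add_mono)
qed

text \<open>The k-th power has no term of degree below k, while only the first \<open>N\<close>
  generators occur; so the power \<open>Suc N\<close> vanishes.\<close>

lemma evn_nilpotent: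
  assumes "body a = 0"
  shows "\<exists>n. a ^ n = 0"
proof -
  obtain N where N: "emb a \<in> gvars {..<N}" using ex_gvars by blast
  have a1: "emb a \<in> gord 1" unfolding gord_def
  proof (intro CollectI allI impI)
    fix S assume nz: "gcoeff (emb a) S \<noteq> 0"
    then have "S \<noteq> {}" "finite S" using assms gcoeff_infinite by (auto simp: body_def)
    then show "1 \<le> card S" by (simp add: Suc_leI card_gt_0_iff)
  qed
  have "emb (a ^ k) \<in> gord k \<inter> gvars {..<N}" for k
  proof (induction k)
    case (Suc k)
    then show ?case using gord_mult[OF a1, of _ k] gvars_mult[OF N] by simp
  qed (auto simp: gord_def gcoeff_one)
  from this[of "Suc N"] have *: "gcoeff (emb (a ^ Suc N)) S \<noteq> 0 \<Longrightarrow> Suc N \<le> card S \<and> S \<subseteq> {..<N}" for S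
    by (auto simp: gord_def gvars_def)
  have "gcoeff (emb (a ^ Suc N)) S = 0" for S
  proof (rule ccontr)
    assume "gcoeff (emb (a ^ Suc N)) S \<noteq> 0"
    from *[OF this] have "Suc N \<le> card S" "card S \<le> N" using card_mono[of "{..<N}" S] by auto
    then show False by simp
  qed
  then have "emb (a ^ Suc N) = emb 0" by (intro grassmann_eqI) (simp del: power_Suc)
  then show ?thesis unfolding emb_eq_iff by blast
qed

text \<open>After division by the body, \<open>1 - c * a\<close> is nilpotent and a finite geometric
  series inverts \<open>c * a\<close>.\<close>

lemma evn_unit:
  assumes "body a \<noteq> 0"
  shows "\<exists>b. a * b = 1"
proof -
  define c where "c = evn_const (inverse (body a))"
  interpret comm_ring_hom "body :: 'a evn \<Rightarrow> 'a" by (rule body_hom)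
  have "body c = inverse (body a)" by (simp add: c_def body_def gcoeff_gconst)
  then have "body (1 - c * a) = 0" using assms by (simp add: hom_distribs)
  then obtain n where n: "(1 - c * a) ^ n = 0" using evn_nilpotent by blast
  have "1 - (1 - c * a) ^ n = (1 - (1 - c * a)) * (\<Sum>i<n. (1 - c * a) ^ i)" by (rule one_diff_power_eq)
  then have "1 = a * (c * (\<Sum>i<n. (1 - c * a) ^ i))" using n by (simp add: mult_ac)
  then show ?thesis by metis
qed

section \<open>Determinants\<close>

text \<open>Matrices are functions here, so that rows and columns can be indexed by expressions such
  as \<open>k div n\<close> without carriers; \<open>fdet_det\<close> gives access to the library
  determinant.\<close>

definition fdet :: "nat \<Rightarrow> (nat \<Rightarrow> nat \<Rightarrow> 'a::comm_ring_1) \<Rightarrow> 'a" where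
  "fdet l M = (\<Sum>p | p permutes {..<l}. of_int (sign p) * (\<Prod>i<l. M i (p i)))"

lemma fdet_cong: "(\<And>i j. i < l \<Longrightarrow> j < l \<Longrightarrow> M i j = M' i j) \<Longrightarrow> fdet l M = fdet l M'"
  unfolding fdet_def
  by (intro sum.cong refl arg_cong2[of _ _ _ _ "(*)"] prod.cong)
    (auto simp: permutes_in_image[of _ "{..<l}", unfolded lessThan_iff])

lemma fdet_det: "fdet l M = det (mat l l (\<lambda>(i, j). M i j))"
proof -
  have "p i < l" if "p permutes {0..<l}" "i < l" for p i
    using permutes_in_image[OF that(1), of i] that(2) by simp
  then show ?thesis
    by (simp add: fdet_def det_def lessThan_atLeast0)
qed

lemma fdet_mult: "fdet l (\<lambda>i j. \<Sum>k<l. A i k * B k j) = fdet l A * fdet l B"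
proof -
  have "mat l l (\<lambda>(i, j). \<Sum>k<l. A i k * B k j) = mat l l (\<lambda>(i, j). A i j) * mat l l (\<lambda>(i, j). B i j)"
    by (rule eq_matI) (auto simp: scalar_prod_def lessThan_atLeast0)
  then show ?thesis by (simp add: fdet_det det_mult[of _ l])
qed

lemma fdet_transpose: "fdet l (\<lambda>i j. M j i) = fdet l M"
proof -
  have "mat l l (\<lambda>(i, j). M j i) = transpose_mat (mat l l (\<lambda>(i, j). M i j))"
    by (rule eq_matI) auto
  then show ?thesis by (simp add: fdet_det det_transpose[of _ l])
qed

text \<open>Rows outside \<open>S\<close> are rows of the identity matrix, so a permutation moving a
  point outside \<open>S\<close> picks a zero entry.\<close>

lemma fdet_subset:
  assumes S: "S \<subseteq> {..<l}" and M: "\<And>i j. i < l \<Longrightarrow> j < l \<Longrightarrow> i \<notin> S \<Longrightarrow> M i j = of_bool (i = j)"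
  shows "fdet l M = (\<Sum>p | p permutes S. of_int (sign p) * (\<Prod>i\<in>S. M i (p i)))"
  unfolding fdet_def
proof (rule sum.mono_neutral_cong_right)
  show "finite {p. p permutes {..<l}}" by (simp add: finite_permutations)
  show "{p. p permutes S} \<subseteq> {p. p permutes {..<l}}" using S by (auto intro: permutes_subset)
  show "\<forall>p\<in>{p. p permutes {..<l}} - {p. p permutes S}. of_int (sign p) * (\<Prod>i<l. M i (p i)) = 0"
  proof
    fix p assume p: "p \<in> {p. p permutes {..<l}} - {p. p permutes S}"
    then have "\<exists>i. i < l \<and> i \<notin> S \<and> p i \<noteq> i"
      using permutes_superset[of p "{..<l}" S] by auto
    then obtain i where i: "i < l" "i \<notin> S" "p i \<noteq> i" by auto
    then have "p i < l" using p permutes_in_image[of p "{..<l}" i] by auto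
    then have "M i (p i) = 0" using M[of i "p i"] i by simp
    then have "(\<Prod>i<l. M i (p i)) = 0" using i by (intro prod_zero) auto
    then show "of_int (sign p) * (\<Prod>i<l. M i (p i)) = 0" by simp
  qed
  fix p assume "p \<in> {p. p permutes S}"
  then have p: "p permutes S" by simp
  have "(\<Prod>i<l. M i (p i)) = (\<Prod>i\<in>S. M i (p i))"
  proof (rule prod.mono_neutral_right)
    show "\<forall>i\<in>{..<l} - S. M i (p i) = 1"
      using M permutes_not_in[OF p] by auto
  qed (use S in auto)
  then show "of_int (sign p) * (\<Prod>i<l. M i (p i)) = of_int (sign p) * (\<Prod>i\<in>S. M i (p i))" by simp
qed

lemma fdet_single_row:
  assumes "j < l"
  shows "fdet l (\<lambda>i k. of_bool (i = k) + (if i = j then c k else 0)) = 1 + c j"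
proof -
  have "fdet l (\<lambda>i k. of_bool (i = k) + (if i = j then c k else 0)) =
      (\<Sum>p | p permutes {j}. of_int (sign p) * (\<Prod>i\<in>{j}. of_bool (i = p i) + (if i = j then c (p i) else 0)))"
    by (rule fdet_subset) (use assms in auto)
  also have "{p. p permutes {j}} = {id}" by (auto simp: permutes_sing)
  finally show ?thesis by simp
qed

text \<open>The Kronecker product of an identity matrix with \<open>M\<close>: one copy of
  \<open>M\<close> on each line of \<open>f\<close>, with \<open>g\<close> as coordinate along the
  line.\<close>

definition block_copies :: "(nat \<Rightarrow> nat) \<Rightarrow> (nat \<Rightarrow> nat) \<Rightarrow> (nat \<Rightarrow> nat \<Rightarrow> 'a::comm_ring_1) \<Rightarrow> nat \<Rightarrow> nat \<Rightarrow> 'a" where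
  "block_copies f g M b b' = (if f b = f b' then M (g b) (g b') else 0)"

text \<open>The matrix is a product of matrices that contain \<open>M\<close> on a single line and
  are the identity elsewhere; each of these has determinant \<open>fdet d M\<close>.\<close>

lemma fdet_block_copies:
  assumes bij: "bij_betw (\<lambda>k. (f k, g k)) {..<l} ({..<q} \<times> {..<d})"
  shows "fdet l (block_copies f g M) = fdet d M ^ q"
proof -
  \<comment> \<open>\<open>K T\<close> carries the block \<open>M\<close> on the lines in
    \<open>T\<close> and the identity on all others, which allows induction on
    \<open>T\<close>.\<close>
  define K where "K T b b' = (if f b = f b' then if f b \<in> T then M (g b) (g b') else of_bool (b = b') else 0)"
    for T b b'
  have fl: "f b < q" "g b < d" if "b < l" for b
    using bij_betwE[OF bij] that by auto
  have inj: "b = b'" if "b < l" "b' < l" "f b = f b'" "g b = g b'" for b b'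
    using bij_betw_imp_inj_on[OF bij] that by (auto dest: inj_onD)
  have single: "fdet l (K {t}) = fdet d M" if t: "t < q" for t
  proof -
    let ?S = "{b. b < l \<and> f b = t}"
    have bS: "bij_betw g ?S {..<d}"
    proof (rule bij_betw_imageI)
      show "inj_on g ?S" by (rule inj_onI, rule inj) auto
      have "r \<in> g ` ?S" if "r < d" for r
      proof -
        have "(t, r) \<in> (\<lambda>k. (f k, g k)) ` {..<l}" using bij t that by (auto simp: bij_betw_def)
        then show ?thesis by auto
      qed
      then show "g ` ?S = {..<d}" using fl by auto
    qed
    define h where "h = inv_into ?S g"
    have hg: "h (g b) = b" if "b \<in> ?S" for b using that bS by (simp add: h_def bij_betw_def)
    have bh: "bij_betw h {..<d} ?S" unfolding h_def by (rule bij_betw_inv_into[OF bS])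
    have gh: "g (h r) = r" if "r \<in> {..<d}" for r
      using that bS by (simp add: h_def bij_betw_def f_inv_into_f)
    have finS: "finite ?S" by simp
    have "fdet l (K {t}) = (\<Sum>p | p permutes ?S. of_int (sign p) * (\<Prod>i\<in>?S. K {t} i (p i)))"
      by (rule fdet_subset) (auto simp: K_def)
    also have "\<dots> = (\<Sum>p | p permutes {..<d}. of_int (sign p) * (\<Prod>i<d. M i (p i)))"
    proof (rule sum.reindex_bij_witness[of _ "map_permutation {..<d} h" "map_permutation ?S g"])
      fix p assume "p \<in> {p. p permutes ?S}"
      then have p: "p permutes ?S" by simp
      show "map_permutation {..<d} h (map_permutation ?S g p) = p"
        by (rule map_permutation_compose_inv[OF bS p]) (rule hg)
      show "map_permutation ?S g p \<in> {p. p permutes {..<d}}"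
        using map_permutation_permutes[OF bS p] by simp
      have s: "sign (map_permutation ?S g p) = sign p"
        by (rule sign_map_permutation[OF _ p finS]) (use bS in \<open>simp add: bij_betw_def\<close>)
      have "(\<Prod>i<d. M i (map_permutation ?S g p i)) = (\<Prod>b\<in>?S. M (g b) (map_permutation ?S g p (g b)))"
        by (rule prod.reindex_bij_betw[OF bS, symmetric])
      also have "\<dots> = (\<Prod>b\<in>?S. K {t} b (p b))"
      proof (rule prod.cong)
        fix b assume b: "b \<in> ?S"
        have "p b \<in> ?S" using permutes_in_image[OF p, of b] b by simp
        moreover have "map_permutation ?S g p (g b) = g (p b)"
          by (rule map_permutation_apply) (use bS b in \<open>auto simp: bij_betw_def\<close>)
        ultimately show "M (g b) (map_permutation ?S g p (g b)) = K {t} b (p b)" using b by (simp add: K_def)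
      qed simp
      finally show "of_int (sign (map_permutation ?S g p)) * (\<Prod>i<d. M i (map_permutation ?S g p i)) =
          of_int (sign p) * (\<Prod>i\<in>?S. K {t} i (p i))" by (simp add: s)
    next
      fix p assume "p \<in> {p. p permutes {..<d}}"
      then have p: "p permutes {..<d}" by simp
      show "map_permutation ?S g (map_permutation {..<d} h p) = p"
        by (rule map_permutation_compose_inv[OF bh p]) (rule gh)
      show "map_permutation {..<d} h p \<in> {p. p permutes ?S}"
        using map_permutation_permutes[OF bh p] by simp
    qed
    finally show ?thesis by (simp add: fdet_def)
  qed
  have step: "fdet l (K (insert t T)) = fdet l (K {t}) * fdet l (K T)" if "t \<notin> T" for t T
  proof -
    have "K (insert t T) b b' = (\<Sum>b''<l. K {t} b b'' * K T b'' b')" if b: "b < l" "b' < l" for b b'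
    proof (cases "f b = t")
      case True
      have "(\<Sum>b''<l. K {t} b b'' * K T b'' b') = (\<Sum>b''<l. if b'' = b' then K {t} b b' else 0)"
        using True \<open>t \<notin> T\<close> by (intro sum.cong) (auto simp: K_def)
      then show ?thesis using True b by (simp add: K_def)
    next
      case False
      have "(\<Sum>b''<l. K {t} b b'' * K T b'' b') = (\<Sum>b''<l. if b'' = b then K T b b' else 0)"
        using False by (intro sum.cong) (auto simp: K_def)
      then show ?thesis using False b by (simp add: K_def)
    qed
    then have "fdet l (K (insert t T)) = fdet l (\<lambda>b b'. \<Sum>b''<l. K {t} b b'' * K T b'' b')"
      by (rule fdet_cong)
    then show ?thesis by (simp add: fdet_mult)
  qed
  have empty: "fdet l (K {}) = 1"
  proof -
    have "fdet l (K {}) = (\<Sum>p | p permutes ({} :: nat set). of_int (sign p) * (\<Prod>i\<in>{}. K {} i (p i)))"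
      by (rule fdet_subset) (auto simp: K_def)
    then show ?thesis by simp
  qed
  have "fdet l (K T) = fdet d M ^ card T" if "finite T" "T \<subseteq> {..<q}" for T
    using that
  proof (induction T rule: finite_induct)
    case (insert t T)
    then show ?case using step[of t T] single[of t] by simp
  qed (simp add: empty)
  from this[of "{..<q}"] have "fdet l (K {..<q}) = fdet d M ^ q" by simp
  moreover have "fdet l (block_copies f g M) = fdet l (K {..<q})"
    by (rule fdet_cong) (auto simp: block_copies_def K_def fl)
  ultimately show ?thesis by simp
qed

section \<open>Alternating products\<close>

lemma prod_list_sum_distrib:
  fixes F :: "nat \<Rightarrow> 'b \<Rightarrow> 'a::ring_1"
  assumes "finite A"
  shows "prod_list (map (\<lambda>k. \<Sum>a\<in>A. F k a) [0..<l]) =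
    (\<Sum>g\<in>{..<l} \<rightarrow>\<^sub>E A. prod_list (map (\<lambda>k. F k (g k)) [0..<l]))"
proof (induction l)
  case (Suc l)
  have m: "map (\<lambda>k. F k ((g(l := a)) k)) [0..<l] = map (\<lambda>k. F k (g k)) [0..<l]" for g a
    by (rule map_cong) auto
  have "(\<Sum>g\<in>{..<Suc l} \<rightarrow>\<^sub>E A. prod_list (map (\<lambda>k. F k (g k)) [0..<Suc l])) =
      (\<Sum>p\<in>A \<times> ({..<l} \<rightarrow>\<^sub>E A). prod_list (map (\<lambda>k. F k (((snd p)(l := fst p)) k)) [0..<Suc l]))"
    unfolding lessThan_Suc PiE_insert_eq
    by (subst sum.reindex[OF inj_combinator[of l "{..<l}"]]) (auto simp: case_prod_unfold o_def)
  also have "\<dots> = (\<Sum>p\<in>A \<times> ({..<l} \<rightarrow>\<^sub>E A). prod_list (map (\<lambda>k. F k (snd p k)) [0..<l]) * F l (fst p))"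
    by (intro sum.cong refl) (simp add: m fun_upd_same del: fun_upd_apply)
  also have "\<dots> = (\<Sum>a\<in>A. \<Sum>g\<in>{..<l} \<rightarrow>\<^sub>E A. prod_list (map (\<lambda>k. F k (g k)) [0..<l]) * F l a)"
    by (simp only: sum.cartesian_product case_prod_unfold)
  also have "\<dots> = (\<Sum>g\<in>{..<l} \<rightarrow>\<^sub>E A. prod_list (map (\<lambda>k. F k (g k)) [0..<l])) * (\<Sum>a\<in>A. F l a)"
    unfolding sum_product by (rule sum.swap)
  finally show ?case using Suc.IH by simp
qed simp

lemma prod_list_scal_emb:
  fixes z :: "nat \<Rightarrow> 'k::field_char_0 stensor"
  shows "prod_list (map (\<lambda>k. scal (emb (c k)) * z k) ks) = scal (emb (prod_list (map c ks))) * prod_list (map z ks)"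
proof (induction ks)
  case (Cons k ks)
  have "scal (emb (c k)) * z k * (scal (emb (prod_list (map c ks))) * prod_list (map z ks)) =
    scal (emb (c k)) * (z k * scal (emb (prod_list (map c ks)))) * prod_list (map z ks)"
    by (simp add: mult.assoc)
  also have "z k * scal (emb (prod_list (map c ks))) = scal (emb (prod_list (map c ks))) * z k"
    by (rule scal_geven_commute[symmetric]) simp
  finally show ?case using Cons by (simp add: scal_mult mult.assoc)
qed simp

lemma prod_list_emb:
  fixes z :: "nat \<Rightarrow> 'k::field_char_0 grassmann"
  shows "prod_list (map (\<lambda>k. emb (c k) * z k) ks) = emb (prod_list (map c ks)) * prod_list (map z ks)"
proof (induction ks)
  case (Cons k ks)
  have "emb (c k) * z k * (emb (prod_list (map c ks)) * prod_list (map z ks)) =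
    emb (c k) * (z k * emb (prod_list (map c ks))) * prod_list (map z ks)"
    by (simp add: mult.assoc)
  also have "z k * emb (prod_list (map c ks)) = emb (prod_list (map c ks)) * z k"
    by (rule geven_commute[symmetric]) simp
  finally show ?case using Cons by (simp add: mult.assoc)
qed simp

text \<open>A product of alternating products, one for each line of \<open>f\<close>, whose factors
  are interleaved in the reading order of the positions. The permutation acts on the indices of the
  vectors, so no super sign enters.\<close>

definition alt_prod :: "(nat \<Rightarrow> nat) \<Rightarrow> (nat \<Rightarrow> nat) \<Rightarrow> nat \<Rightarrow> (nat \<Rightarrow> 'k stensor) \<Rightarrow> 'k::comm_ring_1 stensor" where
  "alt_prod f g l y = (\<Sum>\<sigma>\<in>line_stab f l. of_int (sign \<sigma>) * prod_list (map (\<lambda>k. y (g (\<sigma> k))) [0..<l]))"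

text \<open>A permutation that leaves the lines picks a zero entry, so the signed sum over
  \<open>line_stab f l\<close> is a full determinant of size \<open>l\<close>, to which
  multiplicativity can be applied.\<close>

lemma alt_prod_expand:
  fixes y :: "nat \<Rightarrow> 'k::field_char_0 stensor"
  assumes g: "\<And>k. k < l \<Longrightarrow> g k < d" and y': "\<And>a. a < d \<Longrightarrow> y' a = (\<Sum>b<d. scal (emb (M a b)) * y b)"
  shows "alt_prod f g l y' = (\<Sum>h\<in>{..<l} \<rightarrow>\<^sub>E {..<d}.
    scal (emb (fdet l (\<lambda>k b. if f b = f k then M (g b) (h k) else 0))) * prod_list (map (\<lambda>k. y (h k)) [0..<l]))"
proof -
  have "prod_list (map (\<lambda>k. y' (g (\<sigma> k))) [0..<l]) =
      (\<Sum>h\<in>{..<l} \<rightarrow>\<^sub>E {..<d}. scal (emb (\<Prod>k<l. M (g (\<sigma> k)) (h k))) * prod_list (map (\<lambda>k. y (h k)) [0..<l]))"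
    if \<sigma>: "\<sigma> \<in> line_stab f l" for \<sigma>
  proof -
    have "prod_list (map (\<lambda>k. y' (g (\<sigma> k))) [0..<l]) = prod_list (map (\<lambda>k. \<Sum>b<d. scal (emb (M (g (\<sigma> k)) b)) * y b) [0..<l])"
      by (intro arg_cong[where f = prod_list] map_cong refl y') (use g line_stab_less[OF \<sigma>] in auto)
    also have "\<dots> = (\<Sum>h\<in>{..<l} \<rightarrow>\<^sub>E {..<d}. prod_list (map (\<lambda>k. scal (emb (M (g (\<sigma> k)) (h k))) * y (h k)) [0..<l]))"
      by (rule prod_list_sum_distrib) simp
    finally show ?thesis by (simp add: prod_list_scal_emb prod_lessThan_prod_list)
  qed
  then have "alt_prod f g l y' = (\<Sum>\<sigma>\<in>line_stab f l. \<Sum>h\<in>{..<l} \<rightarrow>\<^sub>E {..<d}.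
      scal (emb (of_int (sign \<sigma>) * (\<Prod>k<l. M (g (\<sigma> k)) (h k)))) * prod_list (map (\<lambda>k. y (h k)) [0..<l]))"
    by (simp add: alt_prod_def sum_distrib_left scal_mult emb_of_int scal_of_int mult.assoc)
  also have "\<dots> = (\<Sum>h\<in>{..<l} \<rightarrow>\<^sub>E {..<d}. scal (emb (\<Sum>\<sigma>\<in>line_stab f l.
      of_int (sign \<sigma>) * (\<Prod>k<l. M (g (\<sigma> k)) (h k)))) * prod_list (map (\<lambda>k. y (h k)) [0..<l]))"
    by (subst sum.swap) (simp only: emb_sum scal_sum sum_distrib_right)
  finally have expand: "alt_prod f g l y' = \<dots>" .
  have det:  "(\<Sum>\<sigma>\<in>line_stab f l. of_int (sign \<sigma>) * (\<Prod>k<l. M (g (\<sigma> k)) (h k))) =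
      fdet l (\<lambda>k b. if f b = f k then M (g b) (h k) else 0)" for h
    unfolding fdet_def
  proof (rule sum.mono_neutral_cong_left)
    show "finite {p. p permutes {..<l}}" by (simp add: finite_permutations)
    show "line_stab f l \<subseteq> {p. p permutes {..<l}}" by (auto simp: line_stab_def)
    show "\<forall>p\<in>{p. p permutes {..<l}} - line_stab f l.
        of_int (sign p) * (\<Prod>k<l. if f (p k) = f k then M (g (p k)) (h k) else 0) = 0"
    proof
      fix p assume "p \<in> {p. p permutes {..<l}} - line_stab f l"
      then obtain k where "k < l" "f (p k) \<noteq> f k" by (auto simp: line_stab_def)
      then have "(\<Prod>k<l. if f (p k) = f k then M (g (p k)) (h k) else 0) = 0"
        by (intro prod_zero) auto
      then show "of_int (sign p) * (\<Prod>k<l. if f (p k) = f k then M (g (p k)) (h k) else 0) = 0" by simp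
    qed
    fix \<sigma> assume "\<sigma> \<in> line_stab f l"
    then have "(\<Prod>k<l. M (g (\<sigma> k)) (h k)) = (\<Prod>k<l. if f (\<sigma> k) = f k then M (g (\<sigma> k)) (h k) else 0)"
      by (intro prod.cong) (auto simp: line_stab_def)
    then show "of_int (sign \<sigma>) * (\<Prod>k<l. M (g (\<sigma> k)) (h k)) =
      of_int (sign \<sigma>) * (\<Prod>k<l. if f (\<sigma> k) = f k then M (g (\<sigma> k)) (h k) else 0)" by simp
  qed
  show ?thesis unfolding expand det ..
qed

text \<open>For every index word the coefficient determinant of \<open>M\<close> is the one of the
  identity matrix times the determinant of \<open>block_copies f g M\<close>. By the bijection every
  one of the \<open>q\<close> lines has exactly \<open>d\<close> positions for the \<open>d\<close>
  vectors, so this factor does not depend on the word.\<close>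

lemma alt_prod_transform:
  fixes y :: "nat \<Rightarrow> 'k::field_char_0 stensor"
  assumes bij: "bij_betw (\<lambda>k. (f k, g k)) {..<l} ({..<q} \<times> {..<d})"
    and y': "\<And>a. a < d \<Longrightarrow> y' a = (\<Sum>b<d. scal (emb (M a b)) * y b)"
  shows "alt_prod f g l y' = scal (emb (fdet d M ^ q)) * alt_prod f g l y"
proof -
  have fl: "f b < q" "g b < d" if "b < l" for b
    using bij_betwE[OF bij] that by auto
  have ex: "\<exists>b<l. f b = s \<and> g b = t" if "s < q" "t < d" for s t
  proof -
    have "(s, t) \<in> (\<lambda>k. (f k, g k)) ` {..<l}" using bij that by (auto simp: bij_betw_def)
    then show ?thesis by auto
  qed
  have inj: "b = b'" if "b < l" "b' < l" "f b = f b'" "g b = g b'" for b b'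
    using bij_betw_imp_inj_on[OF bij] that by (auto dest: inj_onD)
  let ?I = "\<lambda>a b. of_bool (a = b) :: 'k evn"
  let ?D = "\<lambda>M h. fdet l (\<lambda>k b. if f b = f k then M (g b) (h k) else 0)"
  have D: "?D M h = fdet d M ^ q * ?D ?I h" if h: "h \<in> {..<l} \<rightarrow>\<^sub>E {..<d}" for h
  proof -
    have "?D M h = fdet l (\<lambda>k b. \<Sum>b''<l. (if f b'' = f k then ?I (g b'') (h k) else 0) * block_copies f g M b b'')"
    proof (rule fdet_cong)
      fix k b assume kb: "k < l" "b < l"
      obtain c where c: "c < l" "f c = f k" "g c = h k"
        using ex[of "f k" "h k"] fl[OF kb(1)] h kb by (auto simp: PiE_iff)
      have "(\<Sum>b''<l. (if f b'' = f k then ?I (g b'') (h k) else 0) * block_copies f g M b b'') =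
        (\<Sum>b''<l. if b'' = c then block_copies f g M b c else 0)"
      proof (rule sum.cong[OF refl])
        fix b'' assume "b'' \<in> {..<l}"
        then have "f b'' = f k \<and> g b'' = h k \<longleftrightarrow> b'' = c" using c inj[of b'' c] by auto
        then show "(if f b'' = f k then ?I (g b'') (h k) else 0) * block_copies f g M b b'' =
          (if b'' = c then block_copies f g M b c else 0)" by auto
      qed
      also have "\<dots> = (if f b = f k then M (g b) (h k) else 0)"
        using c by (simp add: block_copies_def)
      finally show "(if f b = f k then M (g b) (h k) else 0) =
        (\<Sum>b''<l. (if f b'' = f k then ?I (g b'') (h k) else 0) * block_copies f g M b b'')" by simp
    qed
    also have "\<dots> = ?D ?I h * fdet l (\<lambda>k b. block_copies f g M b k)"
      by (rule fdet_mult[of l "\<lambda>k b''. if f b'' = f k then ?I (g b'') (h k) else 0" "\<lambda>k b. block_copies f g M b k"])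
    also have "\<dots> = ?D ?I h * fdet d M ^ q"
      by (simp only: trans[OF fdet_transpose fdet_block_copies[OF bij]])
    finally show ?thesis by (simp add: mult.commute)
  qed
  have "alt_prod f g l y' = (\<Sum>h\<in>{..<l} \<rightarrow>\<^sub>E {..<d}. scal (emb (?D M h)) * prod_list (map (\<lambda>k. y (h k)) [0..<l]))"
    by (rule alt_prod_expand) (use fl y' in auto)
  also have "\<dots> = scal (emb (fdet d M ^ q)) * (\<Sum>h\<in>{..<l} \<rightarrow>\<^sub>E {..<d}. scal (emb (?D ?I h)) * prod_list (map (\<lambda>k. y (h k)) [0..<l]))"
    unfolding sum_distrib_left
    by (rule sum.cong[OF refl]) (simp only: D emb_simps scal_mult mult.assoc)
  also have "(\<Sum>h\<in>{..<l} \<rightarrow>\<^sub>E {..<d}. scal (emb (?D ?I h)) * prod_list (map (\<lambda>k. y (h k)) [0..<l])) = alt_prod f g l y"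
  proof (rule alt_prod_expand[symmetric])
    fix a assume a: "a < d"
    have "(\<Sum>b<d. scal (emb (?I a b)) * y b) = (\<Sum>b<d. if b = a then y a else 0)"
      by (intro sum.cong) auto
    then show "y a = (\<Sum>b<d. scal (emb (?I a b)) * y b)" using a by simp
  qed (rule fl)
  finally show ?thesis .
qed

lemma godd_prod_repeat:
  fixes z :: "'b \<Rightarrow> 'k::field_char_0 grassmann"
  assumes z: "\<And>k. k \<in> set ks \<Longrightarrow> godd (z k)" and ks: "\<not> distinct ks"
  shows "prod_list (map z ks) = 0"
proof -
  obtain xs ys zs k where k: "ks = xs @ [k] @ ys @ [k] @ zs" using not_distinct_decomp[OF ks] by blast
  have o: "godd (z k)" using z k by auto
  let ?Y = "prod_list (map z ys)"
  have eq: "z k * ?Y = grade_sign 1 ?Y * z k" by (rule godd_commute[OF o])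
  have 0: "z k * (?Y * (z k * r)) = 0" for r
  proof -
    have "z k * (?Y * (z k * r)) = (z k * ?Y) * (z k * r)" by (simp only: mult.assoc)
    also have "\<dots> = grade_sign 1 ?Y * ((z k * z k) * r)" unfolding eq by (simp only: mult.assoc)
    finally show ?thesis by (simp add: godd_square[OF o])
  qed
  show ?thesis by (simp add: k 0)
qed

text \<open>The integer \<open>s\<close> is fixed before the family \<open>z\<close>, so one
  reordering serves the new and the old variables at once.\<close>

lemma godd_prod_reorder:
  assumes "distinct ks" "set ks = {..<L}"
  obtains s :: int where "s \<noteq> 0"
    "\<And>z :: nat \<Rightarrow> 'k::field_char_0 grassmann. (\<And>k. k < L \<Longrightarrow> godd (z k)) \<Longrightarrow>
      prod_list (map z ks) = of_int s * prod_list (map z [0..<L])"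
proof -
  have len: "length ks = L" using assms distinct_card by fastforce
  define \<tau> where "\<tau> k = (if k < L then ks ! k else k)" for k
  have "bij_betw ((!) ks) {..<L} {..<L}" by (rule bij_betw_nth[OF assms(1)]) (simp_all add: len assms(2))
  then have "bij_betw \<tau> {..<L} {..<L}" by (subst bij_betw_cong[of _ _ "(!) ks"]) (auto simp: \<tau>_def)
  then have \<tau>: "\<tau> permutes {..<L}" by (rule bij_imp_permutes) (auto simp: \<tau>_def)
  have ks: "ks = map \<tau> [0..<L]" by (rule nth_equalityI) (auto simp: \<tau>_def len)
  show ?thesis
  proof (rule that[of "sign \<tau>"])
    fix z :: "nat \<Rightarrow> 'k grassmann" assume "\<And>k. k < L \<Longrightarrow> godd (z k)"
    then have "prod_list (map (\<lambda>k. z (\<tau> k)) [0..<L]) = of_int (sign \<tau>) * prod_list (map z [0..<L])"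
      by (rule godd_prod_permute[OF \<tau>])
    then show "prod_list (map z ks) = of_int (sign \<tau>) * prod_list (map z [0..<L])"
      by (simp add: ks o_def)
  qed simp
qed

text \<open>Products with a repeated variable vanish, so only permutations survive in the expansion,
  each with its sign.\<close>

lemma godd_linear_prod:
  fixes z :: "nat \<Rightarrow> 'k::field_char_0 grassmann"
  assumes z: "\<And>k. k < L \<Longrightarrow> godd (z k)"
  shows "prod_list (map (\<lambda>k. \<Sum>b<L. emb (c k b) * z b) [0..<L]) = emb (fdet L c) * prod_list (map z [0..<L])"
proof -
  let ?F = "\<lambda>h. emb (\<Prod>k<L. c k (h k)) * prod_list (map (\<lambda>k. z (h k)) [0..<L])"
  have "prod_list (map (\<lambda>k. \<Sum>b<L. emb (c k b) * z b) [0..<L]) = (\<Sum>h\<in>{..<L} \<rightarrow>\<^sub>E {..<L}. ?F h)"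
    by (subst prod_list_sum_distrib) (simp_all add: prod_list_emb prod_lessThan_prod_list)
  also have "\<dots> = (\<Sum>h\<in>{h \<in> {..<L} \<rightarrow>\<^sub>E {..<L}. inj_on h {..<L}}. ?F h)"
  proof (rule sum.mono_neutral_right)
    show "finite ({..<L} \<rightarrow>\<^sub>E {..<L})" by (rule finite_PiE) auto
    show "\<forall>h\<in>({..<L} \<rightarrow>\<^sub>E {..<L}) - {h \<in> {..<L} \<rightarrow>\<^sub>E {..<L}. inj_on h {..<L}}. ?F h = 0"
    proof
      fix h assume h: "h \<in> ({..<L} \<rightarrow>\<^sub>E {..<L}) - {h \<in> {..<L} \<rightarrow>\<^sub>E {..<L}. inj_on h {..<L}}"
      then have "\<not> distinct (map h [0..<L])" by (auto simp: distinct_map lessThan_atLeast0)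
      then have "prod_list (map z (map h [0..<L])) = 0"
        by (intro godd_prod_repeat z) (use h in \<open>auto simp: PiE_iff\<close>)
      then show "?F h = 0" by (simp add: o_def)
    qed
  qed auto
  also have "\<dots> = (\<Sum>p | p permutes {..<L}. ?F p)"
  proof (rule sum.reindex_bij_witness[of _ "\<lambda>p. restrict p {..<L}" "\<lambda>h k. if k < L then h k else k"])
    fix h assume h: "h \<in> {h \<in> {..<L} \<rightarrow>\<^sub>E {..<L}. inj_on h {..<L}}"
    show "restrict (\<lambda>k. if k < L then h k else k) {..<L} = h"
      using h by (intro ext) (auto simp: PiE_iff extensional_def)
    have "h ` {..<L} = {..<L}" using h by (intro endo_inj_surj) (auto simp: PiE_iff)
    then have "bij_betw h {..<L} {..<L}" using h by (simp add: bij_betw_def)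
    then have "bij_betw (\<lambda>k. if k < L then h k else k) {..<L} {..<L}"
      by (subst bij_betw_cong[of _ _ h]) auto
    then show "(\<lambda>k. if k < L then h k else k) \<in> {p. p permutes {..<L}}"
      using bij_imp_permutes[of "\<lambda>k. if k < L then h k else k" "{..<L}"] by auto
    have m: "map (\<lambda>k. z (if k < L then h k else k)) [0..<L] = map (\<lambda>k. z (h k)) [0..<L]" by (rule map_cong) auto
    have c: "(\<Prod>k<L. c k (if k < L then h k else k)) = (\<Prod>k<L. c k (h k))" by (rule prod.cong) auto
    show "?F (\<lambda>k. if k < L then h k else k) = ?F h" unfolding m c ..
  next
    fix p assume "p \<in> {p. p permutes {..<L}}"
    then have p: "p permutes {..<L}" by simp
    then show "(\<lambda>k. if k < L then restrict p {..<L} k else k) = p"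
      by (intro ext) (auto simp: permutes_not_in)
    have "restrict p {..<L} \<in> {..<L} \<rightarrow>\<^sub>E {..<L}"
      using permutes_in_image[OF p] by (simp add: restrict_PiE_iff)
    then show "restrict p {..<L} \<in> {h \<in> {..<L} \<rightarrow>\<^sub>E {..<L}. inj_on h {..<L}}"
      using permutes_inj_on[OF p, of "{..<L}"] by simp
  qed
  also have "\<dots> = (\<Sum>p | p permutes {..<L}. emb (of_int (sign p) * (\<Prod>k<L. c k (p k))) * prod_list (map z [0..<L]))"
  proof (rule sum.cong[OF refl])
    fix p assume "p \<in> {p. p permutes {..<L}}"
    then have p: "prod_list (map (\<lambda>k. z (p k)) [0..<L]) = of_int (sign p) * prod_list (map z [0..<L])"
      by (intro godd_prod_permute z) auto
    show "?F p = emb (of_int (sign p) * (\<Prod>k<L. c k (p k))) * prod_list (map z [0..<L])"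
      unfolding p emb_simps emb_of_int using mult_of_int_commute[of "sign p" "emb (\<Prod>k<L. c k (p k))"]
      by (simp only: mult.assoc[symmetric])
  qed
  also have "\<dots> = emb (fdet L c) * prod_list (map z [0..<L])"
    by (simp only: fdet_def emb_sum sum_distrib_right)
  finally show ?thesis .
qed

section \<open>Expansion of alternating products into canonical tensors\<close>

text \<open>\<open>b k\<close> records whether \<open>a k\<close> is odd. The exponent counts the
  odd coefficients that pass an odd letter when all coefficients are collected on the right.\<close>

lemma prod_monomials_exact:
  fixes a :: "nat \<Rightarrow> 'k::field_char_0 grassmann"
  assumes a: "\<And>k. k < l \<Longrightarrow> if b k then godd (a k) else geven (a k)"
  shows "prod_list (map (\<lambda>k. word [v k] * scal (a k)) [0..<l]) =
    word (map v [0..<l]) * scal ((-1) ^ card {(i, j). i < j \<and> j < l \<and> b i \<and> odd_letter (v j)} * prod_list (map a [0..<l]))"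
  using a
proof (induction l)
  case (Suc l)
  let ?e = "\<lambda>l. card {(i, j). i < j \<and> j < l \<and> b i \<and> odd_letter (v j)}"
  let ?B = "{i. i < l \<and> b i}" and ?P = "prod_list (map a [0..<l])"
  have "grade_sign 1 (prod_list (map a [0..<k])) = (-1) ^ card {i. i < k \<and> b i} * prod_list (map a [0..<k])" if "k \<le> l" for k
    using that
  proof (induction k)
    case (Suc k)
    have "{i. i < Suc k \<and> b i} = (if b k then insert k {i. i < k \<and> b i} else {i. i < k \<and> b i})"
      by (auto simp: less_Suc_eq)
    then have "card {i. i < Suc k \<and> b i} = card {i. i < k \<and> b i} + of_bool (b k)" by simp
    moreover have "grade_sign 1 (a k) = (-1) ^ of_bool (b k) * a k"
      using Suc.prems assms[of k] \<open>\<And>k. k < Suc l \<Longrightarrow> if b k then godd (a k) else geven (a k)\<close>[of k]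
      by (auto simp: godd_def geven_def)
    moreover have "grade_sign 1 (prod_list (map a [0..<k])) = (-1) ^ card {i. i < k \<and> b i} * prod_list (map a [0..<k])"
      using Suc by simp
    ultimately show ?case by (cases "b k") (auto simp: grade_sign_mult power_add mult.assoc)
  qed simp
  from this[of l] have gsP: "grade_sign 1 ?P = (-1) ^ card ?B * ?P" by simp
  have "{(i, j). i < j \<and> j < Suc l \<and> b i \<and> odd_letter (v j)} =
     {(i, j). i < j \<and> j < l \<and> b i \<and> odd_letter (v j)} \<union> (if odd_letter (v l) then (\<lambda>i. (i, l)) ` ?B else {})"
    by (auto simp: less_Suc_eq)
  moreover have "finite {(i, j). i < j \<and> j < l \<and> b i \<and> odd_letter (v j)}"
    by (rule finite_subset[of _ "{..<l} \<times> {..<l}"]) auto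
  moreover have "card ((\<lambda>i. (i, l)) ` ?B) = card ?B" by (rule card_image) (simp add: inj_on_def)
  ultimately have e: "?e (Suc l) = ?e l + (if odd_letter (v l) then card ?B else 0)"
    by (simp only:) (subst card_Un_disjoint; auto)
  have gs: "grade_sign (par_letter (v l)) ((-1) ^ ?e l * ?P) = (-1) ^ ?e (Suc l) * ?P"
  proof (cases "odd_letter (v l)")
    case True
    have "grade_sign 1 ((-1) ^ ?e l * ?P) = (-1) ^ ?e l * grade_sign 1 ?P"
      by (cases "even (?e l)") (auto simp: grade_sign_uminus)
    then show ?thesis using True by (simp only: e gsP par_letter_def of_bool_eq if_True power_add mult.assoc)
  next
    case False
    then show ?thesis by (simp add: e par_letter_def)
  qed
  have pl: "odd_count [x] = par_letter x" for x by (simp add: odd_count_def par_letter_def)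
  have IH: "prod_list (map (\<lambda>k. word [v k] * scal (a k)) [0..<l]) = word (map v [0..<l]) * scal ((-1) ^ ?e l * ?P)"
    using Suc by simp
  have "prod_list (map (\<lambda>k. word [v k] * scal (a k)) [0..<Suc l]) =
      word (map v [0..<l]) * scal ((-1) ^ ?e l * ?P) * (word [v l] * scal (a l))"
    by (simp add: IH)
  also have "\<dots> = word (map v [0..<Suc l]) * scal ((-1) ^ ?e (Suc l) * ?P * a l)"
    unfolding monomial_mult pl gs by simp
  finally show ?case by (simp add: mult.assoc)
qed simp

text \<open>\<open>l\<close> positions with coordinates \<open>(f, g)\<close> filling a rectangle; on the line \<open>f = a\<close> stand
  the vectors \<open>y a = \<Sum>t\<le>d. V a t \<cdot> C a t\<close> of parity \<open>p\<close>.  A filling is canonical if at position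
  \<open>k\<close> the summand \<open>g k\<close> or \<open>d\<close> is chosen.\<close>

locale line_fillings =
  fixes f g :: "nat \<Rightarrow> nat" and l q d p :: nat
    and V :: "nat \<Rightarrow> nat \<Rightarrow> letter" and C :: "nat \<Rightarrow> nat \<Rightarrow> 'k::field_char_0 grassmann"
  assumes bij: "bij_betw (\<lambda>k. (f k, g k)) {..<l} ({..<q} \<times> {..d})"
    and par: "\<And>a t. a < q \<Longrightarrow> t \<le> d \<Longrightarrow> grade_sign 1 (C a t) = (-1) ^ (p + par_letter (V a t)) * C a t"
    and odd_C: "\<And>a t. a < q \<Longrightarrow> t < d \<Longrightarrow> godd (C a t)"
begin

lemma coords: "k < l \<Longrightarrow> f k < q" "k < l \<Longrightarrow> g k \<le> d"
  using bij_betwE[OF bij] by auto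

lemma ex_pos: "a < q \<Longrightarrow> t \<le> d \<Longrightarrow> \<exists>k<l. f k = a \<and> g k = t"
proof -
  assume "a < q" "t \<le> d"
  then have "(a, t) \<in> (\<lambda>k. (f k, g k)) ` {..<l}" using bij by (auto simp: bij_betw_def)
  then show ?thesis by auto
qed

lemma pos_inj: "k < l \<Longrightarrow> k' < l \<Longrightarrow> f k = f k' \<Longrightarrow> g k = g k' \<Longrightarrow> k = k'"
  using bij_betw_imp_inj_on[OF bij] by (auto dest: inj_onD)

definition fillings :: "(nat \<Rightarrow> nat) set" where
  "fillings = {..<l} \<rightarrow>\<^sub>E {..d}"

definition canonical :: "(nat \<Rightarrow> nat) set" where
  "canonical = {c \<in> fillings. \<forall>k<l. c k = d \<or> c k = g k}"

definition shift :: "(nat \<Rightarrow> nat) \<Rightarrow> (nat \<Rightarrow> nat) \<Rightarrow> nat \<Rightarrow> nat" where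
  "shift c \<sigma> = restrict (\<lambda>k. c (\<sigma> k)) {..<l}"

definition stab :: "(nat \<Rightarrow> nat) \<Rightarrow> (nat \<Rightarrow> nat) set" where
  "stab c = {\<sigma> \<in> line_stab f l. \<forall>k<l. c (\<sigma> k) = c k}"

definition mono :: "(nat \<Rightarrow> nat) \<Rightarrow> 'k stensor" where
  "mono c = prod_list (map (\<lambda>k. word [V (f k) (c k)] * scal (C (f k) (c k))) [0..<l])"

definition vec :: "nat \<Rightarrow> 'k stensor" where
  "vec a = (\<Sum>t\<le>d. word [V a t] * scal (C a t))"

text \<open>Both Young symmetrizers are of this form. With \<open>p = 1\<close> and \<open>f\<close>
  the column, columns are antisymmetrized before rows are symmetrized, as for e_T acting from the
  left; with \<open>p = 0\<close> and \<open>f\<close> the row, the order is that of the right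
  action.\<close>

definition symm :: "(nat \<Rightarrow> nat) \<Rightarrow> 'k stensor" where
  "symm c = symz (Suc p) (line_stab g l) (symz p (line_stab f l) (mono c))"

lemma fillings_finite [simp]: "finite fillings"
  unfolding fillings_def by (rule finite_PiE) auto

lemma canonical_finite [simp]: "finite canonical"
  by (rule finite_subset[OF _ fillings_finite]) (auto simp: canonical_def)

lemma fillings_le: "c \<in> fillings \<Longrightarrow> k < l \<Longrightarrow> c k \<le> d"
  by (auto simp: fillings_def PiE_iff)

lemma mono_tlen: "mono c \<in> tlen l"
  unfolding mono_def using tlen_prod_map[of "[0..<l]" "\<lambda>k. word [V (f k) (c k)] * scal (C (f k) (c k))"]
  by (simp add: tlen_mult_scal)

lemma shift_fillings: "c \<in> fillings \<Longrightarrow> \<sigma> permutes {..<l} \<Longrightarrow> shift c \<sigma> \<in> fillings"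
  unfolding shift_def fillings_def
  by (auto simp: restrict_PiE_iff PiE_iff permutes_in_image[of \<sigma> "{..<l}", unfolded lessThan_iff])

lemma shift_comp:
  "\<tau> permutes {..<l} \<Longrightarrow> shift (shift c \<sigma>) \<tau> = shift c (\<lambda>k. \<sigma> (\<tau> k))"
  unfolding shift_def by (rule ext) (auto simp: restrict_def permutes_in_image[of \<tau> "{..<l}", unfolded lessThan_iff])

lemma shift_pinv:
  assumes "c \<in> fillings" "\<sigma> permutes {..<l}"
  shows "shift (shift c \<sigma>) (pinv \<sigma>) = c" "shift (shift c (pinv \<sigma>)) \<sigma> = c"
  using assms shift_comp[OF permutes_inv[OF assms(2)], of c \<sigma>] shift_comp[OF assms(2), of c "pinv \<sigma>"]
  by (auto simp: permutes_inverses[OF assms(2)] shift_def fillings_def PiE_iff extensional_def fun_eq_iff)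

lemma sum_shift:
  assumes "\<sigma> permutes {..<l}"
  shows "(\<Sum>c\<in>fillings. F (shift c \<sigma>)) = (\<Sum>c\<in>fillings. F c)"
proof (rule sum.reindex_bij_betw, rule bij_betw_byWitness[where f' = "\<lambda>c. shift c (pinv \<sigma>)"])
  show "\<forall>c\<in>fillings. shift (shift c \<sigma>) (pinv \<sigma>) = c" "\<forall>c\<in>fillings. shift (shift c (pinv \<sigma>)) \<sigma> = c"
    using shift_pinv assms by auto
  show "(\<lambda>c. shift c \<sigma>) ` fillings \<subseteq> fillings" "(\<lambda>c. shift c (pinv \<sigma>)) ` fillings \<subseteq> fillings"
    using shift_fillings[OF _ assms] shift_fillings[OF _ permutes_inv[OF assms]] by auto
qed

lemma permuted_mono:
  assumes "c \<in> fillings" "\<sigma> permutes {..<l}"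
  shows "prod_list (map (\<lambda>k. word [V (f (\<sigma> k)) (c (\<sigma> k))] * scal (C (f (\<sigma> k)) (c (\<sigma> k)))) [0..<l]) =
    of_int (sign \<sigma> ^ p) * sym_left (pinv \<sigma>) (mono c)"
proof -
  have ii: "pinv (pinv \<sigma>) = \<sigma>" by (rule inv_inv_eq[OF permutes_bij[OF assms(2)]])
  have s: "sign (pinv \<sigma>) = sign \<sigma>" by (rule sign_inverse[OF permutes_imp_permutation[OF finite_lessThan assms(2)]])
  have "sym_left (pinv \<sigma>) (mono c) = of_int (sign (pinv \<sigma>) ^ p) *
      prod_list (map (\<lambda>k. word [V (f (pinv (pinv \<sigma>) k)) (c (pinv (pinv \<sigma>) k))] *
        scal (C (f (pinv (pinv \<sigma>) k)) (c (pinv (pinv \<sigma>) k)))) [0..<l])"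
    unfolding mono_def
    by (rule sym_left_prod[OF permutes_inv[OF assms(2)], where v = "\<lambda>k. V (f k) (c k)" and a = "\<lambda>k. C (f k) (c k)"])
      (use par coords fillings_le[OF assms(1)] in auto)
  then show ?thesis unfolding ii s by (simp only: of_int_sign_square)
qed

lemma mono_shift:
  assumes "c \<in> fillings" "\<sigma> \<in> line_stab f l"
  shows "mono (shift c \<sigma>) = of_int (sign \<sigma> ^ p) * sym_left (pinv \<sigma>) (mono c)"
proof -
  have "mono (shift c \<sigma>) = prod_list (map (\<lambda>k. word [V (f (\<sigma> k)) (c (\<sigma> k))] * scal (C (f (\<sigma> k)) (c (\<sigma> k)))) [0..<l])"
    unfolding mono_def using assms(2)
    by (intro arg_cong[where f = prod_list] map_cong refl) (auto simp: shift_def line_stab_def)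
  then show ?thesis using permuted_mono[OF assms(1) line_stab_permutes[OF assms(2)]] by simp
qed

text \<open>A shift along the lines of \<open>f\<close> acts on \<open>mono c\<close> up to the sign
  to the power \<open>p\<close>, the very character to which \<open>symz p\<close> projects; the two
  signs cancel.\<close>

lemma symm_shift:
  assumes "c \<in> fillings" "\<sigma> \<in> line_stab f l"
  shows "symm (shift c \<sigma>) = symm c"
  unfolding symm_def mono_shift[OF assms] symz_of_int
    symz_sym_left[OF line_stab_inv[OF assms(2)] mono_tlen] line_stab_sign_inv[OF assms(2)]
  by (simp only: of_int_sign_square)

text \<open>The exponent \<open>Suc p\<close> has two sources: rearranging vectors of parity
  \<open>p\<close> costs the sign to the power \<open>p\<close>, and the alternation contributes one
  further sign.\<close>

lemma alt_prod_fillings: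
  "alt_prod g f l vec = (\<Sum>c\<in>fillings. symz (Suc p) (line_stab g l) (mono c))"
proof -
  have "of_int (sign \<tau>) * prod_list (map (\<lambda>k. vec (f (\<tau> k))) [0..<l]) =
      (\<Sum>c\<in>fillings. of_int (sign (pinv \<tau>) ^ Suc p) * sym_left (pinv \<tau>) (mono c))"
    if \<tau>: "\<tau> \<in> line_stab g l" for \<tau>
  proof -
    have perm: "\<tau> permutes {..<l}" using \<tau> by (rule line_stab_permutes)
    have "prod_list (map (\<lambda>k. vec (f (\<tau> k))) [0..<l]) =
        (\<Sum>c\<in>fillings. prod_list (map (\<lambda>k. word [V (f (\<tau> k)) (c k)] * scal (C (f (\<tau> k)) (c k))) [0..<l]))"
      unfolding vec_def fillings_def by (rule prod_list_sum_distrib) simp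
    also have "\<dots> = (\<Sum>c\<in>fillings. prod_list (map (\<lambda>k. word [V (f (\<tau> k)) (shift c \<tau> k)] * scal (C (f (\<tau> k)) (shift c \<tau> k))) [0..<l]))"
      by (rule sum_shift[OF perm, symmetric])
    also have "\<dots> = (\<Sum>c\<in>fillings. of_int (sign \<tau> ^ p) * sym_left (pinv \<tau>) (mono c))"
    proof (rule sum.cong[OF refl])
      fix c assume c: "c \<in> fillings"
      have "map (\<lambda>k. word [V (f (\<tau> k)) (shift c \<tau> k)] * scal (C (f (\<tau> k)) (shift c \<tau> k))) [0..<l] =
        map (\<lambda>k. word [V (f (\<tau> k)) (c (\<tau> k))] * scal (C (f (\<tau> k)) (c (\<tau> k)))) [0..<l]"
        by (rule map_cong) (auto simp: shift_def)
      then show "prod_list (map (\<lambda>k. word [V (f (\<tau> k)) (shift c \<tau> k)] * scal (C (f (\<tau> k)) (shift c \<tau> k))) [0..<l]) =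
          of_int (sign \<tau> ^ p) * sym_left (pinv \<tau>) (mono c)"
        by (simp only: permuted_mono[OF c perm])
    qed
    finally show ?thesis
      by (simp only: sum_distrib_left line_stab_sign_inv[OF \<tau>] power_Suc of_int_mult mult.assoc)
  qed
  then have "alt_prod g f l vec = (\<Sum>\<tau>\<in>line_stab g l. \<Sum>c\<in>fillings. of_int (sign (pinv \<tau>) ^ Suc p) * sym_left (pinv \<tau>) (mono c))"
    unfolding alt_prod_def by (rule sum.cong[OF refl])
  also have "\<dots> = (\<Sum>\<tau>\<in>line_stab g l. \<Sum>c\<in>fillings. of_int (sign \<tau> ^ Suc p) * sym_left \<tau> (mono c))"
    by (rule line_stab_sum_inv)
  also have "\<dots> = (\<Sum>c\<in>fillings. symz (Suc p) (line_stab g l) (mono c))"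
    unfolding symz_def by (rule sum.swap)
  finally show ?thesis .
qed

text \<open>The set of all fillings is invariant under shifts along the lines of \<open>f\<close>,
  so \<open>mono c\<close> may be replaced by its sum over these shifts at the price of the group
  order. This produces the second symmetrizer.\<close>

lemma alt_prod_symm: "of_nat (card (line_stab f l)) * alt_prod g f l vec = (\<Sum>c\<in>fillings. symm c)"
proof -
  let ?S = "symz (Suc p) (line_stab g l)"
  have "of_nat (card (line_stab f l)) * alt_prod g f l vec = (\<Sum>\<sigma>\<in>line_stab f l. \<Sum>c\<in>fillings. ?S (mono c))"
    by (simp add: alt_prod_fillings)
  also have "\<dots> = (\<Sum>\<sigma>\<in>line_stab f l. \<Sum>c\<in>fillings. ?S (of_int (sign (pinv \<sigma>) ^ p) * sym_left (pinv \<sigma>) (mono c)))"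
  proof (rule sum.cong[OF refl])
    fix \<sigma> assume \<sigma>: "\<sigma> \<in> line_stab f l"
    have "(\<Sum>c\<in>fillings. ?S (mono c)) = (\<Sum>c\<in>fillings. ?S (mono (shift c \<sigma>)))"
      by (rule sum_shift[OF line_stab_permutes[OF \<sigma>], symmetric])
    also have "\<dots> = (\<Sum>c\<in>fillings. ?S (of_int (sign (pinv \<sigma>) ^ p) * sym_left (pinv \<sigma>) (mono c)))"
      by (rule sum.cong[OF refl]) (simp only: mono_shift[OF _ \<sigma>] line_stab_sign_inv[OF \<sigma>])
    finally show "(\<Sum>c\<in>fillings. ?S (mono c)) = (\<Sum>c\<in>fillings. ?S (of_int (sign (pinv \<sigma>) ^ p) * sym_left (pinv \<sigma>) (mono c)))" .
  qed
  also have "\<dots> = (\<Sum>\<sigma>\<in>line_stab f l. \<Sum>c\<in>fillings. ?S (of_int (sign \<sigma> ^ p) * sym_left \<sigma> (mono c)))"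
    by (rule line_stab_sum_inv)
  also have "\<dots> = (\<Sum>c\<in>fillings. \<Sum>\<sigma>\<in>line_stab f l. ?S (of_int (sign \<sigma> ^ p) * sym_left \<sigma> (mono c)))"
    by (rule sum.swap)
  also have "\<dots> = (\<Sum>c\<in>fillings. symm c)"
    by (simp only: symm_def symz_def[of p] symz_sum)
  finally show ?thesis .
qed

text \<open>The same odd coefficient occurs twice in the product. The summand \<open>d\<close> is
  exempt, its coefficient being unrestricted in \<open>odd_C\<close>.\<close>

lemma mono_repeat:
  assumes c: "c \<in> fillings" and k: "k < l" "k' < l" "k < k'" "f k = f k'" "c k = c k'" "c k \<noteq> d"
  shows "mono c = 0"
proof -
  let ?x = "\<lambda>k. word [V (f k) (c k)] * scal (C (f k) (c k))"
  let ?b = "C (f k) (c k)"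
  have split: "[0..<l] = [0..<k] @ [k] @ [Suc k..<k'] @ [k'] @ [Suc k'..<l]"
  proof -
    have "[0..<l] = [0..<k] @ [k..<l]" using k upt_add_eq_append[of 0 k "l - k"] by simp
    also have "[k..<l] = k # [Suc k..<l]" using k by (simp add: upt_conv_Cons)
    also have "[Suc k..<l] = [Suc k..<k'] @ [k'..<l]" using k upt_add_eq_append[of "Suc k" k' "l - k'"] by simp
    also have "[k'..<l] = k' # [Suc k'..<l]" using k by (simp add: upt_conv_Cons)
    finally show ?thesis by simp
  qed
  have o: "godd ?b" using odd_C coords k fillings_le[OF c k(1)] by simp
  let ?Y = "prod_list (map ?x [Suc k..<k']) * word [V (f k') (c k')]"
  have "scal ?b * ?Y * scal ?b = tinv ?Y * (scal ?b * scal ?b)"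
    by (simp only: scal_godd_commute[OF o] mult.assoc)
  then have 0: "scal ?b * ?Y * scal ?b = 0" by (simp add: godd_square[OF o] flip: scal_mult)
  have "mono c = prod_list (map ?x [0..<k]) * word [V (f k) (c k)] * (scal ?b * ?Y * scal ?b) * prod_list (map ?x [Suc k'..<l])"
    unfolding mono_def split using k by (simp add: mult.assoc)
  then show ?thesis unfolding 0 by simp
qed

text \<open>Among all rearrangements along the lines, one with the largest number of summands other
  than \<open>d\<close> in their proper places is canonical: otherwise a transposition would put one
  more into place. Uniqueness of each such summand on its line comes from
  \<open>mono_repeat\<close>.\<close>

lemma ex_canonical:
  assumes c: "c \<in> fillings" and nz: "symm c \<noteq> 0"
  shows "\<exists>\<sigma>\<in>line_stab f l. shift c \<sigma> \<in> canonical"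
proof -
  have nr: "k = k'" if "k < l" "k' < l" "f k = f k'" "c k = c k'" "c k \<noteq> d" for k k'
  proof (rule ccontr)
    assume "k \<noteq> k'"
    then have "mono c = 0"
      using that mono_repeat[OF c, of k k'] mono_repeat[OF c, of k' k] by (cases "k < k'") auto
    then show False using nz by (simp add: symm_def)
  qed
  define cnt where "cnt \<sigma> = card {k. k < l \<and> c (\<sigma> k) = g k \<and> g k \<noteq> d}" for \<sigma>
  have "cnt \<sigma> \<le> l" for \<sigma>
    unfolding cnt_def using card_mono[of "{..<l}" "{k. k < l \<and> c (\<sigma> k) = g k \<and> g k \<noteq> d}"] by auto
  then obtain \<sigma> where \<sigma>: "\<sigma> \<in> line_stab f l" and max: "\<And>\<tau>. \<tau> \<in> line_stab f l \<Longrightarrow> cnt \<tau> \<le> cnt \<sigma>"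
    using ex_has_greatest_nat[of "\<lambda>\<sigma>. \<sigma> \<in> line_stab f l" id cnt "Suc l"] line_stab_id[of f l]
    by (metis le_imp_less_Suc)
  have perm: "\<sigma> permutes {..<l}" using \<sigma> by (rule line_stab_permutes)
  have "c (\<sigma> k) = d \<or> c (\<sigma> k) = g k" if k: "k < l" for k
  proof (rule ccontr)
    assume bad: "\<not> (c (\<sigma> k) = d \<or> c (\<sigma> k) = g k)"
    have sk: "\<sigma> k < l" using k line_stab_less[OF \<sigma>] by simp
    have "c (\<sigma> k) \<le> d" by (rule fillings_le[OF c sk])
    \<comment> \<open>\<open>k'\<close> is the place on the same line where the misplaced summand
      belongs. It is not yet filled correctly, since the summand would then occur twice.\<close>
    then obtain k' where k': "k' < l" "f k' = f k" "g k' = c (\<sigma> k)" using ex_pos[of "f k" "c (\<sigma> k)"] coords k by auto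
    have ne: "k' \<noteq> k" using k' bad by auto
    have sk': "\<sigma> k' < l" using k' line_stab_less[OF \<sigma>] by simp
    have fs: "f (\<sigma> k) = f k" "f (\<sigma> k') = f k'" using \<sigma> k k' by (auto simp: line_stab_def)
    have k'bad: "c (\<sigma> k') \<noteq> g k'"
    proof
      assume "c (\<sigma> k') = g k'"
      then have "\<sigma> k = \<sigma> k'" using nr[OF sk sk'] fs k' bad by auto
      then show False using ne permutes_inj[OF perm] by (auto dest: injD)
    qed
    let ?t = "transpose k k'" and ?A = "\<lambda>\<sigma>. {k. k < l \<and> c (\<sigma> k) = g k \<and> g k \<noteq> d}"
    have t: "?t \<in> line_stab f l"
      unfolding line_stab_def using k k' by (auto intro: permutes_swap_id simp: transpose_def)
    have "insert k' (?A \<sigma>) \<subseteq> ?A (\<sigma> \<circ> ?t)"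
    proof
      fix x assume "x \<in> insert k' (?A \<sigma>)"
      then show "x \<in> ?A (\<sigma> \<circ> ?t)" using k' bad k'bad ne by (auto simp: transpose_def)
    qed
    then have "card (insert k' (?A \<sigma>)) \<le> card (?A (\<sigma> \<circ> ?t))" by (intro card_mono) simp_all
    moreover have "card (insert k' (?A \<sigma>)) = Suc (card (?A \<sigma>))" using k'bad by simp
    ultimately have "card (?A \<sigma>) < card (?A (\<sigma> \<circ> ?t))" by linarith
    then show False using max[OF line_stab_comp[OF \<sigma> t]] unfolding cnt_def by linarith
  qed
  then have "shift c \<sigma> \<in> canonical"
    using shift_fillings[OF c perm] by (simp add: canonical_def) (simp add: shift_def)
  then show ?thesis using \<sigma> by blast
qed

text \<open>In a canonical filling a summand other than \<open>d\<close> determines its position on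
  the line, so a rearrangement into a canonical filling can only permute the places holding
  \<open>d\<close>.\<close>

lemma canonical_unique:
  assumes F: "F \<in> canonical" and \<rho>: "\<rho> \<in> line_stab f l" and F': "shift F \<rho> \<in> canonical"
  shows "\<rho> \<in> stab F"
proof -
  have perm: "\<rho> permutes {..<l}" using \<rho> by (rule line_stab_permutes)
  have 1: "\<rho> k = k" if k: "k < l" and nd: "F (\<rho> k) \<noteq> d" for k
  proof -
    have rk: "\<rho> k < l" using k line_stab_less[OF \<rho>] by simp
    have "F (\<rho> k) = g (\<rho> k)" using F rk nd by (auto simp: canonical_def)
    moreover have "shift F \<rho> k = d \<or> shift F \<rho> k = g k" using F' k by (auto simp: canonical_def)
    then have "F (\<rho> k) = g k" using k nd by (simp add: shift_def)
    ultimately show ?thesis using pos_inj[OF rk k] \<rho> k by (simp add: line_stab_def)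
  qed
  have "F (\<rho> k) = F k" if k: "k < l" for k
  proof (cases "F (\<rho> k) = d")
    case True
    have "F k = d"
    proof (rule ccontr)
      assume nd: "F k \<noteq> d"
      let ?k = "pinv \<rho> k"
      have "?k < l" "\<rho> ?k = k"
        using k line_stab_less[OF line_stab_inv[OF \<rho>]] permutes_inverses[OF perm] by auto
      then have "?k = k" using 1[of ?k] nd by simp
      then show False using True nd \<open>\<rho> ?k = k\<close> by simp
    qed
    then show ?thesis using True by simp
  next
    case False
    then show ?thesis using 1[OF k] by simp
  qed
  then show ?thesis using \<rho> by (simp add: stab_def)
qed

lemma stab_finite [simp]: "finite (stab c)"
  by (rule finite_subset[OF _ line_stab_finite[of f l]]) (auto simp: stab_def)

lemma stab_nonempty: "card (stab c) \<noteq> 0"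
proof -
  have "id \<in> stab c" by (simp add: stab_def)
  then show ?thesis by (auto simp: card_eq_0_iff)
qed

lemma shift_eq_self: "F \<in> fillings \<Longrightarrow> \<rho> \<in> stab F \<Longrightarrow> shift F \<rho> = F"
  by (auto simp: shift_def stab_def fillings_def PiE_iff extensional_def fun_eq_iff)

text \<open>The permutations making \<open>c\<close> canonical form one coset of the stabilizer of
  the canonical filling that they all reach, so the weights add up to 1.\<close>

lemma card_to_canonical:
  assumes c: "c \<in> fillings" and nz: "symm c \<noteq> 0"
  shows "(\<Sum>\<sigma>\<in>{\<sigma> \<in> line_stab f l. shift c \<sigma> \<in> canonical}. 1 / of_nat (card (stab (shift c \<sigma>)))) = (1 :: 'k)"
proof -
  obtain \<sigma>0 where s0: "\<sigma>0 \<in> line_stab f l" "shift c \<sigma>0 \<in> canonical" using ex_canonical[OF assms] by blast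
  have p0: "\<sigma>0 permutes {..<l}" using s0 by (simp add: line_stab_permutes)
  let ?F = "shift c \<sigma>0"
  have Ff: "?F \<in> fillings" using s0 by (simp add: canonical_def)
  have sh: "shift c \<sigma> = shift ?F (pinv \<sigma>0 \<circ> \<sigma>)" if "\<sigma> \<in> line_stab f l" for \<sigma>
  proof -
    have "(pinv \<sigma>0 \<circ> \<sigma>) permutes {..<l}"
      by (rule permutes_compose[OF line_stab_permutes[OF that] permutes_inv[OF p0]])
    from shift_comp[OF this, of c \<sigma>0] show ?thesis by (simp add: permutes_inverses[OF p0])
  qed
  have all: "shift c \<sigma> = ?F \<and> pinv \<sigma>0 \<circ> \<sigma> \<in> stab ?F" if "\<sigma> \<in> line_stab f l" "shift c \<sigma> \<in> canonical" for \<sigma>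
  proof -
    have m: "pinv \<sigma>0 \<circ> \<sigma> \<in> line_stab f l" by (rule line_stab_comp[OF line_stab_inv[OF s0(1)] that(1)])
    have "pinv \<sigma>0 \<circ> \<sigma> \<in> stab ?F"
      by (rule canonical_unique[OF s0(2) m]) (use that sh in simp)
    then show ?thesis using sh[OF that(1)] shift_eq_self[OF Ff] by simp
  qed
  let ?T = "{\<sigma> \<in> line_stab f l. shift c \<sigma> \<in> canonical}"
  have "bij_betw (\<lambda>\<sigma>. pinv \<sigma>0 \<circ> \<sigma>) ?T (stab ?F)"
  proof (rule bij_betw_byWitness[where f' = "\<lambda>\<rho>. \<sigma>0 \<circ> \<rho>"])
    show "\<forall>\<sigma>\<in>?T. \<sigma>0 \<circ> (pinv \<sigma>0 \<circ> \<sigma>) = \<sigma>"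
      by (intro ballI ext) (simp add: permutes_inverses[OF p0])
    show "\<forall>\<rho>\<in>stab ?F. pinv \<sigma>0 \<circ> (\<sigma>0 \<circ> \<rho>) = \<rho>"
      by (intro ballI ext) (simp add: permutes_inverses[OF p0])
    show "(\<lambda>\<sigma>. pinv \<sigma>0 \<circ> \<sigma>) ` ?T \<subseteq> stab ?F" using all by auto
    show "(\<lambda>\<rho>. \<sigma>0 \<circ> \<rho>) ` stab ?F \<subseteq> ?T"
    proof
      fix \<sigma> assume "\<sigma> \<in> (\<lambda>\<rho>. \<sigma>0 \<circ> \<rho>) ` stab ?F"
      then obtain \<rho> where \<rho>: "\<rho> \<in> stab ?F" "\<sigma> = \<sigma>0 \<circ> \<rho>" by auto
      then have rl: "\<rho> \<in> line_stab f l" by (simp add: stab_def)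
      have m: "\<sigma> \<in> line_stab f l" unfolding \<rho>(2) by (rule line_stab_comp[OF s0(1) rl])
      have "shift c \<sigma> = shift ?F \<rho>" using shift_comp[OF line_stab_permutes[OF rl], of c \<sigma>0] \<rho>(2) by (simp add: o_def)
      then show "\<sigma> \<in> ?T" using m shift_eq_self[OF Ff \<rho>(1)] s0(2) by simp
    qed
  qed
  then have "card ?T = card (stab ?F)" by (rule bij_betw_same_card)
  moreover have "(\<Sum>\<sigma>\<in>?T. 1 / of_nat (card (stab (shift c \<sigma>)))) = (\<Sum>\<sigma>\<in>?T. 1 / of_nat (card (stab ?F)) :: 'k)"
  proof (rule sum.cong[OF refl])
    fix \<sigma> assume "\<sigma> \<in> ?T"
    then have "shift c \<sigma> = ?F" using all by blast
    then show "1 / of_nat (card (stab (shift c \<sigma>))) = (1 / of_nat (card (stab ?F)) :: 'k)" by (simp only:)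
  qed
  ultimately show ?thesis using stab_nonempty[of ?F] by simp
qed

text \<open>Each \<open>symm c\<close> is distributed over its canonical rearrangements with the
  weights of \<open>card_to_canonical\<close>. After exchanging the sums, every permutation
  contributes the same amount, and the order of \<open>line_stab f l\<close> cancels.\<close>

lemma alt_prod_canonical:
  "alt_prod g f l vec = (\<Sum>F\<in>canonical. symm F * scal (gconst (1 / of_nat (card (stab F)))))"
proof -
  let ?H = "line_stab f l"
  let ?G = "\<lambda>F. if F \<in> canonical then symm F * scal (gconst (1 / of_nat (card (stab F)))) else 0"
  have step: "symm c = (\<Sum>\<sigma>\<in>?H. ?G (shift c \<sigma>))" if c: "c \<in> fillings" for c
  proof -
    have "(\<Sum>\<sigma>\<in>?H. ?G (shift c \<sigma>)) = (\<Sum>\<sigma>\<in>{\<sigma> \<in> ?H. shift c \<sigma> \<in> canonical}. ?G (shift c \<sigma>))"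
      by (rule sum.mono_neutral_right) auto
    also have "\<dots> = (\<Sum>\<sigma>\<in>{\<sigma> \<in> ?H. shift c \<sigma> \<in> canonical}. symm c * scal (gconst (1 / of_nat (card (stab (shift c \<sigma>))))))"
      by (rule sum.cong[OF refl]) (use symm_shift[OF c] in simp)
    also have "\<dots> = symm c * scal (gconst (\<Sum>\<sigma>\<in>{\<sigma> \<in> ?H. shift c \<sigma> \<in> canonical}. 1 / of_nat (card (stab (shift c \<sigma>)))))"
    proof -
      have gs: "gconst (sum h I) = (\<Sum>i\<in>I. gconst (h i))" for h :: "(nat \<Rightarrow> nat) \<Rightarrow> 'k" and I
        by (induction I rule: infinite_finite_induct) (auto simp: gconst_add)
      show ?thesis by (simp only: gs scal_sum sum_distrib_left)
    qed
    finally show ?thesis using card_to_canonical[OF c] by (cases "symm c = 0") simp_all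
  qed
  have "of_nat (card ?H) * alt_prod g f l vec = (\<Sum>c\<in>fillings. \<Sum>\<sigma>\<in>?H. ?G (shift c \<sigma>))"
    unfolding alt_prod_symm by (rule sum.cong[OF refl step])
  also have "\<dots> = (\<Sum>\<sigma>\<in>?H. \<Sum>c\<in>fillings. ?G (shift c \<sigma>))" by (rule sum.swap)
  also have "\<dots> = (\<Sum>\<sigma>\<in>?H. \<Sum>c\<in>fillings. ?G c)"
    by (rule sum.cong[OF refl]) (rule sum_shift[OF line_stab_permutes])
  also have "\<dots> = of_nat (card ?H) * (\<Sum>c\<in>fillings. ?G c)" by simp
  also have "(\<Sum>c\<in>fillings. ?G c) = (\<Sum>F\<in>canonical. symm F * scal (gconst (1 / of_nat (card (stab F)))))"
    by (rule sum.mono_neutral_cong_right) (auto simp: canonical_def)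
  finally have eq: "of_nat (card ?H) * alt_prod g f l vec = of_nat (card ?H) * (\<Sum>F\<in>canonical. symm F * scal (gconst (1 / of_nat (card (stab F)))))" .
  have "card ?H \<noteq> 0" by (metis card_0_eq empty_iff line_stab_finite line_stab_id)
  then have ne: "(of_nat (card ?H) :: 'k) \<noteq> 0" by simp
  have "x = y" if "of_nat (card ?H) * x = (of_nat (card ?H) * y :: 'k stensor)" for x y
  proof -
    have "scal (gconst (inverse (of_nat (card ?H)))) * (of_nat (card ?H) * z) = z" for z :: "'k stensor"
    proof -
      have "(of_nat (card ?H) :: 'k stensor) = scal (gconst (of_int (int (card ?H))))"
        unfolding gconst_of_int scal_of_int by simp
      then show ?thesis using ne by (simp add: mult.assoc[symmetric] scal_mult[symmetric] gconst_mult[symmetric])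
    qed
    from this[of x] this[of y] that show ?thesis by metis
  qed
  from this[OF eq] show ?thesis .
qed

end

section \<open>Rectangular tableaux\<close>

lemma boxes_rect: "boxes (replicate r N) = map (\<lambda>k. (k div N, k mod N)) [0..<r * N]"
proof -
  have "concat (map (\<lambda>i. map (\<lambda>j. (i, j)) [0..<N]) [0..<r]) = map (\<lambda>k. (k div N, k mod N)) [0..<r * N]"
  proof (induction r)
    case (Suc r)
    have "[0..<Suc r * N] = [0..<r * N] @ [r * N..<r * N + N]"
      using upt_add_eq_append[of 0 "r * N" N] by (simp add: add.commute)
    moreover have "map (\<lambda>k. (k div N, k mod N)) [r * N..<r * N + N] = map (\<lambda>j. (r, j)) [0..<N]"
      by (rule nth_equalityI) auto
    ultimately show ?case using Suc by simp
  qed simp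
  moreover have "map (\<lambda>i. map (\<lambda>j. (i, j)) [0..<replicate r N ! i]) [0..<r] = map (\<lambda>i. map (\<lambda>j. (i, j)) [0..<N]) [0..<r]"
    by (rule map_cong) auto
  ultimately show ?thesis unfolding boxes_def length_replicate by (simp only:)
qed

lemma set_boxes_rect: "set (boxes (replicate r N)) = {..<r} \<times> {..<N}"
proof -
  have "\<exists>k<r * N. i = k div N \<and> j = k mod N" if "i < r" "j < N" for i j
  proof (intro exI[of _ "i * N + j"] conjI)
    have "i * N + j < i * N + N" using that by simp
    also have "\<dots> \<le> r * N" using that by (metis Suc_leI add.commute mult_Suc mult_le_mono1)
    finally show "i * N + j < r * N" .
  qed (use that in auto)
  moreover have "k div N < r \<and> k mod N < N" if "k < r * N" for k
    using that by (metis less_mult_imp_div_less mod_less_divisor gr_zeroI mult_0_right not_less_zero)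
  ultimately show ?thesis unfolding boxes_rect by (fastforce simp: image_iff)
qed

lemma line_stab_cong: "(\<And>k. k < l \<Longrightarrow> f k = f' k) \<Longrightarrow> line_stab f l = line_stab f' l"
proof -
  assume *: "\<And>k. k < l \<Longrightarrow> f k = f' k"
  have "(\<forall>k<l. f (\<sigma> k) = f k) \<longleftrightarrow> (\<forall>k<l. f' (\<sigma> k) = f' k)" if "\<sigma> permutes {..<l}" for \<sigma>
    using * permutes_in_image[OF that] by auto
  then show ?thesis unfolding line_stab_def by blast
qed

lemma row_stab_rect: "row_stab (replicate r N) = line_stab (\<lambda>k. k div N) (r * N)"
  unfolding row_stab_line boxes_rect sum_list_replicate of_nat_id by (rule line_stab_cong) simp

lemma col_stab_rect: "col_stab (replicate r N) = line_stab (\<lambda>k. k mod N) (r * N)"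
  unfolding col_stab_line boxes_rect sum_list_replicate of_nat_id by (rule line_stab_cong) simp

lemma rect_index: "i < r \<Longrightarrow> j < N \<Longrightarrow> i * N + j < r * (N :: nat)"
  by (metis add_less_cancel_left less_le_trans Suc_leI add.commute mult_Suc mult_le_mono1)

lemma bij_rect: "bij_betw (\<lambda>k. (k div N, k mod N)) {..<r * (N :: nat)} ({..<r} \<times> {..<N})"
proof (rule bij_betw_byWitness[where f' = "\<lambda>(i, j). i * N + j"])
  show "(\<lambda>k. (k div N, k mod N)) ` {..<r * N} \<subseteq> {..<r} \<times> {..<N}"
    using set_boxes_rect[of r N] unfolding boxes_rect by (auto simp: lessThan_atLeast0)
  show "(\<lambda>(i, j). i * N + j) ` ({..<r} \<times> {..<N}) \<subseteq> {..<r * N}" by (auto intro: rect_index)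
qed auto

lemma bij_rect': "bij_betw (\<lambda>k. (k mod N, k div N)) {..<r * (N :: nat)} ({..<N} \<times> {..<r})"
proof -
  have "bij_betw prod.swap ({..<r} \<times> {..<N}) ({..<N} \<times> {..<r})"
    by (rule bij_betw_byWitness[where f' = prod.swap]) auto
  from bij_betw_trans[OF bij_rect this] show ?thesis by (simp add: o_def)
qed

lemma rect_inj: "(a :: nat) div N = b div N \<Longrightarrow> a mod N = b mod N \<Longrightarrow> a = b"
  by (metis div_mult_mod_eq)

subsection \<open>The invariant bilinear form on words\<close>

definition kc :: "'k::field_char_0 stensor \<Rightarrow> letter list \<Rightarrow> 'k" where
  "kc x v = gcoeff (tcoeff x v) {}"

text \<open>The symmetric form on constant parts for which the words are orthonormal. It carries no
  sign, in contrast to \<open>pairing\<close>, and it is invariant under the symmetric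
  group.\<close>

definition bform :: "'k::field_char_0 stensor \<Rightarrow> 'k stensor \<Rightarrow> 'k" where
  "bform x y = (\<Sum>v | tcoeff y v \<noteq> 0. kc x v * kc y v)"

lemma kc_simps [simp]:
  "kc 0 v = 0" "kc (x + y) v = kc x v + kc y v" "kc (- x) v = - kc x v"
  by (simp_all add: kc_def)

lemma kc_sum: "kc (sum f I) v = (\<Sum>i\<in>I. kc (f i) v)"
  by (simp add: kc_def tcoeff_sum gcoeff_sum)

lemma kc_word: "kc (word u) v = of_bool (v = u)"
  by (simp add: kc_def tcoeff_word gcoeff_one)

lemma kc_mult_scal: "kc (x * scal a) v = kc x v * gcoeff a {}"
  by (simp add: kc_def gcoeff_mult)

lemma gcoeff_of_int: "gcoeff (of_int z) {} = of_int z"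
  by (metis gcoeff_gconst gconst_of_int)

lemma kc_of_int: "kc (of_int z * x) v = of_int z * kc x v"
  by (simp add: kc_def tcoeff_of_int_mult gcoeff_mult gcoeff_of_int)

lemma kc_m1: "kc ((-1) ^ j * x) v = (-1) ^ j * kc x v"
  by (cases "even j") auto

lemma tcoeff_kc: "x \<in> tvars {} \<Longrightarrow> tcoeff x v = gconst (kc x v)"
  by (rule grassmann_eqI) (auto simp: tvars_def gvars_def kc_def gcoeff_gconst)

lemma bform_superset:
  assumes "finite S" "{v. tcoeff y v \<noteq> 0} \<subseteq> S"
  shows "bform x y = (\<Sum>v\<in>S. kc x v * kc y v)"
  unfolding bform_def by (rule sum.mono_neutral_left) (use assms in \<open>auto simp: kc_def\<close>)

lemma bform_superset':
  assumes "finite S" "{v. tcoeff x v \<noteq> 0} \<subseteq> S"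
  shows "bform x y = (\<Sum>v\<in>S. kc x v * kc y v)"
proof -
  have kx: "kc x v = 0" if "v \<notin> S" for v
  proof -
    have "tcoeff x v = 0" using that assms(2) by auto
    then show ?thesis by (simp add: kc_def)
  qed
  have "bform x y = (\<Sum>v\<in>S \<union> {v. tcoeff y v \<noteq> 0}. kc x v * kc y v)"
    by (rule bform_superset) (use assms in auto)
  also have "\<dots> = (\<Sum>v\<in>S. kc x v * kc y v)"
    by (rule sum.mono_neutral_right) (use assms in \<open>auto simp: kx\<close>)
  finally show ?thesis .
qed

lemma bform_add_left: "bform (x + x') y = bform x y + bform x' y"
  by (simp add: bform_def distrib_right sum.distrib)

lemma bform_zero [simp]: "bform 0 y = 0" "bform x 0 = 0"
  by (simp_all add: bform_def)

lemma bform_commute: "bform x y = bform y x"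
  by (subst bform_superset'[of "{v. tcoeff x v \<noteq> 0}"]) (auto simp: bform_def mult.commute)

lemma bform_add_right: "bform x (y + y') = bform x y + bform x y'"
  using bform_add_left[of y y' x] by (simp add: bform_commute)

lemma bform_sum_left: "bform (sum f I) y = (\<Sum>i\<in>I. bform (f i) y)"
  by (induction I rule: infinite_finite_induct) (auto simp: bform_add_left)

lemma bform_sum_right: "bform x (sum f I) = (\<Sum>i\<in>I. bform x (f i))"
  by (induction I rule: infinite_finite_induct) (auto simp: bform_add_right)

lemma bform_scal_left: "bform (x * scal a) y = gcoeff a {} * bform x y"
  by (simp add: bform_def kc_mult_scal sum_distrib_left mult_ac)

lemma bform_scal_right: "bform x (y * scal a) = gcoeff a {} * bform x y"
  using bform_scal_left[of y a x] by (simp add: bform_commute)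

lemma bform_of_int_left: "bform (of_int z * x) y = of_int z * bform x y"
  using bform_scal_left[of x "of_int z" y] by (simp add: scal_of_int mult_of_int_commute gcoeff_of_int)

lemma bform_of_int_right: "bform x (of_int z * y) = of_int z * bform x y"
  using bform_of_int_left[of z y x] by (simp add: bform_commute)

lemma bform_word: "bform x (word v) = kc x v" "bform (word v) x = kc x v"
proof -
  show "bform x (word v) = kc x v"
    by (subst bform_superset[of "{v}"]) (auto simp: tcoeff_word kc_word)
  then show "bform (word v) x = kc x v" by (simp add: bform_commute)
qed

lemma m1_parity_eq: "even i = even j \<Longrightarrow> (-1 :: 'a::ring_1) ^ i = (-1) ^ j"
  by (simp add: uminus_power_if)

text \<open>Acting by \<open>\<pi>\<close> and then by its inverse gives the identity, which has no
  inverted pairs; so the two signs agree on matching words.\<close>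

lemma bform_sym_left:
  assumes p: "\<pi> permutes {..<l}" and x: "x \<in> tlen l" and y: "y \<in> tlen l"
  shows "bform (sym_left \<pi> x) y = bform x (sym_left (pinv \<pi>) y)"
proof (induction x rule: stensor_induct)
  case (word u a)
  then have u: "length u = l" using x by (auto simp: tlen_def)
  show ?case
  proof (induction y rule: stensor_induct)
    case (word v b)
    then have v: "length v = l" using y by (auto simp: tlen_def)
    have pi: "pinv \<pi> permutes {..<l}" by (rule permutes_inv[OF p])
    have id: "pinv \<pi> \<circ> \<pi> = id" "\<pi> \<circ> pinv \<pi> = id" using permutes_inv_o[OF p] by auto
    have pid: "perm_word id w = w" for w by (simp add: perm_word_def map_nth)
    have bk: "perm_word (pinv \<pi>) (perm_word \<pi> u) = u" "perm_word \<pi> (perm_word (pinv \<pi>) v) = v"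
      using perm_word_comp[of "pinv \<pi>" u \<pi>] perm_word_comp[of \<pi> v "pinv \<pi>"] p pi u v by (simp_all only: id pid)
    have eq: "v = perm_word \<pi> u \<longleftrightarrow> u = perm_word (pinv \<pi>) v" using bk by auto
    have sgn: "even (card (inv_pairs \<pi> u)) = even (card (inv_pairs (pinv \<pi>) v))" if "v = perm_word \<pi> u"
    proof -
      have "inv_pairs id u = {}" by (auto simp: inv_pairs_def)
      then have "even (card (inv_pairs \<pi> u) + card (inv_pairs (pinv \<pi>) (perm_word \<pi> u)))"
        using inv_pairs_comp[of "pinv \<pi>" u \<pi>] p pi u by (simp only: id card.empty) simp
      then show ?thesis using that by simp
    qed
    have "(-1) ^ card (inv_pairs \<pi> u) * of_bool (v = perm_word \<pi> u) =
        (-1) ^ card (inv_pairs (pinv \<pi>) v) * (of_bool (u = perm_word (pinv \<pi>) v) :: 'a)"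
      using eq m1_parity_eq[OF sgn] by auto
    then show ?case
      unfolding sym_left_mult_scal bform_scal_left bform_scal_right sym_left_word
      unfolding bform_word kc_m1 kc_word by (simp only:)
  qed (auto simp: sym_left_add bform_add_right)
qed (auto simp: sym_left_add bform_add_left)

lemma bform_symz:
  assumes x: "x \<in> tlen l" and y: "y \<in> tlen l"
  shows "bform (symz e (line_stab f l) x) y = bform x (symz e (line_stab f l) y)"
proof -
  have "bform (symz e (line_stab f l) x) y = (\<Sum>\<tau>\<in>line_stab f l. of_int (sign \<tau> ^ e) * bform (sym_left \<tau> x) y)"
    by (simp only: symz_def bform_sum_left bform_of_int_left)
  also have "\<dots> = (\<Sum>\<tau>\<in>line_stab f l. of_int (sign (pinv \<tau>) ^ e) * bform x (sym_left (pinv \<tau>) y))"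
    by (rule sum.cong[OF refl]) (simp only: bform_sym_left[OF line_stab_permutes x y] line_stab_sign_inv)
  also have "\<dots> = (\<Sum>\<tau>\<in>line_stab f l. of_int (sign \<tau> ^ e) * bform x (sym_left \<tau> y))"
    by (rule line_stab_sum_inv)
  finally show ?thesis by (simp only: symz_def bform_sum_right bform_of_int_right)
qed

lemma symz_square:
  assumes "x \<in> tlen l"
  shows "symz e (line_stab f l) (symz e (line_stab f l) x) = of_int (int (card (line_stab f l))) * symz e (line_stab f l) x"
proof -
  have "symz e (line_stab f l) (symz e (line_stab f l) x) =
      (\<Sum>\<tau>\<in>line_stab f l. of_int (sign \<tau> ^ e) * (of_int (sign \<tau> ^ e) * symz e (line_stab f l) x))"
    unfolding symz_def[of e "line_stab f l" "symz e (line_stab f l) x"]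
    by (rule sum.cong[OF refl]) (simp only: sym_left_symz[OF _ assms])
  then show ?thesis by (simp only: of_int_sign_square sum_constant of_int_of_nat_eq)
qed

subsection \<open>Young symmetrizers of rectangles\<close>

locale rect =
  fixes r N :: nat
begin

abbreviation "len \<equiv> r * N"
abbreviation "RS \<equiv> line_stab (\<lambda>k. k div N) len"
abbreviation "CS \<equiv> line_stab (\<lambda>k. k mod N) len"

definition young :: "'k::comm_ring_1 stensor \<Rightarrow> 'k stensor" where
  "young x = symz 0 RS (symz 1 CS x)"

lemma young_left_rect: "x \<in> tlen len \<Longrightarrow> young_left (replicate r N) x = young x"
  using young_left_symz[of x "replicate r N"]
  by (simp add: young_def row_stab_rect col_stab_rect sum_list_replicate)

lemma young_tlen: "x \<in> tlen len \<Longrightarrow> young x \<in> tlen len"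
  unfolding young_def by (intro symz_tlen)

text \<open>von Neumann's lemma: a permutation is either a product of a row and a column permutation,
  or it carries two boxes of a column into one row.\<close>

lemma sandwich:
  assumes p: "\<pi> permutes {..<len}"
  shows "\<exists>z::int. \<forall>x\<in>tlen len. symz 0 RS (sym_left \<pi> (symz 1 CS x)) = of_int z * young (x :: 'k::field_char_0 stensor)"
proof (cases "\<exists>k k'. k < len \<and> k' < len \<and> k \<noteq> k' \<and> k div N = k' div N \<and> pinv \<pi> k mod N = pinv \<pi> k' mod N")
  case True
  then obtain k k' where k: "k < len" "k' < len" "k \<noteq> k'" "k div N = k' div N" "pinv \<pi> k mod N = pinv \<pi> k' mod N" by auto
  let ?t = "transpose k k'" and ?s = "transpose (pinv \<pi> k) (pinv \<pi> k')"
  have lt: "pinv \<pi> k < len" "pinv \<pi> k' < len"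
    using k permutes_in_image[OF permutes_inv[OF p], of k] permutes_in_image[OF permutes_inv[OF p], of k'] by auto
  have t: "?t \<in> RS" unfolding line_stab_def using k by (auto intro!: permutes_swap_id simp: transpose_def)
  have s: "?s \<in> CS" unfolding line_stab_def using k lt by (auto intro!: permutes_swap_id simp: transpose_def)
  have ne: "pinv \<pi> k \<noteq> pinv \<pi> k'"
    using k(3) permutes_inj[OF permutes_inv[OF p]] by (auto dest: injD)
  have ts: "?t \<circ> \<pi> = \<pi> \<circ> ?s"
  proof (rule ext)
    fix j
    have "\<pi> j = k \<longleftrightarrow> j = pinv \<pi> k" "\<pi> j = k' \<longleftrightarrow> j = pinv \<pi> k'" using permutes_inverses[OF p] by metis+
    then show "(?t \<circ> \<pi>) j = (\<pi> \<circ> ?s) j" using permutes_inverses[OF p] by (auto simp: transpose_def)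
  qed
  have "symz 0 RS (sym_left \<pi> (symz 1 CS x)) = 0" if x: "x \<in> tlen len" for x :: "'k stensor"
  proof -
    let ?y = "symz 1 CS x"
    have y: "?y \<in> tlen len" by (rule symz_tlen[OF x])
    have "symz 0 RS (sym_left \<pi> ?y) = symz 0 RS (sym_left ?t (sym_left \<pi> ?y))"
      unfolding symz_sym_left[OF t sym_left_tlen[OF y]] by simp
    also have "sym_left ?t (sym_left \<pi> ?y) = sym_left \<pi> (sym_left ?s ?y)"
      by (simp only: sym_left_comp[OF line_stab_permutes[OF t] p y, symmetric]
          sym_left_comp[OF p line_stab_permutes[OF s] y, symmetric] ts)
    also have "sym_left ?s ?y = - ?y"
      unfolding sym_left_symz[OF s x] using ne by (simp add: sign_swap_id)
    also have "symz 0 RS (sym_left \<pi> (- ?y)) = - symz 0 RS (sym_left \<pi> ?y)"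
    proof -
      have m: "- ?y = of_int (- 1) * ?y" by simp
      show ?thesis unfolding m sym_left_of_int symz_of_int by simp
    qed
    finally have "symz 0 RS (sym_left \<pi> ?y) + symz 0 RS (sym_left \<pi> ?y) = 0" by (simp only: add.left_inverse eq_neg_iff_add_eq_0)
    then have "gcoeff (tcoeff (symz 0 RS (sym_left \<pi> ?y)) v) S + gcoeff (tcoeff (symz 0 RS (sym_left \<pi> ?y)) v) S = 0" for v S
      by (metis gcoeff_add gcoeff_zero tcoeff_add tcoeff_zero)
    then have "gcoeff (tcoeff (symz 0 RS (sym_left \<pi> ?y)) v) S = 0" for v S by (simp add: mult_2[symmetric])
    then show ?thesis by (intro stensor_eqI grassmann_eqI) simp
  qed
  then show ?thesis by (intro exI[of _ 0]) simp
next
  case False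
  \<comment> \<open>\<open>\<rho>\<close> moves each box within its row to the column from which
    \<open>\<pi>\<close> brought it. It is injective because no two boxes of a row come from the
    same column; hence \<open>\<pi>\<close> is a column permutation followed by a row
    permutation.\<close>
  define \<rho> where "\<rho> k = (if k < len then (k div N) * N + pinv \<pi> k mod N else k)" for k
  have Npos: "N > 0" if "k < len" for k using that by (cases N) auto
  have \<rho>dm: "\<rho> k div N = k div N" "\<rho> k mod N = pinv \<pi> k mod N" if "k < len" for k
    using that Npos[OF that] by (auto simp: \<rho>_def)
  have \<rho>lt: "\<rho> k < len" if "k < len" for k
    using that Npos[OF that] rect_index[of "k div N" r "pinv \<pi> k mod N" N]
    by (auto simp: \<rho>_def less_mult_imp_div_less)
  have "inj_on \<rho> {..<len}"
  proof (rule inj_onI)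
    fix k k' assume "k \<in> {..<len}" "k' \<in> {..<len}" and eq: "\<rho> k = \<rho> k'"
    then have lt: "k < len" "k' < len" by auto
    have "k div N = k' div N" "pinv \<pi> k mod N = pinv \<pi> k' mod N"
      using \<rho>dm[OF lt(1)] \<rho>dm[OF lt(2)] eq by simp_all
    then show "k = k'" using False lt by blast
  qed
  moreover from this have "\<rho> ` {..<len} = {..<len}" using \<rho>lt by (intro endo_inj_surj) auto
  ultimately have "bij_betw \<rho> {..<len} {..<len}" by (simp add: bij_betw_def)
  then have \<rho>p: "\<rho> permutes {..<len}" by (rule bij_imp_permutes) (auto simp: \<rho>_def)
  have \<rho>: "\<rho> \<in> RS" using \<rho>p \<rho>dm by (simp add: line_stab_def)
  have \<sigma>: "\<rho> \<circ> \<pi> \<in> CS" unfolding line_stab_def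
  proof (intro CollectI conjI allI impI)
    show "\<rho> \<circ> \<pi> permutes {..<len}" by (rule permutes_compose[OF p \<rho>p])
    fix k assume "k < len"
    then have "\<pi> k < len" using permutes_in_image[OF p, of k] by simp
    then show "(\<rho> \<circ> \<pi>) k mod N = k mod N" by (simp add: \<rho>dm permutes_inverses[OF p])
  qed
  have dec: "pinv \<rho> \<circ> (\<rho> \<circ> \<pi>) = \<pi>" by (rule ext) (simp add: permutes_inverses[OF \<rho>p])
  show ?thesis
  proof (intro exI[of _ "sign (\<rho> \<circ> \<pi>)"] ballI)
    fix x :: "'k stensor" assume x: "x \<in> tlen len"
    let ?y = "symz 1 CS x"
    have y: "?y \<in> tlen len" by (rule symz_tlen[OF x])
    have "sym_left \<pi> ?y = sym_left (pinv \<rho>) (sym_left (\<rho> \<circ> \<pi>) ?y)"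
      using sym_left_comp[OF permutes_inv[OF \<rho>p] line_stab_permutes[OF \<sigma>] y] by (simp only: dec)
    also have "sym_left (\<rho> \<circ> \<pi>) ?y = of_int (sign (\<rho> \<circ> \<pi>)) * ?y"
      by (simp only: sym_left_symz[OF \<sigma> x] power_one_right)
    also have "symz 0 RS (sym_left (pinv \<rho>) (of_int (sign (\<rho> \<circ> \<pi>)) * ?y)) = of_int (sign (\<rho> \<circ> \<pi>)) * symz 0 RS ?y"
      unfolding sym_left_of_int symz_of_int symz_sym_left[OF line_stab_inv[OF \<rho>] y] by (simp only: power_0 of_int_1 mult_1_left)
    finally show "symz 0 RS (sym_left \<pi> ?y) = of_int (sign (\<rho> \<circ> \<pi>)) * young x"
      by (simp only: young_def)
  qed
qed

text \<open>Expanding the two inner symmetrizers leaves permutations between a row symmetrizer and a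
  column antisymmetrizer; \<open>sandwich\<close> turns each of them into an integer multiple of
  \<open>young x\<close>.\<close>

lemma young_quasi_idempotent:
  "\<exists>z::int. \<forall>x\<in>tlen len. young (young x) = of_int z * young (x :: 'k::field_char_0 stensor)"
proof -
  have "\<forall>\<pi>\<in>{\<pi>. \<pi> permutes {..<len}}. \<exists>z::int. \<forall>x\<in>tlen len. symz 0 RS (sym_left \<pi> (symz 1 CS x)) = of_int z * young (x :: 'k stensor)"
    using sandwich by blast
  then obtain z :: "(nat \<Rightarrow> nat) \<Rightarrow> int" where z: "\<And>\<pi> x. \<pi> permutes {..<len} \<Longrightarrow> x \<in> tlen len \<Longrightarrow>
      symz 0 RS (sym_left \<pi> (symz 1 CS x)) = of_int (z \<pi>) * young (x :: 'k stensor)"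
    by (metis mem_Collect_eq)
  have "young (young x) = of_int (\<Sum>\<sigma>\<in>CS. \<Sum>\<tau>\<in>RS. sign \<sigma> * z (\<sigma> \<circ> \<tau>)) * young x"
    if x: "x \<in> tlen len" for x :: "'k stensor"
  proof -
    define y where "y = symz 1 CS x"
    have y: "y \<in> tlen len" unfolding y_def by (rule symz_tlen[OF x])
    have A: "young (young x) = symz 0 RS (symz 1 CS (symz 0 RS y))" by (simp only: young_def y_def)
    have B: "symz 0 RS y = (\<Sum>\<tau>\<in>RS. sym_left \<tau> y)"
      by (simp only: symz_def power_0 of_int_1 mult_1_left)
    have C: "symz 1 CS u = (\<Sum>\<sigma>\<in>CS. of_int (sign \<sigma>) * sym_left \<sigma> u)" for u :: "'k stensor"
      by (simp only: symz_def power_one_right)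
    have "young (young x) = (\<Sum>\<sigma>\<in>CS. of_int (sign \<sigma>) * (\<Sum>\<tau>\<in>RS. symz 0 RS (sym_left \<sigma> (sym_left \<tau> y))))"
      unfolding A C
      unfolding symz_sum symz_of_int
      unfolding B sym_left_sum
      unfolding symz_sum ..
    also have "\<dots> = (\<Sum>\<sigma>\<in>CS. of_int (sign \<sigma>) * (\<Sum>\<tau>\<in>RS. of_int (z (\<sigma> \<circ> \<tau>)) * young x))"
    proof (intro sum.cong refl arg_cong2[of _ _ _ _ "(*)"])
      fix \<sigma> \<tau> assume st: "\<sigma> \<in> CS" "\<tau> \<in> RS"
      then have ps: "\<sigma> permutes {..<len}" "\<tau> permutes {..<len}" by (auto dest: line_stab_permutes)
      show "symz 0 RS (sym_left \<sigma> (sym_left \<tau> y)) = of_int (z (\<sigma> \<circ> \<tau>)) * young x"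
        using z[OF permutes_compose[OF ps(2,1)] x] sym_left_comp[OF ps y] by (simp only: y_def)
    qed
    also have "\<dots> = of_int (\<Sum>\<sigma>\<in>CS. \<Sum>\<tau>\<in>RS. sign \<sigma> * z (\<sigma> \<circ> \<tau>)) * young x"
      by (simp only: of_int_sum of_int_mult sum_distrib_left sum_distrib_right mult.assoc)
    finally show ?thesis .
  qed
  then show ?thesis by blast
qed

section \<open>Coefficients of symmetrized canonical words\<close>

definition tab_word :: "(nat \<Rightarrow> letter) \<Rightarrow> letter list" where
  "tab_word w = map w [0..<len]"

definition filling :: "(nat \<Rightarrow> letter) \<Rightarrow> bool" where
  "filling w \<longleftrightarrow> (\<forall>k<len. w k = E (k div N) \<or> w k = Eps (k mod N))"

definition stab_in :: "(nat \<Rightarrow> nat) set \<Rightarrow> (nat \<Rightarrow> letter) \<Rightarrow> (nat \<Rightarrow> nat) set" where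
  "stab_in K w = {\<sigma> \<in> K. \<forall>k<len. w (\<sigma> k) = w k}"

lemma length_tab_word [simp]: "length (tab_word w) = len"
  by (simp add: tab_word_def)

lemma tab_word_nth: "k < len \<Longrightarrow> tab_word w ! k = w k"
  by (simp add: tab_word_def)

lemma perm_word_stab:
  assumes "\<sigma> \<in> stab_in K w" "\<sigma> permutes {..<len}"
  shows "perm_word \<sigma> (tab_word w) = tab_word w"
proof (rule nth_equalityI)
  fix k assume "k < length (perm_word \<sigma> (tab_word w))"
  then have k: "k < len" by simp
  have k': "pinv \<sigma> k < len" using k permutes_in_image[OF permutes_inv[OF assms(2)], of k] by simp
  then have "w (\<sigma> (pinv \<sigma> k)) = w (pinv \<sigma> k)" using assms(1) by (simp add: stab_in_def)
  then show "perm_word \<sigma> (tab_word w) ! k = tab_word w ! k"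
    using k k' by (simp add: perm_word_nth tab_word_nth permutes_inverses[OF assms(2)])
qed simp

lemma filling_letter:
  assumes "filling w" "k < len"
  shows "odd_letter (w k) \<Longrightarrow> w k = Eps (k mod N)" "\<not> odd_letter (w k) \<Longrightarrow> w k = E (k div N)"
  using assms by (auto simp: filling_def)

text \<open>The even letters of a column are pairwise distinct, so a column permutation preserving
  the filling moves odd letters only. The dual statement for rows is
  \<open>row_stab_fix\<close>.\<close>

lemma col_stab_fix:
  assumes w: "filling w" and \<sigma>: "\<sigma> \<in> stab_in CS w" and k: "k < len" "\<not> odd_letter (w k)"
  shows "\<sigma> k = k"
proof -
  have s: "\<sigma> \<in> CS" "w (\<sigma> k) = w k" using \<sigma> k by (auto simp: stab_in_def)
  have lt: "\<sigma> k < len" using k line_stab_less[OF s(1)] by simp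
  have "\<not> odd_letter (w (\<sigma> k))" unfolding s(2) by (rule k(2))
  then have "w (\<sigma> k) = E (\<sigma> k div N)" "w k = E (k div N)" using filling_letter(2)[OF w] lt k by blast+
  then have "\<sigma> k div N = k div N" unfolding s(2) by simp
  moreover have "\<sigma> k mod N = k mod N" using s(1) k(1) by (simp add: line_stab_def)
  ultimately show ?thesis by (rule rect_inj)
qed

lemma row_stab_fix:
  assumes w: "filling w" and \<tau>: "\<tau> \<in> stab_in RS w" and k: "k < len" "odd_letter (w k)"
  shows "\<tau> k = k"
proof -
  have s: "\<tau> \<in> RS" "w (\<tau> k) = w k" using \<tau> k by (auto simp: stab_in_def)
  have lt: "\<tau> k < len" using k line_stab_less[OF s(1)] by simp
  have "odd_letter (w (\<tau> k))" unfolding s(2) by (rule k(2))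
  then have "w (\<tau> k) = Eps (\<tau> k mod N)" "w k = Eps (k mod N)" using filling_letter(1)[OF w] lt k by blast+
  then have "\<tau> k mod N = k mod N" unfolding s(2) by simp
  moreover have "\<tau> k div N = k div N" using s(1) k(1) by (simp add: line_stab_def)
  ultimately show ?thesis by (rule rect_inj[rotated])
qed

lemma row_stab_sign:
  assumes w: "filling w" and \<tau>: "\<tau> \<in> stab_in RS w"
  shows "inv_pairs \<tau> (tab_word w) = {}"
proof -
  have "\<tau> i = i" if "i < len" "odd_letter (tab_word w ! i)" for i
    using row_stab_fix[OF w \<tau> that(1)] that by (simp add: tab_word_nth)
  then show ?thesis by (auto simp: inv_pairs_def)
qed

lemma gmon_prod:
  assumes "distinct ks"
  shows "\<exists>j::nat. prod_list (map (\<lambda>k. if b k then gmon {k} else 1) ks) = (-1) ^ j * (gmon {k \<in> set ks. b k} :: 'k::comm_ring_1 grassmann)"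
  using assms
proof (induction ks)
  case (Cons k ks)
  then obtain j where j: "prod_list (map (\<lambda>k. if b k then gmon {k} else 1) ks) = (-1) ^ j * (gmon {k \<in> set ks. b k} :: 'k grassmann)" by auto
  show ?case
  proof (cases "b k")
    case True
    have set: "{k} \<union> {x \<in> set ks. b x} = {x \<in> set (k # ks). b x}" using True by auto
    let ?S = "{x \<in> set ks. b x}"
    have "gmon {k} * ((-1) ^ j * (gmon ?S :: 'k grassmann)) = (-1) ^ j * (gmon {k} * gmon ?S)"
      by (cases "even j") auto
    also have "gmon {k} * gmon ?S = (-1) ^ inversions {k} ?S * (gmon {x \<in> set (k # ks). b x} :: 'k grassmann)"
      using Cons.prems gmon_mult[of "{k}" ?S] set by auto
    finally show ?thesis using True j
      by (intro exI[of _ "j + inversions {k} ?S"]) (simp add: power_add mult.assoc)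
  next
    case False
    then have "{x \<in> set (k # ks). b x} = {x \<in> set ks. b x}" by auto
    then show ?thesis using False j by auto
  qed
qed (intro exI[of _ 0], simp)

lemma sign_m1_cancel:
  fixes x :: "'k::field_char_0 grassmann"
  assumes eq: "(-1) ^ c * x = of_int s * x" and nz: "gcoeff x S \<noteq> 0"
  shows "of_int s * (-1) ^ c = (1 :: 'k)"
proof -
  have m: "(-1) ^ c * x = gconst ((-1) ^ c) * x" by (cases "even c") (simp_all add: gconst_uminus)
  have "gcoeff ((-1) ^ c * x) S = gcoeff (of_int s * x) S" by (rule arg_cong[OF eq])
  then have "(-1) ^ c * gcoeff x S = of_int s * gcoeff x S"
    unfolding m gconst_of_int[symmetric] gcoeff_gconst_mult .
  then have "(of_int s :: 'k) = (-1) ^ c" using nz by simp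
  then show ?thesis by (simp add: power_add[symmetric])
qed

text \<open>A generator is attached to every even letter, so that all factors become odd and
  \<open>sym_left_prod\<close> with \<open>p = 1\<close> yields \<open>sign \<sigma>\<close>. As
  \<open>\<sigma>\<close> fixes the even positions, the product is unchanged, and comparison with
  the action on the bare word gives the super sign. \<open>gmon_prod\<close> shows that the common
  coefficient is nonzero and may be cancelled.\<close>

lemma col_stab_sign:
  assumes w: "filling w" and \<sigma>: "\<sigma> \<in> stab_in CS w"
  shows "of_int (sign \<sigma>) * (-1) ^ card (inv_pairs \<sigma> (tab_word w)) = (1 :: 'k::field_char_0)"
proof -
  let ?b = "\<lambda>k. \<not> odd_letter (w k)"
  let ?a = "\<lambda>k. if ?b k then gmon {k} else 1 :: 'k grassmann"
  have s: "\<sigma> \<in> CS" using \<sigma> by (simp add: stab_in_def)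
  have p: "\<sigma> permutes {..<len}" by (rule line_stab_permutes[OF s])
  have go: "godd (gmon {k} :: 'k grassmann)" for k by (rule godd_gmon) simp
  let ?M = "prod_list (map (\<lambda>k. word [w k] * scal (?a k)) [0..<len])"
  define e where "e = card {(i, j). i < j \<and> j < len \<and> ?b i \<and> odd_letter (w j)}"
  have e: "?M = word (tab_word w) * scal ((-1) ^ e * prod_list (map ?a [0..<len]))"
    unfolding tab_word_def e_def by (rule prod_monomials_exact) (use go in auto)
  obtain j where j: "prod_list (map ?a [0..<len]) = (-1) ^ (j :: nat) * gmon {k \<in> set [0..<len]. ?b k}"
    using gmon_prod[of "[0..<len]" ?b] by auto
  let ?r = "(-1) ^ e * prod_list (map ?a [0..<len])"
  have fin: "finite {k \<in> set [0..<len]. ?b k}" by simp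
  have "gcoeff ?r {k \<in> set [0..<len]. ?b k} = (-1) ^ (e + j)"
  proof -
    have "?r = gconst ((-1) ^ (e + j)) * gmon {k \<in> set [0..<len]. ?b k}"
      unfolding j by (cases "even e"; cases "even j") (auto simp: gconst_uminus)
    then show ?thesis using fin by (simp add: gcoeff_gconst_mult gcoeff_gmon)
  qed
  then have r0: "gcoeff ?r {k \<in> set [0..<len]. ?b k} \<noteq> 0" by simp
  have "sym_left \<sigma> ?M = of_int (sign \<sigma> ^ 1) * prod_list (map (\<lambda>k. word [w (pinv \<sigma> k)] * scal (?a (pinv \<sigma> k))) [0..<len])"
    by (rule sym_left_prod[OF p, where v = w and a = ?a]) (use go in \<open>auto simp: godd_def par_letter_def\<close>)
  also have "map (\<lambda>k. word [w (pinv \<sigma> k)] * scal (?a (pinv \<sigma> k))) [0..<len] = map (\<lambda>k. word [w k] * scal (?a k)) [0..<len]"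
  proof (rule map_cong[OF refl])
    fix k assume "k \<in> set [0..<len]"
    then have k: "k < len" by simp
    let ?k = "pinv \<sigma> k"
    have k': "?k < len" using k line_stab_less[OF line_stab_inv[OF s]] by simp
    have sk: "\<sigma> ?k = k" by (rule permutes_inverses[OF p])
    then have wk: "w ?k = w k" using \<sigma> k' by (auto simp: stab_in_def)
    have "?k = k" if "?b k" using col_stab_fix[OF w \<sigma> k'] that wk sk by simp
    then have "?a ?k = ?a k" using wk by (cases "?b k") auto
    then show "word [w ?k] * scal (?a ?k) = word [w k] * scal (?a k)" using wk by (simp only:)
  qed
  finally have "sym_left \<sigma> (word (tab_word w) * scal ?r) = of_int (sign \<sigma>) * (word (tab_word w) * scal ?r)"
    unfolding e by (simp only: power_one_right)
  then have "(-1) ^ card (inv_pairs \<sigma> (tab_word w)) * word (tab_word w) * scal ?r = of_int (sign \<sigma>) * (word (tab_word w) * scal ?r)"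
    unfolding sym_left_mult_scal sym_left_word perm_word_stab[OF \<sigma> p] .
  then have "tcoeff ((-1) ^ card (inv_pairs \<sigma> (tab_word w)) * (word (tab_word w) * scal ?r)) (tab_word w) =
      tcoeff (of_int (sign \<sigma>) * (word (tab_word w) * scal ?r)) (tab_word w)" by (simp only: mult.assoc)
  then have "(-1) ^ card (inv_pairs \<sigma> (tab_word w)) * ?r = of_int (sign \<sigma>) * ?r"
    by (simp only: tcoeff_m1_mult tcoeff_of_int_mult tcoeff_mult_scal tcoeff_word simp_thms if_True mult_1_left)
  then show ?thesis using r0 by (rule sign_m1_cancel)
qed

text \<open>Let \<open>u\<close> be the word between the two permutations. An even letter of
  \<open>u\<close> names its row twice, by its origin in \<open>w'\<close> and by its destination in
  \<open>w\<close>; since the column step keeps the column, that letter was not moved by it. Odd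
  letters, which name columns, are likewise not moved by the row step.\<close>

lemma perm_word_canonical:
  assumes w: "filling w" "filling w'" and \<sigma>: "\<sigma> \<in> CS" and \<tau>: "\<tau> \<in> RS"
    and card: "card {k. k < len \<and> \<not> odd_letter (w k)} = card {k. k < len \<and> \<not> odd_letter (w' k)}"
    and eq: "perm_word \<tau> (perm_word \<sigma> (tab_word w')) = tab_word w"
  shows "(\<forall>k<len. w' k = w k) \<and> \<sigma> \<in> stab_in CS w \<and> \<tau> \<in> stab_in RS w"
proof -
  have ps: "\<sigma> permutes {..<len}" and pt: "\<tau> permutes {..<len}" using \<sigma> \<tau> by (auto dest: line_stab_permutes)
  define u where "u k = w (\<tau> k)" for k
  have lt: "pinv \<sigma> k < len" "\<tau> k < len" if "k < len" for k
    using that line_stab_less[OF line_stab_inv[OF \<sigma>]] line_stab_less[OF \<tau>] by auto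
  have u': "u k = w' (pinv \<sigma> k)" if k: "k < len" for k
  proof -
    have "perm_word \<tau> (perm_word \<sigma> (tab_word w')) ! \<tau> k = perm_word \<sigma> (tab_word w') ! k"
      using perm_word_nth_image[of \<tau> "perm_word \<sigma> (tab_word w')" k] pt k by simp
    then show ?thesis using k lt[OF k] by (simp add: eq u_def tab_word_nth perm_word_nth)
  qed
  have ev: "w' k = u k \<and> pinv \<sigma> k = k" if k: "k < len" and e: "\<not> odd_letter (u k)" for k
  proof -
    have "\<not> odd_letter (w' (pinv \<sigma> k))" "\<not> odd_letter (w (\<tau> k))" using e u'[OF k] by (auto simp: u_def)
    then have "u k = E (pinv \<sigma> k div N)" "u k = E (\<tau> k div N)"
      using filling_letter(2)[OF w(2) lt(1)[OF k]] filling_letter(2)[OF w(1) lt(2)[OF k]] u'[OF k] by (auto simp: u_def)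
    moreover have "\<tau> k div N = k div N" using \<tau> k by (simp add: line_stab_def)
    moreover have "pinv \<sigma> k mod N = k mod N" using line_stab_inv[OF \<sigma>] k by (simp add: line_stab_def)
    ultimately have "pinv \<sigma> k div N = k div N" "pinv \<sigma> k mod N = k mod N" by simp_all
    then have "pinv \<sigma> k = k" by (rule rect_inj)
    then show ?thesis using u'[OF k] by simp
  qed
  have od: "w k = u k" if k: "k < len" and e: "odd_letter (u k)" for k
  proof -
    have "odd_letter (w' (pinv \<sigma> k))" "odd_letter (w (\<tau> k))" using e u'[OF k] by (auto simp: u_def)
    then have "u k = Eps (pinv \<sigma> k mod N)" "u k = Eps (\<tau> k mod N)"
      using filling_letter(1)[OF w(2) lt(1)[OF k]] filling_letter(1)[OF w(1) lt(2)[OF k]] u'[OF k] by (auto simp: u_def)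
    moreover have "\<tau> k div N = k div N" using \<tau> k by (simp add: line_stab_def)
    moreover have "pinv \<sigma> k mod N = k mod N" using line_stab_inv[OF \<sigma>] k by (simp add: line_stab_def)
    ultimately have "\<tau> k div N = k div N" "\<tau> k mod N = k mod N" by simp_all
    then have "\<tau> k = k" by (rule rect_inj)
    then show ?thesis by (simp add: u_def)
  qed
  \<comment> \<open>The even positions of \<open>w\<close> lie among those of \<open>u\<close>, and
    these among those of \<open>w'\<close>. As \<open>w\<close> and \<open>w'\<close> have equally
    many even letters, both inclusions are equalities.\<close>
  let ?ev = "\<lambda>w. {k. k < len \<and> \<not> odd_letter (w k)}"
  have c1: "?ev u \<subseteq> ?ev w'" using ev by auto
  have c2: "?ev w \<subseteq> ?ev u"
  proof
    fix k assume k: "k \<in> ?ev w"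
    then have "\<not> odd_letter (u k)" using od[of k] by auto
    then show "k \<in> ?ev u" using k by simp
  qed
  have "card (?ev w) \<le> card (?ev u)" "card (?ev u) \<le> card (?ev w')"
    using card_mono[OF _ c2] card_mono[OF _ c1] by simp_all
  then have cc: "card (?ev u) = card (?ev w')" "card (?ev w) = card (?ev u)" using card by linarith+
  have fin: "finite (?ev w')" "finite (?ev u)" by simp_all
  have eqs: "?ev u = ?ev w'" "?ev w = ?ev u"
    by (rule card_subset_eq[OF fin(1) c1 cc(1)], rule card_subset_eq[OF fin(2) c2 cc(2)])
  have same: "odd_letter (u k) \<longleftrightarrow> odd_letter (w' k)" "odd_letter (w k) \<longleftrightarrow> odd_letter (u k)" if "k < len" for k
    using eqs that by blast+
  have w'u: "w' k = u k" if k: "k < len" for k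
  proof (cases "odd_letter (u k)")
    case True
    then have "u k = w k" "w k = Eps (k mod N)" "w' k = Eps (k mod N)"
      using od[OF k] same[OF k] filling_letter(1)[OF w(1) k] filling_letter(1)[OF w(2) k] by auto
    then show ?thesis by simp
  qed (use ev k in auto)
  have wu: "w k = u k" if k: "k < len" for k
  proof (cases "odd_letter (u k)")
    case False
    then have "w' k = E (k div N)" "w k = E (k div N)"
      using same[OF k] filling_letter(2)[OF w(1) k] filling_letter(2)[OF w(2) k] by auto
    then show ?thesis using w'u[OF k] by simp
  qed (use od k in auto)
  have "w (\<sigma> k) = w k" if k: "k < len" for k
  proof -
    have sk: "\<sigma> k < len" using k line_stab_less[OF \<sigma>] by simp
    have "w (\<sigma> k) = u (\<sigma> k)" by (rule wu[OF sk])
    also have "\<dots> = w' k" using u'[OF sk] by (simp add: permutes_inverses[OF ps])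
    also have "\<dots> = w k" using w'u[OF k] wu[OF k] by simp
    finally show ?thesis .
  qed
  moreover have "w (\<tau> k) = w k" if "k < len" for k using wu[OF that] by (simp add: u_def)
  ultimately show ?thesis using \<sigma> \<tau> w'u wu by (simp add: stab_in_def)
qed

text \<open>By \<open>perm_word_canonical\<close> only pairs of stabilizing permutations reach the
  word \<open>tab_word w\<close>, and only if the fillings agree; each pair contributes 1 because
  column signs cancel and row permutations move no odd letter.\<close>

lemma kc_young:
  assumes w: "filling w" "filling w'"
    and card: "card {k. k < len \<and> \<not> odd_letter (w k)} = card {k. k < len \<and> \<not> odd_letter (w' k)}"
  shows "kc (young (word (tab_word w'))) (tab_word w) =
    (if \<forall>k<len. w' k = w k then of_nat (card (stab_in RS w) * card (stab_in CS w)) else 0 :: 'k::field_char_0)"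
proof -
  let ?W = "tab_word w" and ?W' = "tab_word w'"
  let ?s = "\<lambda>\<tau> \<sigma>. of_int (sign \<sigma>) * ((-1) ^ card (inv_pairs \<sigma> ?W') * (-1) ^ card (inv_pairs \<tau> (perm_word \<sigma> ?W'))) :: 'k"
  have "kc (young (word ?W')) ?W = (\<Sum>\<tau>\<in>RS. \<Sum>\<sigma>\<in>CS. ?s \<tau> \<sigma> * of_bool (?W = perm_word \<tau> (perm_word \<sigma> ?W')))"
    unfolding young_def symz_def sym_left_sum sym_left_of_int sym_left_word sym_left_m1 sum_distrib_left kc_sum kc_of_int kc_m1 kc_word
    by (simp only: power_0 of_int_1 mult_1_left power_one_right mult.assoc)
  also have "\<dots> = (\<Sum>\<tau>\<in>RS. \<Sum>\<sigma>\<in>CS. of_bool ((\<forall>k<len. w' k = w k) \<and> \<sigma> \<in> stab_in CS w \<and> \<tau> \<in> stab_in RS w))"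
  proof (intro sum.cong refl)
    fix \<tau> \<sigma> assume st: "\<tau> \<in> RS" "\<sigma> \<in> CS"
    then have pt: "\<tau> permutes {..<len}" and ps: "\<sigma> permutes {..<len}" by (auto dest: line_stab_permutes)
    show "?s \<tau> \<sigma> * of_bool (?W = perm_word \<tau> (perm_word \<sigma> ?W')) =
      of_bool ((\<forall>k<len. w' k = w k) \<and> \<sigma> \<in> stab_in CS w \<and> \<tau> \<in> stab_in RS w)"
    proof (cases "(\<forall>k<len. w' k = w k) \<and> \<sigma> \<in> stab_in CS w \<and> \<tau> \<in> stab_in RS w")
      case True
      then have W: "?W' = ?W" by (simp add: tab_word_def)
      have pw: "perm_word \<sigma> ?W = ?W" "perm_word \<tau> ?W = ?W"
        using perm_word_stab[OF _ ps] perm_word_stab[OF _ pt] True by auto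
      have i: "inv_pairs \<tau> ?W = {}" using row_stab_sign[OF w(1)] True by blast
      have "of_int (sign \<sigma>) * (-1) ^ card (inv_pairs \<sigma> ?W) = (1 :: 'k)" using col_stab_sign[OF w(1)] True by blast
      then show ?thesis using True unfolding W pw i by simp
    next
      case False
      then have "?W \<noteq> perm_word \<tau> (perm_word \<sigma> ?W')"
        using perm_word_canonical[OF w st(2,1) card] by metis
      then show ?thesis using False by simp
    qed
  qed
  also have "\<dots> = (if \<forall>k<len. w' k = w k then of_nat (card (stab_in RS w) * card (stab_in CS w)) else 0)"
  proof (cases "\<forall>k<len. w' k = w k")
    case True
    have sub: "RS \<inter> stab_in RS w = stab_in RS w" "CS \<inter> stab_in CS w = stab_in CS w"
      by (auto simp: stab_in_def)
    have "(\<Sum>\<tau>\<in>RS. \<Sum>\<sigma>\<in>CS. of_bool (\<sigma> \<in> stab_in CS w \<and> \<tau> \<in> stab_in RS w) :: 'k) =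
        (\<Sum>\<tau>\<in>RS. of_bool (\<tau> \<in> stab_in RS w)) * (\<Sum>\<sigma>\<in>CS. of_bool (\<sigma> \<in> stab_in CS w))"
      unfolding sum_product by (intro sum.cong refl) auto
    also have "\<dots> = of_nat (card (stab_in RS w)) * of_nat (card (stab_in CS w))"
      by (simp add: sum_of_bool_eq sub)
    finally show ?thesis using True by simp
  next
    case False
    then show ?thesis by (simp only: if_False simp_thms of_bool_eq sum.neutral_const)
  qed
  finally show ?thesis .
qed

text \<open>Positivity: if \<open>z\<close> were 0, self-adjointness of the symmetrizers would make
  the tensor \<open>young ?W\<close> orthogonal to itself, although its coefficients are integers
  and not all zero.\<close>

lemma young_factor_nonzero:
  assumes z: "\<forall>x\<in>tlen len. young (young x) = of_int z * young (x :: 'k::field_char_0 stensor)"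
  shows "z \<noteq> 0"
proof
  assume z0: "z = 0"
  let ?w = "\<lambda>k. E (k div N)" and ?R = "of_int (int (card RS)) :: 'k"
  let ?W = "word (tab_word ?w) :: 'k stensor"
  have fw: "filling ?w" by (simp add: filling_def)
  have W: "?W \<in> tlen len" by simp
  let ?c = "symz 1 CS ?W"
  have c: "?c \<in> tlen len" "young ?W \<in> tlen len" by (intro symz_tlen W) (rule young_tlen[OF W])
  \<comment> \<open>The test word is constant along rows and has even letters only. Being row
    symmetric up to a factor, it lets one more row symmetrizer be inserted, and
    \<open>young (young ?W)\<close> appears.\<close>
  have RW: "symz 0 RS ?W = of_int (int (card RS)) * ?W"
  proof -
    have "sym_left \<tau> ?W = ?W" if "\<tau> \<in> RS" for \<tau>
    proof -
      have "\<tau> \<in> stab_in RS ?w" using that by (auto simp: stab_in_def line_stab_def)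
      then show ?thesis
        using perm_word_stab[of \<tau> RS ?w] line_stab_permutes[OF that] row_stab_sign[OF fw, of \<tau>] by (simp add: sym_left_word)
    qed
    then show ?thesis by (simp add: symz_def)
  qed
  have "bform (young ?W) (young ?W) = bform ?c (symz 0 RS (symz 0 RS ?c))"
    unfolding young_def by (rule bform_symz[OF c(1)]) (rule symz_tlen[OF c(1)])
  also have "\<dots> = ?R * bform ?c (young ?W)"
    by (simp only: symz_square[OF c(1)] bform_of_int_right young_def)
  also have "bform ?c (young ?W) = bform ?W (symz 1 CS (young ?W))"
    by (rule bform_symz[OF W c(2)])
  also have "?R * bform ?W (symz 1 CS (young ?W)) = bform (symz 0 RS ?W) (symz 1 CS (young ?W))"
    by (simp only: RW bform_of_int_left)
  also have "\<dots> = bform ?W (symz 0 RS (symz 1 CS (young ?W)))"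
    by (rule bform_symz[OF W symz_tlen[OF c(2)]])
  also have "symz 0 RS (symz 1 CS (young ?W)) = 0"
    using z[rule_format, OF W] z0 by (simp add: young_def)
  finally have B0: "bform (young ?W) (young ?W) = 0" by simp
  \<comment> \<open>The field need not be ordered; the sum of squares is therefore taken in the
    integers.\<close>
  have ints: "\<exists>i::int. kc (young ?W) v = of_int i" for v
  proof -
    have "kc (young ?W) v \<in> \<int>"
      unfolding young_def symz_def sym_left_sum sym_left_of_int sym_left_word sym_left_m1 kc_sum kc_of_int kc_m1 kc_word
      by (intro Ints_sum Ints_mult Ints_of_int Ints_power Ints_minus Ints_1) (simp add: of_bool_def)
    then show ?thesis by (auto elim: Ints_cases)
  qed
  then obtain i :: "letter list \<Rightarrow> int" where i: "\<And>v. kc (young ?W) v = of_int (i v)" by metis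
  have "of_int (\<Sum>v | tcoeff (young ?W) v \<noteq> 0. i v * i v) = (0 :: 'k)"
    using B0 by (simp add: bform_def i)
  then have "(\<Sum>v | tcoeff (young ?W) v \<noteq> 0. i v * i v) = 0" by (simp only: of_int_eq_0_iff)
  then have "\<forall>v\<in>{v. tcoeff (young ?W) v \<noteq> 0}. i v * i v = 0"
    by (subst (asm) sum_nonneg_eq_0_iff) auto
  moreover have ne: "kc (young ?W) (tab_word ?w) \<noteq> 0"
  proof -
    have "id \<in> stab_in RS ?w" "id \<in> stab_in CS ?w" by (auto simp: stab_in_def)
    moreover have "finite (stab_in RS ?w)" "finite (stab_in CS ?w)"
      by (rule finite_subset[OF _ line_stab_finite]; auto simp: stab_in_def)+
    ultimately have "card (stab_in RS ?w) \<noteq> 0" "card (stab_in CS ?w) \<noteq> 0" by auto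
    then show ?thesis using kc_young[OF fw fw refl, where 'k = 'k] by simp
  qed
  moreover from ne have "tcoeff (young ?W) (tab_word ?w) \<noteq> 0" by (auto simp: kc_def)
  ultimately have "i (tab_word ?w) = 0" by simp
  then show False using ne i by simp
qed

end

subsection \<open>Stabilizers\<close>

text \<open>The order of a Young subgroup, by splitting off one fibre at a time.\<close>

lemma card_fiber_stab:
  assumes "finite S" "finite A" "\<phi> ` A \<subseteq> S"
  shows "card {\<sigma>. \<sigma> permutes A \<and> (\<forall>k\<in>A. \<phi> (\<sigma> k) = \<phi> k)} = (\<Prod>v\<in>S. fact (card {k \<in> A. \<phi> k = v}))"
  using assms
proof (induction S arbitrary: A rule: finite_induct)
  case empty
  then have "A = {}" by auto
  then show ?case by simp
next
  case (insert v S)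
  let ?st = "\<lambda>A. {\<sigma>. \<sigma> permutes A \<and> (\<forall>k\<in>A. \<phi> (\<sigma> k) = \<phi> k)}"
  let ?A1 = "{k \<in> A. \<phi> k = v}" and ?A2 = "{k \<in> A. \<phi> k \<noteq> v}"
  have fin: "finite ?A1" "finite ?A2" using insert by auto
  have res: "(\<lambda>k. if k \<in> B then \<sigma> k else k) permutes B"
    if \<sigma>: "\<sigma> \<in> ?st A" and B: "B \<subseteq> A" "\<And>k. k \<in> B \<Longrightarrow> \<sigma> k \<in> B" for \<sigma> B
  proof (rule bij_imp_permutes)
    have "inj_on \<sigma> B" using \<sigma> permutes_inj_on by blast
    moreover from this have "\<sigma> ` B = B" using B insert.prems(1) by (intro endo_inj_surj) (auto intro: finite_subset)
    ultimately have "bij_betw \<sigma> B B" by (simp add: bij_betw_def)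
    then show "bij_betw (\<lambda>k. if k \<in> B then \<sigma> k else k) B B" by (subst bij_betw_cong[of _ _ \<sigma>]) auto
  qed auto
  have "bij_betw (\<lambda>(\<sigma>1, \<sigma>2). \<sigma>1 \<circ> \<sigma>2) ({\<sigma>. \<sigma> permutes ?A1} \<times> ?st ?A2) (?st A)"
  proof (rule bij_betw_byWitness[where f' = "\<lambda>\<sigma>. (\<lambda>k. if k \<in> ?A1 then \<sigma> k else k, \<lambda>k. if k \<in> ?A2 then \<sigma> k else k)"])
    show "\<forall>p\<in>{\<sigma>. \<sigma> permutes ?A1} \<times> ?st ?A2. (\<lambda>\<sigma>. (\<lambda>k. if k \<in> ?A1 then \<sigma> k else k, \<lambda>k. if k \<in> ?A2 then \<sigma> k else k)) ((\<lambda>(\<sigma>1, \<sigma>2). \<sigma>1 \<circ> \<sigma>2) p) = p"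
    proof
      fix p assume "p \<in> {\<sigma>. \<sigma> permutes ?A1} \<times> ?st ?A2"
      then obtain s1 s2 where p: "p = (s1, s2)" "s1 permutes ?A1" "s2 permutes ?A2" by auto
      have a: "(\<lambda>k. if k \<in> ?A1 then (s1 \<circ> s2) k else k) = s1"
        by (rule ext) (use permutes_not_in[OF p(2)] permutes_not_in[OF p(3)] in auto)
      have b: "(\<lambda>k. if k \<in> ?A2 then (s1 \<circ> s2) k else k) = s2"
      proof (rule ext)
        fix k
        show "(if k \<in> ?A2 then (s1 \<circ> s2) k else k) = s2 k"
          using permutes_not_in[OF p(2), of "s2 k"] permutes_not_in[OF p(3), of k] permutes_in_image[OF p(3), of k] by auto
      qed
      show "(\<lambda>\<sigma>. (\<lambda>k. if k \<in> ?A1 then \<sigma> k else k, \<lambda>k. if k \<in> ?A2 then \<sigma> k else k)) ((\<lambda>(\<sigma>1, \<sigma>2). \<sigma>1 \<circ> \<sigma>2) p) = p"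
        unfolding p(1) case_prod_conv a b ..
    qed
    show "\<forall>\<sigma>\<in>?st A. (\<lambda>(\<sigma>1, \<sigma>2). \<sigma>1 \<circ> \<sigma>2) ((\<lambda>\<sigma>. (\<lambda>k. if k \<in> ?A1 then \<sigma> k else k, \<lambda>k. if k \<in> ?A2 then \<sigma> k else k)) \<sigma>) = \<sigma>"
    proof
      fix \<sigma> assume \<sigma>: "\<sigma> \<in> ?st A"
      then have "\<sigma> permutes A" by simp
      have "\<sigma> k \<in> ?A2 \<longleftrightarrow> k \<in> ?A2" "k \<notin> A \<Longrightarrow> \<sigma> k = k" for k
        using \<sigma> permutes_in_image[OF \<open>\<sigma> permutes A\<close>, of k] permutes_not_in[OF \<open>\<sigma> permutes A\<close>, of k] by auto
      then show "(\<lambda>(\<sigma>1, \<sigma>2). \<sigma>1 \<circ> \<sigma>2) ((\<lambda>\<sigma>. (\<lambda>k. if k \<in> ?A1 then \<sigma> k else k, \<lambda>k. if k \<in> ?A2 then \<sigma> k else k)) \<sigma>) = \<sigma>"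
        by (auto simp: fun_eq_iff)
    qed
    show "(\<lambda>(\<sigma>1, \<sigma>2). \<sigma>1 \<circ> \<sigma>2) ` ({\<sigma>. \<sigma> permutes ?A1} \<times> ?st ?A2) \<subseteq> ?st A"
    proof
      fix \<sigma> assume "\<sigma> \<in> (\<lambda>(\<sigma>1, \<sigma>2). \<sigma>1 \<circ> \<sigma>2) ` ({\<sigma>. \<sigma> permutes ?A1} \<times> ?st ?A2)"
      then obtain s1 s2 where s: "\<sigma> = s1 \<circ> s2" "s1 permutes ?A1" "s2 permutes ?A2" "\<forall>k\<in>?A2. \<phi> (s2 k) = \<phi> k" by auto
      have "s1 \<circ> s2 permutes A"
        by (intro permutes_compose) (use s in \<open>auto elim: permutes_subset\<close>)
      moreover have "\<phi> (s1 (s2 k)) = \<phi> k" if "k \<in> A" for k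
      proof (cases "\<phi> k = v")
        case True
        then show ?thesis using permutes_not_in[OF s(3), of k] permutes_in_image[OF s(2), of k] that by auto
      next
        case False
        then have "s2 k \<in> ?A2" using permutes_in_image[OF s(3), of k] that by auto
        then show ?thesis using permutes_not_in[OF s(2), of "s2 k"] s(4) that False by auto
      qed
      ultimately show "\<sigma> \<in> ?st A" using s(1) by simp
    qed
    show "(\<lambda>\<sigma>. (\<lambda>k. if k \<in> ?A1 then \<sigma> k else k, \<lambda>k. if k \<in> ?A2 then \<sigma> k else k)) ` ?st A \<subseteq> {\<sigma>. \<sigma> permutes ?A1} \<times> ?st ?A2"
    proof
      fix p assume "p \<in> (\<lambda>\<sigma>. (\<lambda>k. if k \<in> ?A1 then \<sigma> k else k, \<lambda>k. if k \<in> ?A2 then \<sigma> k else k)) ` ?st A"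
      then obtain \<sigma> where \<sigma>: "\<sigma> \<in> ?st A" and p: "p = (\<lambda>k. if k \<in> ?A1 then \<sigma> k else k, \<lambda>k. if k \<in> ?A2 then \<sigma> k else k)" by auto
      have "\<sigma> k \<in> A" if "k \<in> A" for k using \<sigma> permutes_in_image[of \<sigma> A k] that by simp
      note inA = this
      have "(\<lambda>k. if k \<in> ?A1 then \<sigma> k else k) permutes ?A1"
        by (rule res[OF \<sigma>]) (use \<sigma> inA in auto)
      moreover have "(\<lambda>k. if k \<in> ?A2 then \<sigma> k else k) permutes ?A2"
        by (rule res[OF \<sigma>]) (use \<sigma> inA in auto)
      ultimately show "p \<in> {\<sigma>. \<sigma> permutes ?A1} \<times> ?st ?A2" using \<sigma> by (simp add: p)
    qed
  qed
  then have "card (?st A) = card ({\<sigma>. \<sigma> permutes ?A1} \<times> ?st ?A2)" by (rule bij_betw_same_card[symmetric])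
  also have "\<dots> = fact (card ?A1) * card (?st ?A2)"
    using card_permutations[OF refl fin(1)] by (simp add: card_cartesian_product)
  also have "card (?st ?A2) = (\<Prod>u\<in>S. fact (card {k \<in> ?A2. \<phi> k = u}))"
    by (rule insert.IH) (use insert.prems fin in auto)
  also have "\<dots> = (\<Prod>u\<in>S. fact (card {k \<in> A. \<phi> k = u}))"
    by (intro prod.cong refl arg_cong[where f = fact] arg_cong[where f = card]) (use insert.hyps in auto)
  finally show ?case using insert.hyps by simp
qed

context rect
begin

lemma card_col_stab_in:
  assumes w: "filling w"
  shows "card (stab_in CS w) = (\<Prod>j<N. fact (card {k. k < len \<and> k mod N = j \<and> odd_letter (w k)}))"
proof -
  \<comment> \<open>A colouring whose fibres are the orbits: odd positions are coloured by their
    column, and every even position has the colour \<open>N + k\<close> to itself, which expresses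
    that it stays fixed.\<close>
  define \<phi> where "\<phi> k = (if odd_letter (w k) then k mod N else N + k)" for k
  have m: "k mod N < N" if "k < len" for k using that by (cases N) auto
  have "stab_in CS w = {\<sigma>. \<sigma> permutes {..<len} \<and> (\<forall>k\<in>{..<len}. \<phi> (\<sigma> k) = \<phi> k)}"
  proof (intro Set.set_eqI iffI)
    fix \<sigma> assume \<sigma>: "\<sigma> \<in> stab_in CS w"
    then have s: "\<sigma> \<in> CS" "\<forall>k<len. w (\<sigma> k) = w k" by (auto simp: stab_in_def)
    then have "\<phi> (\<sigma> k) = \<phi> k" if "k < len" for k
      using that col_stab_fix[OF w \<sigma> that] by (auto simp: \<phi>_def line_stab_def)
    then show "\<sigma> \<in> {\<sigma>. \<sigma> permutes {..<len} \<and> (\<forall>k\<in>{..<len}. \<phi> (\<sigma> k) = \<phi> k)}"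
      using line_stab_permutes[OF s(1)] by auto
  next
    fix \<sigma> assume "\<sigma> \<in> {\<sigma>. \<sigma> permutes {..<len} \<and> (\<forall>k\<in>{..<len}. \<phi> (\<sigma> k) = \<phi> k)}"
    then have p: "\<sigma> permutes {..<len}" and ph: "\<And>k. k < len \<Longrightarrow> \<phi> (\<sigma> k) = \<phi> k" by auto
    have "\<sigma> k mod N = k mod N \<and> w (\<sigma> k) = w k" if k: "k < len" for k
    proof (cases "odd_letter (w k)")
      case True
      have sk: "\<sigma> k < len" using permutes_in_image[OF p, of k] k by simp
      have o: "odd_letter (w (\<sigma> k))" using ph[OF k] True m[OF k] by (auto simp: \<phi>_def split: if_splits)
      then have "\<sigma> k mod N = k mod N" using ph[OF k] True by (simp add: \<phi>_def)
      then show ?thesis using filling_letter(1)[OF w sk o] filling_letter(1)[OF w k True] by simp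
    next
      case False
      have "\<sigma> k < len" using permutes_in_image[OF p, of k] k by simp
      then have "\<sigma> k = k" using ph[OF k] False m[of "\<sigma> k"] by (auto simp: \<phi>_def split: if_splits)
      then show ?thesis by simp
    qed
    then show "\<sigma> \<in> stab_in CS w" using p by (auto simp: stab_in_def line_stab_def)
  qed
  then have "card (stab_in CS w) = (\<Prod>v<N + len. fact (card {k \<in> {..<len}. \<phi> k = v}))"
    using card_fiber_stab[of "{..<N + len}" "{..<len}" \<phi>] m by (fastforce simp: \<phi>_def)
  also have "\<dots> = (\<Prod>v<N. fact (card {k \<in> {..<len}. \<phi> k = v}))"
  proof (rule prod.mono_neutral_right)
    show "\<forall>v\<in>{..<N + len} - {..<N}. fact (card {k \<in> {..<len}. \<phi> k = v}) = (1 :: nat)"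
    proof
      fix v assume "v \<in> {..<N + len} - {..<N}"
      then have "{k \<in> {..<len}. \<phi> k = v} \<subseteq> {v - N}" using m by (auto simp: \<phi>_def split: if_splits) (metis not_less)?
      then have "card {k \<in> {..<len}. \<phi> k = v} \<le> 1" using card_mono[of "{v - N}"] by force
      then have "card {k \<in> {..<len}. \<phi> k = v} = 0 \<or> card {k \<in> {..<len}. \<phi> k = v} = 1" by linarith
      then show "fact (card {k \<in> {..<len}. \<phi> k = v}) = (1 :: nat)" by (elim disjE) (simp_all only: fact_0 fact_1)
    qed
  qed auto
  also have "\<dots> = (\<Prod>j<N. fact (card {k. k < len \<and> k mod N = j \<and> odd_letter (w k)}))"
    by (intro prod.cong refl arg_cong[where f = fact] arg_cong[where f = card]) (auto simp: \<phi>_def)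
  finally show ?thesis .
qed

end

section \<open>Canonical tensors\<close>

declare mult_Suc [simp del] mult_Suc_right [simp del]

definition tsupp :: "(letter list \<Rightarrow> bool) \<Rightarrow> 'k::zero stensor set" where
  "tsupp P = {x. \<forall>v. tcoeff x v \<noteq> 0 \<longrightarrow> P v}"

lemma tsupp_word: "P v \<Longrightarrow> (word v :: 'k::comm_ring_1 stensor) \<in> tsupp P"
  by (auto simp: tsupp_def tcoeff_word)

lemma tsupp_zero: "(0 :: 'k::comm_ring_1 stensor) \<in> tsupp P"
  by (simp add: tsupp_def)

lemma tsupp_add: "x \<in> tsupp P \<Longrightarrow> y \<in> tsupp P \<Longrightarrow> (x + y :: 'k::comm_ring_1 stensor) \<in> tsupp P"
  unfolding tsupp_def mem_Collect_eq by (metis add.right_neutral tcoeff_add)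

lemma tsupp_sum: "(\<And>i. i \<in> I \<Longrightarrow> (f i :: 'k::comm_ring_1 stensor) \<in> tsupp P) \<Longrightarrow> sum f I \<in> tsupp P"
  by (induction I rule: infinite_finite_induct) (auto intro: tsupp_add tsupp_zero)

lemma tsupp_mult_scal: "x \<in> tsupp P \<Longrightarrow> (x * scal a :: 'k::comm_ring_1 stensor) \<in> tsupp P"
  by (auto simp: tsupp_def) (metis mult_zero_left)

lemma tsupp_sym_left:
  assumes P: "\<And>v w. mset v = mset w \<Longrightarrow> P v \<Longrightarrow> P w"
    and "\<sigma> permutes {..<l}" "x \<in> tlen l" "x \<in> tsupp P"
  shows "sym_left \<sigma> x \<in> tsupp P"
proof (induction x rule: stensor_induct)
  case (word w a)
  then have w: "length w = l" "P w" using assms by (auto simp: tlen_def tsupp_def)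
  have "P (perm_word \<sigma> w)" by (rule P[OF _ w(2)]) (use mset_perm_word assms(2) w(1) in metis)
  then have "word (perm_word \<sigma> w) * scal ((-1) ^ card (inv_pairs \<sigma> w) * a) \<in> tsupp P"
    by (intro tsupp_mult_scal tsupp_word)
  moreover have "sym_left \<sigma> (word w * scal a) = word (perm_word \<sigma> w) * scal ((-1) ^ card (inv_pairs \<sigma> w) * a)"
    unfolding sym_left_mult_scal sym_left_word scal_mult scal_m1
    by (simp only: m1_commute mult.assoc)
  ultimately show ?case by simp
qed (auto simp: sym_left_add tsupp_add, simp add: tsupp_def)

lemma tsupp_symz:
  assumes P: "\<And>v w. mset v = mset w \<Longrightarrow> P v \<Longrightarrow> P w" and x: "x \<in> tlen l" "x \<in> tsupp P"
  shows "symz e (line_stab f l) x \<in> tsupp P"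
  unfolding symz_def
proof (rule tsupp_sum)
  fix \<tau> assume "\<tau> \<in> line_stab f l"
  then have "sym_left \<tau> x \<in> tsupp P" by (intro tsupp_sym_left[OF P _ x]) (auto dest: line_stab_permutes)
  then have "sym_left \<tau> x * scal (of_int (sign \<tau> ^ e)) \<in> tsupp P" by (rule tsupp_mult_scal)
  also have "sym_left \<tau> x * scal (of_int (sign \<tau> ^ e)) = of_int (sign \<tau> ^ e) * sym_left \<tau> x"
    unfolding scal_of_int by (rule mult_of_int_commute[symmetric])
  finally show "of_int (sign \<tau> ^ e) * sym_left \<tau> x \<in> tsupp P" .
qed

lemma symz_2: "symz (Suc (Suc 0)) K = symz 0 K"
proof
  fix x
  have "sign \<tau> ^ Suc (Suc 0) = sign \<tau> ^ 0" for \<tau> :: "nat \<Rightarrow> nat" by simp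
  then show "symz (Suc (Suc 0)) K x = symz 0 K x" by (simp only: symz_def)
qed

lemma gconst_m1: "(-1) ^ k = gconst ((-1) ^ k)"
  by (simp add: gconst_power gconst_uminus)

text \<open>\<open>kappa\<close> runs over the first \<open>n\<close> columns and the stabilizer
  over all \<open>N\<close>; the additional column of \<open>lambda_h\<close> has no odd letters and
  contributes the factor 1.\<close>

lemma kappa_rect:
  assumes w: "rect.filling r N w" and wF: "\<And>k. k < r * N \<Longrightarrow> w k = F (k div N, k mod N)"
    and n: "n \<le> N" and ev: "\<And>k. k < r * N \<Longrightarrow> k mod N \<ge> n \<Longrightarrow> \<not> odd_letter (w k)"
  shows "kappa n (replicate r N) F = card (rect.stab_in r N (line_stab (\<lambda>k. k mod N) (r * N)) w)"
proof -
  have c: "card {i. (i, j) \<in> set (boxes (replicate r N)) \<and> F (i, j) = Eps j} =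
      card {k. k < r * N \<and> k mod N = j \<and> odd_letter (w k)}" if j: "j < N" for j
  proof (rule bij_betw_same_card)
    show "bij_betw (\<lambda>i. i * N + j) {i. (i, j) \<in> set (boxes (replicate r N)) \<and> F (i, j) = Eps j}
        {k. k < r * N \<and> k mod N = j \<and> odd_letter (w k)}"
    proof (rule bij_betw_byWitness[where f' = "\<lambda>k. k div N"])
      show "(\<lambda>i. i * N + j) ` {i. (i, j) \<in> set (boxes (replicate r N)) \<and> F (i, j) = Eps j}
          \<subseteq> {k. k < r * N \<and> k mod N = j \<and> odd_letter (w k)}"
        using j rect_index[of _ r j N] wF by (auto simp: set_boxes_rect)
      show "(\<lambda>k. k div N) ` {k. k < r * N \<and> k mod N = j \<and> odd_letter (w k)}
          \<subseteq> {i. (i, j) \<in> set (boxes (replicate r N)) \<and> F (i, j) = Eps j}"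
      proof
        fix i assume "i \<in> (\<lambda>k. k div N) ` {k. k < r * N \<and> k mod N = j \<and> odd_letter (w k)}"
        then obtain k where k: "i = k div N" "k < r * N" "k mod N = j" "odd_letter (w k)" by auto
        then have "w k = Eps j" using rect.filling_letter(1)[OF w, of k] by simp
        then show "i \<in> {i. (i, j) \<in> set (boxes (replicate r N)) \<and> F (i, j) = Eps j}"
          using k j wF[of k] by (auto simp: set_boxes_rect less_mult_imp_div_less)
      qed
    qed (use j in auto)
  qed
  have "card (rect.stab_in r N (line_stab (\<lambda>k. k mod N) (r * N)) w) =
      (\<Prod>j<N. fact (card {k. k < r * N \<and> k mod N = j \<and> odd_letter (w k)}))"
    by (rule rect.card_col_stab_in[OF w])
  also have "\<dots> = (\<Prod>j<n. fact (card {k. k < r * N \<and> k mod N = j \<and> odd_letter (w k)}))"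
  proof (rule prod.mono_neutral_right)
    show "\<forall>j\<in>{..<N} - {..<n}. fact (card {k. k < r * N \<and> k mod N = j \<and> odd_letter (w k)}) = (1 :: nat)"
    proof
      fix j assume "j \<in> {..<N} - {..<n}"
      then have "{k. k < r * N \<and> k mod N = j \<and> odd_letter (w k)} = {}" using ev by auto
      then show "fact (card {k. k < r * N \<and> k mod N = j \<and> odd_letter (w k)}) = (1 :: nat)" by (simp only: card.empty fact_0)
    qed
  qed (use n in auto)
  also have "\<dots> = kappa n (replicate r N) F"
    unfolding kappa_def by (intro prod.cong refl arg_cong[where f = fact] c[symmetric]) (use n in auto)
  finally show ?thesis by simp
qed

subsection \<open>Duality\<close>

definition dl :: "'k::comm_ring_1 stensor \<Rightarrow> 'k stensor" where
  "dl = hom_ext (\<lambda>l. word [dual l])"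

lemma dl_word: "dl (word w) = word (map dual w)"
  by (simp add: dl_def hom_ext_word word_prod_list[of "map dual w"] o_def)

lemma dual_dual [simp]: "dual (dual l) = l"
  by (cases l) auto

lemma odd_dual [simp]: "odd_letter (dual l) = odd_letter l"
  by (cases l) auto

lemma map_dual_inj: "map dual v = map dual w \<longleftrightarrow> v = w"
  by (metis dual_dual map_map map_idI comp_apply)

lemma dl_add: "dl (x + y) = dl x + dl y"
  and dl_sum: "dl (sum f I) = (\<Sum>i\<in>I. dl (f i))"
  and dl_mult_scal: "dl (x * scal a) = dl x * scal a"
  and dl_of_int: "dl (of_int z * x) = of_int z * dl x"
  and dl_m1: "dl ((-1) ^ j * x) = (-1) ^ j * dl x"
  by (simp_all add: dl_def hom_ext_add hom_ext_sum hom_ext_mult_scal hom_ext_of_int hom_ext_m1)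

lemma dl_zero [simp]: "dl 0 = 0"
  by (simp add: dl_def)

lemma dl_sym_left:
  assumes "\<sigma> permutes {..<l}" "x \<in> tlen l"
  shows "dl (sym_left \<sigma> x) = sym_left \<sigma> (dl x)"
proof (induction x rule: stensor_induct)
  case (word w a)
  then have w: "length w = l" using assms by (auto simp: tlen_def)
  have "perm_word \<sigma> (map dual w) = map dual (perm_word \<sigma> w)"
    using permutes_in_image[OF permutes_inv[OF assms(1)]] w by (auto simp: perm_word_def)
  moreover have "inv_pairs \<sigma> (map dual w) = inv_pairs \<sigma> w" by (auto simp: inv_pairs_def)
  ultimately show ?case by (simp add: dl_mult_scal dl_word sym_left_mult_scal sym_left_word dl_m1)
qed (auto simp: sym_left_add dl_add)

lemma dl_symz:
  assumes "x \<in> tlen l"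
  shows "dl (symz e (line_stab f l) x) = symz e (line_stab f l) (dl x)"
  unfolding symz_def dl_sum dl_of_int
  by (rule sum.cong[OF refl]) (simp only: dl_sym_left[OF line_stab_permutes assms])

lemma tcoeff_dl: "tcoeff (dl x) (map dual v) = tcoeff x v"
  by (induction x rule: stensor_induct) (auto simp: dl_mult_scal dl_word dl_add tcoeff_word map_dual_inj)

text \<open>The sum is the binomial coefficient \<open>odd_count w\<close> over 2, so the sign of
  the pairing depends only on the number of odd letters.\<close>

lemma odd_pairs_card:
  "card {(i, j). i < j \<and> j < length w \<and> odd_letter (w ! i) \<and> odd_letter (w ! j)} = (\<Sum>i<odd_count w. i)"
proof (induction w rule: rev_induct)
  case (snoc l w)
  let ?P = "\<lambda>w. {(i, j). i < j \<and> j < length w \<and> odd_letter (w ! i) \<and> odd_letter (w ! j)}"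
  let ?B = "{i. i < length w \<and> odd_letter (w ! i)}"
  have B: "card ?B = odd_count w" by (simp add: odd_count_def length_filter_conv_card)
  have "?P (w @ [l]) = ?P w \<union> (if odd_letter l then (\<lambda>i. (i, length w)) ` ?B else {})"
    by (auto simp: nth_append less_Suc_eq)
  moreover have "finite (?P w)" by (rule finite_subset[of _ "{..<length w} \<times> {..<length w}"]) auto
  moreover have "card ((\<lambda>i. (i, length w)) ` ?B) = card ?B" by (rule card_image) (simp add: inj_on_def)
  ultimately have "card (?P (w @ [l])) = card (?P w) + (if odd_letter l then odd_count w else 0)"
    unfolding B[symmetric] by (simp only:) (subst card_Un_disjoint; auto)
  moreover have "odd_count (w @ [l]) = odd_count w + (if odd_letter l then 1 else 0)" by (simp add: odd_count_def)
  ultimately show ?case using snoc by (auto simp: lessThan_Suc)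
qed simp

lemma word_pairing_dual:
  "word_pairing u w = (if u = map dual w then (-1) ^ (\<Sum>i<odd_count w. i) else 0)"
proof (cases "u = map dual w")
  case True
  have "{(i, j). i < j \<and> j < length w \<and> odd_letter (w ! i) \<and> odd_letter (u ! j)} =
      {(i, j). i < j \<and> j < length w \<and> odd_letter (w ! i) \<and> odd_letter (w ! j)}" using True by auto
  moreover have "(\<Prod>k<length w. if u ! k = dual (w ! k) then 1 else 0) = (1 :: 'a)"
    using True by (intro prod.neutral) auto
  ultimately show ?thesis using True odd_pairs_card[of w] by (simp add: word_pairing_def)
next
  case False
  show ?thesis
  proof (cases "length u = length w")
    case True
    then obtain k where "k < length w" "u ! k \<noteq> dual (w ! k)"
      using False by (metis length_map nth_equalityI nth_map)
    then have "(\<Prod>k<length w. if u ! k = dual (w ! k) then 1 else 0) = (0 :: 'a)"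
      by (intro prod_zero) auto
    then show ?thesis using False by (simp add: word_pairing_def)
  qed (use False in \<open>simp add: word_pairing_def\<close>)
qed

lemma gconst_sum: "gconst (sum h I) = (\<Sum>i\<in>I. gconst (h i))"
  by (induction I rule: infinite_finite_induct) (auto simp: gconst_add)

text \<open>With a fixed number of odd letters the signs of the pairing are constant. The
  normalisation of the dual tensors can then be computed with \<open>bform\<close>, for which the
  symmetrizers are self-adjoint.\<close>

lemma pairing_dl:
  assumes x: "x \<in> tvars {}" and y: "y \<in> tvars {}" and ys: "y \<in> tsupp (\<lambda>v. odd_count v = c)"
  shows "pairing (dl x) y = gconst ((-1) ^ (\<Sum>i<c. i) * bform x y)"
proof -
  let ?U = "{u. tcoeff (dl x) u \<noteq> 0}" and ?W = "{w. tcoeff y w \<noteq> 0}"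
  have "pairing (dl x) y = (\<Sum>w\<in>?W. \<Sum>u\<in>?U. gconst (word_pairing u w) * grade_sign (odd_count w) (tcoeff (dl x) u) * tcoeff y w)"
    unfolding pairing_def by (rule sum.swap)
  also have "\<dots> = (\<Sum>w\<in>?W. gconst ((-1) ^ (\<Sum>i<c. i) * (kc x w * kc y w)))"
  proof (rule sum.cong[OF refl])
    fix w assume "w \<in> ?W"
    then have oc: "odd_count w = c" using ys by (auto simp: tsupp_def)
    have gx: "tcoeff (dl x) (map dual w) = gconst (kc x w)" by (simp add: tcoeff_dl tcoeff_kc[OF x])
    have "(\<Sum>u\<in>?U. gconst (word_pairing u w) * grade_sign (odd_count w) (tcoeff (dl x) u) * tcoeff y w) =
        (\<Sum>u\<in>?U. if u = map dual w then gconst ((-1) ^ (\<Sum>i<c. i) * (kc x w * kc y w)) else 0)"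
      by (rule sum.cong[OF refl]) (auto simp: word_pairing_dual oc gx tcoeff_kc[OF y] gconst_mult mult.assoc)
    also have "\<dots> = gconst ((-1) ^ (\<Sum>i<c. i) * (kc x w * kc y w))"
      using gx gconst_eq_iff[of "kc x w" 0] by auto
    finally show "(\<Sum>u\<in>?U. gconst (word_pairing u w) * grade_sign (odd_count w) (tcoeff (dl x) u) * tcoeff y w) =
      gconst ((-1) ^ (\<Sum>i<c. i) * (kc x w * kc y w))" .
  qed
  also have "\<dots> = gconst ((-1) ^ (\<Sum>i<c. i) * bform x y)"
    unfolding bform_def sum_distrib_left gconst_sum ..
  finally show ?thesis .
qed

lemma ring_inv_gconst:
  assumes "c \<noteq> 0"
  shows "ring_inv (gconst c) = gconst (inverse (c :: 'k::field_char_0))"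
  unfolding ring_inv_def
proof (rule the_equality)
  show "gconst c * gconst (inverse c) = 1 \<and> gconst (inverse c) * gconst c = 1"
    using assms by (simp flip: gconst_mult)
  fix y assume y: "gconst c * y = 1 \<and> y * gconst c = 1"
  have "gconst c * y = gconst c * gconst (inverse c)" using y assms by (simp flip: gconst_mult)
  then show "y = gconst (inverse c)" unfolding gconst_mult_cancel[OF assms] .
qed

subsection \<open>The integrand\<close>

definition oprod :: "nat \<Rightarrow> nat set \<Rightarrow> (nat \<Rightarrow> 'k grassmann) \<Rightarrow> 'k::comm_ring_1 grassmann" where
  "oprod L D z = prod_list (map (\<lambda>k. if k \<in> D then z k else 1) [0..<L])"

text \<open>The summands of v_a: index \<open>t < m\<close> stands for e_t with coefficient
  eta_(t,a), the variable number \<open>t * n + a\<close>, and the last index \<open>m\<close> for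
  eps_a with coefficient 1.\<close>

definition VG :: "nat \<Rightarrow> nat \<Rightarrow> nat \<Rightarrow> letter" where
  "VG m a t = (if t < m then E t else Eps a)"

definition CG :: "nat \<Rightarrow> nat \<Rightarrow> (nat \<Rightarrow> 'k grassmann) \<Rightarrow> nat \<Rightarrow> nat \<Rightarrow> 'k::comm_ring_1 grassmann" where
  "CG m n z a t = (if t < m then z (t * n + a) else 1)"

text \<open>The summands of u_a, with coefficients on the right: this absorbs the minus sign of u_a,
  which reappears when an odd coefficient is moved to the front of an odd letter.\<close>

definition VH :: "nat \<Rightarrow> nat \<Rightarrow> nat \<Rightarrow> letter" where
  "VH n a t = (if t < n then Eps_dual t else E_dual a)"

definition CH :: "nat \<Rightarrow> (nat \<Rightarrow> 'k grassmann) \<Rightarrow> nat \<Rightarrow> nat \<Rightarrow> 'k::comm_ring_1 grassmann" where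
  "CH n z a t = (if t < n then z (a * n + t) else 1)"

definition vecG :: "nat \<Rightarrow> nat \<Rightarrow> (nat \<Rightarrow> 'k grassmann) \<Rightarrow> nat \<Rightarrow> 'k::comm_ring_1 stensor" where
  "vecG m n z a = (\<Sum>t\<le>m. word [VG m a t] * scal (CG m n z a t))"

definition vecH :: "nat \<Rightarrow> (nat \<Rightarrow> 'k grassmann) \<Rightarrow> nat \<Rightarrow> 'k::comm_ring_1 stensor" where
  "vecH n z a = (\<Sum>t\<le>n. word [VH n a t] * scal (CH n z a t))"

definition altG :: "nat \<Rightarrow> nat \<Rightarrow> (nat \<Rightarrow> 'k::comm_ring_1 stensor) \<Rightarrow> 'k stensor" where
  "altG m n = alt_prod (\<lambda>k. k div n) (\<lambda>k. k mod n) (Suc m * n)"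

definition altH :: "nat \<Rightarrow> nat \<Rightarrow> (nat \<Rightarrow> 'k::comm_ring_1 stensor) \<Rightarrow> 'k stensor" where
  "altH m n = alt_prod (\<lambda>k. k mod Suc n) (\<lambda>k. k div Suc n) (m * Suc n)"

text \<open>For a set \<open>D\<close> of boxes of the small rectangle, box \<open>(i, j)\<close> being numbered \<open>i * n + j\<close>:
  the canonical fillings with even letters exactly on \<open>D\<close> within the small rectangle.\<close>

definition fillG :: "nat \<Rightarrow> nat \<Rightarrow> nat set \<Rightarrow> nat \<times> nat \<Rightarrow> letter" where
  "fillG m n D = restrict (\<lambda>(i, j). if i * n + j \<in> D then E i else Eps j) ({..<Suc m} \<times> {..<n})"

definition fillH :: "nat \<Rightarrow> nat \<Rightarrow> nat set \<Rightarrow> nat \<times> nat \<Rightarrow> letter" where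
  "fillH m n D = restrict (\<lambda>(i, j). if j < n \<and> i * n + j \<notin> D then Eps j else E i) ({..<m} \<times> {..<Suc n})"

definition letG :: "nat \<Rightarrow> nat set \<Rightarrow> nat \<Rightarrow> letter" where
  "letG n D k = (if k \<in> D then E (k div n) else Eps (k mod n))"

text \<open>In \<open>lambda_g\<close> a position inside the small rectangle is its box number, as
  both have rows of length \<open>n\<close>. The rows of \<open>lambda_h\<close> are longer by one,
  so here the box number has to be recomputed.\<close>

definition oddH :: "nat \<Rightarrow> nat set \<Rightarrow> nat \<Rightarrow> bool" where
  "oddH n D k \<longleftrightarrow> k mod Suc n < n \<and> (k div Suc n) * n + k mod Suc n \<notin> D"

definition letH :: "nat \<Rightarrow> nat set \<Rightarrow> nat \<Rightarrow> letter" where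
  "letH n D k = (if oddH n D k then Eps (k mod Suc n) else E (k div Suc n))"

abbreviation tensG :: "nat \<Rightarrow> nat \<Rightarrow> nat set \<Rightarrow> 'k::comm_ring_1 stensor" where
  "tensG m n D \<equiv> canonical_tensor (lambda_g m n) (fillG m n D)"

abbreviation tensH :: "nat \<Rightarrow> nat \<Rightarrow> nat set \<Rightarrow> 'k::comm_ring_1 stensor" where
  "tensH m n D \<equiv> dual_canonical_tensor (lambda_h m n) (fillH m n D)"

abbreviation stabG :: "nat \<Rightarrow> nat \<Rightarrow> nat set \<Rightarrow> (nat \<Rightarrow> nat) set" where
  "stabG m n D \<equiv> rect.stab_in (Suc m) n (line_stab (\<lambda>k. k mod n) (Suc m * n)) (letG n D)"

abbreviation stabH :: "nat \<Rightarrow> nat \<Rightarrow> nat set \<Rightarrow> (nat \<Rightarrow> nat) set" where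
  "stabH m n D \<equiv> rect.stab_in m (Suc n) (line_stab (\<lambda>k. k div Suc n) (m * Suc n)) (letH n D)"

text \<open>The exponent delivered by \<open>prod_monomials_exact\<close>: in
  \<open>lambda_g\<close> the variables accompany the even letters, that is the boxes of
  \<open>D\<close>. In \<open>lambda_h\<close> they accompany the odd letters, so
  \<open>signH\<close> counts pairs of odd letters.\<close>

definition signG :: "nat \<Rightarrow> nat \<Rightarrow> nat set \<Rightarrow> nat" where
  "signG m n D = card {(i, j). i < j \<and> j < Suc m * n \<and> i \<in> D \<and> odd_letter (letG n D j)}"

definition signH :: "nat \<Rightarrow> nat \<Rightarrow> nat set \<Rightarrow> nat" where
  "signH m n D = card {(i, j). i < j \<and> j < m * Suc n \<and> oddH n D i \<and> odd_letter (letH n D j)}"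

lemma odd_letG: "odd_letter (letG n D k) \<longleftrightarrow> k \<notin> D" and odd_letH: "odd_letter (letH n D k) \<longleftrightarrow> oddH n D k"
  by (simp_all add: letG_def letH_def)

lemma fillingG: "rect.filling r n (letG n D)"
  by (simp add: rect.filling_def letG_def)

lemma fillingH: "rect.filling r (Suc n) (letH n D)"
  by (simp add: rect.filling_def letH_def)

lemma mod_less_rect: "k < r * (N :: nat) \<Longrightarrow> k mod N < N"
  by (cases N) auto

lemma fillG_box: "k < Suc m * n \<Longrightarrow> fillG m n D (k div n, k mod n) = letG n D k"
  using mod_less_rect[of k "Suc m" n] less_mult_imp_div_less[of k "Suc m" n]
  by (simp add: fillG_def letG_def div_mult_mod_eq)

lemma fillH_box: "k < m * Suc n \<Longrightarrow> fillH m n D (k div Suc n, k mod Suc n) = letH n D k"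
  using mod_less_rect[of k m "Suc n"] less_mult_imp_div_less[of k m "Suc n"]
  by (simp add: fillH_def letH_def oddH_def)

lemma wordG: "map (fillG m n D) (boxes (lambda_g m n)) = rect.tab_word (Suc m) n (letG n D)"
  using fillG_box[of _ m n D] by (simp add: lambda_g_def boxes_rect rect.tab_word_def del: replicate_Suc)

lemma wordH: "map (\<lambda>b. dual (fillH m n D b)) (boxes (lambda_h m n)) = map dual (rect.tab_word m (Suc n) (letH n D))"
  "map (fillH m n D) (boxes (lambda_h m n)) = rect.tab_word m (Suc n) (letH n D)"
  using fillH_box[of _ m n D] by (simp_all add: lambda_h_def boxes_rect rect.tab_word_def del: replicate_Suc)

lemma tensG_symz:
  "tensG m n D = symz 0 (line_stab (\<lambda>k. k div n) (Suc m * n)) (symz 1 (line_stab (\<lambda>k. k mod n) (Suc m * n))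
    (word (rect.tab_word (Suc m) n (letG n D))))"
proof -
  have "(word (rect.tab_word (Suc m) n (letG n D)) :: 'a stensor) \<in> tlen (Suc m * n)" by (simp add: rect.tab_word_def)
  from rect.young_left_rect[OF this] show ?thesis
    unfolding canonical_tensor_def wordG rect.young_def by (simp add: lambda_g_def)
qed

lemma tensH_symz:
  "tensH m n D = symz 1 (line_stab (\<lambda>k. k mod Suc n) (m * Suc n)) (symz 0 (line_stab (\<lambda>k. k div Suc n) (m * Suc n))
    (word (map dual (rect.tab_word m (Suc n) (letH n D)))))"
proof -
  have "sum_list (replicate m (Suc n)) = m * Suc n" unfolding sum_list_replicate of_nat_id ..
  moreover have "(word (map dual (rect.tab_word m (Suc n) (letH n D))) :: 'a stensor) \<in> tlen (m * Suc n)" by (simp add: rect.tab_word_def)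
  ultimately have "(word (map dual (rect.tab_word m (Suc n) (letH n D))) :: 'a stensor) \<in> tlen (sum_list (replicate m (Suc n)))"
    by (simp only:)
  from young_right_symz[OF this] show ?thesis
    unfolding dual_canonical_tensor_def wordH row_stab_rect col_stab_rect
    unfolding lambda_h_def Suc_eq_plus1[symmetric] row_stab_rect col_stab_rect .
qed

lemma oprod_all: "L \<le> L' \<Longrightarrow> D \<subseteq> {..<L} \<Longrightarrow> oprod L' D z = oprod L D z"
proof (induction L' rule: dec_induct)
  case (step k)
  then have "k \<notin> D" by auto
  then show ?case using step by (simp add: oprod_def)
qed simp

text \<open>The vectors v_a are odd, hence \<open>p = 1\<close>. A line is a column, and the default
  summand \<open>m\<close> is eps_a, which may stand in every row.\<close>

lemma line_fillings_G:
  assumes z: "\<And>k. k < m * n \<Longrightarrow> godd (z k :: 'k::field_char_0 grassmann)"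
  shows "line_fillings (\<lambda>k. k mod n) (\<lambda>k. k div n) (Suc m * n) n m 1 (VG m) (CG m n z)"
proof
  show "bij_betw (\<lambda>k. (k mod n, k div n)) {..<Suc m * n} ({..<n} \<times> {..m})"
    using bij_rect'[of n "Suc m"] by (simp only: lessThan_Suc_atMost)
qed (use z rect_index in \<open>auto simp: VG_def CG_def par_letter_def godd_def\<close>)

text \<open>The vectors u_a are even, hence \<open>p = 0\<close>. A line is a row, and the default
  summand \<open>n\<close> is the dual of e_a, which may stand in every column.\<close>

lemma line_fillings_H:
  assumes z: "\<And>k. k < m * n \<Longrightarrow> godd (z k :: 'k::field_char_0 grassmann)"
  shows "line_fillings (\<lambda>k. k div Suc n) (\<lambda>k. k mod Suc n) (m * Suc n) m n 0 (VH n) (CH n z)"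
proof
  show "bij_betw (\<lambda>k. (k div Suc n, k mod Suc n)) {..<m * Suc n} ({..<m} \<times> {..n})"
    using bij_rect[of "Suc n" m] by (simp only: lessThan_Suc_atMost)
qed (use z rect_index in \<open>auto simp: VH_def CH_def par_letter_def godd_def\<close>)

lemma altG_expand:
  assumes z: "\<And>k. k < m * n \<Longrightarrow> godd (z k :: 'k::field_char_0 grassmann)"
  shows "altG m n (vecG m n z) = (\<Sum>D\<in>Pow {..<m * n}.
    tensG m n D * scal (gconst ((-1) ^ signG m n D / of_nat (card (stabG m n D))) * oprod (m * n) D z))"
proof -
  let ?l = "Suc m * n"
  interpret L: line_fillings "\<lambda>k. k mod n" "\<lambda>k. k div n" ?l n m 1 "VG m" "CG m n z"
    by (rule line_fillings_G[OF z])
  \<comment> \<open>Boxes in \<open>D\<close> choose the even letter of their row, all others the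
    default \<open>m\<close>. In the last row the two choices coincide, so canonical choices
    correspond to subsets of the small rectangle.\<close>
  define c where "c D = restrict (\<lambda>k. if k \<in> D then k div n else m) {..<?l}" for D
  have dm: "k div n \<le> m" "k mod n < n" if "k < ?l" for k
    using that L.coords by auto
  have Dlt: "k div n < m" "k < ?l" if "k \<in> D" "D \<subseteq> {..<m * n}" for k D
  proof -
    have "k < m * n" using that by auto
    then show "k div n < m" "k < ?l" by (auto simp: less_mult_imp_div_less mult_Suc)
  qed
  have "bij_betw c (Pow {..<m * n}) L.canonical"
  proof (rule bij_betw_byWitness[where f' = "\<lambda>F. {k. k < ?l \<and> F k \<noteq> m}"])
    show "\<forall>D\<in>Pow {..<m * n}. {k. k < ?l \<and> c D k \<noteq> m} = D"
    proof
      fix D assume "D \<in> Pow {..<m * n}"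
      then have D: "D \<subseteq> {..<m * n}" by simp
      show "{k. k < ?l \<and> c D k \<noteq> m} = D"
      proof (intro Set.set_eqI iffI)
        fix k assume "k \<in> D"
        with Dlt[OF this D] show "k \<in> {k. k < ?l \<and> c D k \<noteq> m}" by (simp add: c_def)
      next
        fix k assume "k \<in> {k. k < ?l \<and> c D k \<noteq> m}"
        then show "k \<in> D" by (cases "k \<in> D") (auto simp: c_def)
      qed
    qed
    show "\<forall>F\<in>L.canonical. c {k. k < ?l \<and> F k \<noteq> m} = F"
    proof
      fix F assume F: "F \<in> L.canonical"
      show "c {k. k < ?l \<and> F k \<noteq> m} = F"
      proof (rule ext)
        fix k show "c {k. k < ?l \<and> F k \<noteq> m} k = F k"
          using F by (auto simp: c_def L.canonical_def L.fillings_def PiE_iff extensional_def)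
      qed
    qed
    show "c ` Pow {..<m * n} \<subseteq> L.canonical"
      using dm by (auto split: if_splits simp: c_def L.canonical_def L.fillings_def)
    show "(\<lambda>F. {k. k < ?l \<and> F k \<noteq> m}) ` L.canonical \<subseteq> Pow {..<m * n}"
    proof (intro image_subsetI PowI subsetI)
      fix F k assume F: "F \<in> L.canonical" and "k \<in> {k. k < ?l \<and> F k \<noteq> m}"
      then have k: "k < ?l" "F k \<noteq> m" by simp_all
      then have "k div n \<noteq> m" using F by (auto simp: L.canonical_def)
      then have "k div n < m" using dm[OF k(1)] by simp
      then show "k \<in> {..<m * n}" using dm[OF k(1)] rect_index[of "k div n" m "k mod n" n] by simp
    qed
  qed
  from sum.reindex_bij_betw[OF this, of "\<lambda>F. L.symm F * scal (gconst (1 / of_nat (card (L.stab F))))"]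
  have "altG m n (vecG m n z) = (\<Sum>D\<in>Pow {..<m * n}. L.symm (c D) * scal (gconst (1 / of_nat (card (L.stab (c D))))))"
    unfolding altG_def vecG_def[abs_def] L.vec_def[abs_def, symmetric] by (simp only: L.alt_prod_canonical)
  also have "\<dots> = (\<Sum>D\<in>Pow {..<m * n}.
    tensG m n D * scal (gconst ((-1) ^ signG m n D / of_nat (card (stabG m n D))) * oprod (m * n) D z))"
  proof (rule sum.cong[OF refl])
    fix D assume "D \<in> Pow {..<m * n}"
    then have D: "D \<subseteq> {..<m * n}" by simp
    have V: "VG m (k mod n) (c D k) = letG n D k" and C: "CG m n z (k mod n) (c D k) = (if k \<in> D then z k else 1)"
      if "k < ?l" for k
      using that Dlt[OF _ D, of k] by (auto simp: VG_def CG_def c_def letG_def div_mult_mod_eq)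
    have "L.mono (c D) = prod_list (map (\<lambda>k. word [letG n D k] * scal (if k \<in> D then z k else 1)) [0..<?l])"
      unfolding L.mono_def by (intro arg_cong[where f = prod_list] map_cong refl) (simp add: V C)
    also have "\<dots> = word (map (letG n D) [0..<?l]) * scal ((-1) ^ signG m n D * oprod ?l D z)"
      unfolding signG_def oprod_def by (rule prod_monomials_exact) (use z D in auto)
    also have "oprod ?l D z = oprod (m * n) D z" by (rule oprod_all) (use D in auto)
    finally have M: "L.mono (c D) = word (rect.tab_word (Suc m) n (letG n D)) * scal ((-1) ^ signG m n D * oprod (m * n) D z)"
      by (simp add: rect.tab_word_def)
    have symm: "L.symm (c D) = tensG m n D * scal ((-1) ^ signG m n D * oprod (m * n) D z)"
      unfolding L.symm_def M symz_mult_scal tensG_symz unfolding One_nat_def symz_2 ..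
    have st: "L.stab (c D) = stabG m n D"
    proof -
      have "c D (\<sigma> k) = c D k \<longleftrightarrow> letG n D (\<sigma> k) = letG n D k"
        if \<sigma>: "\<sigma> \<in> line_stab (\<lambda>k. k mod n) ?l" and k: "k < ?l" for \<sigma> k
      proof -
        have sk: "\<sigma> k < ?l" "\<sigma> k mod n = k mod n" using \<sigma> k line_stab_less[OF \<sigma>] by (auto simp: line_stab_def)
        show ?thesis using sk k Dlt[OF _ D, of k] Dlt[OF _ D, of "\<sigma> k"]
          by (auto simp: c_def letG_def)
      qed
      then show ?thesis unfolding L.stab_def rect.stab_in_def by blast
    qed
    have "(-1) ^ signG m n D * oprod (m * n) D z * gconst (1 / of_nat (card (stabG m n D))) =
      gconst ((-1) ^ signG m n D / of_nat (card (stabG m n D))) * oprod (m * n) D z"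
    proof -
      have "oprod (m * n) D z * gconst q = gconst q * oprod (m * n) D z" for q
        by (rule geven_commute[symmetric]) simp
      then show ?thesis
        unfolding gconst_m1 by (simp add: mult.assoc gconst_mult[symmetric])
          (simp add: mult.assoc[symmetric] gconst_mult[symmetric])
    qed
    then show "L.symm (c D) * scal (gconst (1 / of_nat (card (L.stab (c D))))) =
      tensG m n D * scal (gconst ((-1) ^ signG m n D / of_nat (card (stabG m n D))) * oprod (m * n) D z)"
      unfolding symm st by (simp only: mult.assoc scal_mult[symmetric])
  qed
  finally show ?thesis .
qed

text \<open>The last column of \<open>lambda_h\<close> contributes only factors 1; deleting it
  leaves the boxes of the small rectangle in their own order.\<close>

lemma prod_rows:
  "prod_list (map (\<lambda>k. if k mod Suc n < n then F ((k div Suc n) * n + k mod Suc n) else (1 :: 'a::monoid_mult)) [0..<m * Suc n]) =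
    prod_list (map F [0..<m * n])"
proof (induction m)
  case (Suc m)
  let ?H = "\<lambda>k. if k mod Suc n < n then F ((k div Suc n) * n + k mod Suc n) else 1"
  have s1: "[0..<Suc m * Suc n] = [0..<m * Suc n] @ [m * Suc n..<m * Suc n + n] @ [m * Suc n + n]"
    using upt_add_eq_append[of 0 "m * Suc n" "Suc n"] by (simp add: add.commute mult_Suc)
  have s2: "[0..<Suc m * n] = [0..<m * n] @ [m * n..<m * n + n]"
    using upt_add_eq_append[of 0 "m * n" n] by (simp add: add.commute mult_Suc)
  have "map ?H [m * Suc n..<m * Suc n + n] = map F [m * n..<m * n + n]"
  proof (rule nth_equalityI)
    fix i assume "i < length (map ?H [m * Suc n..<m * Suc n + n])"
    then have i: "i < n" by simp
    have "(m * Suc n + i) div Suc n = m" "(m * Suc n + i) mod Suc n = i"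
      using i by (simp_all only: div_mult_self3 mod_mult_self3 mult.commute[of m]) (simp_all add: less_Suc_eq)
    then show "map ?H [m * Suc n..<m * Suc n + n] ! i = map F [m * n..<m * n + n] ! i"
      using i by (simp)
  qed simp
  moreover have "?H (m * Suc n + n) = 1"
  proof -
    have "(m * Suc n + n) mod Suc n = n" by (metis lessI mod_less mod_mult_self3 add.commute)
    then show ?thesis by (simp)
  qed
  ultimately show ?case unfolding s1 s2 using Suc by (simp)
qed simp

text \<open>In contrast to \<open>altG_expand\<close> the variables belong to the odd letters, so
  the monomial is that of the complement of \<open>D\<close>. This complementarity makes the
  integral pair equal fillings.\<close>

lemma altH_expand:
  assumes z: "\<And>k. k < m * n \<Longrightarrow> godd (z k :: 'k::field_char_0 grassmann)"
  shows "altH m n (vecH n z) = (\<Sum>D\<in>Pow {..<m * n}.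
    tensH m n D * scal (gconst ((-1) ^ signH m n D / of_nat (card (stabH m n D))) * oprod (m * n) ({..<m * n} - D) z))"
proof -
  let ?l = "m * Suc n"
  let ?i = "\<lambda>k. (k div Suc n) * n + k mod Suc n"
  interpret L: line_fillings "\<lambda>k. k div Suc n" "\<lambda>k. k mod Suc n" ?l m n 0 "VH n" "CH n z"
    by (rule line_fillings_H[OF z])
  define c where "c D = restrict (\<lambda>k. if oddH n D k then k mod Suc n else n) {..<?l}" for D
  \<comment> \<open>\<open>u b\<close> is the position in \<open>lambda_h\<close> of the box number
    \<open>b\<close>.\<close>
  define u where "u b = (b div n) * Suc n + b mod n" for b
  have dm: "k div Suc n < m" "k mod Suc n \<le> n" if "k < ?l" for k
    using that L.coords by auto
  have ilt: "?i k < m * n" if "k < ?l" "k mod Suc n < n" for k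
    using rect_index[of "k div Suc n" m "k mod Suc n" n] dm[OF that(1)] that by simp
  have u: "u b < ?l" "u b div Suc n = b div n" "u b mod Suc n = b mod n" "b mod n < n" if "b < m * n" for b
  proof -
    have bm: "b mod n < n" "b div n < m" using mod_less_rect[OF that] less_mult_imp_div_less[OF that] by auto
    then have 1: "b mod n < Suc n" by simp
    show "u b < ?l" unfolding u_def by (rule rect_index[OF bm(2) 1])
    show "u b div Suc n = b div n" "u b mod Suc n = b mod n"
      unfolding u_def using 1 by (simp_all)
    show "b mod n < n" by fact
  qed
  have iu: "?i (u b) = b" if "b < m * n" for b
    using u[OF that] by (simp add: div_mult_mod_eq)
  have ui: "u (?i k) = k" if "k < ?l" "k mod Suc n < n" for k
  proof -
    have "?i k div n = k div Suc n" "?i k mod n = k mod Suc n" using that(2) by auto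
    then show ?thesis unfolding u_def by (simp only: div_mult_mod_eq)
  qed
  have oddHu: "oddH n D (u b) \<longleftrightarrow> b \<notin> D" if "b < m * n" for b D
    using iu[OF that] u[OF that] unfolding oddH_def by simp
  have "bij_betw c (Pow {..<m * n}) L.canonical"
  proof (rule bij_betw_byWitness[where f' = "\<lambda>F. {b. b < m * n \<and> F (u b) = n}"])
    show "\<forall>D\<in>Pow {..<m * n}. {b. b < m * n \<and> c D (u b) = n} = D"
    proof
      fix D assume "D \<in> Pow {..<m * n}"
      moreover have "c D (u b) = n \<longleftrightarrow> b \<in> D" if "b < m * n" for b
        using u[OF that] oddHu[OF that, of D] by (auto simp: c_def)
      ultimately show "{b. b < m * n \<and> c D (u b) = n} = D" by auto
    qed
    show "\<forall>F\<in>L.canonical. c {b. b < m * n \<and> F (u b) = n} = F"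
    proof
      fix F assume F: "F \<in> L.canonical"
      show "c {b. b < m * n \<and> F (u b) = n} = F"
      proof (rule ext)
        fix k show "c {b. b < m * n \<and> F (u b) = n} k = F k"
        proof (cases "k < ?l")
          case True
          have Fk: "F k = n \<or> F k = k mod Suc n" using F True by (auto simp: L.canonical_def)
          show ?thesis
          proof (cases "k mod Suc n < n")
            case lt: True
            have "oddH n {b. b < m * n \<and> F (u b) = n} k \<longleftrightarrow> F k \<noteq> n"
              using lt ilt[OF True lt] ui[OF True lt] by (simp add: oddH_def)
            then show ?thesis using True Fk by (auto simp: c_def)
          next
            case False
            then have "k mod Suc n = n" using dm[OF True] by simp
            then show ?thesis using True Fk by (simp add: c_def oddH_def)
          qed
        next
          case False
          then show ?thesis using F by (auto simp: c_def L.canonical_def L.fillings_def PiE_iff extensional_def)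
        qed
      qed
    qed
    show "c ` Pow {..<m * n} \<subseteq> L.canonical"
      using dm by (auto split: if_splits simp: c_def L.canonical_def L.fillings_def restrict_PiE_iff)
  qed auto
  from sum.reindex_bij_betw[OF this, of "\<lambda>F. L.symm F * scal (gconst (1 / of_nat (card (L.stab F))))"]
  have "altH m n (vecH n z) = (\<Sum>D\<in>Pow {..<m * n}. L.symm (c D) * scal (gconst (1 / of_nat (card (L.stab (c D))))))"
    unfolding altH_def vecH_def[abs_def] L.vec_def[abs_def, symmetric] by (simp only: L.alt_prod_canonical)
  also have "\<dots> = (\<Sum>D\<in>Pow {..<m * n}.
    tensH m n D * scal (gconst ((-1) ^ signH m n D / of_nat (card (stabH m n D))) * oprod (m * n) ({..<m * n} - D) z))"
  proof (rule sum.cong[OF refl])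
    fix D assume "D \<in> Pow {..<m * n}"
    then have D: "D \<subseteq> {..<m * n}" by simp
    let ?a = "\<lambda>k. if oddH n D k then z (?i k) else 1"
    have V: "VH n (k div Suc n) (c D k) = dual (letH n D k)" and C: "CH n z (k div Suc n) (c D k) = ?a k"
      if "k < ?l" for k
      using that by (auto simp: VH_def CH_def c_def letH_def oddH_def)
    have pa: "prod_list (map ?a [0..<?l]) = oprod (m * n) ({..<m * n} - D) z"
    proof -
      have "map ?a [0..<?l] = map (\<lambda>k. if k mod Suc n < n then (\<lambda>b. if b \<in> {..<m * n} - D then z b else 1) (?i k) else 1) [0..<?l]"
        by (rule map_cong[OF refl]) (use ilt in \<open>auto simp: oddH_def\<close>)
      then show ?thesis unfolding oprod_def using prod_rows[of n "\<lambda>b. if b \<in> {..<m * n} - D then z b else 1" m] by (simp only:)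
    qed
    have "L.mono (c D) = prod_list (map (\<lambda>k. word [dual (letH n D k)] * scal (?a k)) [0..<?l])"
      unfolding L.mono_def by (intro arg_cong[where f = prod_list] map_cong refl) (simp add: V C)
    also have "\<dots> = word (map (\<lambda>k. dual (letH n D k)) [0..<?l]) * scal ((-1) ^ card {(i, j). i < j \<and> j < ?l \<and> oddH n D i \<and> odd_letter (dual (letH n D j))} * prod_list (map ?a [0..<?l]))"
      by (rule prod_monomials_exact) (use z ilt in \<open>auto simp: oddH_def\<close>)
    finally have M: "L.mono (c D) = word (map dual (rect.tab_word m (Suc n) (letH n D))) *
        scal ((-1) ^ signH m n D * oprod (m * n) ({..<m * n} - D) z)"
      unfolding pa odd_dual signH_def rect.tab_word_def map_map o_def .
    have symm: "L.symm (c D) = tensH m n D * scal ((-1) ^ signH m n D * oprod (m * n) ({..<m * n} - D) z)"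
      unfolding L.symm_def M symz_mult_scal tensH_symz One_nat_def ..
    have st: "L.stab (c D) = stabH m n D"
    proof -
      have "c D (\<sigma> k) = c D k \<longleftrightarrow> letH n D (\<sigma> k) = letH n D k"
        if \<sigma>: "\<sigma> \<in> line_stab (\<lambda>k. k div Suc n) ?l" and k: "k < ?l" for \<sigma> k
      proof -
        have sk: "\<sigma> k < ?l" "\<sigma> k div Suc n = k div Suc n" using \<sigma> k line_stab_less[OF \<sigma>] by (auto simp: line_stab_def)
        have o: "oddH n D j \<Longrightarrow> j mod Suc n < n" for j by (simp add: oddH_def)
        show ?thesis using sk k o[of k] o[of "\<sigma> k"] by (auto simp: c_def letH_def)
      qed
      then show ?thesis unfolding L.stab_def rect.stab_in_def by blast
    qed
    let ?O = "oprod (m * n) ({..<m * n} - D) z"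
    have "(-1) ^ signH m n D * ?O * gconst (1 / of_nat (card (stabH m n D))) =
      gconst ((-1) ^ signH m n D / of_nat (card (stabH m n D))) * ?O"
    proof -
      have "?O * gconst q = gconst q * ?O" for q
        by (rule geven_commute[symmetric]) simp
      then show ?thesis
        unfolding gconst_m1 by (simp add: mult.assoc gconst_mult[symmetric])
          (simp add: mult.assoc[symmetric] gconst_mult[symmetric])
    qed
    then show "L.symm (c D) * scal (gconst (1 / of_nat (card (L.stab (c D))))) =
      tensH m n D * scal (gconst ((-1) ^ signH m n D / of_nat (card (stabH m n D))) * ?O)"
      unfolding symm st by (simp only: mult.assoc scal_mult[symmetric])
  qed
  finally show ?thesis .
qed

section \<open>The tensor as a Berezin integral\<close>

lemma card_stab_in_nonzero: "card (rect.stab_in r N (line_stab f l) w) \<noteq> 0"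
proof -
  have "id \<in> rect.stab_in r N (line_stab f l) w" by (simp add: rect.stab_in_def)
  moreover have "finite (rect.stab_in r N (line_stab f l) w)"
    by (rule finite_subset[OF _ line_stab_finite[of f l]]) (auto simp: rect.stab_in_def)
  ultimately show ?thesis by auto
qed

lemma odd_count_tab_word: "odd_count (rect.tab_word r N w) = card {k. k < r * N \<and> odd_letter (w k)}"
proof -
  have "odd_count (rect.tab_word r N w) = card {i. i < r * N \<and> odd_letter (map w [0..<r * N] ! i)}"
    by (simp add: odd_count_def length_filter_conv_card rect.tab_word_def)
  also have "{i. i < r * N \<and> odd_letter (map w [0..<r * N] ! i)} = {k. k < r * N \<and> odd_letter (w k)}" by auto
  finally show ?thesis .
qed

lemma odd_count_dual: "odd_count (map dual w) = odd_count w"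
  by (simp add: odd_count_def filter_map o_def)

lemma odd_countH:
  "odd_count (rect.tab_word m (Suc n) (letH n D)) = card ({..<m * n} - D)"
proof -
  have "bij_betw (\<lambda>k. (k div Suc n) * n + k mod Suc n) {k. k < m * Suc n \<and> odd_letter (letH n D k)} ({..<m * n} - D)"
  proof (rule bij_betw_byWitness[where f' = "\<lambda>b. (b div n) * Suc n + b mod n"])
    show "\<forall>k\<in>{k. k < m * Suc n \<and> odd_letter (letH n D k)}.
        ((k div Suc n) * n + k mod Suc n) div n * Suc n + ((k div Suc n) * n + k mod Suc n) mod n = k"
    proof
      fix k assume "k \<in> {k. k < m * Suc n \<and> odd_letter (letH n D k)}"
      then have lt: "k mod Suc n < n" by (simp add: odd_letH oddH_def)
      then have "((k div Suc n) * n + k mod Suc n) div n = k div Suc n" "((k div Suc n) * n + k mod Suc n) mod n = k mod Suc n" by auto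
      then show "((k div Suc n) * n + k mod Suc n) div n * Suc n + ((k div Suc n) * n + k mod Suc n) mod n = k"
        by (simp only: div_mult_mod_eq)
    qed
    have u: "(b div n * Suc n + b mod n) div Suc n = b div n" "(b div n * Suc n + b mod n) mod Suc n = b mod n"
      "b div n < m" "b mod n < n" if "b < m * n" for b
    proof -
      show bm: "b mod n < n" "b div n < m" using mod_less_rect[OF that] less_mult_imp_div_less[OF that] by auto
      then have "b mod n < Suc n" by simp
      then show "(b div n * Suc n + b mod n) div Suc n = b div n" "(b div n * Suc n + b mod n) mod Suc n = b mod n" by simp_all
    qed
    show "\<forall>b\<in>{..<m * n} - D. (b div n * Suc n + b mod n) div Suc n * n + (b div n * Suc n + b mod n) mod Suc n = b"
    proof
      fix b assume "b \<in> {..<m * n} - D"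
      then have "b < m * n" by simp
      from u(1,2)[OF this] show "(b div n * Suc n + b mod n) div Suc n * n + (b div n * Suc n + b mod n) mod Suc n = b"
        by (simp only: div_mult_mod_eq)
    qed
    show "(\<lambda>k. k div Suc n * n + k mod Suc n) ` {k. k < m * Suc n \<and> odd_letter (letH n D k)} \<subseteq> {..<m * n} - D"
      using rect_index[of _ m _ n] by (auto simp: odd_letH oddH_def less_mult_imp_div_less)
    show "(\<lambda>b. b div n * Suc n + b mod n) ` ({..<m * n} - D) \<subseteq> {k. k < m * Suc n \<and> odd_letter (letH n D k)}"
    proof
      fix k assume "k \<in> (\<lambda>b. b div n * Suc n + b mod n) ` ({..<m * n} - D)"
      then obtain b where b: "b < m * n" "b \<notin> D" "k = b div n * Suc n + b mod n" by auto
      have "b mod n < Suc n" using u(4)[OF b(1)] by simp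
      then have "k < m * Suc n" unfolding b(3) by (rule rect_index[OF u(3)[OF b(1)]])
      moreover have "oddH n D k" unfolding oddH_def b(3) u(1,2)[OF b(1)] using u(4)[OF b(1)] b(2) by simp
      ultimately show "k \<in> {k. k < m * Suc n \<and> odd_letter (letH n D k)}" by (simp add: odd_letH)
    qed
  qed
  then show ?thesis unfolding odd_count_tab_word by (rule bij_betw_same_card)
qed

lemma odd_countG: "D \<subseteq> {..<m * n} \<Longrightarrow> odd_count (rect.tab_word (Suc m) n (letG n D)) = Suc m * n - card D"
proof -
  assume D: "D \<subseteq> {..<m * n}"
  have "{k. k < Suc m * n \<and> odd_letter (letG n D k)} = {..<Suc m * n} - D" by (auto simp: odd_letG)
  moreover have "card ({..<Suc m * n} - D) = Suc m * n - card D"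
    by (subst card_Diff_subset) (use D in \<open>auto intro: finite_subset simp: mult_Suc\<close>)
  ultimately show ?thesis unfolding odd_count_tab_word by simp
qed

lemma tensG_young: "tensG m n D = rect.young (Suc m) n (word (rect.tab_word (Suc m) n (letG n D)))"
  unfolding tensG_symz rect.young_def ..

lemma lengthG: "length (rect.tab_word (Suc m) n w) = Suc m * n" and lengthH: "length (rect.tab_word m (Suc n) w) = m * Suc n"
  by (simp_all add: rect.tab_word_def)

lemma tensG_supp:
  assumes "\<And>v w. mset v = mset w \<Longrightarrow> P v \<Longrightarrow> P w" "P (rect.tab_word (Suc m) n (letG n D))"
  shows "(tensG m n D :: 'k::comm_ring_1 stensor) \<in> tlen (Suc m * n) \<inter> tsupp P \<inter> tvars {}"
proof -
  let ?W = "word (rect.tab_word (Suc m) n (letG n D)) :: 'k stensor"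
  have "?W \<in> tlen (Suc m * n)" "?W \<in> tsupp P" by (simp add: lengthG, rule tsupp_word[of P, OF assms(2)])
  then show ?thesis unfolding tensG_symz
    by (intro IntI symz_tlen symz_tvars tvars_simps tsupp_symz[of P, OF assms(1)]) auto
qed

lemma tensH_supp:
  assumes "\<And>v w. mset v = mset w \<Longrightarrow> P v \<Longrightarrow> P w" "P (map dual (rect.tab_word m (Suc n) (letH n D)))"
  shows "(tensH m n D :: 'k::comm_ring_1 stensor) \<in> tlen (m * Suc n) \<inter> tsupp P \<inter> tvars {}"
proof -
  let ?W = "word (map dual (rect.tab_word m (Suc n) (letH n D))) :: 'k stensor"
  have "?W \<in> tlen (m * Suc n)" "?W \<in> tsupp P" by (simp add: lengthH, rule tsupp_word[of P, OF assms(2)])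
  then show ?thesis unfolding tensH_symz
    by (intro IntI symz_tlen symz_tvars tvars_simps tsupp_symz[of P, OF assms(1)]) auto
qed

lemma tens_tvars: "(tensG m n D :: 'k::comm_ring_1 stensor) \<in> tvars {}" "(tensH m n D :: 'k stensor) \<in> tvars {}"
proof -
  show "(tensG m n D :: 'k stensor) \<in> tvars {}" by (rule IntD2[OF tensG_supp[of "\<lambda>_. True"]]) simp_all
  show "(tensH m n D :: 'k stensor) \<in> tvars {}" by (rule IntD2[OF tensH_supp[of "\<lambda>_. True"]]) simp_all
qed

lemma tens_tlen: "(tensG m n D :: 'k::comm_ring_1 stensor) \<in> tlen (Suc m * n)" "(tensH m n D :: 'k stensor) \<in> tlen (m * Suc n)"
proof -
  show "(tensG m n D :: 'k stensor) \<in> tlen (Suc m * n)"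
    by (rule IntD1[OF IntD1[OF tensG_supp[of "\<lambda>_. True"]]]) simp_all
  show "(tensH m n D :: 'k stensor) \<in> tlen (m * Suc n)"
    by (rule IntD1[OF IntD1[OF tensH_supp[of "\<lambda>_. True"]]]) simp_all
qed

lemma odd_count_mset_eq: "mset v = mset w \<Longrightarrow> odd_count v = odd_count w"
  by (simp add: odd_count_mset)

lemma tsupp_homog:
  "x \<in> tvars {} \<Longrightarrow> x \<in> tsupp (\<lambda>v. odd_count v = c) \<Longrightarrow> homog c x"
  unfolding homog_def
proof (rule stensor_eqI)
  fix w assume x: "x \<in> tvars {}" "x \<in> tsupp (\<lambda>v. odd_count v = c)"
  have "grade_sign 1 (tcoeff x w) = tcoeff x w"
  proof (rule grassmann_eqI)
    fix S show "gcoeff (grade_sign 1 (tcoeff x w)) S = gcoeff (tcoeff x w) S"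
    proof (cases "gcoeff (tcoeff x w) S = 0")
      case False
      then have "S = {}" using x(1) unfolding tvars_def gvars_def by blast
      then show ?thesis by (simp add: gcoeff_grade_sign)
    qed (simp add: gcoeff_grade_sign)
  qed
  then show "tcoeff (tinv x) w = tcoeff ((-1) ^ c * x) w"
    using x(2) by (cases "tcoeff x w = 0") (auto simp: tcoeff_tinv tcoeff_m1_mult tsupp_def)
qed

lemma tensH_homog: "homog (card ({..<m * n} - D)) (tensH m n D)"
proof (rule tsupp_homog[OF tens_tvars(2)], rule IntD2[OF IntD1[OF tensH_supp]])
  fix v w assume "mset v = mset w" "odd_count v = card ({..<m * n} - D)"
  then show "odd_count w = card ({..<m * n} - D)" by (simp only: odd_count_mset)
qed (simp only: odd_count_dual odd_countH)

lemma tensG_homog: "D \<subseteq> {..<m * n} \<Longrightarrow> homog (Suc m * n - card D) (tensG m n D)"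
proof (rule tsupp_homog[OF tens_tvars(1)], rule IntD2[OF IntD1[OF tensG_supp]])
  fix v w assume "mset v = mset w" "odd_count v = Suc m * n - card D"
  then show "odd_count w = Suc m * n - card D" by (simp only: odd_count_mset)
qed (simp only: odd_countG)

lemma grade_sign_oprod:
  assumes "\<And>k. k < L \<Longrightarrow> godd (z k :: 'k::comm_ring_1 grassmann)" "D \<subseteq> {..<L}"
  shows "grade_sign q (oprod L D z) = (-1) ^ (q * card D) * oprod L D z"
proof -
  have "grade_sign q (oprod k D z) = (-1) ^ (q * card (D \<inter> {..<k})) * oprod k D z" if "k \<le> L" for k
    using that
  proof (induction k)
    case (Suc k)
    have "D \<inter> {..<Suc k} = (if k \<in> D then insert k (D \<inter> {..<k}) else D \<inter> {..<k})" by (auto simp: less_Suc_eq)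
    then have c: "card (D \<inter> {..<Suc k}) = card (D \<inter> {..<k}) + of_bool (k \<in> D)" by simp
    have o: "oprod (Suc k) D z = oprod k D z * (if k \<in> D then z k else 1)" by (simp add: oprod_def)
    have g: "grade_sign q (if k \<in> D then z k else 1) = (-1) ^ (q * of_bool (k \<in> D)) * (if k \<in> D then z k else 1)"
      using grade_sign_godd[of "z k" q] assms(1)[of k] Suc.prems by (cases "k \<in> D") (simp_all del: One_nat_def)
    have e: "q * card (D \<inter> {..<Suc k}) = q * card (D \<inter> {..<k}) + q * of_bool (k \<in> D)"
      unfolding c by (rule distrib_left)
    have comm: "(-1) ^ i * x * ((-1) ^ j * y) = (-1) ^ i * (-1) ^ j * (x * y)" for i j and x y :: "'k grassmann"
      by (cases "even j") (simp_all add: mult.assoc)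
    show ?case unfolding o grade_sign_mult g e power_add using Suc by (simp only: comm Suc_leD)
  qed (simp add: oprod_def)
  moreover have "D \<inter> {..<L} = D" using assms(2) by auto
  ultimately show ?thesis by (metis order_refl)
qed

definition integrand :: "nat \<Rightarrow> nat \<Rightarrow> (nat \<Rightarrow> 'k grassmann) \<Rightarrow> 'k::comm_ring_1 stensor" where
  "integrand m n z = altG m n (vecG m n z) * altH m n (vecH n z)"

text \<open>The signs of both expansions, the sign for moving the monomial of \<open>D\<close> past
  the tensor \<open>tensH\<close>, whose parity is the number of boxes outside \<open>D'\<close>,
  and the two stabilizer weights.\<close>

definition gam :: "nat \<Rightarrow> nat \<Rightarrow> nat set \<Rightarrow> nat set \<Rightarrow> 'k::field_char_0" where
  "gam m n D D' = (-1) ^ (signG m n D + signH m n D' + card ({..<m * n} - D') * card D) /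
    (of_nat (card (stabG m n D)) * of_nat (card (stabH m n D')))"

lemma integrand_expand:
  assumes z: "\<And>k. k < m * n \<Longrightarrow> godd (z k :: 'k::field_char_0 grassmann)"
  shows "integrand m n z = (\<Sum>D\<in>Pow {..<m * n}. \<Sum>D'\<in>Pow {..<m * n}. tensG m n D * tensH m n D' *
    scal (gconst (gam m n D D') * (oprod (m * n) D z * oprod (m * n) ({..<m * n} - D') z)))"
proof -
  let ?L = "m * n"
  have "tensG m n D * scal (gconst a * oprod ?L D z) * (tensH m n D' * scal (gconst b * oprod ?L D'' z)) =
      tensG m n D * tensH m n D' * scal (gconst ((-1) ^ (card ({..<?L} - D') * card D) * a * b) * (oprod ?L D z * oprod ?L D'' z))"
    if D: "D \<in> Pow {..<?L}" for D D' D'' and a b :: 'k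
  proof -
    let ?p = "card ({..<?L} - D')"
    have gs: "grade_sign ?p (oprod ?L D z) = gconst ((-1) ^ (?p * card D)) * oprod ?L D z"
      using grade_sign_oprod[where L = "m * n" and D = D and q = ?p and z = z, OF z] D by (simp add: gconst_m1)
    have c: "scal (gconst a * oprod ?L D z) * tensH m n D' = tensH m n D' * scal (grade_sign ?p (gconst a * oprod ?L D z))"
      by (rule scal_homog[OF tensH_homog])
    have "tensG m n D * scal (gconst a * oprod ?L D z) * (tensH m n D' * scal (gconst b * oprod ?L D'' z)) =
        tensG m n D * (scal (gconst a * oprod ?L D z) * tensH m n D') * scal (gconst b * oprod ?L D'' z)"
      by (simp only: mult.assoc)
    also have "\<dots> = tensG m n D * (tensH m n D' * scal (grade_sign ?p (gconst a * oprod ?L D z))) * scal (gconst b * oprod ?L D'' z)"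
      unfolding c ..
    also have "\<dots> = tensG m n D * tensH m n D' * scal (gconst a * (gconst ((-1) ^ (?p * card D)) * oprod ?L D z) * (gconst b * oprod ?L D'' z))"
      by (simp only: grade_sign_mult gs grade_sign_gconst scal_mult mult.assoc)
    also have "gconst a * (gconst ((-1) ^ (?p * card D)) * oprod ?L D z) * (gconst b * oprod ?L D'' z) =
        gconst a * gconst ((-1) ^ (?p * card D)) * (oprod ?L D z * gconst b) * oprod ?L D'' z"
      by (simp only: mult.assoc)
    also have "oprod ?L D z * gconst b = gconst b * oprod ?L D z"
      by (rule geven_commute[symmetric]) simp
    also have "gconst a * gconst ((-1) ^ (?p * card D)) * (gconst b * oprod ?L D z) * oprod ?L D'' z =
        gconst ((-1) ^ (?p * card D) * a * b) * (oprod ?L D z * oprod ?L D'' z)"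
      by (simp only: mult.assoc[symmetric] gconst_mult[symmetric] mult.commute[of a])
    finally show ?thesis .
  qed
  note main = this
  have gm: "(-1) ^ (card ({..<?L} - D') * card D) * ((-1) ^ signG m n D / of_nat (card (stabG m n D))) *
       ((-1) ^ signH m n D' / of_nat (card (stabH m n D'))) = (gam m n D D' :: 'k)" for D D'
    by (simp add: gam_def power_add mult_ac)
  have eG: "altG m n (vecG m n z) = (\<Sum>D\<in>Pow {..<m * n}.
      tensG m n D * scal (gconst ((-1) ^ signG m n D / of_nat (card (stabG m n D))) * oprod (m * n) D z))"
    using z by (rule altG_expand)
  have eH: "altH m n (vecH n z) = (\<Sum>D\<in>Pow {..<m * n}.
      tensH m n D * scal (gconst ((-1) ^ signH m n D / of_nat (card (stabH m n D))) * oprod (m * n) ({..<m * n} - D) z))"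
    using z by (rule altH_expand)
  from main have "integrand m n z = (\<Sum>D\<in>Pow {..<?L}. \<Sum>D'\<in>Pow {..<?L}. tensG m n D * tensH m n D' *
     scal (gconst ((-1) ^ (card ({..<?L} - D') * card D) * ((-1) ^ signG m n D / of_nat (card (stabG m n D))) *
       ((-1) ^ signH m n D' / of_nat (card (stabH m n D')))) * (oprod ?L D z * oprod ?L ({..<?L} - D') z)))"
    unfolding integrand_def eG eH sum_product
    by (intro sum.cong refl) simp
  then show ?thesis unfolding gm .
qed

lemma oprod_gmon:
  assumes "D \<subseteq> {..<L}"
  shows "oprod L D (\<lambda>k. gmon {N + k}) = (gmon ((+) N ` D) :: 'k::comm_ring_1 grassmann)"
proof -
  have "oprod k D (\<lambda>k. gmon {N + k}) = (gmon ((+) N ` (D \<inter> {..<k})) :: 'k grassmann)" if "k \<le> L" for k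
    using that
  proof (induction k)
    case (Suc k)
    have o: "oprod (Suc k) D (\<lambda>k. gmon {N + k}) = oprod k D (\<lambda>k. gmon {N + k}) * (if k \<in> D then gmon {N + k} else 1 :: 'k grassmann)"
      by (simp add: oprod_def)
    show ?case
    proof (cases "k \<in> D")
      case True
      let ?A = "(+) N ` (D \<inter> {..<k})"
      have "{(a, b). a \<in> ?A \<and> b \<in> {N + k} \<and> b < a} = {}" by auto
      then have "inversions ?A {N + k} = 0" unfolding inversions_def by (simp only: card.empty)
      moreover have "?A \<inter> {N + k} = {}" by auto
      moreover have "?A \<union> {N + k} = (+) N ` (D \<inter> {..<Suc k})" using True by (auto simp: less_Suc_eq)
      ultimately show ?thesis using Suc True by (simp add: o gmon_mult)
    next
      case False
      then have "D \<inter> {..<Suc k} = D \<inter> {..<k}" by (auto simp: less_Suc_eq)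
      then show ?thesis using Suc False by (simp add: o)
    qed
  qed (simp add: oprod_def)
  moreover have "D \<inter> {..<L} = D" using assms by auto
  ultimately show ?thesis by (metis order_refl)
qed

text \<open>If \<open>D\<close> is not contained in \<open>D'\<close>, a variable is repeated; if it
  is properly contained, a variable is missing. Only equality gives the top monomial.\<close>

lemma gtop_oprod:
  assumes D: "D \<subseteq> {..<L}" and D': "D' \<subseteq> {..<L}"
  shows "gtop N L (oprod L D (\<lambda>k. gmon {N + k}) * oprod L ({..<L} - D') (\<lambda>k. gmon {N + k})) =
    (if D' = D then (-1) ^ inversions D ({..<L} - D) else 0 :: 'k::comm_ring_1 grassmann)"
proof -
  let ?O = "{..<L} - D'" and ?s = "(+) N"
  have fin: "finite (?s ` D)" "finite (?s ` ?O)" using D by (auto intro: finite_subset)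
  have inv: "inversions (?s ` D) (?s ` ?O) = inversions D ?O"
  proof -
    have "bij_betw (\<lambda>(a, b). (N + a, N + b)) {(a, b). a \<in> D \<and> b \<in> ?O \<and> b < a} {(a, b). a \<in> ?s ` D \<and> b \<in> ?s ` ?O \<and> b < a}"
      by (auto simp: bij_betw_def inj_on_def image_iff)
    then show ?thesis unfolding inversions_def by (rule bij_betw_same_card[symmetric])
  qed
  have pow: "gtop N L ((-1) ^ i * x) = (-1) ^ i * gtop N L x" for i and x :: "'k grassmann"
    by (cases "even i") (auto simp: gtop_uminus)
  show ?thesis
  proof (cases "D \<inter> ?O = {}")
    case True
    then have disj: "?s ` D \<inter> ?s ` ?O = {}" by auto
    have un: "?s ` D \<union> ?s ` ?O = ?s ` (D \<union> ?O)" by auto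
    have sub: "D \<union> ?O \<subseteq> {..<L}" using D by auto
    have "D \<union> ?O = {..<L} \<longleftrightarrow> D' = D" using True D D' by auto
    then show ?thesis
      using oprod_gmon[OF D, of N, where 'k = 'k] oprod_gmon[of ?O L N, where 'k = 'k] True
      by (auto simp: gmon_mult[OF fin] disj un pow gtop_gmon[OF sub] inv)
  next
    case False
    then have "?s ` D \<inter> ?s ` ?O \<noteq> {}" by auto
    moreover have "D' \<noteq> D" using False by auto
    ultimately show ?thesis
      using oprod_gmon[OF D, of N, where 'k = 'k] oprod_gmon[of ?O L N, where 'k = 'k]
      by (auto simp: gmon_mult[OF fin])
  qed
qed

lemma ttop_integrand:
  "ttop N (m * n) (integrand m n (\<lambda>k. gmon {N + k})) = (\<Sum>D\<in>Pow {..<m * n}. tensG m n D * tensH m n D *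
    scal (gconst (gam m n D D * (-1) ^ inversions D ({..<m * n} - D) :: 'k::field_char_0)))"
proof -
  let ?L = "m * n" and ?z = "\<lambda>k. gmon {N + k} :: 'k grassmann"
  have z: "godd (?z k)" for k by (rule godd_gmon) simp
  have tv: "(tensG m n D * tensH m n D' :: 'k stensor) \<in> tvars {..<N}" for D D'
  proof -
    have "(tensG m n D * tensH m n D' :: 'k stensor) \<in> tvars {}" by (intro tvars_mult tens_tvars)
    then show ?thesis by (auto simp: tvars_def intro: gvars_mono)
  qed
  have "ttop N ?L (integrand m n ?z) = (\<Sum>D\<in>Pow {..<?L}. \<Sum>D'\<in>Pow {..<?L}. tensG m n D * tensH m n D' *
      scal (gconst (gam m n D D') * (if D' = D then (-1) ^ inversions D ({..<?L} - D) else 0)))"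
    unfolding integrand_expand[OF z] ttop_sum
    by (intro sum.cong refl) (simp only: ttop_mult_scal[OF tv] gtop_mult[OF gvars_simps(3)] gtop_oprod PowD)
  also have "\<dots> = (\<Sum>D\<in>Pow {..<?L}. \<Sum>D'\<in>Pow {..<?L}. if D' = D then tensG m n D * tensH m n D *
      scal (gconst (gam m n D D * (-1) ^ inversions D ({..<?L} - D))) else 0)"
    by (intro sum.cong refl) (auto simp: gconst_m1 gconst_mult)
  also have "\<dots> = (\<Sum>D\<in>Pow {..<?L}. tensG m n D * tensH m n D *
      scal (gconst (gam m n D D * (-1) ^ inversions D ({..<?L} - D))))"
    by (intro sum.cong refl) simp
  finally show ?thesis .
qed

text \<open>\<open>signG\<close> counts the pairs inside the small rectangle and, for every box of
  \<open>D\<close>, the \<open>n\<close> odd letters of the last row. Adding the inversions of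
  \<open>D\<close> against its complement completes the inner pairs to the full product of
  cardinalities, which then occurs twice.\<close>

lemma signG_parity:
  assumes D: "D \<subseteq> {..<m * n}"
  shows "even (signG m n D + card ({..<m * n} - D) * card D + inversions D ({..<m * n} - D)) = even (n * card D)"
proof -
  let ?O = "{..<m * n} - D"
  let ?A = "{(i, j). i \<in> D \<and> j \<in> ?O \<and> i < j}" and ?B = "D \<times> {m * n..<Suc m * n}"
  have fD: "finite D" using D by (auto intro: finite_subset)
  have "{(i, j). i < j \<and> j < Suc m * n \<and> i \<in> D \<and> odd_letter (letG n D j)} = ?A \<union> ?B"
    using D by (auto simp: odd_letG mult_Suc)
  moreover have "finite ?A" by (rule finite_subset[of _ "D \<times> ?O"]) (use fD in auto)
  moreover have "?A \<inter> ?B = {}" by auto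
  ultimately have "signG m n D = card ?A + card ?B"
    unfolding signG_def using fD by (simp only:) (subst card_Un_disjoint; simp)
  moreover have "card ?B = card D * n" using fD by (simp add: card_cartesian_product mult_Suc)
  moreover have "card ?A = inversions ?O D" unfolding inversions_def
    by (rule bij_betw_same_card[of prod.swap]) (auto simp: bij_betw_def inj_on_def image_iff)
  moreover have "inversions ?O D + inversions D ?O = card ?O * card D"
    by (rule inversions_swap) (use fD in auto)
  ultimately have E: "signG m n D + card ?O * card D + inversions D ?O = 2 * (card ?O * card D) + n * card D"
    by (simp add: mult_ac)
  show ?thesis unfolding E by simp
qed

text \<open>Self-adjointness moves the symmetrizers of the dual tensor to the other argument, where
  two Young symmetrizers meet and produce the factor \<open>z\<close>; the remaining coefficient is
  given by \<open>kc_young\<close>.\<close>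

lemma pairing_H:
  assumes z: "\<forall>x\<in>tlen (m * Suc n). rect.young m (Suc n) (rect.young m (Suc n) x) = of_int z * rect.young m (Suc n) (x :: 'k::field_char_0 stensor)"
  shows "kc (tensH m n D) v = kc (symz 1 (line_stab (\<lambda>k. k mod Suc n) (m * Suc n)) (symz 0 (line_stab (\<lambda>k. k div Suc n) (m * Suc n))
      (word (rect.tab_word m (Suc n) (letH n D)) :: 'k stensor))) (map dual v)"
    and "bform (symz 1 (line_stab (\<lambda>k. k mod Suc n) (m * Suc n)) (symz 0 (line_stab (\<lambda>k. k div Suc n) (m * Suc n))
      (word (rect.tab_word m (Suc n) (letH n D)) :: 'k stensor))) (rect.young m (Suc n) (word (rect.tab_word m (Suc n) (letH n D)))) =
      of_int z * (of_nat (card (stabH m n D)) * of_nat (card (rect.stab_in m (Suc n) (line_stab (\<lambda>k. k mod Suc n) (m * Suc n)) (letH n D))))"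
    and "pairing (tensH m n D) (canonical_tensor (lambda_h m n) (fillH m n D) :: 'k stensor) =
      gconst ((-1) ^ signH m n D * (of_int z * (of_nat (card (stabH m n D)) *
        of_nat (card (rect.stab_in m (Suc n) (line_stab (\<lambda>k. k mod Suc n) (m * Suc n)) (letH n D))))))"
proof -
  let ?W = "rect.tab_word m (Suc n) (letH n D)"
  let ?w = "word ?W :: 'k stensor"
  let ?C = "symz 1 (line_stab (\<lambda>k. k mod Suc n) (m * Suc n)) :: 'k stensor \<Rightarrow> 'k stensor"
  let ?R = "symz 0 (line_stab (\<lambda>k. k div Suc n) (m * Suc n)) :: 'k stensor \<Rightarrow> 'k stensor"
  have w: "?w \<in> tlen (m * Suc n)" by (simp add: lengthH)
  have tl: "?R ?w \<in> tlen (m * Suc n)" "?C ?w \<in> tlen (m * Suc n)" "?R (?C ?w) \<in> tlen (m * Suc n)" "?C (?R (?C ?w)) \<in> tlen (m * Suc n)"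
    by (intro symz_tlen w)+
  have y: "rect.young m (Suc n) x = ?R (?C x)" for x :: "'k stensor" by (simp add: rect.young_def)
  have dual: "tensH m n D = dl (?C (?R ?w))"
    unfolding tensH_symz dl_symz[OF tl(1)] dl_symz[OF w] dl_word ..
  show "kc (tensH m n D) v = kc (?C (?R ?w)) (map dual v)"
    using tcoeff_dl[of "?C (?R ?w)" "map dual v"] by (simp add: dual kc_def o_def)
  have "bform (?C (?R ?w)) (?R (?C ?w)) = bform (?R ?w) (?C (?R (?C ?w)))"
    by (rule bform_symz[OF tl(1,3)])
  also have "\<dots> = bform ?w (?R (?C (?R (?C ?w))))" by (rule bform_symz[OF w tl(4)])
  also have "?R (?C (?R (?C ?w))) = of_int z * ?R (?C ?w)" using z[rule_format, OF w] by (simp only: y)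
  also have "bform ?w (of_int z * ?R (?C ?w)) = of_int z * kc (rect.young m (Suc n) ?w) ?W"
    by (simp only: bform_of_int_right bform_word(2) y)
  also have "kc (rect.young m (Suc n) ?w) ?W = of_nat (card (stabH m n D)) *
      of_nat (card (rect.stab_in m (Suc n) (line_stab (\<lambda>k. k mod Suc n) (m * Suc n)) (letH n D)))"
    using rect.kc_young[OF fillingH fillingH refl, of m n D, where 'k = 'k] by simp
  finally show b: "bform (?C (?R ?w)) (rect.young m (Suc n) ?w) = of_int z * (of_nat (card (stabH m n D)) *
      of_nat (card (rect.stab_in m (Suc n) (line_stab (\<lambda>k. k mod Suc n) (m * Suc n)) (letH n D))))"
    by (simp only: y)
  have can: "canonical_tensor (lambda_h m n) (fillH m n D) = rect.young m (Suc n) ?w"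
    unfolding canonical_tensor_def wordH using rect.young_left_rect[OF w] by (simp add: lambda_h_def)
  have s: "(\<Sum>i<odd_count ?W. i) = signH m n D"
  proof -
    have "{(i, j). i < j \<and> j < length ?W \<and> odd_letter (?W ! i) \<and> odd_letter (?W ! j)} =
        {(i, j). i < j \<and> j < m * Suc n \<and> oddH n D i \<and> odd_letter (letH n D j)}"
      by (auto simp: lengthH rect.tab_word_nth odd_letH)
    then show ?thesis using odd_pairs_card[of ?W] by (simp add: signH_def)
  qed
  have tv: "?C (?R ?w) \<in> tvars {}" "?R (?C ?w) \<in> tvars {}" by (intro symz_tvars tvars_simps)+
  have "?w \<in> tsupp (\<lambda>v. odd_count v = odd_count ?W)" by (rule tsupp_word) simp
  then have ts: "?R (?C ?w) \<in> tsupp (\<lambda>v. odd_count v = odd_count ?W)"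
    by (intro tsupp_symz w tl) (auto dest: odd_count_mset_eq)
  show "pairing (tensH m n D) (canonical_tensor (lambda_h m n) (fillH m n D) :: 'k stensor) =
      gconst ((-1) ^ signH m n D * (of_int z * (of_nat (card (stabH m n D)) *
        of_nat (card (rect.stab_in m (Suc n) (line_stab (\<lambda>k. k mod Suc n) (m * Suc n)) (letH n D))))))"
    unfolding dual can b[symmetric] s[symmetric] y by (rule pairing_dl[OF tv ts])
qed

lemma canonical_fillings_box:
  "F \<in> canonical_fillings m n (replicate r N) \<longleftrightarrow> F \<in> extensional ({..<r} \<times> {..<N}) \<and>
    (\<forall>i<r. \<forall>j<N. (F (i, j) = E i \<and> i < m) \<or> (F (i, j) = Eps j \<and> j < n))"
proof -
  have pt: "v \<in> Omega m n \<and> (\<forall>k. v = E k \<longrightarrow> k = i) \<and> (\<forall>k. v = Eps k \<longrightarrow> k = j) \<longleftrightarrow>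
      (v = E i \<and> i < m) \<or> (v = Eps j \<and> j < n)" for v i j
    by (cases v) (auto simp: Omega_def)
  have "F \<in> canonical_fillings m n (replicate r N) \<longleftrightarrow> F \<in> extensional ({..<r} \<times> {..<N}) \<and>
    (\<forall>i<r. \<forall>j<N. F (i, j) \<in> Omega m n \<and> (\<forall>k. F (i, j) = E k \<longrightarrow> k = i) \<and> (\<forall>k. F (i, j) = Eps k \<longrightarrow> k = j))"
    unfolding canonical_fillings_def set_boxes_rect mem_Collect_eq PiE_iff by blast
  then show ?thesis by (simp only: pt)
qed

text \<open>A pair of matching fillings is determined by the set \<open>D\<close> of boxes of the
  small rectangle with even letters, since the last column of \<open>lambda_h\<close> and the last
  row of \<open>lambda_g\<close> are forced.\<close>

lemma sum_matching:
  "(\<Sum>(H, F)\<in>matching_fillings m n. \<Phi> H F) = (\<Sum>D\<in>Pow {..<m * n}. \<Phi> (fillH m n D) (fillG m n D))"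
proof -
  let ?p = "\<lambda>b. (b div n, b mod n)"
  have mf: "(H, F) \<in> matching_fillings m n \<longleftrightarrow> H \<in> canonical_fillings m n (replicate m (Suc n)) \<and>
      F \<in> canonical_fillings m n (replicate (Suc m) n) \<and> (\<forall>i<m. \<forall>j<n. H (i, j) = F (i, j))" for H F
    by (simp add: matching_fillings_def lambda_h_def lambda_g_def)
  have bm: "b mod n < n" "b div n < m" if "b < m * n" for b
    using mod_less_rect[OF that] less_mult_imp_div_less[OF that] by auto
  have "bij_betw (\<lambda>D. (fillH m n D, fillG m n D)) (Pow {..<m * n}) (matching_fillings m n)"
  proof (rule bij_betw_byWitness[where f' = "\<lambda>(H, F). {b. b < m * n \<and> \<not> odd_letter (F (?p b))}"])
    show "\<forall>D\<in>Pow {..<m * n}. (\<lambda>(H, F). {b. b < m * n \<and> \<not> odd_letter (F (?p b))}) (fillH m n D, fillG m n D) = D"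
    proof
      fix D assume D: "D \<in> Pow {..<m * n}"
      have "fillG m n D (?p b) = letG n D b" if "b < m * n" for b
        using fillG_box[of b m n D] that by (simp add: mult_Suc)
      then show "(\<lambda>(H, F). {b. b < m * n \<and> \<not> odd_letter (F (?p b))}) (fillH m n D, fillG m n D) = D"
        using D by (auto simp: odd_letG)
    qed
    show "(\<lambda>D. (fillH m n D, fillG m n D)) ` Pow {..<m * n} \<subseteq> matching_fillings m n"
    proof (rule image_subsetI)
      fix D assume "D \<in> Pow {..<m * n}"
      then have D: "D \<subseteq> {..<m * n}" by simp
      have im: "i < m" if "i * n + j \<in> D" "j < n" for i j
      proof -
        have "i * n + j < m * n" using D that by auto
        then have "(i * n + j) div n < m" by (rule less_mult_imp_div_less)
        then show ?thesis using that by simp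
      qed
      show "(fillH m n D, fillG m n D) \<in> matching_fillings m n"
        unfolding mf canonical_fillings_box using im
        by (auto simp: fillG_def fillH_def restrict_def extensional_def)
    qed
    show "(\<lambda>(H, F). {b. b < m * n \<and> \<not> odd_letter (F (?p b))}) ` matching_fillings m n \<subseteq> Pow {..<m * n}" by auto
    show "\<forall>a\<in>matching_fillings m n. (fillH m n ((\<lambda>(H, F). {b. b < m * n \<and> \<not> odd_letter (F (?p b))}) a),
        fillG m n ((\<lambda>(H, F). {b. b < m * n \<and> \<not> odd_letter (F (?p b))}) a)) = a"
    proof
      fix a assume a: "a \<in> matching_fillings m n"
      obtain H F where aHF: "a = (H, F)" by (cases a)
      have "(H, F) \<in> matching_fillings m n" using a aHF by simp
      then have He: "H \<in> extensional ({..<m} \<times> {..<Suc n})" and Fe: "F \<in> extensional ({..<Suc m} \<times> {..<n})"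
        and Hc: "\<And>i j. i < m \<Longrightarrow> j < Suc n \<Longrightarrow> H (i, j) = E i \<or> (H (i, j) = Eps j \<and> j < n)"
        and Fc: "\<And>i j. i < Suc m \<Longrightarrow> j < n \<Longrightarrow> (F (i, j) = E i \<and> i < m) \<or> F (i, j) = Eps j"
        and HF: "\<And>i j. i < m \<Longrightarrow> j < n \<Longrightarrow> H (i, j) = F (i, j)"
        unfolding mf canonical_fillings_box by blast+
      let ?D = "{b. b < m * n \<and> \<not> odd_letter (F (?p b))}"
      have inD: "i * n + j \<in> ?D \<longleftrightarrow> i < m \<and> \<not> odd_letter (F (i, j))" if "j < n" for i j
      proof -
        have "i * n + j < m * n \<longleftrightarrow> i < m"
          using rect_index[of i m j n] less_mult_imp_div_less[of "i * n + j" m n] that by auto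
        then show ?thesis using that by simp
      qed
      have "fillG m n ?D (i, j) = F (i, j)" for i j
        using Fc[of i j] Fe inD[of j i] by (cases "i < Suc m \<and> j < n") (auto simp: fillG_def extensional_def)
      moreover have "fillH m n ?D (i, j) = H (i, j)" for i j
      proof (cases "i < m \<and> j < Suc n")
        case True
        then show ?thesis using Hc[of i j] HF[of i j] inD[of j i] by (cases "j < n") (auto simp: fillH_def)
      next
        case False
        then show ?thesis using He by (auto simp: fillH_def extensional_def)
      qed
      ultimately show "(fillH m n ((\<lambda>(H, F). {b. b < m * n \<and> \<not> odd_letter (F (?p b))}) a),
        fillG m n ((\<lambda>(H, F). {b. b < m * n \<and> \<not> odd_letter (F (?p b))}) a)) = a"
        unfolding aHF by (auto simp: fun_eq_iff)
    qed
  qed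
  from sum.reindex_bij_betw[OF this, of "\<lambda>(H, F). \<Phi> H F"] show ?thesis by simp
qed

text \<open>By \<open>kappa_rect\<close> the factorials in \<open>alpha\<close> are orders of column
  stabilizers. Hence they cancel against those in the integral and in the pairing.\<close>

lemma alpha_fill:
  assumes D: "D \<subseteq> {..<m * n}"
  shows "(alpha m n (fillH m n D) (fillG m n D) :: 'k::field_char_0) = (-1) ^ (n * card ({..<m * n} - D)) *
    of_nat (card (rect.stab_in m (Suc n) (line_stab (\<lambda>k. k mod Suc n) (m * Suc n)) (letH n D))) / of_nat (card (stabG m n D))"
proof -
  have "rho m n (fillH m n D) = card ({..<m * n} - D)"
    unfolding rho_def
  proof (rule bij_betw_same_card[of "\<lambda>(i, j). i * n + j"], rule bij_betw_byWitness[where f' = "\<lambda>b. (b div n, b mod n)"])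
    show "(\<lambda>(i, j). i * n + j) ` {(i, j). i < m \<and> j < n \<and> odd_letter (fillH m n D (i, j))} \<subseteq> {..<m * n} - D"
      by (auto simp: rect_index fillH_def split: if_splits)
    show "(\<lambda>b. (b div n, b mod n)) ` ({..<m * n} - D) \<subseteq> {(i, j). i < m \<and> j < n \<and> odd_letter (fillH m n D (i, j))}"
    proof (rule image_subsetI)
      fix b assume b: "b \<in> {..<m * n} - D"
      then have "b div n < m" "b mod n < n" using mod_less_rect[of b m n] less_mult_imp_div_less[of b m n] by auto
      moreover have "b div n * n + b mod n = b" by (rule div_mult_mod_eq)
      ultimately show "(b div n, b mod n) \<in> {(i, j). i < m \<and> j < n \<and> odd_letter (fillH m n D (i, j))}"
        using b by (simp add: fillH_def)
    qed
  qed (auto simp: div_mult_mod_eq)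
  moreover have "kappa n (lambda_h m n) (fillH m n D) = card (rect.stab_in m (Suc n) (line_stab (\<lambda>k. k mod Suc n) (m * Suc n)) (letH n D))"
    unfolding lambda_h_def Suc_eq_plus1[symmetric]
    by (rule kappa_rect[OF fillingH]) (auto simp: fillH_box odd_letH oddH_def)
  moreover have "kappa n (lambda_g m n) (fillG m n D) = card (stabG m n D)"
    unfolding lambda_g_def Suc_eq_plus1[symmetric]
    by (rule kappa_rect[OF fillingG]) (auto simp: fillG_box not_le dest: mod_less_rect)
  ultimately show ?thesis by (simp add: alpha_def)
qed

text \<open>In the quotient of \<open>alpha\<close> by the pairing the column stabilizer of the
  filling of \<open>lambda_h\<close> cancels, and the weights left are those of \<open>gam\<close>.
  The nonzero coefficient of \<open>tensH m n {}\<close> is recorded for the proof that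
  \<open>b_star\<close> does not vanish.\<close>

theorem b_star_integral:
  obtains \<kappa> :: "'k::field_char_0" where "\<kappa> \<noteq> 0"
    "\<And>N. ttop N (m * n) (integrand m n (\<lambda>k. gmon {N + k})) = b_star m n * scal (gconst \<kappa>)"
    "b_star m n = (\<Sum>D\<in>Pow {..<m * n}. tensG m n D * tensH m n D * scal (gconst (gam m n D D * (-1) ^ inversions D ({..<m * n} - D) / \<kappa>)))"
    "\<exists>v. kc (tensH m n {} :: 'k stensor) v \<noteq> 0"
proof -
  obtain z :: int where z: "\<forall>x\<in>tlen (m * Suc n). rect.young m (Suc n) (rect.young m (Suc n) x) = of_int z * rect.young m (Suc n) (x :: 'k stensor)"
    using rect.young_quasi_idempotent[of m "Suc n", where 'k = 'k] by auto
  have z0: "z \<noteq> 0" by (rule rect.young_factor_nonzero[OF z])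
  let ?SC = "\<lambda>D. card (rect.stab_in m (Suc n) (line_stab (\<lambda>k. k mod Suc n) (m * Suc n)) (letH n D))"
  \<comment> \<open>The constant of quasi-idempotence and the part of the sign that does not depend
    on \<open>D\<close>; neither involves \<open>N\<close>.\<close>
  define \<kappa> :: 'k where "\<kappa> = of_int z * (-1) ^ (n * (m * n))"
  have k0: "\<kappa> \<noteq> 0" using z0 by (simp add: \<kappa>_def)
  have trm: "tensG m n D * h_dual' m n (fillH m n D) (fillG m n D) =
      tensG m n D * tensH m n D * scal (gconst (gam m n D D * (-1) ^ inversions D ({..<m * n} - D) / \<kappa>))"
    if D: "D \<in> Pow {..<m * n}" for D
  proof -
    have Ds: "D \<subseteq> {..<m * n}" using D by simp
    let ?P = "(-1) ^ signH m n D * (of_int z * (of_nat (card (stabH m n D)) * of_nat (?SC D))) :: 'k"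
    let ?al = "alpha m n (fillH m n D) (fillG m n D) :: 'k"
    have nz: "(of_nat (card (stabH m n D)) :: 'k) \<noteq> 0" "(of_nat (?SC D) :: 'k) \<noteq> 0" "(of_nat (card (stabG m n D)) :: 'k) \<noteq> 0"
      using card_stab_in_nonzero by simp_all
    have P0: "?P \<noteq> 0" using z0 nz by simp
    have h: "h_dual' m n (fillH m n D) (fillG m n D) = tensH m n D * scal (gconst (?al * inverse ?P))"
      unfolding h_dual'_def Let_def pairing_H(3)[OF z] ring_inv_gconst[OF P0] gconst_mult[symmetric]
      by (rule scal_geven_commute) simp
    have cD: "card ({..<m * n} - D) + card D = m * n"
      using card_Diff_subset[of D "{..<m * n}"] card_mono[of "{..<m * n}" D] Ds finite_subset[OF Ds] by simp
    \<comment> \<open>This is what the sign in \<open>alpha\<close> is for: \<open>n\<close> times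
      the number of odd boxes differs from the exponent \<open>n * card D\<close> of
      \<open>signG_parity\<close> by the constant \<open>n * (m * n)\<close>, modulo 2.\<close>
    have "even (n * card ({..<m * n} - D) + signH m n D + n * (m * n)) = even (signG m n D + signH m n D + card ({..<m * n} - D) * card D + inversions D ({..<m * n} - D))"
    proof -
      have "n * card ({..<m * n} - D) + n * card D = n * (m * n)" unfolding distrib_left[symmetric] cD ..
      from this[symmetric] show ?thesis using signG_parity[OF Ds] by (auto simp: even_add)
    qed
    then have sg: "(-1 :: 'k) ^ (n * card ({..<m * n} - D) + signH m n D + n * (m * n)) =
        (-1) ^ (signG m n D + signH m n D + card ({..<m * n} - D) * card D + inversions D ({..<m * n} - D))"
      by (rule m1_parity_eq)
    have inv1: "inverse ((-1 :: 'k) ^ i) = (-1) ^ i" for i by (cases "even i") auto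
    have "?al * inverse ?P = (-1) ^ (n * card ({..<m * n} - D) + signH m n D) / (of_nat (card (stabG m n D)) * of_int z * of_nat (card (stabH m n D)))"
      unfolding alpha_fill[OF Ds] using nz z0 by (simp add: field_simps power_add inv1)
    also have "\<dots> = (-1) ^ (n * card ({..<m * n} - D) + signH m n D + n * (m * n)) / (of_nat (card (stabG m n D)) * of_nat (card (stabH m n D)) * \<kappa>)"
      unfolding \<kappa>_def using nz z0 by (simp add: field_simps power_add)
    also have "\<dots> = gam m n D D * (-1) ^ inversions D ({..<m * n} - D) / \<kappa>"
      unfolding sg gam_def using nz k0 by (simp add: field_simps power_add)
    finally show ?thesis unfolding h by (simp only: mult.assoc)
  qed
  have b: "b_star m n = (\<Sum>D\<in>Pow {..<m * n}. tensG m n D * tensH m n D * scal (gconst (gam m n D D * (-1) ^ inversions D ({..<m * n} - D) / \<kappa>)))"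
    unfolding b_star_def sum_matching by (rule sum.cong[OF refl trm])
  have "ttop N (m * n) (integrand m n (\<lambda>k. gmon {N + k})) = b_star m n * scal (gconst \<kappa>)" for N
    unfolding ttop_integrand b sum_distrib_right
  proof (intro sum.cong refl)
    fix D
    have "gconst (gam m n D D * (-1) ^ inversions D ({..<m * n} - D)) =
        gconst (gam m n D D * (-1) ^ inversions D ({..<m * n} - D) / \<kappa>) * gconst \<kappa>"
      unfolding gconst_mult[symmetric] using k0 by simp
    then show "tensG m n D * tensH m n D * scal (gconst (gam m n D D * (-1) ^ inversions D ({..<m * n} - D))) =
        tensG m n D * tensH m n D * scal (gconst (gam m n D D * (-1) ^ inversions D ({..<m * n} - D) / \<kappa>)) * scal (gconst \<kappa>)"
      by (simp only: scal_mult mult.assoc)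
  qed
  moreover have "\<exists>v. kc (tensH m n {} :: 'k stensor) v \<noteq> 0"
  proof (rule ccontr)
    assume "\<not> ?thesis"
    then have 0: "kc (tensH m n {} :: 'k stensor) v = 0" for v by simp
    let ?x = "symz 1 (line_stab (\<lambda>k. k mod Suc n) (m * Suc n)) (symz 0 (line_stab (\<lambda>k. k div Suc n) (m * Suc n))
      (word (rect.tab_word m (Suc n) (letH n {})) :: 'k stensor))"
    have "kc ?x v = 0" for v
      using pairing_H(1)[OF z, of "{}" "map dual v"] 0[of "map dual v"] by (simp add: o_def)
    then have "bform ?x (rect.young m (Suc n) (word (rect.tab_word m (Suc n) (letH n {})))) = 0" by (simp add: bform_def)
    then show False unfolding pairing_H(2)[OF z] using z0 card_stab_in_nonzero by simp
  qed
  ultimately show ?thesis using that k0 b by blast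
qed

lemma kc_mult_append: "x \<in> tlen (length u) \<Longrightarrow> kc (x * y) (u @ v) = kc x u * kc y v"
  by (simp add: kc_def tcoeff_mult_append gcoeff_mult gcoeff_grade_sign)

section \<open>Shape, parity and nonvanishing of the tensor\<close>

lemma b_star_properties:
  shows b_star_tvars: "(b_star m n :: 'k::field_char_0 stensor) \<in> tvars {}"
    and b_star_homog: "homog n (b_star m n :: 'k stensor)"
    and b_star_tensors: "(b_star m n :: 'k stensor) \<in> tensors m n ((m + 1) * n) (m * (n + 1))"
    and b_star_nonzero: "\<exists>u. kc (b_star m n :: 'k stensor) u \<noteq> 0"
proof -
  obtain \<kappa> :: 'k where k0: "\<kappa> \<noteq> 0"
    and b: "b_star m n = (\<Sum>D\<in>Pow {..<m * n}. tensG m n D * tensH m n D * scal (gconst (gam m n D D * (-1) ^ inversions D ({..<m * n} - D) / \<kappa>)))"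
    and nz: "\<exists>v. kc (tensH m n {} :: 'k stensor) v \<noteq> 0"
    by (rule b_star_integral[of m n, where 'k = 'k]) (rule that; assumption)
  show "(b_star m n :: 'k stensor) \<in> tvars {}"
    unfolding b by (intro tvars_sum tvars_mult tens_tvars tvars_scal gvars_simps)
  show "homog n (b_star m n :: 'k stensor)"
    unfolding b
  proof (rule homog_sum)
    fix D assume D: "D \<in> Pow {..<m * n}"
    then have Ds: "D \<subseteq> {..<m * n}" by simp
    \<comment> \<open>An even box of the small rectangle lowers the number of odd letters in both
      fillings, so the parity of the product is that of the \<open>n\<close> odd letters in the last
      row of \<open>lambda_g\<close>.\<close>
    let ?p = "Suc m * n - card D + card ({..<m * n} - D) + 0"
    have "card D \<le> m * n" "card ({..<m * n} - D) = m * n - card D"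
      using card_mono[OF _ Ds] card_Diff_subset[OF finite_subset[OF Ds] Ds] by auto
    then have "?p = n + 2 * (m * n - card D)" by (simp add: mult_Suc)
    then have "even ?p = even n" by simp
    moreover have "homog ?p (tensG m n D * tensH m n D * scal (gconst (gam m n D D * (-1) ^ inversions D ({..<m * n} - D) / \<kappa>)))"
      by (intro homog_mult tensG_homog[OF Ds] tensH_homog homog_scal) simp
    ultimately show "homog n (tensG m n D * tensH m n D * scal (gconst (gam m n D D * (-1) ^ inversions D ({..<m * n} - D) / \<kappa>)))"
      using homog_cong by blast
  qed
  show "(b_star m n :: 'k stensor) \<in> tensors m n ((m + 1) * n) (m * (n + 1))"
  proof -
    let ?k = "Suc m * n" and ?l = "m * Suc n"
    have "(tensG m n D * tensH m n D * scal c :: 'k stensor) \<in> tsupp (\<lambda>w. length w = ?k + ?l \<and> set (take ?k w) \<subseteq> Omega m n \<and> set (drop ?k w) \<subseteq> dual ` Omega m n)"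
      if D: "D \<in> Pow {..<m * n}" for D c
    proof (rule tsupp_mult_scal, unfold tsupp_def mem_Collect_eq, intro allI impI)
      fix w assume w: "tcoeff (tensG m n D * tensH m n D :: 'k stensor) w \<noteq> 0"
      have len: "length w = ?k + ?l" using w tlen_mult[OF tens_tlen] unfolding tlen_def by blast
      have Om: "letG n D k \<in> Omega m n" if "k < ?k" for k
        using that D mod_less_rect[OF that] by (auto simp: letG_def Omega_def less_mult_imp_div_less)
      have OmH: "letH n D k \<in> Omega m n" if "k < ?l" for k
        using that by (auto simp: letH_def oddH_def Omega_def less_mult_imp_div_less)
      have sG: "(tensG m n D :: 'k stensor) \<in> tsupp (\<lambda>v. set v \<subseteq> Omega m n)"
        by (rule IntD2[OF IntD1[OF tensG_supp]], blast dest: mset_eq_setD) (auto simp: rect.tab_word_def Om)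
      have sH: "(tensH m n D :: 'k stensor) \<in> tsupp (\<lambda>v. set v \<subseteq> dual ` Omega m n)"
        by (rule IntD2[OF IntD1[OF tensH_supp]], blast dest: mset_eq_setD) (auto simp: rect.tab_word_def OmH)
      have "tcoeff (tensG m n D * tensH m n D :: 'k stensor) (take ?k w @ drop ?k w) =
          grade_sign (odd_count (drop ?k w)) (tcoeff (tensG m n D) (take ?k w)) * tcoeff (tensH m n D) (drop ?k w)"
        by (rule tcoeff_mult_append) (use tens_tlen(1)[of m n D] len in simp)
      then have "tcoeff (tensG m n D :: 'k stensor) (take ?k w) \<noteq> 0" "tcoeff (tensH m n D :: 'k stensor) (drop ?k w) \<noteq> 0"
        using w by auto
      then show "length w = ?k + ?l \<and> set (take ?k w) \<subseteq> Omega m n \<and> set (drop ?k w) \<subseteq> dual ` Omega m n"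
        using len sG sH unfolding tsupp_def by blast
    qed
    then have "(b_star m n :: 'k stensor) \<in> tsupp (\<lambda>w. length w = ?k + ?l \<and> set (take ?k w) \<subseteq> Omega m n \<and> set (drop ?k w) \<subseteq> dual ` Omega m n)"
      unfolding b by (rule tsupp_sum)
    then show ?thesis by (simp add: tensors_def tsupp_def)
  qed
  show "\<exists>u. kc (b_star m n :: 'k stensor) u \<noteq> 0"
  proof -
    obtain v where v: "kc (tensH m n {} :: 'k stensor) v \<noteq> 0" using nz by blast
    \<comment> \<open>The word with odd letters only: every other set \<open>D\<close> gives fewer
      odd letters, so a single summand contributes to the coefficient.\<close>
    let ?W = "rect.tab_word (Suc m) n (letG n {})"
    have zero: "kc (tensG m n D :: 'k stensor) ?W = 0" if D: "D \<in> Pow {..<m * n}" "D \<noteq> {}" for D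
    proof -
      have Ds: "D \<subseteq> {..<m * n}" "finite D" using D finite_subset by auto
      then have "card D > 0" "card D \<le> m * n" using D(2) card_mono[OF _ Ds(1)] by (auto simp: card_gt_0_iff)
      then have "odd_count ?W \<noteq> Suc m * n - card D" unfolding odd_countG[OF empty_subsetI] by (simp add: mult_Suc)
      moreover have "(tensG m n D :: 'k stensor) \<in> tsupp (\<lambda>v. odd_count v = Suc m * n - card D)"
        by (rule IntD2[OF IntD1[OF tensG_supp]]) (simp_all only: odd_count_mset odd_countG[OF Ds(1), unfolded odd_count_mset])
      ultimately have "tcoeff (tensG m n D :: 'k stensor) ?W = 0" unfolding tsupp_def by blast
      then show ?thesis by (simp add: kc_def)
    qed
    have tl: "tensG m n D \<in> (tlen (length ?W) :: 'k stensor set)" for D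
      using tens_tlen(1)[of m n D, where 'k = 'k] by (simp add: lengthG)
    let ?c = "\<lambda>D. gam m n D D * (-1) ^ inversions D ({..<m * n} - D) / \<kappa>"
    have "kc (b_star m n) (?W @ v) = (\<Sum>D\<in>Pow {..<m * n}. kc (tensG m n D) ?W * kc (tensH m n D) v * ?c D)"
      unfolding b kc_sum kc_mult_scal kc_mult_append[OF tl] by (simp add: gcoeff_gconst)
    also have "\<dots> = (\<Sum>D\<in>Pow {..<m * n}. if D = {} then kc (tensG m n {}) ?W * kc (tensH m n {}) v * ?c {} else 0)"
      by (intro sum.cong refl) (auto simp: zero)
    also have "\<dots> = kc (tensG m n {}) ?W * kc (tensH m n {}) v * ?c {}" by simp
    also have "\<dots> \<noteq> 0"
    proof -
      have "kc (tensG m n {} :: 'k stensor) ?W \<noteq> 0"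
        unfolding tensG_young using rect.kc_young[OF fillingG fillingG refl, of "Suc m" n "{}", where 'k = 'k] card_stab_in_nonzero by simp
      moreover have "?c {} \<noteq> 0" using k0 card_stab_in_nonzero by (simp add: gam_def)
      ultimately show ?thesis using v by simp
    qed
    finally show ?thesis by blast
  qed
qed

text \<open>A linear substitution with coefficients free of the integration variables acts on the
  integral through the change of variables it induces on the integrand.\<close>

lemma b_star_transform:
  fixes f :: "letter \<Rightarrow> 'k::field_char_0 stensor"
  assumes f: "\<And>l. f l \<in> tvars {..<N}" and ev: "geven s" "geven \<chi>"
    and z: "\<And>k. k < m * n \<Longrightarrow> godd (z k)"
    and int: "hom_ext f (integrand m n (\<lambda>k. gmon {N + k})) = integrand m n z * scal s"
    and top: "\<And>ks. set ks \<subseteq> {..<m * n} \<Longrightarrow> gtop N (m * n) (prod_list (map z ks) * s) =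
      \<chi> * gtop N (m * n) (prod_list (map (\<lambda>k. gmon {N + k}) ks))"
  shows "hom_ext f (b_star m n) = b_star m n * scal \<chi>"
proof -
  let ?L = "m * n" and ?e = "\<lambda>k. gmon {N + k} :: 'k grassmann"
  obtain \<kappa> :: 'k where k0: "\<kappa> \<noteq> 0" and k: "\<And>N. ttop N ?L (integrand m n (\<lambda>k. gmon {N + k})) = b_star m n * scal (gconst \<kappa>)"
    by (rule b_star_integral[of m n, where 'k = 'k]) (rule that; assumption)
  have e: "godd (?e k)" for k by (rule godd_gmon) simp
  have tv: "(tensG m n D * tensH m n D' :: 'k stensor) \<in> tvars {..<N}" for D D'
  proof -
    have "(tensG m n D * tensH m n D' :: 'k stensor) \<in> tvars {}" by (intro tvars_mult tens_tvars)
    then show ?thesis by (auto simp: tvars_def intro: gvars_mono)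
  qed
  have op: "oprod ?L D y = prod_list (map y (filter (\<lambda>k. k \<in> D) [0..<?L]))" for D and y :: "nat \<Rightarrow> 'k grassmann"
  proof -
    have "prod_list (map (\<lambda>k. if k \<in> D then y k else 1) ks) = prod_list (map y (filter (\<lambda>k. k \<in> D) ks))" for ks
      by (induction ks) auto
    then show ?thesis by (simp add: oprod_def)
  qed
  \<comment> \<open>Both monomials together form a product over a list of variables, possibly with
    repetitions; for this reason \<open>top\<close> speaks about lists.\<close>
  have pt: "gtop N ?L (oprod ?L D z * oprod ?L D' z * s) = \<chi> * gtop N ?L (oprod ?L D ?e * oprod ?L D' ?e)" for D D'
    using top[of "filter (\<lambda>k. k \<in> D) [0..<?L] @ filter (\<lambda>k. k \<in> D') [0..<?L]"] unfolding op by auto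
  have ez: "integrand m n z = (\<Sum>D\<in>Pow {..<m * n}. \<Sum>D'\<in>Pow {..<m * n}. tensG m n D * tensH m n D' *
      scal (gconst (gam m n D D') * (oprod (m * n) D z * oprod (m * n) ({..<m * n} - D') z)))"
    using z by (rule integrand_expand)
  have "ttop N ?L (integrand m n z * scal s) = ttop N ?L (integrand m n ?e) * scal \<chi>"
    unfolding ez integrand_expand[of m n ?e, OF e] sum_distrib_right ttop_sum
  proof (intro sum.cong refl)
    fix D D'
    let ?g = "gconst (gam m n D D') :: 'k grassmann" and ?O = "{..<?L} - D'"
    have "ttop N ?L (tensG m n D * tensH m n D' * scal (?g * (oprod ?L D z * oprod ?L ?O z)) * scal s) =
        tensG m n D * tensH m n D' * scal (gtop N ?L (?g * (oprod ?L D z * oprod ?L ?O z * s)))"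
      by (simp only: mult.assoc[of _ "scal _" "scal s"] scal_mult[symmetric] ttop_mult_scal[OF tv]) (simp only: mult.assoc)
    also have "gtop N ?L (?g * (oprod ?L D z * oprod ?L ?O z * s)) = ?g * (gtop N ?L (oprod ?L D ?e * oprod ?L ?O ?e) * \<chi>)"
      unfolding gtop_mult[OF gvars_simps(3)] pt geven_commute[OF ev(2)] ..
    also have "\<dots> = gtop N ?L (?g * (oprod ?L D ?e * oprod ?L ?O ?e)) * \<chi>"
      unfolding gtop_mult[OF gvars_simps(3)] by (simp only: mult.assoc)
    finally show "ttop N ?L (tensG m n D * tensH m n D' * scal (?g * (oprod ?L D z * oprod ?L ?O z)) * scal s) =
        ttop N ?L (tensG m n D * tensH m n D' * scal (?g * (oprod ?L D ?e * oprod ?L ?O ?e))) * scal \<chi>"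
      by (simp only: ttop_mult_scal[OF tv]) (simp only: scal_mult mult.assoc)
  qed
  then have "hom_ext f (b_star m n) * scal (gconst \<kappa>) = b_star m n * scal (gconst \<kappa>) * scal \<chi>"
    using ttop_hom_ext[where f = f and x = "integrand m n ?e" and L = ?L, OF f] unfolding int k hom_ext_mult_scal by simp
  also have "\<dots> = b_star m n * scal \<chi> * scal (gconst \<kappa>)"
    using geven_commute[OF ev(2), of "gconst \<kappa>"] by (simp only: mult.assoc scal_mult[symmetric])
  finally have eq: "hom_ext f (b_star m n) * scal (gconst \<kappa>) = b_star m n * scal \<chi> * scal (gconst \<kappa>)" .
  have c: "x * scal (gconst \<kappa>) * scal (gconst (inverse \<kappa>)) = x" for x :: "'k stensor"
    using k0 by (simp add: mult.assoc scal_mult[symmetric] gconst_mult[symmetric])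
  show ?thesis using arg_cong[OF eq, of "\<lambda>x. x * scal (gconst (inverse \<kappa>))"] unfolding c .
qed

section \<open>Linear changes of variables\<close>

lemma sum_of_bool_left: "i < (l :: nat) \<Longrightarrow> (\<Sum>t<l. of_bool (i = t) * f t) = (f i :: 'a::ring_1)"
proof -
  assume "i < l"
  moreover have "(\<Sum>t<l. of_bool (i = t) * f t) = (\<Sum>t<l. if t = i then f t else 0)" by (rule sum.cong) auto
  ultimately show ?thesis by simp
qed

lemma sum_of_bool_right: "i < (l :: nat) \<Longrightarrow> (\<Sum>t<l. f t * of_bool (t = i)) = (f i :: 'a::ring_1)"
proof -
  assume "i < l"
  moreover have "(\<Sum>t<l. f t * of_bool (t = i)) = (\<Sum>t<l. if t = i then f t else 0)" by (rule sum.cong) auto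
  ultimately show ?thesis by simp
qed

lemma sum_lessThan_add: "(\<Sum>i<m + n. f i) = (\<Sum>i<m. f i) + (\<Sum>i<n. f (m + i :: nat) :: 'a::ab_group_add)"
  by (induction n) (simp_all add: add.assoc)

lemma sum_rect: "(\<Sum>b<m * n. f b) = (\<Sum>t<m. \<Sum>s<n. f (t * n + s :: nat) :: 'a::ab_group_add)"
proof (induction m)
  case (Suc m)
  have "Suc m * n = m * n + n" by (simp add: mult_Suc)
  then show ?case using Suc by (simp add: sum_lessThan_add)
qed simp

lemma mat_mult_entry:
  "A \<in> carrier_mat p q \<Longrightarrow> B \<in> carrier_mat q r \<Longrightarrow> i < p \<Longrightarrow> j < r \<Longrightarrow>
    (A * B) $$ (i, j) = (\<Sum>k<q. A $$ (i, k) * B $$ (k, j))"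
  by (simp add: scalar_prod_def atLeast0LessThan)

section \<open>Block matrices and the substitutions they define\<close>

definition blk where
  "blk m n a b c d = mat (m + n) (m + n) (\<lambda>(i, j). if i < m then if j < m then a i j else b i (j - m)
    else if j < m then c (i - m) j else d (i - m) (j - m))"

lemma blk_carrier [simp]: "blk m n a b c d \<in> carrier_mat (m + n) (m + n)"
  by (simp add: blk_def)

lemma blk_index [simp]:
  "i < m \<Longrightarrow> j < m \<Longrightarrow> blk m n a b c d $$ (i, j) = a i j"
  "i < m \<Longrightarrow> j < n \<Longrightarrow> blk m n a b c d $$ (i, m + j) = b i j"
  "i < n \<Longrightarrow> j < m \<Longrightarrow> blk m n a b c d $$ (m + i, j) = c i j"
  "i < n \<Longrightarrow> j < n \<Longrightarrow> blk m n a b c d $$ (m + i, m + j) = d i j"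
  by (simp_all add: blk_def)

lemma blk_index':
  "i < m + n \<Longrightarrow> j < m + n \<Longrightarrow> blk m n a b c d $$ (i, j) = (if i < m then if j < m then a i j else b i (j - m)
    else if j < m then c (i - m) j else d (i - m) (j - m))"
  by (simp add: blk_def)

lemma blk_cong:
  assumes "\<And>i j. i < m \<Longrightarrow> j < m \<Longrightarrow> a i j = a' i j" "\<And>i j. i < m \<Longrightarrow> j < n \<Longrightarrow> b i j = b' i j"
    "\<And>i j. i < n \<Longrightarrow> j < m \<Longrightarrow> c i j = c' i j" "\<And>i j. i < n \<Longrightarrow> j < n \<Longrightarrow> d i j = d' i j"
  shows "blk m n a b c d = blk m n a' b' c' d'"
  unfolding blk_def by (rule cong_mat) (use assms in auto)

lemma blk_mult:
  fixes a :: "nat \<Rightarrow> nat \<Rightarrow> 'a::ring_1"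
  shows "blk m n a b c d * blk m n a' b' c' d' = blk m n
    (\<lambda>i j. (\<Sum>t<m. a i t * a' t j) + (\<Sum>t<n. b i t * c' t j)) (\<lambda>i j. (\<Sum>t<m. a i t * b' t j) + (\<Sum>t<n. b i t * d' t j))
    (\<lambda>i j. (\<Sum>t<m. c i t * a' t j) + (\<Sum>t<n. d i t * c' t j)) (\<lambda>i j. (\<Sum>t<m. c i t * b' t j) + (\<Sum>t<n. d i t * d' t j))"
    (is "?A * ?B = ?C")
proof (rule eq_matI)
  fix i j assume "i < dim_row ?C" "j < dim_col ?C"
  then have ij: "i < m + n" "j < m + n" by (simp_all add: blk_def)
  have "(?A * ?B) $$ (i, j) = (\<Sum>k<m. ?A $$ (i, k) * ?B $$ (k, j)) + (\<Sum>k<n. ?A $$ (i, m + k) * ?B $$ (m + k, j))"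
    using mat_mult_entry[OF blk_carrier[of m n a b c d] blk_carrier[of m n a' b' c' d'] ij] by (simp only: sum_lessThan_add)
  also have "\<dots> = ?C $$ (i, j)"
  proof -
    have "(\<Sum>k<m. ?A $$ (i, k) * ?B $$ (k, j)) = (\<Sum>k<m. (if i < m then a i k else c (i - m) k) * (if j < m then a' k j else b' k (j - m)))"
      by (rule sum.cong) (use ij in \<open>auto simp: blk_index'\<close>)
    moreover have "(\<Sum>k<n. ?A $$ (i, m + k) * ?B $$ (m + k, j)) =
        (\<Sum>k<n. (if i < m then b i k else d (i - m) k) * (if j < m then c' k j else d' k (j - m)))"
      by (rule sum.cong) (use ij in \<open>auto simp: blk_index'\<close>)
    ultimately show ?thesis using ij by (simp add: blk_index')
  qed
  finally show "(?A * ?B) $$ (i, j) = ?C $$ (i, j)" .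
qed (simp_all add: blk_def)

definition idf :: "nat \<Rightarrow> nat \<Rightarrow> 'a::zero_neq_one" where
  "idf i j = of_bool (i = j)"

lemma blk_idf: "blk m n idf (\<lambda>_ _. 0) (\<lambda>_ _. 0) idf = 1\<^sub>m (m + n)"
  by (rule eq_matI) (auto simp: blk_def idf_def)

definition supermat :: "nat \<Rightarrow> nat \<Rightarrow> 'k::comm_ring_1 grassmann mat \<Rightarrow> bool" where
  "supermat m n M \<longleftrightarrow> M \<in> carrier_mat (m + n) (m + n) \<and>
    (\<forall>i<m + n. \<forall>j<m + n. if (i < m) = (j < m) then geven (M $$ (i, j)) else godd (M $$ (i, j)))"

lemma supermat_blk:
  assumes "\<And>i j. i < m \<Longrightarrow> j < m \<Longrightarrow> geven (a i j)" "\<And>i j. i < m \<Longrightarrow> j < n \<Longrightarrow> godd (b i j)"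
    "\<And>i j. i < n \<Longrightarrow> j < m \<Longrightarrow> godd (c i j)" "\<And>i j. i < n \<Longrightarrow> j < n \<Longrightarrow> geven (d i j)"
  shows "supermat m n (blk m n a b c d)"
  using assms by (auto simp: supermat_def blk_index')

lemma theta_simps [simp]: "i < m \<Longrightarrow> theta m i = E i" "theta m (m + j) = Eps j"
  by (simp_all add: theta_def)

definition vcol :: "nat \<Rightarrow> nat \<Rightarrow> 'k grassmann mat \<Rightarrow> nat \<Rightarrow> 'k::comm_ring_1 stensor" where
  "vcol m n M j = (\<Sum>i<m + n. word [theta m i] * scal (M $$ (i, j)))"

definition vrow :: "nat \<Rightarrow> nat \<Rightarrow> 'k grassmann mat \<Rightarrow> nat \<Rightarrow> 'k::comm_ring_1 stensor" where
  "vrow m n M i = (\<Sum>k<m + n. scal (M $$ (i, k)) * word [dual (theta m k)])"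

text \<open>\<open>M\<close> acts on vectors and \<open>M'\<close> on dual vectors, with no relation
  between them, so composing substitutions requires nothing about inverses. Letters out of range are
  fixed, which makes the parity condition of \<open>hom_ext_mult\<close> hold for every
  letter.\<close>

fun lmap :: "nat \<Rightarrow> nat \<Rightarrow> 'k grassmann mat \<Rightarrow> 'k grassmann mat \<Rightarrow> letter \<Rightarrow> 'k::comm_ring_1 stensor" where
  "lmap m n M M' (E i) = (if i < m then vcol m n M i else word [E i])"
| "lmap m n M M' (Eps j) = (if j < n then vcol m n M (m + j) else word [Eps j])"
| "lmap m n M M' (E_dual i) = (if i < m then vrow m n M' i else word [E_dual i])"
| "lmap m n M M' (Eps_dual j) = (if j < n then vrow m n M' (m + j) else word [Eps_dual j])"

lemma lmap_theta:
  assumes "i < m + n"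
  shows "lmap m n M M' (theta m i) = vcol m n M i" "lmap m n M M' (dual (theta m i)) = vrow m n M' i"
  using assms by (auto simp: theta_def)

lemma odd_letter_theta: "odd_letter (theta m i) \<longleftrightarrow> m \<le> i" "odd_letter (dual (theta m i)) \<longleftrightarrow> m \<le> i"
  by (auto simp: theta_def)

lemma homog_letter: "homog (of_bool (odd_letter l)) (word [l])"
  using homog_word[of "[l]"] by (cases "odd_letter l") (simp_all add: odd_count_def)

lemma supermat_homog:
  assumes "supermat m n M" "i < m + n" "j < m + n"
  shows "homog (of_bool ((i < m) \<noteq> (j < m))) (scal (M $$ (i, j)))"
  using assms homog_scal[of "M $$ (i, j)"] by (auto simp: supermat_def split: if_splits)

lemma vcol_homog:
  assumes M: "supermat m n M" and j: "j < m + n"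
  shows "homog (of_bool (m \<le> j)) (vcol m n M j)"
  unfolding vcol_def
proof (rule homog_sum)
  fix i assume "i \<in> {..<m + n}"
  then have "homog (of_bool (m \<le> i) + of_bool ((i < m) \<noteq> (j < m))) (word [theta m i] * scal (M $$ (i, j)))"
    using homog_letter[of "theta m i"] by (intro homog_mult supermat_homog[OF M]) (auto simp: odd_letter_theta j)
  moreover have "even (of_bool (m \<le> i) + of_bool ((i < m) \<noteq> (j < m)) :: nat) = even (of_bool (m \<le> j) :: nat)" by auto
  ultimately show "homog (of_bool (m \<le> j)) (word [theta m i] * scal (M $$ (i, j)))" using homog_cong by blast
qed

lemma vrow_homog:
  assumes M: "supermat m n M" and i: "i < m + n"
  shows "homog (of_bool (m \<le> i)) (vrow m n M i)"
  unfolding vrow_def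
proof (rule homog_sum)
  fix k assume "k \<in> {..<m + n}"
  then have "homog (of_bool ((i < m) \<noteq> (k < m)) + of_bool (m \<le> k)) (scal (M $$ (i, k)) * word [dual (theta m k)])"
    using homog_letter[of "dual (theta m k)"] by (intro homog_mult supermat_homog[OF M]) (auto simp: odd_letter_theta i)
  moreover have "even (of_bool ((i < m) \<noteq> (k < m)) + of_bool (m \<le> k) :: nat) = even (of_bool (m \<le> i) :: nat)" by auto
  ultimately show "homog (of_bool (m \<le> i)) (scal (M $$ (i, k)) * word [dual (theta m k)])" using homog_cong by blast
qed

lemma lmap_homog:
  assumes "supermat m n M" "supermat m n M'"
  shows "homog (of_bool (odd_letter l)) (lmap m n M M' l)"
proof (cases l)
  case (E i)
  then show ?thesis using vcol_homog[OF assms(1), of i] homog_letter[of l] by (cases "i < m") simp_all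
next
  case (Eps j)
  then show ?thesis using vcol_homog[OF assms(1), of "m + j"] homog_letter[of l] by (cases "j < n") simp_all
next
  case (E_dual i)
  then show ?thesis using vrow_homog[OF assms(2), of i] homog_letter[of l] by (cases "i < m") simp_all
next
  case (Eps_dual j)
  then show ?thesis using vrow_homog[OF assms(2), of "m + j"] homog_letter[of l] by (cases "j < n") simp_all
qed

text \<open>Columns of basis vectors compose covariantly and rows of dual vectors contravariantly,
  as they do for a matrix and its inverse.\<close>

lemma lmap_comp:
  fixes M :: "'k::field_char_0 grassmann mat"
  assumes M: "supermat m n M" "supermat m n M'" and P: "P \<in> carrier_mat (m + n) (m + n)" "P' \<in> carrier_mat (m + n) (m + n)"
  shows "hom_ext (lmap m n M M') (hom_ext (lmap m n P P') x) = hom_ext (lmap m n (M * P) (P' * M')) x"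
proof -
  let ?f = "lmap m n M M'"
  have c: "M \<in> carrier_mat (m + n) (m + n)" "M' \<in> carrier_mat (m + n) (m + n)" using M by (simp_all add: supermat_def)
  note f = lmap_homog[OF M]
  have col: "hom_ext ?f (vcol m n P j) = vcol m n (M * P) j" if j: "j < m + n" for j
  proof -
    have "hom_ext ?f (vcol m n P j) = (\<Sum>i<m + n. vcol m n M i * scal (P $$ (i, j)))"
      unfolding vcol_def[of m n P] by (simp add: hom_ext_sum hom_ext_mult_scal hom_ext_letter lmap_theta)
    also have "\<dots> = (\<Sum>i<m + n. \<Sum>k<m + n. word [theta m k] * scal (M $$ (k, i) * P $$ (i, j)))"
      by (simp add: vcol_def sum_distrib_right mult.assoc scal_mult)
    also have "\<dots> = (\<Sum>k<m + n. \<Sum>i<m + n. word [theta m k] * scal (M $$ (k, i) * P $$ (i, j)))" by (rule sum.swap)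
    also have "\<dots> = vcol m n (M * P) j"
      unfolding vcol_def
    proof (rule sum.cong[OF refl])
      fix k assume "k \<in> {..<m + n}"
      then show "(\<Sum>i<m + n. word [theta m k] * scal (M $$ (k, i) * P $$ (i, j))) = word [theta m k] * scal ((M * P) $$ (k, j))"
        using mat_mult_entry[OF c(1) P(1) _ j, of k] by (simp only: lessThan_iff scal_sum sum_distrib_left)
    qed
    finally show ?thesis .
  qed
  have row: "hom_ext ?f (vrow m n P' i) = vrow m n (P' * M') i" if i: "i < m + n" for i
  proof -
    have "hom_ext ?f (vrow m n P' i) = (\<Sum>k<m + n. scal (P' $$ (i, k)) * vrow m n M' k)"
      unfolding vrow_def[of m n P'] by (simp add: hom_ext_sum hom_ext_mult[OF f] hom_ext_letter lmap_theta)
    also have "\<dots> = (\<Sum>k<m + n. \<Sum>j<m + n. scal (P' $$ (i, k) * M' $$ (k, j)) * word [dual (theta m j)])"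
      by (simp add: vrow_def sum_distrib_left mult.assoc scal_mult)
    also have "\<dots> = (\<Sum>j<m + n. \<Sum>k<m + n. scal (P' $$ (i, k) * M' $$ (k, j)) * word [dual (theta m j)])" by (rule sum.swap)
    also have "\<dots> = vrow m n (P' * M') i"
      unfolding vrow_def
    proof (rule sum.cong[OF refl])
      fix j assume "j \<in> {..<m + n}"
      then show "(\<Sum>k<m + n. scal (P' $$ (i, k) * M' $$ (k, j)) * word [dual (theta m j)]) = scal ((P' * M') $$ (i, j)) * word [dual (theta m j)]"
        using mat_mult_entry[OF P(2) c(2) i, of j] by (simp only: lessThan_iff scal_sum sum_distrib_right)
    qed
    finally show ?thesis .
  qed
  have "hom_ext ?f (lmap m n P P' l) = lmap m n (M * P) (P' * M') l" for l
    by (cases l) (simp_all add: col row hom_ext_letter)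
  then show ?thesis unfolding hom_ext_comp[OF f] by simp
qed

definition transforms :: "nat \<Rightarrow> nat \<Rightarrow> 'k grassmann mat \<Rightarrow> 'k grassmann mat \<Rightarrow> 'k::field_char_0 grassmann \<Rightarrow> bool" where
  "transforms m n M M' \<chi> \<longleftrightarrow> hom_ext (lmap m n M M') (b_star m n) = b_star m n * scal \<chi>"

lemma transforms_comp:
  assumes "transforms m n M M' \<chi>" "transforms m n P P' \<psi>" "supermat m n M" "supermat m n M'"
    "P \<in> carrier_mat (m + n) (m + n)" "P' \<in> carrier_mat (m + n) (m + n)"
  shows "transforms m n (M * P) (P' * M') (\<chi> * \<psi>)"
  using assms unfolding transforms_def
  by (simp add: lmap_comp[OF assms(3-6), symmetric] hom_ext_mult_scal scal_mult mult.assoc)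

lemma hom_ext_alt_prod:
  fixes f :: "letter \<Rightarrow> 'k::field_char_0 stensor"
  assumes f: "\<And>l. homog (of_bool (odd_letter l)) (f l)"
  shows "hom_ext f (alt_prod g h l y) = alt_prod g h l (\<lambda>a. hom_ext f (y a))"
  by (simp add: alt_prod_def hom_ext_sum hom_ext_of_int hom_ext_prod_list[OF f] o_def)

lemma vecG_split: "vecG m n z a = (\<Sum>i<m. word [E i] * scal (z (i * n + a))) + word [Eps a]"
  by (simp add: vecG_def VG_def CG_def lessThan_Suc_atMost[symmetric])

text \<open>Moving the odd coefficient in front of an odd letter gives the minus sign in
  u_a.\<close>

lemma vecH_split:
  fixes z :: "nat \<Rightarrow> 'k::field_char_0 grassmann"
  assumes z: "\<And>t. t < n \<Longrightarrow> godd (z (a * n + t))"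
  shows "vecH n z a = word [E_dual a] - (\<Sum>t<n. scal (z (a * n + t)) * word [Eps_dual t])"
proof -
  have "word [Eps_dual t] * scal (z (a * n + t)) = - (scal (z (a * n + t)) * word [Eps_dual t])" if "t < n" for t
    using z[OF that] by (simp add: scal_mult_word odd_count_def godd_def scal_uminus)
  then have "(\<Sum>t<n. word [Eps_dual t] * scal (z (a * n + t))) = - (\<Sum>t<n. scal (z (a * n + t)) * word [Eps_dual t])"
    by (simp add: sum_negf)
  moreover have "vecH n z a = (\<Sum>t<n. word [Eps_dual t] * scal (z (a * n + t))) + word [E_dual a]"
    by (simp add: vecH_def VH_def CH_def lessThan_Suc_atMost[symmetric])
  ultimately show ?thesis by simp
qed

lemma vcol_blk:
  "j < m \<Longrightarrow> vcol m n (blk m n a b c d) j = (\<Sum>i<m. word [E i] * scal (a i j)) + (\<Sum>i<n. word [Eps i] * scal (c i j))"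
  "j < n \<Longrightarrow> vcol m n (blk m n a b c d) (m + j) = (\<Sum>i<m. word [E i] * scal (b i j)) + (\<Sum>i<n. word [Eps i] * scal (d i j))"
  by (simp_all add: vcol_def sum_lessThan_add)

lemma vrow_blk:
  "i < m \<Longrightarrow> vrow m n (blk m n a b c d) i = (\<Sum>k<m. scal (a i k) * word [E_dual k]) + (\<Sum>k<n. scal (b i k) * word [Eps_dual k])"
  "i < n \<Longrightarrow> vrow m n (blk m n a b c d) (m + i) = (\<Sum>k<m. scal (c i k) * word [E_dual k]) + (\<Sum>k<n. scal (d i k) * word [Eps_dual k])"
  by (simp_all add: vrow_def sum_lessThan_add)

lemma scal_collect_right:
  "(\<Sum>t<p. (\<Sum>i<q. w i * scal (f i t)) * scal (y t)) = (\<Sum>i<q. w i * scal (\<Sum>t<p. f i t * y t))" for p q :: nat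
  unfolding scal_sum sum_distrib_left sum_distrib_right scal_mult mult.assoc by (rule sum.swap)

lemma scal_collect_left:
  "(\<Sum>t<p. scal (y t) * (\<Sum>i<q. scal (f t i) * w i)) = (\<Sum>i<q. scal (\<Sum>t<p. y t * f t i) * w i)" for p q :: nat
  unfolding scal_sum sum_distrib_left sum_distrib_right scal_mult mult.assoc by (rule sum.swap)

text \<open>The matrix with blocks \<open>a\<close>, \<open>b\<close>, \<open>c\<close>, \<open>d\<close> acts on the chart \<open>\<eta>\<close> by
  \<open>\<eta> \<mapsto> z = (b + a \<eta>) (d + c \<eta>)\<inverse>\<close>.\<close>

lemma transforms_moebius:
  fixes a b c d a' b' c' d' :: "nat \<Rightarrow> nat \<Rightarrow> 'k::field_char_0 grassmann" and P Q :: "nat \<Rightarrow> nat \<Rightarrow> 'k evn"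
    and \<eta> :: "nat \<Rightarrow> 'k grassmann"
  assumes eta: "\<eta> = (\<lambda>k. gmon {N + k})"
    and M: "supermat m n (blk m n a b c d)" "supermat m n (blk m n a' b' c' d')"
    and vars: "\<And>i j. i < m \<Longrightarrow> j < m \<Longrightarrow> a i j \<in> gvars {..<N} \<and> a' i j \<in> gvars {..<N}"
      "\<And>i j. i < m \<Longrightarrow> j < n \<Longrightarrow> b i j \<in> gvars {..<N} \<and> b' i j \<in> gvars {..<N}"
      "\<And>i j. i < n \<Longrightarrow> j < m \<Longrightarrow> c i j \<in> gvars {..<N} \<and> c' i j \<in> gvars {..<N}"
      "\<And>i j. i < n \<Longrightarrow> j < n \<Longrightarrow> d i j \<in> gvars {..<N} \<and> d' i j \<in> gvars {..<N}"
    and z: "\<And>k. k < m * n \<Longrightarrow> godd (z k)"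
    and P: "\<And>k l. k < n \<Longrightarrow> l < n \<Longrightarrow> d l k + (\<Sum>t<m. c l t * \<eta> (t * n + k)) = emb (P k l)"
      "\<And>k i. k < n \<Longrightarrow> i < m \<Longrightarrow> b i k + (\<Sum>t<m. a i t * \<eta> (t * n + k)) = (\<Sum>l<n. z (i * n + l) * emb (P k l))"
    and Q: "\<And>i j. i < m \<Longrightarrow> j < m \<Longrightarrow> a' i j - (\<Sum>t<n. \<eta> (i * n + t) * c' t j) = emb (Q i j)"
      "\<And>i t. i < m \<Longrightarrow> t < n \<Longrightarrow> (\<Sum>s<n. \<eta> (i * n + s) * d' s t) - b' i t = (\<Sum>j<m. emb (Q i j) * z (j * n + t))"
    and \<chi>: "geven \<chi>"
    and top: "\<And>ks. set ks \<subseteq> {..<m * n} \<Longrightarrow>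
      gtop N (m * n) (prod_list (map z ks) * emb (fdet n P ^ Suc m * fdet m Q ^ Suc n)) =
      \<chi> * gtop N (m * n) (prod_list (map \<eta> ks))"
  shows "transforms m n (blk m n a b c d) (blk m n a' b' c' d') \<chi>"
proof -
  let ?f = "lmap m n (blk m n a b c d) (blk m n a' b' c' d')"
  note f = lmap_homog[OF M]
  have e: "godd (\<eta> k)" for k unfolding eta by (rule godd_gmon) simp
  have ftv: "?f l \<in> tvars {..<N}" for l
    using vars by (cases l)
      (auto simp: vcol_blk vrow_blk intro!: tvars_add tvars_sum tvars_mult tvars_scal tvars_simps)
  have yG: "hom_ext ?f (vecG m n \<eta> k) = (\<Sum>l<n. scal (emb (P k l)) * vecG m n z l)" if k: "k < n" for k
  proof -
    have "hom_ext ?f (vecG m n \<eta> k) = (\<Sum>t<m. ?f (E t) * scal (\<eta> (t * n + k))) + ?f (Eps k)"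
      by (simp add: vecG_split hom_ext_add hom_ext_sum hom_ext_mult_scal hom_ext_letter)
    also have "(\<Sum>t<m. ?f (E t) * scal (\<eta> (t * n + k))) =
        (\<Sum>t<m. ((\<Sum>i<m. word [E i] * scal (a i t)) + (\<Sum>l<n. word [Eps l] * scal (c l t))) * scal (\<eta> (t * n + k)))"
      by (intro sum.cong refl) (simp add: vcol_blk)
    also have "?f (Eps k) = (\<Sum>i<m. word [E i] * scal (b i k)) + (\<Sum>l<n. word [Eps l] * scal (d l k))"
      using k by (simp add: vcol_blk)
    also have "(\<Sum>t<m. ((\<Sum>i<m. word [E i] * scal (a i t)) + (\<Sum>l<n. word [Eps l] * scal (c l t))) * scal (\<eta> (t * n + k))) +
        ((\<Sum>i<m. word [E i] * scal (b i k)) + (\<Sum>l<n. word [Eps l] * scal (d l k))) =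
        (\<Sum>i<m. word [E i] * scal (b i k + (\<Sum>t<m. a i t * \<eta> (t * n + k)))) +
        (\<Sum>l<n. word [Eps l] * scal (d l k + (\<Sum>t<m. c l t * \<eta> (t * n + k))))"
      by (simp only: distrib_right sum.distrib scal_collect_right scal_add distrib_left) (simp only: add_ac)
    also have "(\<Sum>i<m. word [E i] * scal (b i k + (\<Sum>t<m. a i t * \<eta> (t * n + k)))) =
        (\<Sum>i<m. word [E i] * scal (\<Sum>l<n. z (i * n + l) * emb (P k l)))"
      by (intro sum.cong refl) (simp add: P(2)[OF k])
    also have "(\<Sum>l<n. word [Eps l] * scal (d l k + (\<Sum>t<m. c l t * \<eta> (t * n + k)))) = (\<Sum>l<n. word [Eps l] * scal (emb (P k l)))"
      by (intro sum.cong refl) (simp add: P(1)[OF k])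
    also have "(\<Sum>i<m. word [E i] * scal (\<Sum>l<n. z (i * n + l) * emb (P k l))) + (\<Sum>l<n. word [Eps l] * scal (emb (P k l))) =
        (\<Sum>l<n. vecG m n z l * scal (emb (P k l)))"
      by (simp only: vecG_split distrib_right sum.distrib scal_collect_right)
    also have "\<dots> = (\<Sum>l<n. scal (emb (P k l)) * vecG m n z l)"
      by (intro sum.cong refl scal_geven_commute[symmetric] geven_emb)
    finally show ?thesis .
  qed
  have yH: "hom_ext ?f (vecH n \<eta> i) = (\<Sum>j<m. scal (emb (Q i j)) * vecH n z j)" if i: "i < m" for i
  proof -
    have "hom_ext ?f (vecH n \<eta> i) = ?f (E_dual i) - (\<Sum>t<n. scal (\<eta> (i * n + t)) * ?f (Eps_dual t))"
      by (simp add: vecH_split[OF e] hom_ext_diff hom_ext_sum hom_ext_mult[OF f] hom_ext_letter)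
    also have "?f (E_dual i) = (\<Sum>j<m. scal (a' i j) * word [E_dual j]) + (\<Sum>t<n. scal (b' i t) * word [Eps_dual t])"
      using i by (simp add: vrow_blk)
    also have "(\<Sum>t<n. scal (\<eta> (i * n + t)) * ?f (Eps_dual t)) =
       (\<Sum>t<n. scal (\<eta> (i * n + t)) * ((\<Sum>j<m. scal (c' t j) * word [E_dual j]) + (\<Sum>s<n. scal (d' t s) * word [Eps_dual s])))"
      by (intro sum.cong refl) (simp add: vrow_blk)
    also have "(\<Sum>j<m. scal (a' i j) * word [E_dual j]) + (\<Sum>t<n. scal (b' i t) * word [Eps_dual t]) -
       (\<Sum>t<n. scal (\<eta> (i * n + t)) * ((\<Sum>j<m. scal (c' t j) * word [E_dual j]) + (\<Sum>s<n. scal (d' t s) * word [Eps_dual s]))) =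
       (\<Sum>j<m. scal (a' i j - (\<Sum>t<n. \<eta> (i * n + t) * c' t j)) * word [E_dual j]) -
       (\<Sum>t<n. scal ((\<Sum>s<n. \<eta> (i * n + s) * d' s t) - b' i t) * word [Eps_dual t])"
      by (simp only: distrib_left sum.distrib scal_collect_left scal_diff left_diff_distrib sum_subtractf) (simp only: algebra_simps)
    also have "(\<Sum>j<m. scal (a' i j - (\<Sum>t<n. \<eta> (i * n + t) * c' t j)) * word [E_dual j]) =
        (\<Sum>j<m. scal (emb (Q i j)) * word [E_dual j])"
      by (intro sum.cong refl) (simp add: Q(1)[OF i])
    also have "(\<Sum>t<n. scal ((\<Sum>s<n. \<eta> (i * n + s) * d' s t) - b' i t) * word [Eps_dual t]) =
        (\<Sum>t<n. scal (\<Sum>j<m. emb (Q i j) * z (j * n + t)) * word [Eps_dual t])"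
      by (intro sum.cong refl) (simp add: Q(2)[OF i])
    also have "(\<Sum>j<m. scal (emb (Q i j)) * word [E_dual j]) - (\<Sum>t<n. scal (\<Sum>j<m. emb (Q i j) * z (j * n + t)) * word [Eps_dual t]) =
        (\<Sum>j<m. scal (emb (Q i j)) * (word [E_dual j] - (\<Sum>t<n. scal (z (j * n + t)) * word [Eps_dual t])))"
      by (simp only: right_diff_distrib sum_subtractf scal_collect_left)
    also have "\<dots> = (\<Sum>j<m. scal (emb (Q i j)) * vecH n z j)"
    proof (intro sum.cong refl)
      fix j assume "j \<in> {..<m}"
      then have "godd (z (j * n + t))" if "t < n" for t using z[OF rect_index] that by simp
      then show "scal (emb (Q i j)) * (word [E_dual j] - (\<Sum>t<n. scal (z (j * n + t)) * word [Eps_dual t])) = scal (emb (Q i j)) * vecH n z j"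
        by (simp only: vecH_split)
    qed
    finally show ?thesis .
  qed
  \<comment> \<open>\<open>lambda_g\<close> has \<open>Suc m\<close> rows, each alternating in the
    v_k, and \<open>lambda_h\<close> has \<open>Suc n\<close> columns, each alternating in the u_i.
    These numbers are the exponents of the two determinants.\<close>
  let ?s = "emb (fdet n P ^ Suc m * fdet m Q ^ Suc n)"
  have "hom_ext ?f (integrand m n \<eta>) = altG m n (\<lambda>k. hom_ext ?f (vecG m n \<eta> k)) * altH m n (\<lambda>i. hom_ext ?f (vecH n \<eta> i))"
    unfolding integrand_def hom_ext_mult[OF f] altG_def altH_def hom_ext_alt_prod[OF f] ..
  also have "altG m n (\<lambda>k. hom_ext ?f (vecG m n \<eta> k)) = scal (emb (fdet n P ^ Suc m)) * altG m n (vecG m n z)"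
    unfolding altG_def by (rule alt_prod_transform[OF bij_rect yG])
  also have "altH m n (\<lambda>i. hom_ext ?f (vecH n \<eta> i)) = scal (emb (fdet m Q ^ Suc n)) * altH m n (vecH n z)"
    unfolding altH_def by (rule alt_prod_transform[OF bij_rect' yH])
  also have "scal (emb (fdet n P ^ Suc m)) * altG m n (vecG m n z) * (scal (emb (fdet m Q ^ Suc n)) * altH m n (vecH n z)) =
      integrand m n z * scal ?s"
  proof -
    have "scal (emb p) * x * (scal (emb q) * y) = x * y * scal (emb (p * q))" for p q and x y :: "'k stensor"
    proof -
      have "scal (emb p) * x * (scal (emb q) * y) = x * (scal (emb (p * q)) * y)"
        unfolding scal_geven_commute[OF geven_emb, of p x] emb_simps scal_mult by (simp only: mult.assoc)
      then show ?thesis unfolding scal_geven_commute[OF geven_emb, of "p * q" y] by (simp only: mult.assoc)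
    qed
    then show ?thesis unfolding integrand_def .
  qed
  finally have int: "hom_ext ?f (integrand m n \<eta>) = integrand m n z * scal ?s" .
  show ?thesis unfolding transforms_def
    by (rule b_star_transform[where s = ?s and z = z, OF ftv geven_emb \<chi> z int[unfolded eta] top[unfolded eta]])
qed

section \<open>Generators of the general linear supergroup\<close>

lemma ex_gvars_fun: "\<exists>N. \<forall>i<p. \<forall>j<q. f i j \<in> gvars {..<N}" for p q :: nat
proof -
  have "finite ((\<lambda>(i, j). f i j) ` ({..<p} \<times> {..<q}))" by simp
  from ex_gvars_finite[OF this] show ?thesis by (auto simp: image_subset_iff)
qed

lemma godd_anticommute:
  fixes a :: "'k::field_char_0 grassmann"
  assumes "godd a" "godd b"
  shows "a * b = - (b * a)"
  using godd_commute[OF assms(1), of b] assms(2) by (simp add: godd_def)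

lemma godd_sandwich:
  fixes a :: "'k::field_char_0 grassmann"
  assumes "godd a"
  shows "a * (y * a) = 0"
  using godd_commute[OF assms, of y] godd_square[OF assms] by (simp add: mult.assoc[symmetric]) (simp add: mult.assoc)

lemma geven_idf [simp]: "geven (idf i j)"
  by (simp add: idf_def)

lemma gvars_idf [simp]: "idf i j \<in> gvars U"
  by (simp add: idf_def)

lemma emb_idf [simp]: "emb (idf i j) = idf i j"
  by (simp add: idf_def)

lemma idf_commute: "idf i j = idf j i"
  unfolding idf_def by (rule arg_cong[where f = of_bool]) blast

lemma sum_idf:
  "i < (l :: nat) \<Longrightarrow> (\<Sum>t<l. idf i t * f t) = (f i :: 'a::ring_1)"
  "i < (l :: nat) \<Longrightarrow> (\<Sum>t<l. f t * idf t i) = (f i :: 'a::ring_1)"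
  unfolding idf_def by (simp_all only: sum_of_bool_left sum_of_bool_right)

lemma fdet_idf: "fdet l idf = 1"
proof -
  have "mat l l (\<lambda>(i, j). idf i j) = (1\<^sub>m l :: 'a mat)" by (rule eq_matI) (auto simp: idf_def)
  then show ?thesis by (simp add: fdet_det)
qed

section \<open>Upper unitriangular matrices: translations of the chart\<close>

lemma gtop_shift:
  fixes y :: "nat \<Rightarrow> 'k::field_char_0 grassmann"
  assumes y: "\<And>k. k < L \<Longrightarrow> godd (y k)" "\<And>k. k < L \<Longrightarrow> y k \<in> gvars {..<N}" and ks: "set ks \<subseteq> {..<L}"
  shows "gtop N L (prod_list (map (\<lambda>k. gmon {N + k} + y k) ks)) = gtop N L (prod_list (map (\<lambda>k. gmon {N + k}) ks))"
proof -
  let ?e = "\<lambda>k. gmon {N + k} :: 'k grassmann" and ?Z = "{N..<N + L}"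
  let ?z = "\<lambda>k. ?e k + y k"
  have e: "godd (?e k)" for k by (rule godd_gmon) simp
  have eZ: "?e k \<in> gdeg ?Z 1" for k
    by (rule gmon_gdeg) (use card_mono[of "{N + k}" "{N + k} \<inter> ?Z"] in simp)
  have yZ: "y k \<in> gdeg ?Z 0" if "k < L" for k
    by (rule gdeg_gvars[OF y(2)[OF that]]) auto
  have zZ: "?z k \<in> gdeg ?Z 1" if "k < L" for k
    using gdeg_add[OF eZ gdeg_mono[OF _ yZ[OF that]]] by simp
  \<comment> \<open>Replacing a shifted variable by the variable itself lowers the degree in the
    integration variables by one, so the difference cannot reach the top degree.\<close>
  have diff: "prod_list (map ?z xs) - prod_list (map ?e xs) \<in> gdeg ?Z (length xs - 1)" if "set xs \<subseteq> {..<L}" for xs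
    using that
  proof (induction xs)
    case (Cons k xs)
    have k: "k < L" and xs: "set xs \<subseteq> {..<L}" using Cons.prems by auto
    have pz: "prod_list (map ?z xs) \<in> gdeg ?Z (length (map ?z xs))"
      by (rule gdeg_prod_list) (use xs zZ in auto)
    have "y k * prod_list (map ?z xs) \<in> gdeg ?Z (0 + length (map ?z xs))" by (rule gdeg_mult[OF yZ[OF k] pz])
    moreover have "?e k * (prod_list (map ?z xs) - prod_list (map ?e xs)) \<in> gdeg ?Z (length xs)"
    proof (cases xs)
      case (Cons a list)
      then show ?thesis using gdeg_mult[OF eZ Cons.IH[OF xs], of k] Cons.IH[OF xs] gdeg_mult[OF eZ, of _ "length xs - 1" k] Cons by simp
    qed simp
    ultimately have "y k * prod_list (map ?z xs) + ?e k * (prod_list (map ?z xs) - prod_list (map ?e xs)) \<in> gdeg ?Z (length xs)"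
      using gdeg_add by fastforce
    moreover have "prod_list (map ?z (k # xs)) - prod_list (map ?e (k # xs)) =
        y k * prod_list (map ?z xs) + ?e k * (prod_list (map ?z xs) - prod_list (map ?e xs))"
      by (simp add: algebra_simps)
    ultimately show ?case by simp
  qed simp
  show ?thesis
  \<comment> \<open>The degree bound only helps for lists of at most \<open>L\<close> variables.
    Longer lists repeat a variable, and then both products vanish.\<close>
  proof (cases "distinct ks")
    case True
    have len: "length ks \<le> L" using card_mono[OF _ ks] distinct_card[OF True] by simp
    show ?thesis
    proof (cases ks)
      case (Cons a list)
      then have "length ks - 1 < L" using len by simp
      then have "gtop N L (prod_list (map ?z ks) - prod_list (map ?e ks)) = 0" by (rule gtop_low_degree[OF diff[OF ks]])
      then show ?thesis by (simp add: gtop_diff)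
    qed simp
  next
    case False
    have "prod_list (map ?z ks) = 0" by (rule godd_prod_repeat[OF _ False], rule godd_add[OF e y(1)]) (use ks in auto)
    moreover have "prod_list (map ?e ks) = 0" by (rule godd_prod_repeat[OF e False])
    ultimately show ?thesis by simp
  qed
qed

text \<open>Here the chart is the translation of eta by \<open>X\<close>, and both determinant
  factors are 1; the integral is invariant under translations.\<close>

lemma transforms_upper:
  fixes X :: "nat \<Rightarrow> nat \<Rightarrow> 'k::field_char_0 grassmann"
  assumes X: "\<And>i j. i < m \<Longrightarrow> j < n \<Longrightarrow> godd (X i j)"
  shows "transforms m n (blk m n idf X (\<lambda>_ _. 0) idf) (blk m n idf (\<lambda>i j. - X i j) (\<lambda>_ _. 0) idf) 1"
proof -
  obtain N where N: "\<And>i j. i < m \<Longrightarrow> j < n \<Longrightarrow> X i j \<in> gvars {..<N}" using ex_gvars_fun[of m n X] by blast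
  let ?\<eta> = "\<lambda>k. gmon {N + k} :: 'k grassmann"
  let ?z = "\<lambda>k. ?\<eta> k + X (k div n) (k mod n)"
  have e: "godd (?\<eta> k)" for k by (rule godd_gmon) simp
  have k: "k div n < m" "k mod n < n" if "k < m * n" for k
    using mod_less_rect[OF that] less_mult_imp_div_less[OF that] by auto
  show ?thesis
  proof (rule transforms_moebius[where N = N and z = ?z and P = idf and Q = idf, OF refl])
    show "supermat m n (blk m n idf X (\<lambda>_ _. 0) idf)" "supermat m n (blk m n idf (\<lambda>i j. - X i j) (\<lambda>_ _. 0) idf)"
      by (rule supermat_blk; simp add: X godd_uminus)+
    show "X i j \<in> gvars {..<N} \<and> - X i j \<in> gvars {..<N}" if "i < m" "j < n" for i j
      using N[OF that] gvars_uminus by blast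
    show "godd (?z k)" if "k < m * n" for k using e X k[OF that] godd_add by blast
    show "idf l k + (\<Sum>t<m. 0 * ?\<eta> (t * n + k)) = emb (idf k l)" for k l by (simp add: idf_def)
    show "X i k + (\<Sum>t<m. idf i t * ?\<eta> (t * n + k)) = (\<Sum>l<n. ?z (i * n + l) * emb (idf k l))" if "k < n" "i < m" for k i
    proof -
      have "(\<Sum>l<n. ?z (i * n + l) * emb (idf k l)) = (\<Sum>l<n. ?z (i * n + l) * idf l k)"
        by (simp only: emb_idf idf_commute[of k])
      then show ?thesis using that by (simp add: sum_idf add.commute)
    qed
    show "idf i j - (\<Sum>t<n. ?\<eta> (i * n + t) * 0) = emb (idf i j)" for i j by simp
    show "(\<Sum>s<n. ?\<eta> (i * n + s) * idf s t) - (- X i t) = (\<Sum>j<m. emb (idf i j) * ?z (j * n + t))" if "i < m" "t < n" for i t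
      using that by (simp add: sum_idf)
    show "gtop N (m * n) (prod_list (map ?z ks) * emb (fdet n idf ^ Suc m * fdet m idf ^ Suc n)) =
        1 * gtop N (m * n) (prod_list (map ?\<eta> ks))" if "set ks \<subseteq> {..<m * n}" for ks
      using gtop_shift[of "m * n" "\<lambda>k. X (k div n) (k mod n)" N ks] that X N k by (simp add: fdet_idf)
  qed simp_all
qed

section \<open>Block diagonal matrices: linear maps of the chart\<close>

lemma gtop_linear:
  fixes c :: "nat \<Rightarrow> nat \<Rightarrow> 'k::field_char_0 evn"
  assumes c: "\<And>k b. k < L \<Longrightarrow> b < L \<Longrightarrow> emb (c k b) \<in> gvars {..<N}" and ks: "set ks \<subseteq> {..<L}" and s: "emb s \<in> gvars {..<N}"
  shows "gtop N L (prod_list (map (\<lambda>k. \<Sum>b<L. emb (c k b) * gmon {N + b}) ks) * emb s) =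
    emb (s * fdet L c) * gtop N L (prod_list (map (\<lambda>k. gmon {N + k}) ks))"
proof -
  let ?e = "\<lambda>k. gmon {N + k} :: 'k grassmann" and ?Z = "{N..<N + L}"
  let ?z = "\<lambda>k. \<Sum>b<L. emb (c k b) * ?e b"
  have e: "godd (?e k)" for k by (rule godd_gmon) simp
  have z: "godd (?z k)" for k
  proof (rule godd_sum)
    fix b show "godd (emb (c k b) * ?e b)"
      using e[of b] geven_emb[of "c k b"] by (simp add: geven_def godd_def grade_sign_mult)
  qed
  have eZ: "?e k \<in> gdeg ?Z 1" for k
    by (rule gmon_gdeg) (use card_mono[of "{N + k}" "{N + k} \<inter> ?Z"] in simp)
  have zZ: "?z k \<in> gdeg ?Z 1" if "k < L" for k
  proof (rule gdeg_sum)
    fix b assume "b \<in> {..<L}"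
    then have "emb (c k b) \<in> gdeg ?Z 0" using c that by (intro gdeg_gvars[of _ "{..<N}"]) auto
    from gdeg_mult[OF this eZ] show "emb (c k b) * ?e b \<in> gdeg ?Z 1" by simp
  qed
  have comm: "gtop N L (x * emb s) = emb s * gtop N L x" for x
    unfolding geven_commute[OF geven_emb, of s x, symmetric] by (rule gtop_mult[OF s])
  show ?thesis
  \<comment> \<open>A list containing every variable once gives the determinant. A shorter list has
    too low a degree, and a repetition makes both products vanish.\<close>
  proof (cases "distinct ks")
    case True
    have len: "length ks = card (set ks)" using distinct_card[OF True] by simp
    show ?thesis
    proof (cases "set ks = {..<L}")
      case full: True
      obtain r :: int where r: "\<And>z :: nat \<Rightarrow> 'k grassmann. (\<And>k. k < L \<Longrightarrow> godd (z k)) \<Longrightarrow>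
          prod_list (map z ks) = of_int r * prod_list (map z [0..<L])"
        by (rule godd_prod_reorder[OF True full]) blast
      have fv: "emb (fdet L c) \<in> gvars {..<N}"
      proof -
        have "fdet L c = (\<Sum>p | p permutes {..<L}. of_int (sign p) * (\<Prod>i<L. c i (p i)))" by (simp add: fdet_def)
        moreover have "emb (of_int (sign p) * (\<Prod>i<L. c i (p i))) \<in> gvars {..<N}" if p: "p permutes {..<L}" for p
        proof -
          have "p i < L" if "i < L" for i using permutes_in_image[OF p, of i] that by simp
          then have "prod_list (map (\<lambda>k. emb (c k (p k))) [0..<L]) \<in> gvars {..<N}"
            by (intro gvars_prod_list) (use c in auto)
          then show ?thesis using gvars_mult[OF gvars_simps(3)[of "of_int (sign p)"]]
            by (simp add: emb_of_int emb_prod gconst_of_int)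
        qed
        ultimately show ?thesis by (auto simp: emb_sum intro!: gvars_sum)
      qed
      have "prod_list (map ?z ks) = of_int r * (emb (fdet L c) * prod_list (map ?e [0..<L]))"
        unfolding r[of ?z, OF z] godd_linear_prod[of L ?e c, OF e] ..
      also have "\<dots> = emb (fdet L c) * (of_int r * prod_list (map ?e [0..<L]))"
      proof -
        have "of_int r * emb (fdet L c) = emb (fdet L c) * of_int r"
          using geven_commute[OF geven_emb, of "fdet L c" "of_int r"] by simp
        then show ?thesis by (simp only: mult.assoc[symmetric])
      qed
      also have "of_int r * prod_list (map ?e [0..<L]) = prod_list (map ?e ks)" using r[of ?e, OF e] by simp
      finally show ?thesis unfolding comm by (simp add: gtop_mult[OF fv] mult.assoc)
    next
      case False
      then have "card (set ks) < L" using psubset_card_mono[of "{..<L}" "set ks"] ks by auto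
      then have l: "length ks < L" using len by simp
      have "prod_list (map ?z ks) \<in> gdeg ?Z (length (map ?z ks))" by (rule gdeg_prod_list) (use ks zZ in auto)
      then have "gtop N L (prod_list (map ?z ks)) = 0" by (rule gtop_low_degree) (use l in simp)
      moreover have "prod_list (map ?e ks) \<in> gdeg ?Z (length (map ?e ks))" by (rule gdeg_prod_list) (use eZ in auto)
      then have "gtop N L (prod_list (map ?e ks)) = 0" by (rule gtop_low_degree) (use l in simp)
      ultimately show ?thesis unfolding comm by simp
    qed
  next
    case False
    have "prod_list (map ?z ks) = 0" "prod_list (map ?e ks) = 0"
      by (rule godd_prod_repeat[OF z False], rule godd_prod_repeat[OF e False])
    then show ?thesis by simp
  qed
qed

text \<open>This is the matrix of the linear map sending eta to \<open>S\<close> eta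
  \<open>D\<close>. It factors into left and right multiplication, each of which is a direct sum of
  copies of one matrix.\<close>

lemma fdet_kronecker:
  fixes S :: "nat \<Rightarrow> nat \<Rightarrow> 'a::comm_ring_1"
  shows "fdet (m * n) (\<lambda>k b. S (k div n) (b div n) * D (b mod n) (k mod n)) = fdet m S ^ n * fdet n D ^ m"
proof -
  let ?A = "block_copies (\<lambda>k. k mod n) (\<lambda>k. k div n) S" and ?B = "block_copies (\<lambda>k. k div n) (\<lambda>k. k mod n) (\<lambda>i j. D j i)"
  have "fdet (m * n) (\<lambda>k b. S (k div n) (b div n) * D (b mod n) (k mod n)) = fdet (m * n) (\<lambda>k b. \<Sum>l<m * n. ?A k l * ?B l b)"
  proof (rule fdet_cong)
    fix k b assume kb: "k < m * n" "b < m * n"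
    then have kb': "k mod n < n" "b div n < m" using mod_less_rect less_mult_imp_div_less by auto
    have "(\<Sum>l<m * n. ?A k l * ?B l b) = (\<Sum>t<m. \<Sum>s<n. of_bool (k mod n = s) * (of_bool (b div n = t) * (S (k div n) t * D (b mod n) s)))"
      unfolding sum_rect by (intro sum.cong refl) (auto simp: block_copies_def)
    also have "\<dots> = (\<Sum>t<m. of_bool (b div n = t) * (S (k div n) t * D (b mod n) (k mod n)))"
      by (simp only: sum_of_bool_left[OF kb'(1)])
    also have "\<dots> = S (k div n) (b div n) * D (b mod n) (k mod n)" by (simp only: sum_of_bool_left[OF kb'(2)])
    finally show "S (k div n) (b div n) * D (b mod n) (k mod n) = (\<Sum>l<m * n. ?A k l * ?B l b)" ..
  qed
  also have "\<dots> = fdet (m * n) ?A * fdet (m * n) ?B" by (rule fdet_mult)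
  also have "fdet (m * n) ?A = fdet m S ^ n" by (rule fdet_block_copies[OF bij_rect'])
  also have "fdet (m * n) ?B = fdet n D ^ m" unfolding fdet_block_copies[OF bij_rect] fdet_transpose[of n D] ..
  finally show ?thesis .
qed

lemma sum4_swap: "(\<Sum>b<p. \<Sum>t<q. \<Sum>s<r. f b t s) = (\<Sum>t<q. \<Sum>s<r. \<Sum>b<p. f b t s :: 'a::ab_group_add)" for p q r :: nat
proof -
  have "(\<Sum>b<p. \<Sum>t<q. \<Sum>s<r. f b t s) = (\<Sum>t<q. \<Sum>b<p. \<Sum>s<r. f b t s)" by (rule sum.swap)
  also have "\<dots> = (\<Sum>t<q. \<Sum>s<r. \<Sum>b<p. f b t s)" by (intro sum.cong refl sum.swap)
  finally show ?thesis .
qed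

text \<open>The chart becomes \<open>S\<close> eta \<open>D'\<close>. The alternating products
  contribute \<open>fdet n D\<close> to the power \<open>m + 1\<close> and \<open>fdet m S'\<close>
  to the power \<open>n + 1\<close>; the Jacobian, with \<open>m\<close> factors
  \<open>fdet n D'\<close> and \<open>n\<close> factors \<open>fdet m S\<close>, cancels all but one
  factor of each kind. The extra row and the extra column of the two rectangles are what
  remains.\<close>

lemma transforms_diag:
  fixes S D :: "nat \<Rightarrow> nat \<Rightarrow> 'k::field_char_0 evn"
  assumes S: "\<And>i j. i < m \<Longrightarrow> j < m \<Longrightarrow> (\<Sum>t<m. S' i t * S t j) = idf i j" and dS: "fdet m S * fdet m S' = 1"
    and D: "\<And>i j. i < n \<Longrightarrow> j < n \<Longrightarrow> (\<Sum>t<n. D' i t * D t j) = idf i j" and dD: "fdet n D * fdet n D' = 1"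
  shows "transforms m n (blk m n (\<lambda>i j. emb (S i j)) (\<lambda>_ _. 0) (\<lambda>_ _. 0) (\<lambda>i j. emb (D i j)))
    (blk m n (\<lambda>i j. emb (S' i j)) (\<lambda>_ _. 0) (\<lambda>_ _. 0) (\<lambda>i j. emb (D' i j))) (emb (fdet m S' * fdet n D))"
proof -
  let ?c = "\<lambda>k b. S (k div n) (b div n) * D' (b mod n) (k mod n)"
  let ?s = "fdet n (\<lambda>i j. D j i) ^ Suc m * fdet m S' ^ Suc n"
  obtain N where N: "\<And>i j. i < m \<Longrightarrow> j < m \<Longrightarrow> emb (S i j) \<in> gvars {..<N} \<and> emb (S' i j) \<in> gvars {..<N}"
    "\<And>i j. i < n \<Longrightarrow> j < n \<Longrightarrow> emb (D i j) \<in> gvars {..<N} \<and> emb (D' i j) \<in> gvars {..<N}" "emb ?s \<in> gvars {..<N}"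
  proof -
    obtain N1 where 1: "\<forall>i<m. \<forall>j<m. emb (S i j) \<in> gvars {..<N1}" using ex_gvars_fun[of m m "\<lambda>i j. emb (S i j)"] ..
    obtain N2 where 2: "\<forall>i<m. \<forall>j<m. emb (S' i j) \<in> gvars {..<N2}" using ex_gvars_fun[of m m "\<lambda>i j. emb (S' i j)"] ..
    obtain N3 where 3: "\<forall>i<n. \<forall>j<n. emb (D i j) \<in> gvars {..<N3}" using ex_gvars_fun[of n n "\<lambda>i j. emb (D i j)"] ..
    obtain N4 where 4: "\<forall>i<n. \<forall>j<n. emb (D' i j) \<in> gvars {..<N4}" using ex_gvars_fun[of n n "\<lambda>i j. emb (D' i j)"] ..
    obtain N5 where 5: "emb ?s \<in> gvars {..<N5}" using ex_gvars by blast
    let ?N = "N1 + N2 + N3 + N4 + N5"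
    have sub: "{..<N1} \<subseteq> {..<?N}" "{..<N2} \<subseteq> {..<?N}" "{..<N3} \<subseteq> {..<?N}" "{..<N4} \<subseteq> {..<?N}" "{..<N5} \<subseteq> {..<?N}" by auto
    show thesis
    proof (rule that[of ?N])
      show "emb (S i j) \<in> gvars {..<?N} \<and> emb (S' i j) \<in> gvars {..<?N}" if "i < m" "j < m" for i j
        using gvars_mono[OF sub(1) 1[rule_format, OF that]] gvars_mono[OF sub(2) 2[rule_format, OF that]] by (rule conjI)
      show "emb (D i j) \<in> gvars {..<?N} \<and> emb (D' i j) \<in> gvars {..<?N}" if "i < n" "j < n" for i j
        using gvars_mono[OF sub(3) 3[rule_format, OF that]] gvars_mono[OF sub(4) 4[rule_format, OF that]] by (rule conjI)
    qed (rule gvars_mono[OF sub(5) 5])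
  qed
  let ?\<eta> = "\<lambda>k. gmon {N + k} :: 'k grassmann"
  let ?z = "\<lambda>k. \<Sum>b<m * n. emb (?c k b) * ?\<eta> b"
  have z: "?z (i * n + a) = (\<Sum>t<m. \<Sum>s<n. emb (S i t * D' s a) * ?\<eta> (t * n + s))" if "a < n" for i a
    unfolding sum_rect using that by (intro sum.cong refl) simp
  have dv: "k div n < m" "k mod n < n" if "k < m * n" for k
    using mod_less_rect[OF that] less_mult_imp_div_less[OF that] by auto
  show ?thesis
  proof (rule transforms_moebius[where N = N and z = ?z and P = "\<lambda>i j. D j i" and Q = S', OF refl])
    show "supermat m n (blk m n (\<lambda>i j. emb (S i j)) (\<lambda>_ _. 0) (\<lambda>_ _. 0) (\<lambda>i j. emb (D i j)))"
      "supermat m n (blk m n (\<lambda>i j. emb (S' i j)) (\<lambda>_ _. 0) (\<lambda>_ _. 0) (\<lambda>i j. emb (D' i j)))"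
      by (rule supermat_blk; simp)+
    show "godd (?z k)" for k
    proof (rule godd_sum)
      fix b have "godd (?\<eta> b)" by (rule godd_gmon) simp
      then show "godd (emb (?c k b) * ?\<eta> b)" using geven_emb[of "?c k b"] unfolding geven_def godd_def grade_sign_mult by simp
    qed
    show "emb (D l k) + (\<Sum>t<m. 0 * ?\<eta> (t * n + k)) = emb (D l k)" for k l by simp
    show "0 + (\<Sum>t<m. emb (S i t) * ?\<eta> (t * n + k)) = (\<Sum>l<n. ?z (i * n + l) * emb (D l k))" if k: "k < n" and i: "i < m" for k i
    proof -
      have "(\<Sum>l<n. ?z (i * n + l) * emb (D l k)) = (\<Sum>l<n. \<Sum>t<m. \<Sum>s<n. emb (S i t * (D' s l * D l k)) * ?\<eta> (t * n + s))"
      proof (intro sum.cong refl)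
        fix l assume "l \<in> {..<n}"
        then have l: "l < n" by simp
        have "emb (S i t * D' s l) * ?\<eta> (t * n + s) * emb (D l k) = emb (S i t * (D' s l * D l k)) * ?\<eta> (t * n + s)" for t s
          using geven_commute[OF geven_emb, of "D l k" "?\<eta> (t * n + s)"] by (simp add: mult.assoc)
        then show "?z (i * n + l) * emb (D l k) = (\<Sum>t<m. \<Sum>s<n. emb (S i t * (D' s l * D l k)) * ?\<eta> (t * n + s))"
          unfolding z[OF l] sum_distrib_right by (intro sum.cong refl)
      qed
      also have "\<dots> = (\<Sum>t<m. \<Sum>s<n. \<Sum>l<n. emb (S i t * (D' s l * D l k)) * ?\<eta> (t * n + s))" by (rule sum4_swap)
      also have "\<dots> = (\<Sum>t<m. \<Sum>s<n. emb (S i t) * ?\<eta> (t * n + s) * idf s k)"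
      proof (intro sum.cong refl)
        fix t s assume "s \<in> {..<n}"
        then have s: "s < n" by simp
        have "(\<Sum>l<n. emb (S i t * (D' s l * D l k)) * ?\<eta> (t * n + s)) = emb (S i t * (\<Sum>l<n. D' s l * D l k)) * ?\<eta> (t * n + s)"
          by (simp only: sum_distrib_left emb_sum sum_distrib_right)
        then show "(\<Sum>l<n. emb (S i t * (D' s l * D l k)) * ?\<eta> (t * n + s)) = emb (S i t) * ?\<eta> (t * n + s) * idf s k"
          unfolding D[OF s k] by (simp add: idf_def)
      qed
      also have "\<dots> = (\<Sum>t<m. emb (S i t) * ?\<eta> (t * n + k))" by (simp only: sum_idf[OF k])
      finally show ?thesis by simp
    qed
    show "emb (S' i j) - (\<Sum>t<n. ?\<eta> (i * n + t) * 0) = emb (S' i j)" for i j by simp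
    show "(\<Sum>s<n. ?\<eta> (i * n + s) * emb (D' s t)) - 0 = (\<Sum>j<m. emb (S' i j) * ?z (j * n + t))" if i: "i < m" and t: "t < n" for i t
    proof -
      have "(\<Sum>j<m. emb (S' i j) * ?z (j * n + t)) = (\<Sum>j<m. \<Sum>r<m. \<Sum>s<n. emb (S' i j * S j r * D' s t) * ?\<eta> (r * n + s))"
        unfolding z[OF t] sum_distrib_left by (simp add: mult.assoc)
      also have "\<dots> = (\<Sum>r<m. \<Sum>s<n. \<Sum>j<m. emb (S' i j * S j r * D' s t) * ?\<eta> (r * n + s))" by (rule sum4_swap)
      also have "\<dots> = (\<Sum>r<m. \<Sum>s<n. idf i r * (emb (D' s t) * ?\<eta> (r * n + s)))"
      proof (intro sum.cong refl)
        fix r s assume "r \<in> {..<m}"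
        then have r: "r < m" by simp
        have "(\<Sum>j<m. emb (S' i j * S j r * D' s t) * ?\<eta> (r * n + s)) = emb ((\<Sum>j<m. S' i j * S j r) * D' s t) * ?\<eta> (r * n + s)"
          by (simp only: emb_sum sum_distrib_right)
        then show "(\<Sum>j<m. emb (S' i j * S j r * D' s t) * ?\<eta> (r * n + s)) = idf i r * (emb (D' s t) * ?\<eta> (r * n + s))"
          unfolding S[OF i r] by (simp add: idf_def)
      qed
      also have "\<dots> = (\<Sum>r<m. idf i r * (\<Sum>s<n. emb (D' s t) * ?\<eta> (r * n + s)))" by (simp only: sum_distrib_left)
      also have "\<dots> = (\<Sum>s<n. emb (D' s t) * ?\<eta> (i * n + s))" by (rule sum_idf[OF i])
      also have "\<dots> = (\<Sum>s<n. ?\<eta> (i * n + s) * emb (D' s t))" by (intro sum.cong refl geven_commute geven_emb)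
      finally show ?thesis by simp
    qed
    show "gtop N (m * n) (prod_list (map ?z ks) * emb ?s) = emb (fdet m S' * fdet n D) * gtop N (m * n) (prod_list (map ?\<eta> ks))"
      if ks: "set ks \<subseteq> {..<m * n}" for ks
    proof -
      have c: "emb (?c k b) \<in> gvars {..<N}" if "k < m * n" "b < m * n" for k b
        using N(1)[OF dv(1)[OF that(1)] dv(1)[OF that(2)]] N(2)[OF dv(2)[OF that(2)] dv(2)[OF that(1)]]
        by (simp add: gvars_mult)
      have "?s * fdet (m * n) ?c = fdet m S' * fdet n D"
      proof -
        have "?s * fdet (m * n) ?c = fdet n D ^ Suc m * fdet m S' ^ Suc n * (fdet m S ^ n * fdet n D' ^ m)"
          unfolding fdet_kronecker fdet_transpose[of n D] ..
        also have "\<dots> = fdet m S' * fdet n D * ((fdet m S * fdet m S') ^ n * (fdet n D * fdet n D') ^ m)"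
          by (simp only: power_mult_distrib power_Suc mult_ac)
        finally show ?thesis unfolding dS dD by simp
      qed
      then show ?thesis using gtop_linear[of "m * n" ?c N ks ?s, OF c ks N(3)] by simp
    qed
    show "geven (emb (fdet m S' * fdet n D))" by (rule geven_emb)
  qed (use N in simp_all)
qed

section \<open>Lower unitriangular matrices: quadratic changes of the chart\<close>

text \<open>All corrections carry the factor \<open>x\<close>, so products of two of them vanish and
  the product is expanded to first order. The part of each correction proportional to its own
  variable is collected in the sum of the \<open>c k\<close>; every other term lacks the variable of
  the factor it replaces and will integrate to 0.\<close>

lemma prod_list_chart:
  fixes e :: "nat \<Rightarrow> 'k::field_char_0 grassmann"
  assumes x: "godd x" and e: "\<And>k. godd (e k)" "\<And>k l. k \<noteq> l \<Longrightarrow> e k \<in> gvars (- {N + l})"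
    and w: "w = x * e q" and r: "\<And>k. r k \<in> gvars (- {N + k})" and ks: "distinct ks"
  shows "\<exists>R. (\<forall>k\<in>set ks. R k \<in> gvars (- {N + k})) \<and>
    prod_list (map (\<lambda>k. e k * (1 + of_int (c k) * w) + x * r k) ks) =
    prod_list (map e ks) * (1 + of_int (\<Sum>k\<in>set ks. c k) * w) + x * (\<Sum>k\<in>set ks. R k)"
  using ks
proof (induction ks)
  case (Cons k ks)
  let ?y = "\<lambda>k. e k * (1 + of_int (c k) * w) + x * r k"
  let ?P = "prod_list (map e ks)" and ?C = "\<Sum>k\<in>set ks. c k"
  from Cons obtain R where R: "\<And>k. k \<in> set ks \<Longrightarrow> R k \<in> gvars (- {N + k})"
    and IH: "prod_list (map ?y ks) = ?P * (1 + of_int ?C * w) + x * (\<Sum>k\<in>set ks. R k)" by auto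
  let ?S = "\<Sum>k\<in>set ks. R k"
  have k: "k \<notin> set ks" using Cons.prems by simp
  have wev: "geven w" unfolding w by (rule geven_mult_odd[OF x e(1)])
  have wx: "w * x = 0" unfolding w using godd_sandwich[OF x, of "e q"] by (simp add: mult.assoc)
  have xw: "x * y * w = 0" for y
    unfolding geven_commute[OF wev, of "x * y", symmetric] by (simp add: mult.assoc[symmetric] wx)
  have ww: "w * w = 0" using xw[of "e q"] by (simp add: w)
  have icomm: "of_int i * y = y * of_int i" for i and y :: "'k grassmann" by (rule mult_of_int_commute)
  have t1: "e k * (1 + of_int (c k) * w) * (?P * (1 + of_int ?C * w)) = e k * ?P * (1 + of_int (c k + ?C) * w)"
  proof -
    have C: "(1 + of_int (c k) * w) * ?P = ?P * (1 + of_int (c k) * w)"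
    proof (rule geven_commute)
      have "geven (of_int (c k) * w)"
        using wev grade_sign_gconst[of 1 "of_int (c k) :: 'k"] by (simp add: geven_def grade_sign_mult gconst_of_int)
      then show "geven (1 + of_int (c k) * w)" by (intro geven_add geven_simps)
    qed
    have "e k * (1 + of_int (c k) * w) * (?P * (1 + of_int ?C * w)) =
        e k * ((1 + of_int (c k) * w) * ?P) * (1 + of_int ?C * w)" by (simp only: mult.assoc)
    also have "\<dots> = e k * ?P * ((1 + of_int (c k) * w) * (1 + of_int ?C * w))" unfolding C by (simp only: mult.assoc)
    also have "(1 + of_int (c k) * w) * (1 + of_int ?C * w) = 1 + of_int (c k + ?C) * w"
    proof -
      have "of_int (c k) * w * (of_int ?C * w) = of_int (c k) * of_int ?C * (w * w)"
      proof -
        have "of_int (c k) * w * (of_int ?C * w) = of_int (c k) * (w * of_int ?C) * w" by (simp only: mult.assoc)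
        then show ?thesis unfolding icomm[of ?C w, symmetric] by (simp only: mult.assoc)
      qed
      then show ?thesis by (simp add: algebra_simps ww)
    qed
    finally show ?thesis .
  qed
  have t2: "e k * (1 + of_int (c k) * w) * (x * ?S) = x * - (e k * ?S)"
  proof -
    have "(1 + of_int (c k) * w) * (x * ?S) = x * ?S"
      by (simp add: distrib_right mult.assoc) (simp add: mult.assoc[symmetric] wx mult.assoc[of _ w x])
    then have "e k * (1 + of_int (c k) * w) * (x * ?S) = e k * x * ?S" by (simp only: mult.assoc)
    also have "e k * x = - (x * e k)" by (rule godd_anticommute[OF e(1) x])
    finally show ?thesis by (simp add: mult.assoc)
  qed
  have t3: "x * r k * (?P * (1 + of_int ?C * w)) = x * (r k * ?P)"
  proof -
    have "x * r k * ?P * (of_int ?C * w) = of_int ?C * (x * (r k * ?P) * w)"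
      by (simp only: mult.assoc icomm)
    then show ?thesis unfolding xw by (simp add: distrib_left mult.assoc)
  qed
  have t4: "x * r k * (x * ?S) = 0"
    using godd_sandwich[OF x, of "r k"] by (simp add: mult.assoc[symmetric])
  let ?R = "\<lambda>l. if l = k then r k * ?P else - (e k * R l)"
  have "prod_list (map ?y (k # ks)) = (e k * (1 + of_int (c k) * w) + x * r k) * (?P * (1 + of_int ?C * w) + x * ?S)"
    by (simp only: list.map prod_list.Cons IH)
  also have "\<dots> = e k * (1 + of_int (c k) * w) * (?P * (1 + of_int ?C * w)) + e k * (1 + of_int (c k) * w) * (x * ?S) +
      (x * r k * (?P * (1 + of_int ?C * w)) + x * r k * (x * ?S))"
    by (simp only: distrib_right distrib_left add.assoc add.left_commute)
  also have "\<dots> = e k * ?P * (1 + of_int (c k + ?C) * w) + x * (r k * ?P + - (e k * ?S))"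
    unfolding t1 t2 t3 t4 by (simp add: distrib_left right_diff_distrib)
  also have "r k * ?P + - (e k * ?S) = (\<Sum>l\<in>set (k # ks). ?R l)"
  proof -
    have "(\<Sum>l\<in>set ks. ?R l) = (\<Sum>l\<in>set ks. - (e k * R l))" by (rule sum.cong) (use k in auto)
    then show ?thesis using k by (simp add: sum_negf sum_distrib_left)
  qed
  finally have eq: "prod_list (map ?y (k # ks)) =
    prod_list (map e (k # ks)) * (1 + of_int (\<Sum>k\<in>set (k # ks). c k) * w) + x * (\<Sum>l\<in>set (k # ks). ?R l)"
    using k by simp
  have "?R l \<in> gvars (- {N + l})" if "l \<in> set (k # ks)" for l
  proof (cases "l = k")
    case True
    have Pv: "?P \<in> gvars (- {N + k})" by (rule gvars_prod_list) (use k in \<open>auto intro!: e(2)\<close>)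
    show ?thesis using True gvars_mult[OF r Pv] by simp
  next
    case False
    then have "R l \<in> gvars (- {N + l})" "e k \<in> gvars (- {N + l})" using that R e(2) by auto
    from gvars_uminus[OF gvars_mult[OF this(2,1)]] show ?thesis using False by simp
  qed
  with eq show ?case by (intro exI[of _ ?R] conjI ballI)
qed simp

lemma power_one_plus_nilpotent:
  fixes w :: "'a::comm_ring_1"
  assumes "w * w = 0"
  shows "(1 + w) ^ k = 1 + of_nat k * w"
proof (induction k)
  case (Suc k)
  have "(1 + w) * (1 + of_nat k * w) = 1 + of_nat (Suc k) * w + of_nat k * (w * w)" by (simp add: algebra_simps)
  then show ?case unfolding assms power_Suc Suc by simp
qed simp

text \<open>The terms surviving to first order in \<open>x\<close> are the divergence of the
  quadratic change of variables and the expansion of the determinant factors. The first is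
  \<open>n - m\<close> on the one list of variables where it matters, the second is
  \<open>m - n\<close>, so the integral is unchanged.\<close>

lemma transforms_lower_elementary:
  fixes x :: "'k::field_char_0 grassmann"
  assumes x: "godd x" and j: "j < n" and i: "i < m"
  shows "transforms m n (blk m n idf (\<lambda>_ _. 0) (\<lambda>b t. if b = j \<and> t = i then x else 0) idf)
    (blk m n idf (\<lambda>_ _. 0) (\<lambda>b t. if b = j \<and> t = i then - x else 0) idf) 1"
proof -
  obtain N where N: "x \<in> gvars {..<N}" using ex_gvars by blast
  let ?L = "m * n"
  define e where "e k = (gmon {N + k} :: 'k grassmann)" for k
  have e: "godd (e k)" for k unfolding e_def by (rule godd_gmon) simp
  have ev: "e k \<in> gvars (- {N + l})" if "k \<noteq> l" for k l unfolding e_def by (rule gmon_gvars) (use that in auto)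
  have eq: "e = (\<lambda>k. gmon {N + k})" by (simp add: fun_eq_iff e_def)
  define q where "q = i * n + j"
  define w where "w = x * e q"
  \<comment> \<open>The solution of z (1 + c eta) = eta, with \<open>c\<close> having the single
    entry \<open>x\<close> at \<open>(j, i)\<close>. As \<open>x\<close> squares to zero, z = eta -
    eta c eta, and moving \<open>x\<close> to the front changes the sign.\<close>
  define z where "z k = e k + x * (e ((k div n) * n + j) * e (i * n + k mod n))" for k
  have zia: "z (l * n + a) = e (l * n + a) + x * (e (l * n + j) * e (i * n + a))" if "a < n" for l a
    using that by (simp add: z_def)
  have zodd: "godd (z k)" for k
    unfolding z_def by (intro godd_add e godd_mult2[OF x] geven_mult_odd)
  have exe: "e k * x = - (x * e k)" for k by (rule godd_anticommute[OF e x])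
  have "\<exists>y. emb y = x * e (i * n + a)" "\<exists>y. emb y = e (a * n + j) * x" for a
    by (intro geven_emb_ex geven_mult_odd x e)+
  then obtain xe ye where xe: "\<And>a. emb (xe a) = x * e (i * n + a)" and ye: "\<And>a. emb (ye a) = e (a * n + j) * x" by metis
  let ?P = "\<lambda>a b. of_bool (b = a) + (if b = j then xe a else 0)" and ?Q = "\<lambda>a b. of_bool (a = b) + (if b = i then ye a else 0)"
  have dP: "fdet n ?P = 1 + xe j"
    using fdet_single_row[OF j, of xe] fdet_transpose[of n ?P] by (simp add: eq_commute)
  have dQ: "fdet m ?Q = 1 + ye i"
    using fdet_single_row[OF i, of ye] fdet_transpose[of m ?Q] by (simp add: eq_commute)
  show ?thesis
  proof (rule transforms_moebius[where N = N and z = z and P = ?P and Q = ?Q, OF eq])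
    show "supermat m n (blk m n idf (\<lambda>_ _. 0) (\<lambda>b t. if b = j \<and> t = i then x else 0) idf)"
      "supermat m n (blk m n idf (\<lambda>_ _. 0) (\<lambda>b t. if b = j \<and> t = i then - x else 0) idf)"
      by (rule supermat_blk; simp add: x godd_uminus)+
    show "(if b = j \<and> t = i then x else 0) \<in> gvars {..<N} \<and> (if b = j \<and> t = i then - x else 0) \<in> gvars {..<N}" for b t
      using N gvars_uminus[OF N] by simp
    show "godd (z k)" for k by (rule zodd)
    show "idf l k + (\<Sum>t<m. (if l = j \<and> t = i then x else 0) * e (t * n + k)) = emb (?P k l)" for k l
    proof -
      have "(\<Sum>t<m. (if l = j \<and> t = i then x else 0) * e (t * n + k)) = (\<Sum>t<m. of_bool (i = t) * (if l = j then x * e (t * n + k) else 0))"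
        by (intro sum.cong refl) auto
      then show ?thesis by (simp add: sum_of_bool_left[OF i] idf_def xe)
    qed
    show "0 + (\<Sum>t<m. idf l t * e (t * n + k)) = (\<Sum>a<n. z (l * n + a) * emb (?P k a))" if k: "k < n" and l: "l < m" for k l
    proof -
      have "(\<Sum>a<n. z (l * n + a) * emb (?P k a)) = (\<Sum>a<n. z (l * n + a) * of_bool (a = k)) + (\<Sum>a<n. z (l * n + a) * emb (xe k) * of_bool (a = j))"
        unfolding sum.distrib[symmetric] by (intro sum.cong refl) (simp add: distrib_left)
      also have "\<dots> = z (l * n + k) + z (l * n + j) * emb (xe k)"
        by (simp only: sum_of_bool_right[OF k] sum_of_bool_right[OF j])
      also have "z (l * n + j) * emb (xe k) = - (x * (e (l * n + j) * e (i * n + k)))"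
      proof -
        have "x * (e (l * n + j) * e (i * n + j)) * (x * e (i * n + k)) = x * ((e (l * n + j) * e (i * n + j)) * x) * e (i * n + k)"
          by (simp only: mult.assoc)
        also have "\<dots> = 0" unfolding godd_sandwich[OF x] by simp
        finally have "z (l * n + j) * emb (xe k) = e (l * n + j) * x * e (i * n + k)"
          unfolding zia[OF j] xe by (simp add: distrib_right mult.assoc)
        then show ?thesis unfolding exe by (simp add: mult.assoc)
      qed
      finally show ?thesis using sum_idf(1)[OF l, of "\<lambda>t. e (t * n + k)"] by (simp add: zia[OF k])
    qed
    show "idf a b - (\<Sum>t<n. e (a * n + t) * (if t = j \<and> b = i then - x else 0)) = emb (?Q a b)" for a b
    proof -
      have "(\<Sum>t<n. e (a * n + t) * (if t = j \<and> b = i then - x else 0)) = (\<Sum>t<n. (if b = i then - (e (a * n + t) * x) else 0) * of_bool (t = j))"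
        by (intro sum.cong refl) auto
      then show ?thesis by (simp add: sum_of_bool_right[OF j] idf_def ye)
    qed
    show "(\<Sum>s<n. e (a * n + s) * idf s t) - 0 = (\<Sum>b<m. emb (?Q a b) * z (b * n + t))" if a: "a < m" and t: "t < n" for a t
    proof -
      have "(\<Sum>b<m. emb (?Q a b) * z (b * n + t)) = (\<Sum>b<m. of_bool (a = b) * z (b * n + t)) + (\<Sum>b<m. of_bool (i = b) * (emb (ye a) * z (b * n + t)))"
        unfolding sum.distrib[symmetric] by (intro sum.cong refl) (auto simp: distrib_right)
      also have "\<dots> = z (a * n + t) + emb (ye a) * z (i * n + t)"
        by (simp only: sum_of_bool_left[OF a] sum_of_bool_left[OF i])
      also have "emb (ye a) * z (i * n + t) = - (x * (e (a * n + j) * e (i * n + t)))"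
      proof -
        have "x * (e (a * n + j) * (x * (e (i * n + j) * e (i * n + t)))) = x * (e (a * n + j) * x) * (e (i * n + j) * e (i * n + t))"
          by (simp only: mult.assoc)
        also have "\<dots> = 0" unfolding godd_sandwich[OF x] by simp
        finally show ?thesis
          unfolding ye exe zia[OF t] by (simp add: distrib_left mult.assoc)
      qed
      finally show ?thesis using sum_idf(2)[OF t, of "\<lambda>s. e (a * n + s)"] by (simp add: zia[OF t])
    qed
    show "gtop N ?L (prod_list (map z ks) * emb (fdet n ?P ^ Suc m * fdet m ?Q ^ Suc n)) = 1 * gtop N ?L (prod_list (map e ks))"
      if ks: "set ks \<subseteq> {..<?L}" for ks
    proof (cases "distinct ks")
      case False
      have "prod_list (map z ks) = 0" "prod_list (map e ks) = 0"
        by (rule godd_prod_repeat[OF zodd False], rule godd_prod_repeat[OF e False])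
      then show ?thesis by simp
    next
      case True
      \<comment> \<open>The multiple of \<open>e k * w\<close> contained in the quadratic term. In
        row \<open>i\<close> that term is \<open>x * (e q * e k)\<close> and in column
        \<open>j\<close> it is \<open>x * (e k * e q)\<close>, which have opposite signs; at
        \<open>q\<close> itself it vanishes.\<close>
      define c where "c k = (of_bool (k div n = i) - of_bool (k mod n = j) :: int)" for k
      let ?d = "int m - int n"
      have wev: "geven w" unfolding w_def by (rule geven_mult_odd[OF x e])
      have wx: "w * x = 0" unfolding w_def using godd_sandwich[OF x, of "e q"] by (simp add: mult.assoc)
      have qd: "q div n = i" "q mod n = j" "q < ?L" using j rect_index[OF i j] by (simp_all add: q_def)
      have ww: "w * w = 0"
        unfolding w_def using godd_sandwich[OF x, of "e q"] by (simp add: mult.assoc[symmetric])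
      \<comment> \<open>Both matrices differ from the identity in one column only, with diagonal
        corrections \<open>w\<close> and \<open>-w\<close>; since \<open>w\<close> squares to zero,
        the powers contribute \<open>Suc m - Suc n\<close> times \<open>w\<close>.\<close>
      have s: "emb (fdet n ?P ^ Suc m * fdet m ?Q ^ Suc n) = 1 + of_int ?d * w"
      proof -
        have xw: "emb (xe j) = w" and yw: "ye i = - xe j"
          using exe[of q] by (simp_all add: xe ye w_def q_def emb_eq_iff[symmetric])
        have nil: "xe j * xe j = 0" using ww by (simp add: emb_eq_iff[symmetric] xw)
        then have nil': "- xe j * - xe j = 0" by simp
        have "fdet n ?P ^ Suc m * fdet m ?Q ^ Suc n = (1 + of_nat (Suc m) * xe j) * (1 + of_nat (Suc n) * - xe j)"
          unfolding dP dQ yw power_one_plus_nilpotent[OF nil] power_one_plus_nilpotent[OF nil'] ..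
        also have "\<dots> = 1 + of_int ?d * xe j - of_nat (Suc m) * of_nat (Suc n) * (xe j * xe j)"
          by (simp add: algebra_simps)
        also have "\<dots> = 1 + of_int ?d * xe j" unfolding nil by simp
        finally show ?thesis by (simp only: emb_simps emb_of_int xw)
      qed
      \<comment> \<open>Off row \<open>i\<close> and column \<open>j\<close> the quadratic term
        involves two variables different from the one with number \<open>k\<close>.\<close>
      define r where "r k = (if k div n \<noteq> i \<and> k mod n \<noteq> j then e ((k div n) * n + j) * e (i * n + k mod n) else 0)" for k
      have rv: "r k \<in> gvars (- {N + k})" for k
      proof (cases "k div n \<noteq> i \<and> k mod n \<noteq> j")
        case True
        have n0: "0 < n" using j by simp
        have "((k div n) * n + j) mod n = j" using j by simp
        then have "(k div n) * n + j \<noteq> k" using True by metis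
        moreover have "(i * n + k mod n) div n = i" using n0 by simp
        then have "i * n + k mod n \<noteq> k" using True by metis
        ultimately show ?thesis unfolding r_def using True gvars_mult[OF ev ev] by simp
      qed (auto simp: r_def)
      have zc: "z k = e k * (1 + of_int (c k) * w) + x * r k" for k
      proof -
        have we: "e k * w = x * (e q * e k)" unfolding geven_commute[OF wev, symmetric] by (simp add: w_def mult.assoc)
        have eqk: "e k * e q = - (e q * e k)" by (rule godd_anticommute[OF e e])
        have kk: "k div n * n + k mod n = k" by simp
        consider "k div n = i" "k mod n = j" | "k div n = i" "k mod n \<noteq> j" | "k div n \<noteq> i" "k mod n = j" | "k div n \<noteq> i" "k mod n \<noteq> j"
          by blast
        then show ?thesis
        proof cases
          case 1
          then have "k = q" using kk by (simp add: q_def)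
          then show ?thesis using 1 godd_square[OF e, of q] by (simp add: z_def r_def c_def q_def)
        next
          case 2
          then have k: "i * n + k mod n = k" using kk by simp
          show ?thesis using 2 by (simp add: z_def r_def c_def k distrib_left we q_def[symmetric])
        next
          case 3
          then have k: "k div n * n + j = k" using kk by simp
          show ?thesis using 3 by (simp add: z_def r_def c_def k right_diff_distrib we q_def[symmetric] eqk)
        next
          case 4
          then show ?thesis by (simp add: z_def r_def c_def)
        qed
      qed
      obtain R where R: "\<And>k. k \<in> set ks \<Longrightarrow> R k \<in> gvars (- {N + k})"
        and pz: "prod_list (map z ks) = prod_list (map e ks) * (1 + of_int (\<Sum>k\<in>set ks. c k) * w) + x * (\<Sum>k\<in>set ks. R k)"
        using prod_list_chart[where x = x and e = e and N = N and w = w and q = q and r = r and ks = ks and c = c,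
          OF x e ev w_def rv True] unfolding zc[symmetric] by blast
      let ?p = "prod_list (map e ks)" and ?C = "\<Sum>k\<in>set ks. c k" and ?S = "\<Sum>k\<in>set ks. R k"
      have icomm: "of_int i * y = y * of_int i" for i and y :: "'k grassmann" by (rule mult_of_int_commute)
      have "prod_list (map z ks) * (1 + of_int ?d * w) = ?p + ?p * (of_int (?C + ?d) * w) + x * ?S"
      proof -
        have "of_int ?C * w * (of_int ?d * w) = of_int ?C * of_int ?d * (w * w)"
        proof -
          have "of_int ?C * w * (of_int ?d * w) = of_int ?C * (w * of_int ?d) * w" by (simp only: mult.assoc)
          then show ?thesis unfolding icomm[of ?d w, symmetric] by (simp only: mult.assoc)
        qed
        then have 1: "(1 + of_int ?C * w) * (1 + of_int ?d * w) = 1 + of_int (?C + ?d) * w"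
          by (simp add: algebra_simps ww)
        have "x * ?S * (of_int ?d * w) = of_int ?d * (x * ?S * w)" by (simp only: mult.assoc icomm)
        also have "x * ?S * w = w * x * ?S" unfolding geven_commute[OF wev, of "x * ?S", symmetric] by (simp only: mult.assoc)
        finally have 2: "x * ?S * (1 + of_int ?d * w) = x * ?S" by (simp add: distrib_left wx)
        have "prod_list (map z ks) * (1 + of_int ?d * w) =
            ?p * ((1 + of_int ?C * w) * (1 + of_int ?d * w)) + x * ?S * (1 + of_int ?d * w)"
          unfolding pz distrib_right[of "?p * (1 + of_int ?C * w)" "x * ?S"] by (simp only: mult.assoc)
        then show ?thesis unfolding 1 2 by (simp only: distrib_left mult_1_right)
      qed
      moreover have "gtop N ?L (x * ?S) = 0"
      proof -
        have "gtop N ?L (R k) = 0" if "k \<in> set ks" for k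
          by (rule gtop_missing[OF R[OF that]]) (use ks that in auto)
        then show ?thesis unfolding gtop_mult[OF N] gtop_sum by simp
      qed
      \<comment> \<open>Multiplication by \<open>w\<close> brings in the variable number
        \<open>q\<close>. The top degree is reached exactly if \<open>ks\<close> lists all the other
        variables; then the \<open>c k\<close> sum to \<open>n - m\<close>, because
        \<open>c q\<close> is 0, and the factor \<open>?C + ?d\<close> vanishes.\<close>
      moreover have "gtop N ?L (?p * (of_int (?C + ?d) * w)) = 0"
      proof -
        have pw: "?p * (of_int (?C + ?d) * w) = of_int (?C + ?d) * (x * prod_list (map e (q # ks)))"
        proof -
          have "?p * (of_int (?C + ?d) * w) = of_int (?C + ?d) * (?p * w)"
            unfolding mult.assoc[symmetric] icomm[of "?C + ?d" ?p] ..
          also have "?p * w = w * ?p" by (rule geven_commute[OF wev, symmetric])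
          finally show ?thesis by (simp add: w_def mult.assoc)
        qed
        have iv: "of_int (?C + ?d) \<in> (gvars {..<N} :: 'k grassmann set)"
          using gvars_simps(3)[of "of_int (?C + ?d) :: 'k" "{..<N}"] by (simp only: gconst_of_int)
        have "of_int (?C + ?d) * (x * gtop N ?L (prod_list (map e (q # ks)))) = 0"
        proof (cases "distinct (q # ks) \<and> set (q # ks) = {..<?L}")
          case True
          then have "set ks = {..<?L} - {q}" by auto
          then have "?C = (\<Sum>k<?L. c k)"
            using sum.remove[of "{..<?L}" q c] qd by (simp add: c_def)
          also have "\<dots> = (\<Sum>t<m. \<Sum>s<n. of_bool (t = i) - of_bool (s = j))"
            unfolding sum_rect by (intro sum.cong refl) (simp add: c_def)
          also have "\<dots> = int n - int m"
            using sum_of_bool_right[OF i, of "\<lambda>_. int n"] sum_of_bool_right[OF j, of "\<lambda>_. 1 :: int"] by (simp add: sum_subtractf)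
          finally show ?thesis by simp
        next
          case F: False
          have "gtop N ?L (prod_list (map e (q # ks))) = 0"
          proof (cases "distinct (q # ks)")
            case True
            then obtain k where k: "k < ?L" "k \<notin> set (q # ks)" using F ks qd by auto
            have "prod_list (map e (q # ks)) \<in> gvars (- {N + k})"
              by (rule gvars_prod_list) (use k in \<open>auto intro!: ev\<close>)
            then show ?thesis by (rule gtop_missing[OF _ k(1)])
          next
            case False
            show ?thesis unfolding godd_prod_repeat[OF e False] by simp
          qed
          then show ?thesis by simp
        qed
        then show ?thesis unfolding pw gtop_mult[OF iv] gtop_mult[OF N] .
      qed
      ultimately show ?thesis unfolding s by (simp add: gtop_add)
    qed
  qed simp_all
qed

text \<open>Lower unitriangular matrices multiply by adding their lower blocks, so the matrix is a
  product of elementary ones. Treating one entry at a time keeps the parameter square zero.\<close>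

lemma transforms_lower:
  fixes Y :: "nat \<Rightarrow> nat \<Rightarrow> 'k::field_char_0 grassmann"
  assumes Y: "\<And>i j. i < n \<Longrightarrow> j < m \<Longrightarrow> godd (Y i j)"
  shows "transforms m n (blk m n idf (\<lambda>_ _. 0) Y idf) (blk m n idf (\<lambda>_ _. 0) (\<lambda>i j. - Y i j) idf) 1"
proof -
  let ?Y = "\<lambda>T b t. if (b, t) \<in> T then Y b t else 0"
  have "transforms m n (blk m n idf (\<lambda>_ _. 0) (?Y T) idf) (blk m n idf (\<lambda>_ _. 0) (\<lambda>b t. - ?Y T b t) idf) 1"
    if "finite T" "T \<subseteq> {..<n} \<times> {..<m}" for T
    using that
  proof (induction T rule: finite_induct)
    case empty
    show ?case using transforms_upper[of m n "\<lambda>_ _. 0 :: 'k grassmann"] by simp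
  next
    case (insert p T)
    obtain j i where p: "p = (j, i)" by (cases p)
    have ji: "j < n" "i < m" using insert.prems p by auto
    let ?x = "Y j i"
    let ?e = "\<lambda>y b t. if b = j \<and> t = i then y else (0 :: 'k grassmann)"
    have x: "godd ?x" using Y ji by simp
    have m1: "supermat m n (blk m n idf (\<lambda>_ _. 0) (?e ?x) idf)" "supermat m n (blk m n idf (\<lambda>_ _. 0) (?e (- ?x)) idf)"
      by (rule supermat_blk; simp add: x godd_uminus)+
    have mul: "blk m n idf (\<lambda>_ _. 0) C idf * blk m n idf (\<lambda>_ _. 0) C' idf = blk m n idf (\<lambda>_ _. 0) (\<lambda>b t. C b t + C' b t :: 'k grassmann) idf" for C C'
      unfolding blk_mult by (rule blk_cong) (simp_all add: sum_idf)
    have "transforms m n (blk m n idf (\<lambda>_ _. 0) (?e ?x) idf * blk m n idf (\<lambda>_ _. 0) (?Y T) idf)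
        (blk m n idf (\<lambda>_ _. 0) (\<lambda>b t. - ?Y T b t) idf * blk m n idf (\<lambda>_ _. 0) (?e (- ?x)) idf) (1 * 1)"
      by (rule transforms_comp[OF transforms_lower_elementary[OF x ji] insert.IH m1 blk_carrier blk_carrier])
        (use insert.prems in auto)
    moreover have "(\<lambda>b t. ?e ?x b t + ?Y T b t) = ?Y (insert p T)" "(\<lambda>b t. - ?Y T b t + ?e (- ?x) b t) = (\<lambda>b t. - ?Y (insert p T) b t)"
      using insert.hyps(2) by (auto simp: fun_eq_iff p)
    ultimately show ?case unfolding mul by simp
  qed
  from this[of "{..<n} \<times> {..<m}"]
  have "transforms m n (blk m n idf (\<lambda>_ _. 0) (?Y ({..<n} \<times> {..<m})) idf) (blk m n idf (\<lambda>_ _. 0) (\<lambda>b t. - ?Y ({..<n} \<times> {..<m}) b t) idf) 1"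
    by simp
  moreover have "blk m n idf (\<lambda>_ _. 0) (?Y ({..<n} \<times> {..<m})) idf = blk m n idf (\<lambda>_ _. 0) Y idf"
    "blk m n idf (\<lambda>_ _. 0) (\<lambda>b t. - ?Y ({..<n} \<times> {..<m}) b t) idf = blk m n idf (\<lambda>_ _. 0) (\<lambda>i j. - Y i j) idf"
    by (rule blk_cong; simp)+
  ultimately show ?thesis by (simp only:)
qed

section \<open>The action of the general linear supergroup\<close>

lemma mat_inv_eq:
  assumes A: "A \<in> carrier_mat N N" and B: "B \<in> carrier_mat N N" and AB: "A * B = 1\<^sub>m N" "B * A = 1\<^sub>m N"
  shows "mat_inv A = B"
  unfolding mat_inv_def
proof (rule the_equality)
  show "B \<in> carrier_mat (dim_col A) (dim_row A) \<and> inverts_mat A B \<and> inverts_mat B A"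
    using A B AB by (auto simp: inverts_mat_def)
next
  fix C assume "C \<in> carrier_mat (dim_col A) (dim_row A) \<and> inverts_mat A C \<and> inverts_mat C A"
  then have C: "C \<in> carrier_mat N N" "C * A = 1\<^sub>m N" using A by (auto simp: inverts_mat_def)
  have "C = C * (A * B)" unfolding AB(1) using C(1) by simp
  also have "\<dots> = (C * A) * B" by (rule assoc_mult_mat[OF C(1) A B, symmetric])
  also have "\<dots> = B" unfolding C(2) using B by simp
  finally show "C = B" .
qed

lemma inverse_mat_mult:
  fixes A :: "'a::semiring_1 mat"
  assumes "A \<in> carrier_mat N N" "A' \<in> carrier_mat N N" "B \<in> carrier_mat N N" "B' \<in> carrier_mat N N"
    and "A * A' = 1\<^sub>m N" "B * B' = 1\<^sub>m N"
  shows "(A * B) * (B' * A') = 1\<^sub>m N"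
proof -
  have "(A * B) * (B' * A') = A * (B * (B' * A'))" by (rule assoc_mult_mat) (use assms in auto)
  also have "B * (B' * A') = (B * B') * A'" by (rule assoc_mult_mat[symmetric]) (use assms in auto)
  also have "\<dots> = A'" unfolding assms(6) by (rule left_mult_one_mat[OF assms(2)])
  finally show ?thesis unfolding assms(5) .
qed

lemma ring_inv_eq: "x * y = 1 \<Longrightarrow> y * x = 1 \<Longrightarrow> ring_inv x = y"
  unfolding ring_inv_def
proof (rule the_equality)
  fix z assume xy: "x * y = 1" and "x * z = 1 \<and> z * x = 1"
  then have "z = z * (x * y)" "z * x = 1" by simp_all
  then show "z = y" by (simp add: mult.assoc[symmetric])
qed simp

lemma leibniz_det_emb:
  assumes A: "A \<in> carrier_mat l l" and M: "\<And>i j. i < l \<Longrightarrow> j < l \<Longrightarrow> A $$ (i, j) = emb (M i j)"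
  shows "leibniz_det A = emb (fdet l M)"
proof -
  have d: "dim_row A = l" using A by simp
  have "prod_list (map (\<lambda>i. A $$ (i, p i)) [0..<l]) = emb (\<Prod>i<l. M i (p i))" if p: "p permutes {0..<l}" for p
    unfolding emb_prod
  proof (intro arg_cong[where f = prod_list] map_cong refl)
    fix i assume "i \<in> set [0..<l]"
    then show "A $$ (i, p i) = emb (M i (p i))" using M permutes_in_image[OF p, of i] by simp
  qed
  then show ?thesis unfolding leibniz_det_def d fdet_def
    by (simp add: emb_sum emb_of_int atLeast0LessThan)
qed

text \<open>An even matrix is invertible as soon as its body is: the body of its determinant is then
  nonzero, the determinant is a unit by \<open>evn_unit\<close>, and the adjugate gives the inverse
  on both sides.\<close>

lemma evn_matrix_inverse:
  fixes a b :: "nat \<Rightarrow> nat \<Rightarrow> 'k::field_char_0 grassmann"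
  assumes a: "\<And>i j. i < l \<Longrightarrow> j < l \<Longrightarrow> geven (a i j)"
    and b: "\<And>i j. i < l \<Longrightarrow> j < l \<Longrightarrow> (\<Sum>t<l. gcoeff (a i t) {} * gcoeff (b t j) {}) = of_bool (i = j)"
  obtains A A' :: "nat \<Rightarrow> nat \<Rightarrow> 'k evn" where "\<And>i j. i < l \<Longrightarrow> j < l \<Longrightarrow> emb (A i j) = a i j"
    "\<And>i j. i < l \<Longrightarrow> j < l \<Longrightarrow> (\<Sum>t<l. A i t * A' t j) = idf i j"
    "\<And>i j. i < l \<Longrightarrow> j < l \<Longrightarrow> (\<Sum>t<l. A' i t * A t j) = idf i j" "fdet l A * fdet l A' = 1"
proof -
  interpret comm_ring_hom "body :: 'k evn \<Rightarrow> 'k" by (rule body_hom)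
  define A where "A i j = (SOME y. emb y = a i j)" for i j
  have A: "emb (A i j) = a i j" if "i < l" "j < l" for i j
    unfolding A_def by (rule someI_ex[OF geven_emb_ex[OF a[OF that]]])
  have "body (fdet l A) = fdet l (\<lambda>i j. body (A i j))"
    by (simp add: fdet_def hom_distribs)
  then have "body (fdet l A) * fdet l (\<lambda>i j. gcoeff (b i j) {}) = fdet l (\<lambda>i j. \<Sum>t<l. body (A i t) * gcoeff (b t j) {})"
    by (simp only: fdet_mult)
  also have "\<dots> = fdet l idf"
    by (rule fdet_cong) (use b A in \<open>simp add: body_def idf_def\<close>)
  finally have "body (fdet l A) \<noteq> 0" unfolding fdet_idf by auto
  then obtain u where u: "fdet l A * u = 1" using evn_unit by blast
  let ?M = "mat l l (\<lambda>(i, j). A i j)"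
  have M: "?M \<in> carrier_mat l l" by simp
  note adj = adj_mat[OF M, folded fdet_det]
  define A' where "A' i j = u * adj_mat ?M $$ (i, j)" for i j
  have 1: "(\<Sum>t<l. A i t * A' t j) = idf i j" if ij: "i < l" "j < l" for i j
  proof -
    have "(\<Sum>t<l. A i t * A' t j) = u * (?M * adj_mat ?M) $$ (i, j)"
      unfolding mat_mult_entry[OF M adj(1) ij] sum_distrib_left by (intro sum.cong refl) (use ij in \<open>simp add: A'_def mult_ac\<close>)
    also have "\<dots> = fdet l A * u * of_bool (i = j)" unfolding adj(2) using ij by simp
    finally show ?thesis unfolding u by (simp add: idf_def)
  qed
  have 2: "(\<Sum>t<l. A' i t * A t j) = idf i j" if ij: "i < l" "j < l" for i j
  proof -
    have "(\<Sum>t<l. A' i t * A t j) = u * (adj_mat ?M * ?M) $$ (i, j)"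
      unfolding mat_mult_entry[OF adj(1) M ij] sum_distrib_left by (intro sum.cong refl) (use ij in \<open>simp add: A'_def mult_ac\<close>)
    also have "\<dots> = fdet l A * u * of_bool (i = j)" unfolding adj(3) using ij by simp
    finally show ?thesis unfolding u by (simp add: idf_def)
  qed
  have "fdet l A * fdet l A' = fdet l (\<lambda>i j. \<Sum>t<l. A i t * A' t j)" by (rule fdet_mult[symmetric])
  also have "\<dots> = fdet l idf" by (rule fdet_cong) (rule 1)
  finally have "fdet l A * fdet l A' = 1" unfolding fdet_idf .
  with A 1 2 show thesis by (rule that)
qed

lemma godd_body: "godd (x :: 'k::field_char_0 grassmann) \<Longrightarrow> gcoeff x {} = 0"
  unfolding godd_iff by fastforce

lemma blk_inverse:
  fixes X :: "nat \<Rightarrow> nat \<Rightarrow> 'a::ring_1"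
  shows "blk m n idf X (\<lambda>_ _. 0) idf * blk m n idf (\<lambda>i j. - X i j) (\<lambda>_ _. 0) idf = 1\<^sub>m (m + n)"
    "blk m n idf (\<lambda>i j. - X i j) (\<lambda>_ _. 0) idf * blk m n idf X (\<lambda>_ _. 0) idf = 1\<^sub>m (m + n)"
    "blk m n idf (\<lambda>_ _. 0) X idf * blk m n idf (\<lambda>_ _. 0) (\<lambda>i j. - X i j) idf = 1\<^sub>m (m + n)"
    "blk m n idf (\<lambda>_ _. 0) (\<lambda>i j. - X i j) idf * blk m n idf (\<lambda>_ _. 0) X idf = 1\<^sub>m (m + n)"
  unfolding blk_mult blk_idf[symmetric] by (rule blk_cong; simp add: sum_idf sum_negf)+

lemma blk_diag_inverse:
  assumes "\<And>i j. i < m \<Longrightarrow> j < m \<Longrightarrow> (\<Sum>t<m. S i t * S' t j) = idf i j"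
    "\<And>i j. i < n \<Longrightarrow> j < n \<Longrightarrow> (\<Sum>t<n. D i t * D' t j) = idf i j"
  shows "blk m n (\<lambda>i j. emb (S i j)) (\<lambda>_ _. 0) (\<lambda>_ _. 0) (\<lambda>i j. emb (D i j)) *
    blk m n (\<lambda>i j. emb (S' i j)) (\<lambda>_ _. 0) (\<lambda>_ _. 0) (\<lambda>i j. emb (D' i j)) = 1\<^sub>m (m + n)"
  unfolding blk_mult blk_idf[symmetric]
proof (rule blk_cong)
  show "(\<Sum>t<m. emb (S i t) * emb (S' t j)) + (\<Sum>t<n. 0 * 0) = idf i j" if "i < m" "j < m" for i j
    using arg_cong[OF assms(1)[OF that], of emb] by (simp add: emb_sum)
  show "(\<Sum>t<m. 0 * 0) + (\<Sum>t<n. emb (D i t) * emb (D' t j)) = idf i j" if "i < n" "j < n" for i j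
    using arg_cong[OF assms(2)[OF that], of emb] by (simp add: emb_sum)
qed simp_all

text \<open>Gauss decomposition: a supermatrix is upper unitriangular times block diagonal times lower
  unitriangular, the diagonal blocks being the Schur complement and \<open>A\<^sub>2\<^sub>2\<close>.\<close>

lemma transforms_invertible:
  fixes M :: "'k::field_char_0 grassmann mat"
  assumes M: "supermat m n M" and B: "B \<in> carrier_mat (m + n) (m + n)" "M * B = 1\<^sub>m (m + n)"
  obtains \<chi> where "transforms m n M (mat_inv M) \<chi>" "\<chi> = ring_inv (Ber m M)" "geven \<chi>"
proof -
  have Mc: "M \<in> carrier_mat (m + n) (m + n)" using M by (simp add: supermat_def)
  define a b c d where "a i j = M $$ (i, j)" and "b i j = M $$ (i, m + j)" and "c i j = M $$ (m + i, j)"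
    and "d i j = M $$ (m + i, m + j)" for i j
  have par: "\<And>i j. i < m \<Longrightarrow> j < m \<Longrightarrow> geven (a i j)" "\<And>i j. i < m \<Longrightarrow> j < n \<Longrightarrow> godd (b i j)"
    "\<And>i j. i < n \<Longrightarrow> j < m \<Longrightarrow> godd (c i j)" "\<And>i j. i < n \<Longrightarrow> j < n \<Longrightarrow> geven (d i j)"
  proof -
    have p: "if (i < m) = (j < m) then geven (M $$ (i, j)) else godd (M $$ (i, j))" if "i < m + n" "j < m + n" for i j
      using M that by (simp add: supermat_def)
    show "geven (a i j)" if "i < m" "j < m" for i j using p[of i j] that by (simp add: a_def)
    show "godd (b i j)" if "i < m" "j < n" for i j using p[of i "m + j"] that by (simp add: b_def)
    show "godd (c i j)" if "i < n" "j < m" for i j using p[of "m + i" j] that by (simp add: c_def)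
    show "geven (d i j)" if "i < n" "j < n" for i j using p[of "m + i" "m + j"] that by (simp add: d_def)
  qed
  have prod: "(\<Sum>k<m. M $$ (i, k) * B $$ (k, j)) + (\<Sum>k<n. M $$ (i, m + k) * B $$ (m + k, j)) = of_bool (i = j)"
    if "i < m + n" "j < m + n" for i j
    using arg_cong[OF B(2), of "\<lambda>A. A $$ (i, j)"] that
    unfolding mat_mult_entry[OF Mc B(1) that] sum_lessThan_add by simp
  have coeff1: "gcoeff (of_bool p :: 'k grassmann) {} = of_bool p" for p by (simp add: gcoeff_one)
  \<comment> \<open>On bodies the odd blocks vanish, so the equation \<open>M * B = 1\<close> splits
    into one equation for each diagonal block.\<close>
  have bd: "(\<Sum>k<m. gcoeff (M $$ (i, k)) {} * gcoeff (B $$ (k, j)) {}) +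
      (\<Sum>k<n. gcoeff (M $$ (i, m + k)) {} * gcoeff (B $$ (m + k, j)) {}) = of_bool (i = j)"
    if "i < m + n" "j < m + n" for i j
    using arg_cong[OF prod[OF that], of "\<lambda>x. gcoeff x {}"] by (simp only: gcoeff_add gcoeff_sum gcoeff_mult_empty coeff1)
  have "(\<Sum>t<n. gcoeff (d i t) {} * gcoeff (B $$ (m + t, m + j)) {}) = of_bool (i = j)" if "i < n" "j < n" for i j
  proof -
    have "(\<Sum>k<m. gcoeff (M $$ (m + i, k)) {} * gcoeff (B $$ (k, m + j)) {}) = 0"
      by (rule sum.neutral) (use godd_body[OF par(3)] that in \<open>auto simp: c_def\<close>)
    then show ?thesis using bd[of "m + i" "m + j"] that by (simp add: d_def)
  qed
  then obtain D D' where D: "\<And>i j. i < n \<Longrightarrow> j < n \<Longrightarrow> emb (D i j) = d i j"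
    "\<And>i j. i < n \<Longrightarrow> j < n \<Longrightarrow> (\<Sum>t<n. D i t * D' t j) = idf i j"
    "\<And>i j. i < n \<Longrightarrow> j < n \<Longrightarrow> (\<Sum>t<n. D' i t * D t j) = idf i j" "fdet n D * fdet n D' = 1"
    using evn_matrix_inverse[of n d "\<lambda>i j. B $$ (m + i, m + j)", OF par(4)] by blast
  \<comment> \<open>The off-diagonal factors of the decomposition are A12 A22^-1 and A22^-1
    A21.\<close>
  define X where "X i j = (\<Sum>t<n. b i t * emb (D' t j))" for i j
  define Y where "Y i j = (\<Sum>t<n. emb (D' i t) * c t j)" for i j
  have Xo: "godd (X i j)" if "i < m" for i j
    unfolding X_def by (intro godd_sum godd_mult2 par geven_emb) (use that in auto)
  have Yo: "godd (Y i j)" if "j < m" for i j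
    unfolding Y_def
  proof (rule godd_sum)
    fix t assume "t \<in> {..<n}"
    then have "godd (c t j)" using par(3) that by simp
    then show "godd (emb (D' i t) * c t j)"
      unfolding geven_commute[OF geven_emb] by (rule godd_mult2[OF _ geven_emb])
  qed
  \<comment> \<open>The Schur complement, which differs from A11 by products of odd elements and
    therefore has the same body.\<close>
  define s where "s i j = a i j - (\<Sum>t<n. X i t * c t j)" for i j
  have sev: "geven (s i j)" if "i < m" "j < m" for i j
    unfolding s_def by (intro geven_diff geven_sum geven_mult_odd par Xo) (use that in auto)
  have "(\<Sum>t<m. gcoeff (s i t) {} * gcoeff (B $$ (t, j)) {}) = of_bool (i = j)" if "i < m" "j < m" for i j
  proof -
    have sb: "gcoeff (s i t) {} = gcoeff (M $$ (i, t)) {}" for t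
      using godd_body[OF Xo[OF that(1)]] by (simp add: s_def gcoeff_sum gcoeff_mult_empty a_def)
    have "(\<Sum>k<n. gcoeff (M $$ (i, m + k)) {} * gcoeff (B $$ (m + k, j)) {}) = 0"
      by (rule sum.neutral) (use godd_body[OF par(2)] that in \<open>auto simp: b_def\<close>)
    then show ?thesis using bd[of i j] that by (simp add: sb)
  qed
  then obtain S S' where S: "\<And>i j. i < m \<Longrightarrow> j < m \<Longrightarrow> emb (S i j) = s i j"
    "\<And>i j. i < m \<Longrightarrow> j < m \<Longrightarrow> (\<Sum>t<m. S i t * S' t j) = idf i j"
    "\<And>i j. i < m \<Longrightarrow> j < m \<Longrightarrow> (\<Sum>t<m. S' i t * S t j) = idf i j" "fdet m S * fdet m S' = 1"
    using evn_matrix_inverse[of m s "\<lambda>i j. B $$ (i, j)", OF sev] by blast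
  let ?U = "blk m n idf X (\<lambda>_ _. 0) idf" and ?U' = "blk m n idf (\<lambda>i j. - X i j) (\<lambda>_ _. 0) idf"
  let ?L = "blk m n idf (\<lambda>_ _. 0) Y idf" and ?L' = "blk m n idf (\<lambda>_ _. 0) (\<lambda>i j. - Y i j) idf"
  let ?G = "blk m n (\<lambda>i j. emb (S i j)) (\<lambda>_ _. 0) (\<lambda>_ _. 0) (\<lambda>i j. emb (D i j))"
  let ?G' = "blk m n (\<lambda>i j. emb (S' i j)) (\<lambda>_ _. 0) (\<lambda>_ _. 0) (\<lambda>i j. emb (D' i j))"
  let ?M' = "(?L' * ?G') * ?U'"
  \<comment> \<open>The unitriangular factors contribute 1, so the character is the inverse
    determinant of the Schur complement times the determinant of A22, that is the inverse of the
    Berezinian.\<close>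
  let ?\<chi> = "emb (fdet m S' * fdet n D)"
  have DY: "(\<Sum>t<n. emb (D i t) * Y t j) = c i j" if "i < n" for i j
  proof -
    have "(\<Sum>t<n. emb (D i t) * Y t j) = (\<Sum>t<n. \<Sum>r<n. emb (D i t * D' t r) * c r j)"
      unfolding Y_def sum_distrib_left by (simp add: mult.assoc)
    also have "\<dots> = (\<Sum>r<n. \<Sum>t<n. emb (D i t * D' t r) * c r j)" by (rule sum.swap)
    also have "\<dots> = (\<Sum>r<n. emb (\<Sum>t<n. D i t * D' t r) * c r j)" by (simp only: emb_sum sum_distrib_right)
    also have "\<dots> = (\<Sum>r<n. idf i r * c r j)" by (intro sum.cong refl) (simp add: D(2)[OF that])
    finally show ?thesis using that by (simp add: sum_idf)
  qed
  have XD: "(\<Sum>t<n. X i t * emb (D t j)) = b i j" if "j < n" for i j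
  proof -
    have "(\<Sum>t<n. X i t * emb (D t j)) = (\<Sum>t<n. \<Sum>r<n. b i r * emb (D' r t * D t j))"
      unfolding X_def sum_distrib_right by (simp add: mult.assoc)
    also have "\<dots> = (\<Sum>r<n. \<Sum>t<n. b i r * emb (D' r t * D t j))" by (rule sum.swap)
    also have "\<dots> = (\<Sum>r<n. b i r * emb (\<Sum>t<n. D' r t * D t j))" by (simp only: emb_sum sum_distrib_left)
    also have "\<dots> = (\<Sum>r<n. b i r * idf r j)" by (intro sum.cong refl) (simp add: D(3)[OF _ that])
    finally show ?thesis using that by (simp add: sum_idf)
  qed
  have XD': "(\<Sum>t<n. X i t * d t j) = b i j" if "j < n" for i j
    unfolding XD[OF that, symmetric] by (intro sum.cong refl) (simp add: D(1) that)
  have GL: "?G * ?L = blk m n (\<lambda>i j. emb (S i j)) (\<lambda>_ _. 0) c (\<lambda>i j. emb (D i j))"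
    unfolding blk_mult by (rule blk_cong) (simp_all add: sum_idf DY)
  have Meq: "?U * (?G * ?L) = M"
  proof -
    have "?U * (?G * ?L) = blk m n a b c d"
      unfolding GL unfolding blk_mult
      by (rule blk_cong) (simp_all add: sum_idf XD XD' S(1) D(1) s_def)
    also have "\<dots> = M"
    proof (rule eq_matI)
      fix i j assume "i < dim_row M" "j < dim_col M"
      then have "i < m + n" "j < m + n" using Mc by auto
      then show "blk m n a b c d $$ (i, j) = M $$ (i, j)"
        by (auto simp: blk_index' a_def b_def c_def d_def)
    qed (use Mc in \<open>auto simp: blk_def\<close>)
    finally show ?thesis .
  qed
  have car: "?G * ?L \<in> carrier_mat (m + n) (m + n)" "?L' * ?G' \<in> carrier_mat (m + n) (m + n)"
    by (rule mult_carrier_mat[OF blk_carrier blk_carrier])+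
  have sU: "supermat m n ?U" "supermat m n ?U'" and sG: "supermat m n ?G" "supermat m n ?G'"
    by (rule supermat_blk; simp add: Xo godd_uminus)+
  have T: "transforms m n M ?M' (1 * (?\<chi> * 1))"
  proof -
    have TU: "transforms m n ?U ?U' 1" by (rule transforms_upper) (rule Xo)
    have TL: "transforms m n ?L ?L' 1" by (rule transforms_lower) (rule Yo)
    have TG: "transforms m n ?G ?G' ?\<chi>" by (rule transforms_diag[OF S(3,4) D(3,4)])
    have "transforms m n (?G * ?L) (?L' * ?G') (?\<chi> * 1)"
      by (rule transforms_comp[OF TG TL sG blk_carrier blk_carrier])
    from transforms_comp[OF TU this sU car] show ?thesis unfolding Meq .
  qed
  have inv: "M * ?M' = 1\<^sub>m (m + n)" "?M' * M = 1\<^sub>m (m + n)"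
  proof -
    have g: "?G * ?G' = 1\<^sub>m (m + n)" "?G' * ?G = 1\<^sub>m (m + n)"
      by (rule blk_diag_inverse[OF S(2) D(2)], assumption+) (rule blk_diag_inverse[OF S(3) D(3)], assumption+)
    have "(?G * ?L) * (?L' * ?G') = 1\<^sub>m (m + n)"
      by (rule inverse_mat_mult[OF blk_carrier blk_carrier blk_carrier blk_carrier g(1) blk_inverse(3)])
    from inverse_mat_mult[OF blk_carrier blk_carrier car blk_inverse(1)[of m n X] this]
    show "M * ?M' = 1\<^sub>m (m + n)" unfolding Meq .
    have "(?L' * ?G') * (?G * ?L) = 1\<^sub>m (m + n)"
      by (rule inverse_mat_mult[OF blk_carrier blk_carrier blk_carrier blk_carrier blk_inverse(4) g(2)])
    from inverse_mat_mult[OF car(2,1) blk_carrier blk_carrier this blk_inverse(2)[of m n X]]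
    show "?M' * M = 1\<^sub>m (m + n)" unfolding Meq .
  qed
  have minv: "mat_inv M = ?M'"
    by (rule mat_inv_eq[OF Mc _ inv]) (rule mult_carrier_mat[OF car(2) blk_carrier])
  have ber: "Ber m M = emb (fdet m S * fdet n D')"
  proof -
    let ?A11 = "mat m m (\<lambda>(i, j). a i j)" and ?A12 = "mat m n (\<lambda>(i, j). b i j)"
    let ?A21 = "mat n m (\<lambda>(i, j). c i j)" and ?A22 = "mat n n (\<lambda>(i, j). d i j)"
    let ?Di = "mat n n (\<lambda>(i, j). emb (D' i j))"
    have dims: "dim_row M = m + n" "dim_col M = m + n" using Mc by auto
    have sb: "split_block M m m = (?A11, ?A12, ?A21, ?A22)"
      unfolding split_block_def Let_def dims
      by (auto simp: a_def b_def c_def d_def add.commute intro!: cong_mat)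
    have cm: "?A12 \<in> carrier_mat m n" "?A21 \<in> carrier_mat n m" "?A22 \<in> carrier_mat n n" "?Di \<in> carrier_mat n n" by simp_all
    have Di: "mat_inv ?A22 = ?Di"
    proof (rule mat_inv_eq[OF cm(3,4)])
      show "?A22 * ?Di = 1\<^sub>m n"
      proof (rule eq_matI)
        fix i j assume "i < dim_row (1\<^sub>m n)" "j < dim_col (1\<^sub>m n)"
        then have ij: "i < n" "j < n" by simp_all
        have "(?A22 * ?Di) $$ (i, j) = (\<Sum>t<n. emb (D i t) * emb (D' t j))"
          unfolding mat_mult_entry[OF cm(3,4) ij] by (intro sum.cong refl) (use ij D(1) in simp)
        also have "\<dots> = emb (idf i j)" by (simp add: D(2)[OF ij, symmetric] emb_sum del: emb_idf)
        finally show "(?A22 * ?Di) $$ (i, j) = 1\<^sub>m n $$ (i, j)" using ij by (simp add: idf_def)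
      qed simp_all
      show "?Di * ?A22 = 1\<^sub>m n"
      proof (rule eq_matI)
        fix i j assume "i < dim_row (1\<^sub>m n)" "j < dim_col (1\<^sub>m n)"
        then have ij: "i < n" "j < n" by simp_all
        have "(?Di * ?A22) $$ (i, j) = (\<Sum>t<n. emb (D' i t) * emb (D t j))"
          unfolding mat_mult_entry[OF cm(4,3) ij] by (intro sum.cong refl) (use ij D(1) in simp)
        also have "\<dots> = emb (idf i j)" by (simp add: D(3)[OF ij, symmetric] emb_sum del: emb_idf)
        finally show "(?Di * ?A22) $$ (i, j) = 1\<^sub>m n $$ (i, j)" using ij by (simp add: idf_def)
      qed simp_all
    qed
    have c2: "?A12 * ?Di \<in> carrier_mat m n" by (rule mult_carrier_mat[OF cm(1,4)])
    have "leibniz_det ?Di = emb (fdet n D')" by (rule leibniz_det_emb) simp_all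
    moreover have "leibniz_det (?A11 - ?A12 * ?Di * ?A21) = emb (fdet m S)"
    proof (rule leibniz_det_emb)
      show "?A11 - ?A12 * ?Di * ?A21 \<in> carrier_mat m m"
        by (rule minus_carrier_mat) (rule mult_carrier_mat[OF c2 cm(2)])
      fix i j assume ij: "i < m" "j < m"
      have "(?A12 * ?Di) $$ (i, t) = X i t" if "t < n" for t
        unfolding mat_mult_entry[OF cm(1,4) ij(1) that] X_def by (intro sum.cong refl) (use ij that in simp)
      then have "(?A12 * ?Di * ?A21) $$ (i, j) = (\<Sum>t<n. X i t * c t j)"
        unfolding mat_mult_entry[OF c2 cm(2) ij] by (intro sum.cong refl) (use ij in simp)
      moreover have "(?A11 - ?A12 * ?Di * ?A21) $$ (i, j) = ?A11 $$ (i, j) - (?A12 * ?Di * ?A21) $$ (i, j)"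
        by (rule index_minus_mat(1)) (use ij in simp_all)
      ultimately show "(?A11 - ?A12 * ?Di * ?A21) $$ (i, j) = emb (S i j)"
        using ij by (simp only: S(1) s_def) simp
    qed
    ultimately show ?thesis unfolding Ber_def sb prod.case Di by simp
  qed
  have one: "fdet m S * fdet n D' * (fdet m S' * fdet n D) = 1"
  proof -
    have "fdet m S * fdet n D' * (fdet m S' * fdet n D) = (fdet m S * fdet m S') * (fdet n D * fdet n D')" by (simp only: mult_ac)
    then show ?thesis unfolding S(4) D(4) by simp
  qed
  have "ring_inv (Ber m M) = ?\<chi>"
    unfolding ber
  proof (rule ring_inv_eq)
    show "emb (fdet m S * fdet n D') * ?\<chi> = 1" using arg_cong[OF one, of emb] by (simp only: emb_simps)
    show "?\<chi> * emb (fdet m S * fdet n D') = 1"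
      using arg_cong[OF one, of emb] geven_commute[OF geven_emb, of "fdet m S' * fdet n D"] by (simp only: emb_simps)
  qed
  moreover have "transforms m n M (mat_inv M) ?\<chi>" using T unfolding minv by simp
  ultimately show thesis using that geven_emb by metis
qed

section \<open>From operators to supermatrices\<close>

lemma V_space_expansion:
  fixes x :: "'k::comm_ring_1 stensor"
  assumes "x \<in> V_space m n"
  shows "x = (\<Sum>i<m + n. word [theta m i] * scal (tcoeff x [theta m i]))"
proof -
  let ?g = "\<lambda>i. [theta m i]"
  have inj: "inj_on ?g {..<m + n}" by (auto simp: inj_on_def theta_def split: if_splits)
  have "{w. tcoeff x w \<noteq> 0} \<subseteq> ?g ` {..<m + n}"
  proof
    fix w assume "w \<in> {w. tcoeff x w \<noteq> 0}"
    then have w: "length w = 1 + 0 \<and> set (take 1 w) \<subseteq> Omega m n" using assms unfolding tensors_def by blast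
    then obtain l where l: "w = [l]" "l \<in> Omega m n" by (cases w) auto
    then consider i where "l = E i" "i < m" | j where "l = Eps j" "j < n" by (auto simp: Omega_def)
    then show "w \<in> ?g ` {..<m + n}"
    proof cases
      case 1
      then show ?thesis using l(1) by (intro image_eqI[of _ _ i]) simp_all
    next
      case 2
      then show ?thesis using l(1) by (intro image_eqI[of _ _ "m + j"]) simp_all
    qed
  qed
  from stensor_expansion[OF _ this] show ?thesis by (simp add: sum.reindex[OF inj])
qed

lemma word_theta_V_space: "i < m + n \<Longrightarrow> (word [theta m i] :: 'k::comm_ring_1 stensor) \<in> V_space m n"
  by (auto simp: tensors_def tcoeff_word Omega_def theta_def)

lemma V_space_add: "x \<in> V_space m n \<Longrightarrow> y \<in> V_space m n \<Longrightarrow> (x + y :: 'k::comm_ring_1 stensor) \<in> V_space m n"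
  unfolding tensors_def mem_Collect_eq tcoeff_add by (metis add.right_neutral add.left_neutral)

lemma V_space_scal: "x \<in> V_space m n \<Longrightarrow> (x * scal a :: 'k::comm_ring_1 stensor) \<in> V_space m n"
  unfolding tensors_def mem_Collect_eq tcoeff_mult_scal by (metis mult_zero_left)

lemma GL_V_linear:
  fixes A :: "'k::comm_ring_1 stensor \<Rightarrow> 'k stensor"
  assumes A: "A \<in> GL_V m n" and "k \<le> m + n"
  shows "(\<Sum>j<k. word [theta m j] * scal (c j)) \<in> V_space m n \<and>
    A (\<Sum>j<k. word [theta m j] * scal (c j)) = (\<Sum>j<k. A (word [theta m j]) * scal (c j))"
  using assms(2)
proof (induction k)
  case 0
  have z: "(0 :: 'k stensor) \<in> V_space m n" by (simp add: tensors_def)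
  then have "A (0 * scal 0) = A 0 * scal 0" using A unfolding GL_V_def by blast
  then show ?case using z by simp
next
  case (Suc k)
  have v: "word [theta m k] * scal (c k) \<in> V_space m n" by (rule V_space_scal[OF word_theta_V_space]) (use Suc in simp)
  have lin: "A (x + y) = A x + A y" "A (x * scal a) = A x * scal a" if "x \<in> V_space m n" "y \<in> V_space m n" for x y a
    using A that unfolding GL_V_def by blast+
  have w: "(word [theta m k] :: 'k stensor) \<in> V_space m n" by (rule word_theta_V_space) (use Suc in simp)
  have IH: "(\<Sum>j<k. word [theta m j] * scal (c j)) \<in> V_space m n"
    "A (\<Sum>j<k. word [theta m j] * scal (c j)) = (\<Sum>j<k. A (word [theta m j]) * scal (c j))" using Suc by simp_all
  show ?case unfolding sum.lessThan_Suc lin(1)[OF IH(1) v] lin(2)[OF w w] IH(2)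
    using V_space_add[OF IH(1) v] by simp
qed

text \<open>Preservation of parity makes the matrix a supermatrix, and surjectivity provides a right
  inverse. That the inverse is two-sided comes out of the Gauss decomposition in
  \<open>transforms_invertible\<close>.\<close>

lemma GL_V_matrix:
  fixes A :: "'k::field_char_0 stensor \<Rightarrow> 'k stensor"
  assumes A: "A \<in> GL_V m n"
  shows GL_V_col: "\<And>j. j < m + n \<Longrightarrow> A (word [theta m j]) = vcol m n (matrix_of m n A) j"
    and GL_V_supermat: "supermat m n (matrix_of m n A)"
    and GL_V_right_inverse: "\<exists>B. B \<in> carrier_mat (m + n) (m + n) \<and> matrix_of m n A * B = 1\<^sub>m (m + n)"
proof -
  let ?M = "matrix_of m n A"
  have bij: "bij_betw A (V_space m n) (V_space m n)"
    and par: "\<And>p x. x \<in> V_space m n \<Longrightarrow> has_parity p x \<Longrightarrow> has_parity p (A x)"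
    using A unfolding GL_V_def by blast+
  have entry: "?M $$ (i, j) = tcoeff (A (word [theta m j])) [theta m i]" if "i < m + n" "j < m + n" for i j
    using that by (simp add: matrix_of_def)
  have Mc: "?M \<in> carrier_mat (m + n) (m + n)" by (simp add: matrix_of_def)
  show "A (word [theta m j]) = vcol m n ?M j" if j: "j < m + n" for j
  proof -
    have "A (word [theta m j]) \<in> V_space m n" using bij word_theta_V_space[OF j] bij_betwE by blast
    from V_space_expansion[OF this] show ?thesis unfolding vcol_def by (simp add: entry j)
  qed
  have oc: "odd_count [theta m i] = of_bool (m \<le> i)" for i
    using odd_letter_theta(1)[of m i] by (cases "m \<le> i") (simp_all add: odd_count_def)
  show "supermat m n ?M" unfolding supermat_def
  proof (intro conjI allI impI Mc)
    fix i j assume ij: "i < m + n" "j < m + n"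
    have "homog (of_bool (m \<le> j)) (word [theta m j] :: 'k stensor)"
      using homog_word[of "[theta m j]", where 'a = 'k] unfolding oc .
    then have "homog (of_bool (m \<le> j)) (A (word [theta m j]))"
      using par[OF word_theta_V_space[OF ij(2)]] by (simp only: has_parity_homog)
    from homog_tcoeff[OF this, of "[theta m i]"]
    show "if (i < m) = (j < m) then geven (?M $$ (i, j)) else godd (?M $$ (i, j))"
      unfolding entry[OF ij] oc by (cases "m \<le> i"; cases "m \<le> j") simp_all
  qed
  \<comment> \<open>The coordinates of a preimage of a basis vector form a column of the right
    inverse.\<close>
  have "\<exists>c. \<forall>k<m + n. (\<Sum>j<m + n. ?M $$ (k, j) * c j) = of_bool (k = i)" if i: "i < m + n" for i
  proof -
    obtain x where x: "x \<in> V_space m n" "A x = word [theta m i]"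
      using bij word_theta_V_space[OF i] unfolding bij_betw_def by (metis imageE)
    let ?c = "\<lambda>j. tcoeff x [theta m j]"
    have "word [theta m i] = (\<Sum>j<m + n. A (word [theta m j]) * scal (?c j))"
      using GL_V_linear[OF A order_refl, of ?c] x V_space_expansion[OF x(1)] by simp
    then have "tcoeff (word [theta m i]) [theta m k] = (\<Sum>j<m + n. tcoeff (A (word [theta m j])) [theta m k] * ?c j)" for k
      by (simp add: tcoeff_sum tcoeff_mult_scal)
    moreover have "tcoeff (word [theta m i]) [theta m k] = (of_bool (k = i) :: 'k grassmann)" for k
      by (auto simp: tcoeff_word theta_def split: if_splits)
    ultimately show ?thesis by (intro exI[of _ ?c]) (simp add: entry)
  qed
  then obtain c where c: "\<And>i k. i < m + n \<Longrightarrow> k < m + n \<Longrightarrow> (\<Sum>j<m + n. ?M $$ (k, j) * c i j) = of_bool (k = i)" by metis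
  let ?B = "mat (m + n) (m + n) (\<lambda>(j, i). c i j)"
  have "?M * ?B = 1\<^sub>m (m + n)"
  proof (rule eq_matI)
    fix k i assume "k < dim_row (1\<^sub>m (m + n))" "i < dim_col (1\<^sub>m (m + n))"
    then have ki: "k < m + n" "i < m + n" by simp_all
    have "?B \<in> carrier_mat (m + n) (m + n)" by simp
    then show "(?M * ?B) $$ (k, i) = 1\<^sub>m (m + n) $$ (k, i)"
      using c[OF ki(2,1)] ki by (simp add: mat_mult_entry[OF Mc _ ki])
  qed (use Mc in simp_all)
  then show "\<exists>B. B \<in> carrier_mat (m + n) (m + n) \<and> ?M * B = 1\<^sub>m (m + n)" by (intro exI[of _ ?B]) simp
qed

text \<open>\<open>act_letter\<close> and \<open>lmap\<close> need to agree only on the letters of V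
  and its dual; \<open>b_star_tensors\<close> guarantees that no other letters occur.\<close>

lemma act_b_star:
  fixes A :: "'k::field_char_0 stensor \<Rightarrow> 'k stensor"
  assumes A: "A \<in> GL_V m n"
  obtains \<chi> where "act m n A (b_star m n) = b_star m n * scal \<chi>" "\<chi> = ring_inv (Ber m (matrix_of m n A))" "geven \<chi>"
proof -
  let ?M = "matrix_of m n A"
  obtain B where B: "B \<in> carrier_mat (m + n) (m + n)" "?M * B = 1\<^sub>m (m + n)" using GL_V_right_inverse[OF A] by blast
  obtain \<chi> where \<chi>: "transforms m n ?M (mat_inv ?M) \<chi>" "\<chi> = ring_inv (Ber m ?M)" "geven \<chi>"
    by (rule transforms_invertible[OF GL_V_supermat[OF A] B])
  have "act m n A (b_star m n) = hom_ext (act_letter m n A) (b_star m n)" by (simp add: act_def hom_ext_def)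
  also have "\<dots> = hom_ext (lmap m n ?M (mat_inv ?M)) (b_star m n)"
  proof (rule hom_ext_cong)
    fix w l assume w: "tcoeff (b_star m n :: 'k stensor) w \<noteq> 0" "l \<in> set w"
    let ?k = "(m + 1) * n"
    have "set (take ?k w) \<subseteq> Omega m n" "set (drop ?k w) \<subseteq> dual ` Omega m n"
      using b_star_tensors[of m n, where 'k = 'k] w(1) unfolding tensors_def by blast+
    moreover have "set w = set (take ?k w) \<union> set (drop ?k w)"
      unfolding set_append[symmetric] append_take_drop_id ..
    ultimately have "l \<in> Omega m n \<union> dual ` Omega m n" using w(2) by blast
    then consider i where "l = E i" "i < m" | j where "l = Eps j" "j < n" | i where "l = E_dual i" "i < m" | j where "l = Eps_dual j" "j < n"
      by (auto simp: Omega_def)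
    then show "act_letter m n A l = lmap m n ?M (mat_inv ?M) l"
    proof cases
      case 1
      then show ?thesis using GL_V_col[OF A, of i] by simp
    next
      case 2
      then show ?thesis using GL_V_col[OF A, of "m + j"] by simp
    qed (simp_all add: dual_image_def vrow_def)
  qed
  finally show thesis using that \<chi> unfolding transforms_def by simp
qed

theorem theorem3p2:
  fixes m n :: nat
  shows "(b_star m n :: 'k::field_char_0 stensor) \<in> tensors m n ((m + 1) * n) (m * (n + 1)) \<and>
    one_dimensional (GL_generated m n (b_star m n :: 'k stensor)) \<and>
    (\<forall>\<A> :: 'k stensor \<Rightarrow> 'k stensor. \<A> \<in> GL_V m n \<longrightarrow>
       act m n \<A> (b_star m n) = scal (ring_inv (Ber m (matrix_of m n \<A>))) * b_star m n)"
proof (intro conjI allI impI)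
  let ?b = "b_star m n :: 'k stensor"
  show "?b \<in> tensors m n ((m + 1) * n) (m * (n + 1))" by (rule b_star_tensors)
  show "act m n A ?b = scal (ring_inv (Ber m (matrix_of m n A))) * ?b" if A: "A \<in> GL_V m n" for A
  proof -
    obtain \<chi> where \<chi>: "act m n A ?b = ?b * scal \<chi>" "\<chi> = ring_inv (Ber m (matrix_of m n A))" "geven \<chi>"
      by (rule act_b_star[OF A])
    show ?thesis unfolding \<chi>(1) \<chi>(2)[symmetric] by (rule scal_geven_commute[OF \<chi>(3), symmetric])
  qed
  \<comment> \<open>The right multiples of \<open>b_star\<close> are already stable under all
    operations, so they are the generated module.\<close>
  let ?M = "{?b * scal a | a. True}"
  have "GL_submodule m n ?M"
    unfolding GL_submodule_def
  proof (intro conjI ballI allI)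
    show "0 \<in> ?M" by (auto intro: exI[of _ 0])
    show "x + y \<in> ?M" if xy: "x \<in> ?M" "y \<in> ?M" for x y
    proof -
      obtain a a' where "x = ?b * scal a" "y = ?b * scal a'" using xy by blast
      then have "x + y = ?b * scal (a + a')" by (simp add: scal_add distrib_left)
      then show ?thesis by blast
    qed
    show "x * scal c \<in> ?M" "scal c * x \<in> ?M" if x: "x \<in> ?M" for x c
    proof -
      obtain a where a: "x = ?b * scal a" using x by blast
      have "x * scal c = ?b * scal (a * c)" unfolding a by (simp add: scal_mult mult.assoc)
      then show "x * scal c \<in> ?M" by blast
      \<comment> \<open>\<open>b_star\<close> is homogeneous of parity \<open>n\<close>, so a left
        factor can be moved to the right at the price of \<open>grade_sign n\<close>.\<close>
      have "scal c * x = ?b * scal (grade_sign n c * a)"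
        unfolding a mult.assoc[symmetric] scal_homog[OF b_star_homog] by (simp add: scal_mult mult.assoc)
      then show "scal c * x \<in> ?M" by blast
    qed
    show "act m n A x \<in> ?M" if A: "A \<in> GL_V m n" and x: "x \<in> ?M" for A x
    proof -
      obtain a where a: "x = ?b * scal a" using x by blast
      obtain \<chi> where \<chi>: "act m n A ?b = ?b * scal \<chi>" by (rule act_b_star[OF A]) (rule that)
      have "act m n A x = act m n A ?b * scal a" unfolding a act_def by (rule linear_ext_scal)
      then have "act m n A x = ?b * scal (\<chi> * a)" by (simp add: \<chi> scal_mult mult.assoc)
      then show ?thesis by blast
    qed
  qed
  moreover have "?b \<in> ?M" by (auto intro: exI[of _ 1])
  moreover have "?M \<subseteq> M" if "GL_submodule m n M" "?b \<in> M" for M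
    using that unfolding GL_submodule_def by blast
  ultimately have gen: "GL_generated m n ?b = ?M"
    unfolding GL_generated_def by blast
  obtain u where u: "kc ?b u \<noteq> 0" using b_star_nonzero by blast
  \<comment> \<open>Some coefficient of \<open>b_star\<close> is a nonzero constant, hence
    invertible, and it determines the scalar; this gives freeness of rank one.\<close>
  have cancel: "a = a'" if eq: "?b * scal a = ?b * scal a'" for a a'
  proof -
    have "tcoeff ?b u = gconst (kc ?b u)"
    proof (rule grassmann_eqI)
      fix S show "gcoeff (tcoeff ?b u) S = gcoeff (gconst (kc ?b u)) S"
        using b_star_tvars[of m n, where 'k = 'k] by (cases "S = {}") (auto simp: kc_def gcoeff_gconst tvars_def gvars_def)
    qed
    then have "gconst (kc ?b u) * a = gconst (kc ?b u) * a'"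
      using arg_cong[OF eq, of "\<lambda>x. tcoeff x u"] by (simp add: tcoeff_mult_scal)
    then have "gconst (inverse (kc ?b u)) * gconst (kc ?b u) * a = gconst (inverse (kc ?b u)) * gconst (kc ?b u) * a'"
      by (simp only: mult.assoc)
    then show ?thesis using u by (simp add: gconst_mult[symmetric])
  qed
  show "one_dimensional (GL_generated m n ?b)"
    unfolding one_dimensional_def gen
  proof (intro exI conjI allI ballI)
    show "has_parity n ?b" unfolding has_parity_homog by (rule b_star_homog)
    show "?b * scal a \<in> ?M" for a by blast
    show "\<exists>!a. x = ?b * scal a" if x: "x \<in> ?M" for x
    proof -
      obtain a where a: "x = ?b * scal a" using x by blast
      then show ?thesis using cancel by (intro ex1I[of _ a]) auto
    qed
  qed
qed

end
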